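(* Let $n\ge2k$ be an integer. Then $\{\mathbf A^\lambda_k:\lambda\in\Lambda^{\mathbf A_k}_n\}$ is a complete set of pairwise non-isomorphic irreducible $\mathbf A_k$-modules, where $\mathbf A^\lambda_k=\mathbb C\mathcal W^{|\lambda^*|}_{\mathcal A_k}\otimes\mathfrak S^{\lambda^*}_{|\lambda^*|}$ with the action $d\cdot(w\otimes v)=n^{\ell(d,w)}(d\circ w\circ d^T)\otimes\sigma_{d,w}\cdot v$ if $\mathrm{pn}(d\circ w\circ d^T)=|\lambda^*|$ and $0$ otherwise ($d\in\mathcal A_k$).
   Context: Fix an integer $k\ge1$ and a parameter $n$. $\mathcal P_k$ is the set of set partitions of $\{1,\dots,k,1',\dots,k'\}$ (parts are called blocks), drawn as diagrams with top row $1,\dots,k$ and bottom row $1',\dots,k'$. For $d_1,d_2\in\mathcal P_k$ the concatenation $d_1\circ d_2$ is formed by stacking $d_1$ above $d_2$, identifying the bottom row of $d_1$ with the top row of $d_2$, taking connected components, restricting to the outer two rows and discarding components lying entirely in the middle row; $\ell(d_1,d_2)$ is the number of discarded components. $\mathbf P_k(n)$ is the $\mathbb C$-algebra with basis $\mathcal P_k$ and product $d_1d_2=n^{\ell(d_1,d_2)}d_1\circ d_2$. A block is propagating if it meets both rows; $\mathrm{pn}(d)$ is the number of propagating blocks. Planar: drawable without crossings inside the rectangle spanned by the vertices. Subalgebras: $\mathbf R_k$ (blocks have at most one vertex in each row), $\mathbf B_k(n)$ (all blocks of size 2), $\mathbf{RB}_k(n)$ (size 1 or 2), and $\mathbf{TL}_k(n),\mathbf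 M_k(n),\mathbf{PR}_k$ = planar diagrams of $\mathbf B_k,\mathbf{RB}_k,\mathbf R_k$. $\mathbf A_k$ is any of these seven algebras with diagram basis $\mathcal A_k$. For $\lambda=[\lambda_1,\dots,\lambda_\ell]\vdash n$, $\lambda^*=[\lambda_2,\dots,\lambda_\ell]$. $\Lambda^{\mathbf A_k}_n$: $\{\lambda\vdash n:|\lambda^*|\le k\}$ for $\mathbf P_k,\mathbf{RB}_k,\mathbf R_k$; $\{\lambda:|\lambda^*|\le k,\ |\lambda^*|\equiv k\bmod2\}$ for $\mathbf B_k$; $\{[n-m,m]:0\le m\le k\}$ for $\mathbf M_k,\mathbf{PR}_k$; $\{[n-m,m]:m\le k,\ m\equiv k\bmod2\}$ for $\mathbf{TL}_k$. $\mathfrak S^\mu_m$ is the Specht module for $\mu\vdash m$ ($[m]$: trivial module). Symmetric $m$-diagrams: $d^T$ is the reflection of $d$ ($j\leftrightarrow j'$). A symmetric $m$-diagram $w$ is determined by a set partition $\mathrm{top}(w)$ of $\{1,\dots,k\}$ with $m$ distinguished (propagating) blocks: its blocks are $B\cup B'$ for distinguished $B$, and $B$, $B'$ separately otherwise. $\mathcal W^m_{\mathcal A_k}$ = such diagrams in $\mathcal A_k$. Propagating blocks are ordered by their largest top element. If $\mathrm{pn}(d\circ w\circ d^T)=m$, then $d\circ w\circ d^T$ is a symmetric $m$-diagram and the twist $\sigma_{d,w}\in\mathfrak S_m$ sends $i$ to $j$ when the $i$-th propagating block of $w$ is connected to the $j$-th propagating block of $d\circ w\circ d^T$; $\ell(d,w)$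 is the number of components discarded in forming $d\circ w$. *)

theory Defs
  imports Complex_Main "HOL-Library.Disjoint_Sets" "HOL-Combinatorics.Permutations" "HOL-Library.Function_Algebras"
begin

datatype vert = Top nat | Bot nat

type_synonym diagram = "vert set set"

definition verts :: "nat \<Rightarrow> vert set" where
  "verts k = Top ` {1..k} \<union> Bot ` {1..k}"

definition all_diagrams :: "nat \<Rightarrow> diagram set" where
  "all_diagrams k = {d. partition_on (verts k) d}"

definition tp :: "vert set \<Rightarrow> nat set" where
  "tp X = {i. Top i \<in> X}"

definition bt :: "vert set \<Rightarrow> nat set" where
  "bt X = {i. Bot i \<in> X}"

definition propagating :: "vert set \<Rightarrow> bool" where
  "propagating X \<longleftrightarrow> tp X \<noteq> {} \<and> bt X \<noteq> {}"

definition props :: "diagram \<Rightarrow> vert set set" where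
  "props d = {X \<in> d. propagating X}"

definition pn :: "diagram \<Rightarrow> nat" where
  "pn d = card (props d)"

fun flipv :: "vert \<Rightarrow> vert" where
  "flipv (Top i) = Bot i" | "flipv (Bot i) = Top i"

definition transp :: "diagram \<Rightarrow> diagram" where
  "transp d = (\<lambda>X. flipv ` X) ` d"

text \<open>Stacking a list of diagrams: diagram number j occupies rows j (its top row)
  and j+1 (its bottom row); a vertex of the stack is (row, index).\<close>
fun emb :: "nat \<Rightarrow> vert \<Rightarrow> nat \<times> nat" where
  "emb j (Top i) = (j, i)" | "emb j (Bot i) = (Suc j, i)"

definition stack_rel :: "diagram list \<Rightarrow> ((nat \<times> nat) \<times> (nat \<times> nat)) set" where
  "stack_rel ds = {(x, y). \<exists>j < length ds. \<exists>B \<in> ds ! j. x \<in> emb j ` B \<and> y \<in> emb j ` B}"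

definition comps :: "diagram list \<Rightarrow> (nat \<times> nat) set set" where
  "comps ds = {(stack_rel ds)\<^sup>+ `` {x} | x. x \<in> Field (stack_rel ds)}"

definition outer_at :: "nat \<Rightarrow> (nat \<times> nat) set \<Rightarrow> vert set" where
  "outer_at h C = {Top i | i. (0, i) \<in> C} \<union> {Bot i | i. (h, i) \<in> C}"

definition compose :: "diagram \<Rightarrow> diagram \<Rightarrow> diagram" (infixl "\<circ>\<^sub>d" 70) where
  "compose d1 d2 = {outer_at 2 C | C. C \<in> comps [d1, d2] \<and> outer_at 2 C \<noteq> {}}"

definition ell :: "diagram \<Rightarrow> diagram \<Rightarrow> nat" where
  "ell d1 d2 = card {C \<in> comps [d1, d2]. outer_at 2 C = {}}"

definition id_diagram :: "nat \<Rightarrow> diagram" where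
  "id_diagram k = {{Top i, Bot i} | i. i \<in> {1..k}}"

text \<open>Planarity: vertices placed around the boundary of the rectangle in the order
  1,...,k,k',...,1'; a diagram is planar iff no two distinct blocks interleave.\<close>
fun bpos :: "nat \<Rightarrow> vert \<Rightarrow> nat" where
  "bpos k (Top i) = i" | "bpos k (Bot i) = 2 * k + 1 - i"

definition planar :: "nat \<Rightarrow> diagram \<Rightarrow> bool" where
  "planar k d \<longleftrightarrow> \<not> (\<exists>B \<in> d. \<exists>C \<in> d. B \<noteq> C \<and>
      (\<exists>a \<in> B. \<exists>c \<in> B. \<exists>b \<in> C. \<exists>e \<in> C.
         bpos k a < bpos k b \<and> bpos k b < bpos k c \<and> bpos k c < bpos k e))"

datatype alg_kind = Partition | Rook | Brauer | RookBrauer | TemperleyLieb | Motzkin | PlanarRook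

definition rook_diag :: "diagram \<Rightarrow> bool" where
  "rook_diag d \<longleftrightarrow> (\<forall>X \<in> d. card (tp X) \<le> 1 \<and> card (bt X) \<le> 1)"

definition brauer_diag :: "diagram \<Rightarrow> bool" where
  "brauer_diag d \<longleftrightarrow> (\<forall>X \<in> d. card X = 2)"

definition rookbrauer_diag :: "diagram \<Rightarrow> bool" where
  "rookbrauer_diag d \<longleftrightarrow> (\<forall>X \<in> d. card X = 1 \<or> card X = 2)"

fun diag_basis :: "alg_kind \<Rightarrow> nat \<Rightarrow> diagram set" where
  "diag_basis Partition k = all_diagrams k"
| "diag_basis Rook k = {d \<in> all_diagrams k. rook_diag d}"
| "diag_basis Brauer k = {d \<in> all_diagrams k. brauer_diag d}"
| "diag_basis RookBrauer k = {d \<in> all_diagrams k. rookbrauer_diag d}"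
| "diag_basis TemperleyLieb k = {d \<in> all_diagrams k. brauer_diag d \<and> planar k d}"
| "diag_basis Motzkin k = {d \<in> all_diagrams k. rookbrauer_diag d \<and> planar k d}"
| "diag_basis PlanarRook k = {d \<in> all_diagrams k. rook_diag d \<and> planar k d}"

definition alg_carrier :: "alg_kind \<Rightarrow> nat \<Rightarrow> (diagram \<Rightarrow> complex) set" where
  "alg_carrier A k = {a. \<forall>d. a d \<noteq> 0 \<longrightarrow> d \<in> diag_basis A k}"

definition alg_mult :: "alg_kind \<Rightarrow> nat \<Rightarrow> nat \<Rightarrow>
    (diagram \<Rightarrow> complex) \<Rightarrow> (diagram \<Rightarrow> complex) \<Rightarrow> (diagram \<Rightarrow> complex)" where
  "alg_mult A k n a b = (\<lambda>e. \<Sum>d1 \<in> diag_basis A k. \<Sum>d2 \<in> diag_basis A k.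
      if d1 \<circ>\<^sub>d d2 = e then a d1 * b d2 * of_nat n ^ ell d1 d2 else 0)"

definition alg_one :: "nat \<Rightarrow> diagram \<Rightarrow> complex" where
  "alg_one k = (\<lambda>e. if e = id_diagram k then 1 else 0)"

text \<open>A (left, unital) A_k-module: an additive subgroup V of some abelian group
  with a biadditive, associative, unital action of the algebra. (Complex scalars act
  through the algebra, c = c times the identity diagram.)\<close>
definition is_module :: "alg_kind \<Rightarrow> nat \<Rightarrow> nat \<Rightarrow> 'v::ab_group_add set \<Rightarrow>
    ((diagram \<Rightarrow> complex) \<Rightarrow> 'v \<Rightarrow> 'v) \<Rightarrow> bool" where
  "is_module A k n V act \<longleftrightarrow>
     0 \<in> V \<and> (\<forall>x \<in> V. \<forall>y \<in> V. x + y \<in> V) \<and> (\<forall>x \<in> V. - x \<in> V)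
   \<and> (\<forall>a \<in> alg_carrier A k. \<forall>x \<in> V. act a x \<in> V)
   \<and> (\<forall>a \<in> alg_carrier A k. \<forall>b \<in> alg_carrier A k. \<forall>x \<in> V. act (a + b) x = act a x + act b x)
   \<and> (\<forall>a \<in> alg_carrier A k. \<forall>x \<in> V. \<forall>y \<in> V. act a (x + y) = act a x + act a y)
   \<and> (\<forall>a \<in> alg_carrier A k. \<forall>b \<in> alg_carrier A k. \<forall>x \<in> V.
        act (alg_mult A k n a b) x = act a (act b x))
   \<and> (\<forall>x \<in> V. act (alg_one k) x = x)"

definition is_submodule :: "alg_kind \<Rightarrow> nat \<Rightarrow> 'v::ab_group_add set \<Rightarrow>
    ((diagram \<Rightarrow> complex) \<Rightarrow> 'v \<Rightarrow> 'v) \<Rightarrow> 'v set \<Rightarrow> bool" where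
  "is_submodule A k V act U \<longleftrightarrow> U \<subseteq> V \<and> 0 \<in> U \<and> (\<forall>x \<in> U. \<forall>y \<in> U. x + y \<in> U)
     \<and> (\<forall>a \<in> alg_carrier A k. \<forall>x \<in> U. act a x \<in> U)"

definition irreducible_module :: "alg_kind \<Rightarrow> nat \<Rightarrow> nat \<Rightarrow> 'v::ab_group_add set \<Rightarrow>
    ((diagram \<Rightarrow> complex) \<Rightarrow> 'v \<Rightarrow> 'v) \<Rightarrow> bool" where
  "irreducible_module A k n V act \<longleftrightarrow> is_module A k n V act \<and> V \<noteq> {0}
     \<and> (\<forall>U. is_submodule A k V act U \<longrightarrow> U = {0} \<or> U = V)"

definition module_iso :: "alg_kind \<Rightarrow> nat \<Rightarrow> 'v::ab_group_add set \<Rightarrow>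
    ((diagram \<Rightarrow> complex) \<Rightarrow> 'v \<Rightarrow> 'v) \<Rightarrow> 'w::ab_group_add set \<Rightarrow>
    ((diagram \<Rightarrow> complex) \<Rightarrow> 'w \<Rightarrow> 'w) \<Rightarrow> bool" where
  "module_iso A k V act W act' \<longleftrightarrow> (\<exists>f. bij_betw f V W
     \<and> (\<forall>x \<in> V. \<forall>y \<in> V. f (x + y) = f x + f y)
     \<and> (\<forall>a \<in> alg_carrier A k. \<forall>x \<in> V. f (act a x) = act' a (f x)))"

definition is_int_partition :: "nat list \<Rightarrow> nat \<Rightarrow> bool" where
  "is_int_partition lam n \<longleftrightarrow> sorted_wrt (\<ge>) lam \<and> (\<forall>x \<in> set lam. 0 < x) \<and> sum_list lam = n"

definition star_size :: "nat list \<Rightarrow> nat" where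
  "star_size lam = sum_list (tl lam)"

fun Lambda :: "alg_kind \<Rightarrow> nat \<Rightarrow> nat \<Rightarrow> nat list set" where
  "Lambda Partition k n = {lam. is_int_partition lam n \<and> star_size lam \<le> k}"
| "Lambda RookBrauer k n = {lam. is_int_partition lam n \<and> star_size lam \<le> k}"
| "Lambda Rook k n = {lam. is_int_partition lam n \<and> star_size lam \<le> k}"
| "Lambda Brauer k n = {lam. is_int_partition lam n \<and> star_size lam \<le> k
                              \<and> star_size lam mod 2 = k mod 2}"
| "Lambda Motzkin k n = {lam. is_int_partition lam n \<and> length lam \<le> 2 \<and> star_size lam \<le> k}"
| "Lambda PlanarRook k n = {lam. is_int_partition lam n \<and> length lam \<le> 2 \<and> star_size lam \<le> k}"
| "Lambda TemperleyLieb k n = {lam. is_int_partition lam n \<and> length lam \<le> 2 \<and> star_size lam \<le> k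
                              \<and> star_size lam mod 2 = k mod 2}"

definition cells :: "nat list \<Rightarrow> (nat \<times> nat) set" where
  "cells mu = {(r, c). r < length mu \<and> c < mu ! r}"

definition tableaux :: "nat list \<Rightarrow> (nat \<times> nat \<Rightarrow> nat) set" where
  "tableaux mu = {t. bij_betw t (cells mu) {1..sum_list mu} \<and> (\<forall>x. x \<notin> cells mu \<longrightarrow> t x = 0)}"

text \<open>A tabloid is recorded as the function sending each entry to its row (0 outside 1..m).\<close>
definition tabloid_of :: "nat list \<Rightarrow> (nat \<times> nat \<Rightarrow> nat) \<Rightarrow> nat \<Rightarrow> nat" where
  "tabloid_of mu t = (\<lambda>j. if j \<in> {1..sum_list mu} then fst (the_inv_into (cells mu) t j) else 0)"

definition col_of :: "nat list \<Rightarrow> (nat \<times> nat \<Rightarrow> nat) \<Rightarrow> nat \<Rightarrow> nat" where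
  "col_of mu t j = snd (the_inv_into (cells mu) t j)"

definition col_stab :: "nat list \<Rightarrow> (nat \<times> nat \<Rightarrow> nat) \<Rightarrow> (nat \<Rightarrow> nat) set" where
  "col_stab mu t = {p. p permutes {1..sum_list mu} \<and>
                     (\<forall>j \<in> {1..sum_list mu}. col_of mu t (p j) = col_of mu t j)}"

definition polytabloid :: "nat list \<Rightarrow> (nat \<times> nat \<Rightarrow> nat) \<Rightarrow> (nat \<Rightarrow> nat) \<Rightarrow> complex" where
  "polytabloid mu t = (\<lambda>T. \<Sum>p \<in> col_stab mu t.
      if tabloid_of mu (p \<circ> t) = T then of_int (sign p) else 0)"

definition specht :: "nat list \<Rightarrow> ((nat \<Rightarrow> nat) \<Rightarrow> complex) set" where
  "specht mu = {(\<lambda>T. \<Sum>t \<in> tableaux mu. c t * polytabloid mu t T) | c. True}"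

text \<open>Action of a permutation s of 1..m: s.{t} = {s o t}, i.e. (s.f)(T) = f(T o s).\<close>
definition perm_act :: "(nat \<Rightarrow> nat) \<Rightarrow> ((nat \<Rightarrow> nat) \<Rightarrow> complex) \<Rightarrow> (nat \<Rightarrow> nat) \<Rightarrow> complex" where
  "perm_act s f = (\<lambda>T. f (T \<circ> s))"

definition sym_diagram_of :: "nat set set \<Rightarrow> nat set set \<Rightarrow> diagram" where
  "sym_diagram_of P D = {Top ` B \<union> Bot ` B | B. B \<in> D}
      \<union> {Top ` B | B. B \<in> P - D} \<union> {Bot ` B | B. B \<in> P - D}"

definition symW :: "alg_kind \<Rightarrow> nat \<Rightarrow> nat \<Rightarrow> diagram set" where
  "symW A k m = {sym_diagram_of P D | P D. partition_on {1..k} P \<and> D \<subseteq> P \<and> card D = m}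
                \<inter> diag_basis A k"

definition prop_rank :: "diagram \<Rightarrow> vert set \<Rightarrow> nat" where
  "prop_rank d X = Suc (card {Y \<in> props d. Max (tp Y) < Max (tp X)})"

definition twist :: "diagram \<Rightarrow> diagram \<Rightarrow> nat \<Rightarrow> nat \<Rightarrow> nat" where
  "twist d w m i = (if i \<in> {1..m} then
      (THE j. \<exists>X \<in> props w. \<exists>Y \<in> props (d \<circ>\<^sub>d w \<circ>\<^sub>d transp d).
          prop_rank w X = i \<and> prop_rank (d \<circ>\<^sub>d w \<circ>\<^sub>d transp d) Y = j \<and>
          (\<exists>C \<in> comps [d, w, transp d]. emb 1 ` X \<subseteq> C \<and> outer_at 3 C = Y))
    else i)"

text \<open>The module A^lambda_k = C W^m (x) S^{lambda*}, m = |lambda*|, realised as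
  functions F : diagram -> Specht vectors, supported on W^m.\<close>
definition Amod :: "alg_kind \<Rightarrow> nat \<Rightarrow> nat list \<Rightarrow> (diagram \<Rightarrow> (nat \<Rightarrow> nat) \<Rightarrow> complex) set" where
  "Amod A k lam = {F. (\<forall>w. w \<notin> symW A k (star_size lam) \<longrightarrow> F w = 0)
                    \<and> (\<forall>w \<in> symW A k (star_size lam). F w \<in> specht (tl lam))}"

definition Aact :: "alg_kind \<Rightarrow> nat \<Rightarrow> nat \<Rightarrow> nat list \<Rightarrow> (diagram \<Rightarrow> complex) \<Rightarrow>
    (diagram \<Rightarrow> (nat \<Rightarrow> nat) \<Rightarrow> complex) \<Rightarrow> (diagram \<Rightarrow> (nat \<Rightarrow> nat) \<Rightarrow> complex)" where
  "Aact A k n lam a F = (\<lambda>w' T. \<Sum>d \<in> diag_basis A k. \<Sum>w \<in> symW A k (star_size lam).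
      if d \<circ>\<^sub>d w \<circ>\<^sub>d transp d = w' \<and> pn w' = star_size lam
      then a d * of_nat n ^ ell d w * perm_act (twist d w (star_size lam)) (F w) T
      else 0)"

end

theory Submission
  imports Defs
begin

text \<open>A diagram is a relation between colourings of its two rows by n colours, hence a 0/1 matrix; this
  represents the algebra, with reflection of diagrams acting as the adjoint. Since n \<ge> 2k, distinct
  blocks can receive distinct colours, so the representation is faithful and a* a = 0 forces a = 0.
  Applied modulo diagrams of propagating number below m, this positivity shows that every nonzero F in
  A^lambda is moved by some diagram of propagating number m to a nonzero vector supported on a single
  symmetric diagram. A diagram is determined by its two halves and a permutation of its m propagating
  blocks, so irreducibility reduces to that of the Specht modules, and an isomorphism between two of
  the modules restricts to one of Specht modules.

  Given an irreducible V, let m be the least propagating number of a diagram acting nonzero, and w a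
  symmetric m-diagram acting nonzero. The diagrams with both halves w form the group S_m (the trivial
  group in the planar cases) up to powers of n, and w V is an irreducible representation of it. It is a
  Specht module, and translating it by diagrams with bottom half w gives a nonzero homomorphism from
  A^lambda to V.\<close>

text \<open>Every fact about stacking is reduced to relations and counting. The composite becomes
  the composition of relations, which yields associativity at once, and the number of discarded
  components is a logarithm: two colours already suffice to read it off the number of middle rows
  between two constant outer rows. Halves of diagrams are compared through the projections
  \<open>d \<cdot> transp d\<close> and \<open>transp d \<cdot> d\<close>. If the lower half of a is
  the upper half of b, no propagating block is lost and permutations multiply, as for arrows of a
  groupoid. A module is only an abelian group with an action, so completeness cannot come from
  counting dimensions or conjugacy classes; homomorphisms have to be constructed. For the symmetric
  group this is done with the sum of all transpositions. A vector fixed by a Young subgroup with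
  least label sum yields its eigenvalue on V, and likewise on V tensored with the sign. The two
  eigenvalues add up to a constant, which forces the row labels found in V and the column labels
  found in the sign twist to be the coordinates of one tableau.\<close>

notation compose (infixl "\<cdot>" 70)

section \<open>Diagrams as relations between colourings\<close>

definition vl :: "(nat => 'c) => (nat => 'c) => vert => 'c" where
 "vl x y u = (case u of Top i => x i | Bot i => y i)"

definition same :: "diagram => vert => vert => bool" where
 "same d u v \<longleftrightarrow> (\<exists>B\<in>d. u \<in> B \<and> v \<in> B)"

text \<open>Colours are arbitrary natural numbers, so that one relation serves both for two colours
  (recovering combinatorial data) and for n colours (the representation). Rows are total functions
  whose values outside \<open>{1..k}\<close> are irrelevant, see \<open>rel_cong\<close>.\<close>

definition rel :: "diagram => ((nat => nat) \<times> (nat => nat)) set" where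
 "rel d = {(x, y). \<forall>u v. same d u v --> vl x y u = vl x y v}"

lemma vl_simps [simp]: "vl x y (Top i) = x i" "vl x y (Bot i) = y i"
 by (simp_all add: vl_def)

lemma verts_simps [simp]: "Top i \<in> verts k \<longleftrightarrow> i \<in> {1..k}" "Bot i \<in> verts k \<longleftrightarrow> i \<in> {1..k}"
 by (auto simp: verts_def)

lemma finite_verts [simp]: "finite (verts k)"
 by (simp add: verts_def)

lemma all_diagramsD: "d \<in> all_diagrams k ==> partition_on (verts k) d"
 by (simp add: all_diagrams_def)

lemma finite_all_diagrams [simp]: "finite (all_diagrams k)"
 unfolding all_diagrams_def by (rule finitely_many_partition_on) simp

lemma finite_diagram: "d \<in> all_diagrams k ==> finite d"
 by (metis all_diagramsD finite_verts finite_elements)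

lemma finite_block: "d \<in> all_diagrams k ==> B \<in> d ==> finite B"
 using partition_onD1[OF all_diagramsD] by (metis Sup_upper finite_subset finite_verts)

lemma block_sub: "d \<in> all_diagrams k ==> B \<in> d ==> u \<in> B ==> u \<in> verts k"
 using partition_onD1[OF all_diagramsD] by blast

lemma block_unique:
 "d \<in> all_diagrams k ==> B \<in> d ==> C \<in> d ==> u \<in> B ==> u \<in> C ==> B = C"
 using disjointD[OF partition_onD2[OF all_diagramsD]] by blast

lemma block_ex: "d \<in> all_diagrams k ==> u \<in> verts k ==> \<exists>B\<in>d. u \<in> B"
 using partition_onD1[OF all_diagramsD] by blast

lemma block_nonempty: "d \<in> all_diagrams k ==> B \<in> d ==> B \<noteq> {}"
 using partition_onD3[OF all_diagramsD] by blast

lemma all_diagramsI: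
 assumes "\<And>B u. B \<in> d ==> u \<in> B ==> u \<in> verts k"
  and "\<And>u. u \<in> verts k ==> \<exists>B\<in>d. u \<in> B"
  and "\<And>B. B \<in> d ==> B \<noteq> {}"
  and "\<And>B C u. B \<in> d ==> C \<in> d ==> u \<in> B ==> u \<in> C ==> B = C"
 shows "d \<in> all_diagrams k"
 unfolding all_diagrams_def mem_Collect_eq partition_on_def disjoint_def
 using assms by blast

lemma same_refl: "d \<in> all_diagrams k ==> u \<in> verts k ==> same d u u"
 unfolding same_def using block_ex by blast

lemma same_sym: "same d u v ==> same d v u"
 unfolding same_def by blast

lemma same_trans: "d \<in> all_diagrams k ==> same d u v ==> same d v w ==> same d u w"
 unfolding same_def by (metis block_unique)

lemma same_verts: "d \<in> all_diagrams k ==> same d u v ==> u \<in> verts k \<and> v \<in> verts k"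
 unfolding same_def by (meson block_sub)

lemma block_eq_same: "d \<in> all_diagrams k ==> B \<in> d ==> u \<in> B ==> B = {v. same d u v}"
 unfolding same_def by (auto dest: block_unique)

lemma diagram_eq_same:
 assumes "d \<in> all_diagrams k"
 shows "d = {{v. same d u v} |u. u \<in> verts k}"
proof -
 have "B \<in> {{v. same d u v} |u. u \<in> verts k}" if "B \<in> d" for B
 proof -
  obtain u where u: "u \<in> B" using block_nonempty[OF assms \<open>B \<in> d\<close>] by blast
  thus ?thesis
   using block_eq_same[OF assms that u] block_sub[OF assms that u] by blast
 qed
 moreover have "{v. same d u v} \<in> d" if "u \<in> verts k" for u
  using that assms block_ex block_eq_same by metis
 ultimately show ?thesis by blast
qed

lemma diagram_eqI:
 assumes "d \<in> all_diagrams k" "e \<in> all_diagrams k"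
  and "\<And>u v. u \<in> verts k ==> v \<in> verts k ==> same d u v \<longleftrightarrow> same e u v"
 shows "d = e"
proof -
 have "same d u v \<longleftrightarrow> same e u v" for u v
  using assms same_verts by blast
 thus ?thesis
  using diagram_eq_same[OF assms(1)] diagram_eq_same[OF assms(2)] by simp
qed

text \<open>The indicator function of the block of u is a compatible colouring that separates u from
  every vertex outside this block. Hence the relation determines the diagram.\<close>

lemma same_iff_rel:
 assumes "d \<in> all_diagrams k" "u \<in> verts k" "v \<in> verts k"
 shows "same d u v \<longleftrightarrow> (\<forall>(x, y)\<in>rel d. vl x y u = vl x y v)"
proof
 assume "same d u v"
 thus "\<forall>(x, y)\<in>rel d. vl x y u = vl x y v" by (auto simp: rel_def)
next
 assume *: "\<forall>(x, y)\<in>rel d. vl x y u = vl x y v"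
 define x :: "nat => nat" where "x i = (if same d u (Top i) then 1 else 0)" for i
 define y :: "nat => nat" where "y i = (if same d u (Bot i) then 1 else 0)" for i
 have v: "vl x y w = (if same d u w then 1 else 0)" for w
  by (cases w) (auto simp: x_def y_def)
 have "(x, y) \<in> rel d"
 proof -
  have "same d u a \<longleftrightarrow> same d u b" if "same d a b" for a b
   using that same_trans[OF assms(1)] same_sym by metis
  thus ?thesis by (simp add: rel_def v)
 qed
 hence "vl x y u = vl x y v" using * by blast
 thus "same d u v"
  using same_refl[OF assms(1,2)] by (simp add: v split: if_splits)
qed

lemma rel_inj:
 assumes "d \<in> all_diagrams k" "e \<in> all_diagrams k" "rel d = rel e"
 shows "d = e"
 by (rule diagram_eqI[OF assms(1,2)]) (simp add: same_iff_rel[OF assms(1)] same_iff_rel[OF assms(2)] assms(3))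

lemma rel_cong:
 assumes "d \<in> all_diagrams k" "(x, y) \<in> rel d"
  and "\<And>i. i \<in> {1..k} ==> x i = x' i" "\<And>i. i \<in> {1..k} ==> y i = y' i"
 shows "(x', y') \<in> rel d"
proof -
 have e: "vl x y u = vl x' y' u" if "u \<in> verts k" for u
  using that assms(3,4) by (cases u) auto
 show ?thesis
  using assms(2) same_verts[OF assms(1)] e unfolding rel_def by auto
qed

lemma rel_const [simp]: "((\<lambda>_. c), (\<lambda>_. c)) \<in> rel d"
proof -
 have "vl (\<lambda>_. c) (\<lambda>_. c) u = c" for u by (cases u) auto
 thus ?thesis by (simp add: rel_def)
qed

subsection \<open>Stacks\<close>

fun outv :: "nat => vert => nat \<times> nat" where
 "outv h (Top i) = (0, i)" | "outv h (Bot i) = (h, i)"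

text \<open>Stacks of any positive height are treated together: height 2 gives the composite, height
  3 occurs in the definition of the twist.\<close>

definition outer_diagram :: "diagram list => diagram" where
 "outer_diagram ds = {outer_at (length ds) C | C. C \<in> comps ds \<and> outer_at (length ds) C \<noteq> {}}"

lemma outer_at_eq: "outer_at h C = {v. outv h v \<in> C}"
proof -
 have "v \<in> outer_at h C \<longleftrightarrow> outv h v \<in> C" for v
  by (cases v) (auto simp: outer_at_def)
 thus ?thesis by blast
qed

lemma compose_eq_outer: "d1 \<cdot> d2 = outer_diagram [d1, d2]"
 by (simp add: compose_def outer_diagram_def numeral_2_eq_2)

lemma stack_rel_same:
 "(p, q) \<in> stack_rel ds \<longleftrightarrow> (\<exists>j<length ds. \<exists>u v. same (ds ! j) u v \<and> p = emb j u \<and> q = emb j v)"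
 unfolding stack_rel_def same_def by blast

locale stack =
 fixes k :: nat and ds :: "diagram list"
 assumes ds: "set ds \<subseteq> all_diagrams k" "ds \<noteq> []"
begin

abbreviation "E \<equiv> (stack_rel ds)\<^sup>+"
abbreviation "N \<equiv> {0..length ds} \<times> {1..k}"

lemma ds_nth: "j < length ds ==> ds ! j \<in> all_diagrams k"
 using ds(1) by (meson nth_mem subsetD)

lemma emb_N: "j < length ds ==> u \<in> verts k ==> emb j u \<in> N"
 by (cases u) auto

lemma stack_N: "(p, q) \<in> stack_rel ds ==> p \<in> N \<and> q \<in> N"
 unfolding stack_rel_same using same_verts[OF ds_nth] emb_N by blast

lemma E_N: "(p, q) \<in> E ==> p \<in> N \<and> q \<in> N"
 by (induction rule: trancl_induct) (auto dest: stack_N)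

lemma stack_refl:
 assumes "p \<in> N" shows "(p, p) \<in> stack_rel ds"
proof -
 obtain r i where p: "p = (r, i)" "r \<le> length ds" "i \<in> {1..k}" using assms by auto
 obtain j u where "j < length ds" "u \<in> verts k" "p = emb j u"
 proof (cases "r < length ds")
  case True
  thus ?thesis using that[of r "Top i"] p by simp
 next
  case False
  hence "r = length ds" using p by simp
  thus ?thesis using that[of "length ds - 1" "Bot i"] p ds(2) by simp
 qed
 thus ?thesis unfolding stack_rel_same using same_refl ds_nth by blast
qed

lemma Field_N: "Field (stack_rel ds) = N"
 using stack_N stack_refl unfolding Field_def by blast

lemma E_refl: "p \<in> N ==> (p, p) \<in> E"
 using stack_refl by blast

lemma E_sym: "(p, q) \<in> E ==> (q, p) \<in> E"
proof -
 have "sym (stack_rel ds)" unfolding sym_def stack_rel_same by (metis same_sym)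
 thus "(p, q) \<in> E ==> (q, p) \<in> E" using sym_trancl symD by metis
qed

lemma E_trans: "(p, q) \<in> E ==> (q, r) \<in> E ==> (p, r) \<in> E"
 by (rule trancl_trans)

lemma comps_eq: "comps ds = {E `` {p} |p. p \<in> N}"
 unfolding comps_def Field_N ..

lemma comps_N: "C \<in> comps ds ==> C \<subseteq> N"
 unfolding comps_eq using E_N by auto

lemma comps_memD: "C \<in> comps ds ==> p \<in> C ==> C = E `` {p}"
 unfolding comps_eq using E_sym E_trans by blast

lemma comps_ex: "p \<in> N ==> \<exists>C\<in>comps ds. p \<in> C"
 unfolding comps_eq using E_refl by blast

lemma comps_nonempty: "C \<in> comps ds ==> C \<noteq> {}"
 unfolding comps_eq using E_refl by blast

lemma outv_N: "outv (length ds) u \<in> N \<longleftrightarrow> u \<in> verts k"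
 by (cases u) auto

lemma outer_memI: "u \<in> verts k ==> \<exists>C\<in>comps ds. u \<in> outer_at (length ds) C"
 using comps_ex outv_N unfolding outer_at_eq by blast

lemma outer_diagram_in: "outer_diagram ds \<in> all_diagrams k"
proof (rule all_diagramsI)
 fix B u assume "B \<in> outer_diagram ds" "u \<in> B"
 then obtain C where "C \<in> comps ds" "outv (length ds) u \<in> C"
  unfolding outer_diagram_def outer_at_eq by auto
 thus "u \<in> verts k" using comps_N outv_N by (metis subsetD)
next
 fix u assume "u \<in> verts k"
 then obtain C where "C \<in> comps ds" "u \<in> outer_at (length ds) C" using outer_memI by blast
 thus "\<exists>B\<in>outer_diagram ds. u \<in> B" unfolding outer_diagram_def by auto
next
 fix B assume "B \<in> outer_diagram ds"
 thus "B \<noteq> {}" unfolding outer_diagram_def by blast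
next
 fix B C u assume "B \<in> outer_diagram ds" "C \<in> outer_diagram ds" "u \<in> B" "u \<in> C"
 thus "B = C" unfolding outer_diagram_def outer_at_eq
  by clarify (metis comps_memD)
qed

lemma same_outer:
 "same (outer_diagram ds) u v \<longleftrightarrow> (outv (length ds) u, outv (length ds) v) \<in> E"
proof
 assume "same (outer_diagram ds) u v"
 then obtain C where "C \<in> comps ds" "outv (length ds) u \<in> C" "outv (length ds) v \<in> C"
  unfolding same_def outer_diagram_def outer_at_eq by blast
 thus "(outv (length ds) u, outv (length ds) v) \<in> E" using comps_memD by blast
next
 assume *: "(outv (length ds) u, outv (length ds) v) \<in> E"
 let ?C = "E `` {outv (length ds) u}"
 have "?C \<in> comps ds" using * E_N comps_eq by blast
 moreover have u: "u \<in> outer_at (length ds) ?C" "v \<in> outer_at (length ds) ?C"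
  using * E_N[OF *] E_refl unfolding outer_at_eq by auto
 ultimately have "outer_at (length ds) ?C \<in> outer_diagram ds"
  unfolding outer_diagram_def by blast
 thus "same (outer_diagram ds) u v" unfolding same_def using u by blast
qed

definition resp :: "(nat \<times> nat => nat) => bool" where
 "resp f \<longleftrightarrow> (\<forall>j<length ds. ((\<lambda>i. f (j, i)), (\<lambda>i. f (Suc j, i))) \<in> rel (ds ! j))"

lemma resp_iff: "resp f \<longleftrightarrow> (\<forall>(p, q)\<in>E. f p = f q)"
proof -
 have v: "vl (\<lambda>i. f (j, i)) (\<lambda>i. f (Suc j, i)) u = f (emb j u)" for j u
  by (cases u) auto
 have "resp f \<longleftrightarrow> (\<forall>(p, q)\<in>stack_rel ds. f p = f q)"
 proof
  assume r: "resp f"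
  have "f p = f q" if pq: "(p, q) \<in> stack_rel ds" for p q
  proof -
   obtain j u v where "j < length ds" "same (ds ! j) u v" "p = emb j u" "q = emb j v"
    using pq unfolding stack_rel_same by blast
   thus ?thesis using r unfolding resp_def rel_def mem_Collect_eq case_prod_conv v by blast
  qed
  thus "\<forall>(p, q)\<in>stack_rel ds. f p = f q" by blast
 next
  assume r: "\<forall>(p, q)\<in>stack_rel ds. f p = f q"
  have "f (emb j u) = f (emb j v)" if "j < length ds" "same (ds ! j) u v" for j u v
  proof -
   have "(emb j u, emb j v) \<in> stack_rel ds" unfolding stack_rel_same using that by blast
   thus ?thesis using r by blast
  qed
  thus "resp f" unfolding resp_def rel_def mem_Collect_eq case_prod_conv v by blast
 qed
 also have "\<dots> \<longleftrightarrow> (\<forall>(p, q)\<in>E. f p = f q)"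
 proof
  assume *: "\<forall>(p, q)\<in>stack_rel ds. f p = f q"
  have "f p = f q" if "(p, q) \<in> E" for p q
   using that by (induction rule: trancl_induct) (use * in auto)
  thus "\<forall>(p, q)\<in>E. f p = f q" by blast
 qed auto
 finally show ?thesis .
qed

text \<open>On a component that reaches an outer row the colour is forced by x and z; on the
  discarded components it is free and taken from \<open>g\<close>.\<close>

definition extend :: "(nat \<times> nat => nat) => (nat => nat) => (nat => nat) => nat \<times> nat => nat" where
 "extend g x z p = (if \<exists>u. (p, outv (length ds) u) \<in> E
   then vl x z (SOME u. (p, outv (length ds) u) \<in> E) else g p)"

lemma extend_outer:
 assumes "(x, z) \<in> rel (outer_diagram ds)" "(p, outv (length ds) u) \<in> E"
 shows "extend g x z p = vl x z u"
proof -
 let ?u = "SOME u. (p, outv (length ds) u) \<in> E"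
 have "(p, outv (length ds) ?u) \<in> E" using assms(2) by (rule someI)
 hence "same (outer_diagram ds) ?u u"
  unfolding same_outer using assms(2) E_sym E_trans by blast
 hence "vl x z ?u = vl x z u" using assms(1) by (simp add: rel_def)
 thus ?thesis using assms(2) by (auto simp: extend_def)
qed

lemma extend_resp:
 assumes xz: "(x, z) \<in> rel (outer_diagram ds)"
  and g: "\<And>p q. (p, q) \<in> E ==> \<nexists>u. (p, outv (length ds) u) \<in> E ==> g p = g q"
 shows "resp (extend g x z)"
proof -
 have "extend g x z p = extend g x z q" if pq: "(p, q) \<in> E" for p q
 proof (cases "\<exists>u. (p, outv (length ds) u) \<in> E")
  case True
  then obtain u where "(p, outv (length ds) u) \<in> E" by blast
  moreover from this have "(q, outv (length ds) u) \<in> E" using pq E_sym E_trans by blast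
  ultimately show ?thesis using extend_outer[OF xz] by simp
 next
  case False
  hence "\<not> (\<exists>u. (q, outv (length ds) u) \<in> E)" using pq E_trans by blast
  thus ?thesis using False pq g by (auto simp: extend_def)
 qed
 thus ?thesis unfolding resp_iff by blast
qed

text \<open>Compatible colourings of a stack are those constant on its components. Their outer
  traces are therefore compatible with the composite, and conversely \<open>extend\<close> supplies
  the inner rows.\<close>

lemma rel_outer:
 "(x, z) \<in> rel (outer_diagram ds) \<longleftrightarrow>
  (\<exists>f. resp f \<and> (\<forall>u\<in>verts k. f (outv (length ds) u) = vl x z u))"
proof
 assume *: "(x, z) \<in> rel (outer_diagram ds)"
 have "extend (\<lambda>_. 0) x z (outv (length ds) u) = vl x z u" if "u \<in> verts k" for u
  using that extend_outer[OF *] E_refl outv_N by blast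
 thus "\<exists>f. resp f \<and> (\<forall>u\<in>verts k. f (outv (length ds) u) = vl x z u)"
  using extend_resp[OF *, of "\<lambda>_. 0"] by blast
next
 assume "\<exists>f. resp f \<and> (\<forall>u\<in>verts k. f (outv (length ds) u) = vl x z u)"
 then obtain f where f: "resp f" "\<And>u. u \<in> verts k ==> f (outv (length ds) u) = vl x z u" by blast
 have "vl x z u = vl x z v" if "same (outer_diagram ds) u v" for u v
 proof -
  have "(outv (length ds) u, outv (length ds) v) \<in> E" using that same_outer by simp
  moreover from this have "u \<in> verts k" "v \<in> verts k" using E_N outv_N by blast+
  ultimately show ?thesis using f unfolding resp_iff by (metis (mono_tags, lifting) case_prodD)
 qed
 thus "(x, z) \<in> rel (outer_diagram ds)" by (simp add: rel_def)
qed

end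

lemma compose_in: "d1 \<in> all_diagrams k ==> d2 \<in> all_diagrams k ==> d1 \<cdot> d2 \<in> all_diagrams k"
 unfolding compose_eq_outer by (rule stack.outer_diagram_in) (simp add: stack_def)

text \<open>The colouring of the middle row is the intermediate element of the relational
  composition. All monoid identities below are read off from relations by means of this and
  \<open>rel_inj\<close>.\<close>

lemma rel_compose:
 assumes d: "d1 \<in> all_diagrams k" "d2 \<in> all_diagrams k"
 shows "rel (d1 \<cdot> d2) = rel d1 O rel d2"
proof -
 interpret stack k "[d1, d2]" using d by (simp add: stack_def)
 have r: "resp f \<longleftrightarrow> ((\<lambda>i. f (0, i)), (\<lambda>i. f (1, i))) \<in> rel d1 \<and> ((\<lambda>i. f (1, i)), (\<lambda>i. f (2, i))) \<in> rel d2" for f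
  unfolding resp_def by (auto simp: less_Suc_eq numeral_2_eq_2)
 have "(x, z) \<in> rel (d1 \<cdot> d2) \<longleftrightarrow> (x, z) \<in> rel d1 O rel d2" for x z
 proof
  assume "(x, z) \<in> rel (d1 \<cdot> d2)"
  then obtain f where f: "resp f" "\<forall>u\<in>verts k. f (outv 2 u) = vl x z u"
   unfolding compose_eq_outer rel_outer by (auto simp: numeral_2_eq_2)
  have o: "f (0, i) = x i" "f (2, i) = z i" if "i \<in> {1..k}" for i
   using f(2)[rule_format, of "Top i"] f(2)[rule_format, of "Bot i"] that by auto
  from f(1) have r1: "((\<lambda>i. f (0, i)), (\<lambda>i. f (1, i))) \<in> rel d1"
   and r2: "((\<lambda>i. f (1, i)), (\<lambda>i. f (2, i))) \<in> rel d2" unfolding r by auto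
  have "(x, (\<lambda>i. f (1, i))) \<in> rel d1" by (rule rel_cong[OF d(1) r1]) (auto simp: o)
  moreover have "((\<lambda>i. f (1, i)), z) \<in> rel d2" by (rule rel_cong[OF d(2) r2]) (auto simp: o)
  ultimately show "(x, z) \<in> rel d1 O rel d2" by blast
 next
  assume "(x, z) \<in> rel d1 O rel d2"
  then obtain y where y: "(x, y) \<in> rel d1" "(y, z) \<in> rel d2" by blast
  define f where "f = (\<lambda>(r :: nat, i). if r = 0 then x i else if r = 1 then y i else z i :: nat)"
  have "f (outv (2::nat) u) = vl x z u" for u by (cases u) (auto simp: f_def)
  moreover have "resp f" unfolding r using y by (simp add: f_def)
  ultimately show "(x, z) \<in> rel (d1 \<cdot> d2)"
   unfolding compose_eq_outer rel_outer by (auto simp: numeral_2_eq_2)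
 qed
 thus ?thesis by auto
qed

section \<open>Reflection and identity: the monoid of diagrams as a regular star-semigroup\<close>

lemma flipv_flipv [simp]: "flipv (flipv u) = u"
 by (cases u) auto

lemma flipv_verts [simp]: "flipv u \<in> verts k \<longleftrightarrow> u \<in> verts k"
 by (cases u) auto

lemma flip_image_mem: "u \<in> flipv ` B \<longleftrightarrow> flipv u \<in> B"
 by (metis flipv_flipv image_eqI imageE)

lemma transp_in: "d \<in> all_diagrams k ==> transp d \<in> all_diagrams k"
proof (rule all_diagramsI)
 assume d: "d \<in> all_diagrams k"
 show "u \<in> verts k" if "B \<in> transp d" "u \<in> B" for B u
  using that block_sub[OF d] unfolding transp_def by auto
 show "\<exists>B\<in>transp d. u \<in> B" if "u \<in> verts k" for u
  using that block_ex[OF d, of "flipv u"] unfolding transp_def by (auto simp: flip_image_mem)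
 show "B \<noteq> {}" if "B \<in> transp d" for B
  using that block_nonempty[OF d] unfolding transp_def by auto
 show "B = C" if BC: "B \<in> transp d" "C \<in> transp d" "u \<in> B" "u \<in> C" for B C u
 proof -
  obtain B' C' where e: "B' \<in> d" "C' \<in> d" "B = flipv ` B'" "C = flipv ` C'"
   using BC unfolding transp_def by blast
  hence "flipv u \<in> B'" "flipv u \<in> C'" using BC by (simp_all add: flip_image_mem)
  thus ?thesis using block_unique[OF d e(1,2)] e(3,4) by metis
 qed
qed

lemma same_transp: "same (transp d) u v \<longleftrightarrow> same d (flipv u) (flipv v)"
 unfolding same_def transp_def by (auto simp: flip_image_mem)

lemma rel_transp: "rel (transp d) = (rel d)\<inverse>"
proof -
 have v: "vl x y u = vl y x (flipv u)" for x y :: "nat => nat" and u by (cases u) auto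
 have "(x, y) \<in> rel (transp d) \<longleftrightarrow> (y, x) \<in> rel d" for x y
  unfolding rel_def same_transp by (auto simp: v[of x y]) (metis flipv_flipv)
 thus ?thesis by auto
qed

lemma id_in: "id_diagram k \<in> all_diagrams k"
proof (rule all_diagramsI)
 show "\<exists>B\<in>id_diagram k. u \<in> B" if "u \<in> verts k" for u
  using that by (cases u) (auto simp: id_diagram_def)
qed (auto simp: id_diagram_def)

lemma rel_id: "rel (id_diagram k) = {(x, y). \<forall>i\<in>{1..k}. x i = y i}"
proof -
 have "(x, y) \<in> rel (id_diagram k) \<longleftrightarrow> (\<forall>i\<in>{1..k}. x i = y i)" for x y
 proof
  assume *: "(x, y) \<in> rel (id_diagram k)"
  show "\<forall>i\<in>{1..k}. x i = y i"
  proof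
   fix i assume "i \<in> {1..k}"
   hence "same (id_diagram k) (Top i) (Bot i)" unfolding same_def id_diagram_def by blast
   hence "vl x y (Top i) = vl x y (Bot i)" using * unfolding rel_def by blast
   thus "x i = y i" by simp
  qed
 qed (auto simp: rel_def same_def id_diagram_def)
 thus ?thesis by auto
qed

lemma compose_assoc:
 assumes "a \<in> all_diagrams k" "b \<in> all_diagrams k" "c \<in> all_diagrams k"
 shows "(a \<cdot> b) \<cdot> c = a \<cdot> (b \<cdot> c)"
 by (rule rel_inj[of _ k])
  (simp_all add: assms compose_in rel_compose[of _ k] O_assoc)

lemma transp_compose:
 assumes "a \<in> all_diagrams k" "b \<in> all_diagrams k"
 shows "transp (a \<cdot> b) = transp b \<cdot> transp a"
 by (rule rel_inj[of _ k])
  (simp_all add: assms compose_in transp_in rel_compose[of _ k] rel_transp converse_relcomp)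

lemma transp_transp [simp]: "transp (transp a) = a"
proof -
 have "flipv ` flipv ` X = X" for X by (auto simp: image_image)
 thus ?thesis by (simp add: transp_def image_image)
qed

text \<open>The relation is difunctional: a constraint inside one row is copied from the first or
  the last pair, and a constraint between the rows is passed along x, p, q, y.\<close>

lemma compose_regular:
 assumes "d \<in> all_diagrams k"
 shows "d \<cdot> transp d \<cdot> d = d"
proof (rule rel_inj[of _ k])
 have "(x, y) \<in> rel d" if r: "(x, p) \<in> rel d" "(q, p) \<in> rel d" "(q, y) \<in> rel d" for x y p q
  unfolding rel_def mem_Collect_eq case_prod_conv
 proof (intro allI impI)
  fix u v assume s: "same d u v"
  have e: "vl x p u = vl x p v" "vl q p u = vl q p v" "vl q y u = vl q y v"
   using r s by (auto simp: rel_def)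
  show "vl x y u = vl x y v" using e by (cases u; cases v) auto
 qed
 thus "rel (d \<cdot> transp d \<cdot> d) = rel d"
  using assms by (auto simp: rel_compose[of _ k] compose_in transp_in rel_transp)
qed (use assms in \<open>simp_all add: compose_in transp_in\<close>)

lemma id_compose: "d \<in> all_diagrams k ==> id_diagram k \<cdot> d = d"
proof (rule rel_inj[of _ k])
 assume d: "d \<in> all_diagrams k"
 show "rel (id_diagram k \<cdot> d) = rel d"
  unfolding rel_compose[OF id_in d] rel_id using rel_cong[OF d] by fastforce
qed (simp_all add: compose_in id_in)

lemma transp_id: "transp (id_diagram k) = id_diagram k"
 by (rule rel_inj[of _ k]) (auto simp: transp_in id_in rel_transp rel_id)

lemma compose_id: "d \<in> all_diagrams k ==> d \<cdot> id_diagram k = d"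
 by (metis id_compose id_in transp_compose transp_id transp_in transp_transp)

section \<open>Symmetric diagrams and propagating numbers\<close>

text \<open>The upper half of a diagram consists of \<open>tops\<close>, the partition induced on
  the top row, and \<open>dtop\<close>, the classes that propagate.\<close>

definition tops :: "diagram => nat set set" where
 "tops d = {tp B |B. B \<in> d \<and> tp B \<noteq> {}}"

definition dtop :: "diagram => nat set set" where
 "dtop d = tp ` props d"

lemma relD: "(x, y) \<in> rel d ==> same d u v ==> vl x y u = vl x y v"
 by (simp add: rel_def)

lemma relI: "(\<And>u v. same d u v ==> vl x y u = vl x y v) ==> (x, y) \<in> rel d"
 by (simp add: rel_def)

lemma tp_iff [simp]: "i \<in> tp B \<longleftrightarrow> Top i \<in> B"
 by (simp add: tp_def)

lemma bt_iff [simp]: "i \<in> bt B \<longleftrightarrow> Bot i \<in> B"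
 by (simp add: bt_def)

lemma tp_flip [simp]: "tp (flipv ` B) = bt B"
 unfolding tp_def bt_def by (simp add: flip_image_mem)

lemma bt_flip [simp]: "bt (flipv ` B) = tp B"
 unfolding tp_def bt_def by (simp add: flip_image_mem)

lemma propagating_flip [simp]: "propagating (flipv ` B) \<longleftrightarrow> propagating B"
 by (auto simp: propagating_def)

lemma props_transp: "props (transp d) = (`) flipv ` props d"
 by (auto simp: props_def transp_def)

lemma inj_flip_image: "inj ((`) flipv)"
proof (rule inj_onI)
 fix A B assume "flipv ` A = flipv ` B"
 hence "flipv ` flipv ` A = flipv ` flipv ` B" by simp
 thus "A = B" by (simp add: image_image)
qed

lemma pn_transp [simp]: "pn (transp d) = pn d"
 unfolding pn_def props_transp by (rule card_image) (meson inj_flip_image inj_on_subset subset_UNIV)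

lemma dtop_transp: "dtop (transp d) = bt ` props d"
 by (simp add: dtop_def props_transp image_image)

lemma tops_transp: "tops (transp d) = {bt B |B. B \<in> d \<and> bt B \<noteq> {}}"
proof -
 have "x \<in> tops (transp d) \<longleftrightarrow> (\<exists>C\<in>d. x = tp (flipv ` C) \<and> tp (flipv ` C) \<noteq> {})" for x
  unfolding tops_def transp_def mem_Collect_eq Bex_def image_iff by metis
 hence "x \<in> tops (transp d) \<longleftrightarrow> x \<in> {bt B |B. B \<in> d \<and> bt B \<noteq> {}}" for x
  unfolding tp_flip mem_Collect_eq Bex_def by metis
 thus ?thesis by (rule set_eqI)
qed

lemma tp_Top [simp]: "tp (Top ` B) = B" "tp (Bot ` B) = {}" "bt (Top ` B) = {}" "bt (Bot ` B) = B"
 "tp (Top ` B \<union> Bot ` C) = B" "bt (Top ` B \<union> Bot ` C) = C"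
 by (auto simp: tp_def bt_def)

lemma sameI: "X \<in> d ==> u \<in> X ==> v \<in> X ==> same d u v"
 unfolding same_def by metis

lemma propsD: "B \<in> props d ==> B \<in> d" "B \<in> props d ==> tp B \<noteq> {}" "B \<in> props d ==> bt B \<noteq> {}"
 by (auto simp: props_def propagating_def)

lemma dtop_sub_tops: "dtop d \<subseteq> tops d"
 unfolding dtop_def tops_def using propsD by blast

lemma inj_tp:
 assumes "d \<in> all_diagrams k" shows "inj_on tp {B \<in> d. tp B \<noteq> {}}"
proof (rule inj_onI)
 fix B C assume "B \<in> {B \<in> d. tp B \<noteq> {}}" "C \<in> {B \<in> d. tp B \<noteq> {}}" "tp B = tp C"
 moreover from this obtain i where "i \<in> tp B" "i \<in> tp C" by blast
 ultimately show "B = C" using block_unique[OF assms, of B C "Top i"] unfolding tp_iff by blast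
qed

lemma inj_tp_props: "d \<in> all_diagrams k ==> inj_on tp (props d)"
 by (rule inj_on_subset[OF inj_tp]) (auto dest: propsD)

lemma inj_bt_props:
 assumes "d \<in> all_diagrams k" shows "inj_on bt (props d)"
proof (rule inj_onI)
 fix B C assume "B \<in> props d" "C \<in> props d" "bt B = bt C"
 moreover from this obtain i where "i \<in> bt B" "i \<in> bt C" using propsD(3) by blast
 ultimately show "B = C" using block_unique[OF assms, of B C "Bot i"] propsD(1) unfolding bt_iff by blast
qed

lemma card_dtop: "d \<in> all_diagrams k ==> card (dtop d) = pn d"
 unfolding dtop_def pn_def by (rule card_image) (rule inj_tp_props)

lemma same_Top_iff: "same d (Top i) (Top j) \<longleftrightarrow> (\<exists>B\<in>tops d. i \<in> B \<and> j \<in> B)"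
proof
 assume "same d (Top i) (Top j)"
 then obtain B where "B \<in> d" "i \<in> tp B" "j \<in> tp B" by (auto simp: same_def)
 thus "\<exists>B\<in>tops d. i \<in> B \<and> j \<in> B" unfolding tops_def by blast
qed (auto simp: same_def tops_def)

lemma prop_iff_same: "i \<in> \<Union>(dtop d) \<longleftrightarrow> (\<exists>j. same d (Top i) (Bot j))"
proof -
 have "i \<in> \<Union>(dtop d) \<longleftrightarrow> (\<exists>B\<in>d. propagating B \<and> Top i \<in> B)"
  by (auto simp: dtop_def props_def)
 moreover have "propagating B \<longleftrightarrow> (\<exists>i. Top i \<in> B) \<and> (\<exists>j. Bot j \<in> B)" for B
  by (auto simp: propagating_def tp_def bt_def)
 ultimately show ?thesis unfolding same_def by metis
qed

lemma tops_partition: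
 assumes "d \<in> all_diagrams k" shows "partition_on {1..k} (tops d)"
proof (rule partition_onI)
 have "i \<in> \<Union> (tops d) \<longleftrightarrow> i \<in> {1..k}" for i
 proof -
  have "i \<in> \<Union> (tops d) \<longleftrightarrow> same d (Top i) (Top i)" by (auto simp: same_Top_iff)
  also have "\<dots> \<longleftrightarrow> Top i \<in> verts k" using same_refl[OF assms] same_verts[OF assms] by metis
  finally show ?thesis by simp
 qed
 thus "\<Union> (tops d) = {1..k}" by blast
next
 fix p q assume pq: "p \<in> tops d" "q \<in> tops d" "p \<noteq> q"
 then obtain B C where BC: "B \<in> d" "C \<in> d" "p = tp B" "q = tp C" by (auto simp: tops_def)
 hence "B \<noteq> C" using pq by blast
 thus "disjnt p q" using block_unique[OF assms BC(1,2)] BC by (auto simp: disjnt_def)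
qed (auto simp: tops_def)

lemma tops_unique:
 assumes "d \<in> all_diagrams k" "B \<in> tops d" "C \<in> tops d" "i \<in> B" "i \<in> C"
 shows "B = C"
 using disjointD[OF partition_onD2[OF tops_partition[OF assms(1)]] assms(2,3)] assms(4,5) by blast

lemma finite_tops: "d \<in> all_diagrams k ==> finite (tops d)"
 using finite_elements[OF _ tops_partition] by blast

lemma finite_dtop: "d \<in> all_diagrams k ==> finite (dtop d)"
 using finite_subset[OF dtop_sub_tops finite_tops] .

lemma dtop_props: "d \<in> all_diagrams k ==> finite (props d)"
 using finite_diagram by (simp add: props_def)

section \<open>Symmetric diagrams given by a partition and distinguished blocks\<close>

context
 fixes k :: nat and P D :: "nat set set" assumes P: "partition_on {1..k} P" and D: "D \<subseteq> P"
begin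

lemma P_unique: "B \<in> P ==> C \<in> P ==> i \<in> B ==> i \<in> C ==> B = C"
 using disjointD[OF partition_onD2[OF P]] by blast

lemma P_ne: "B \<in> P ==> B \<noteq> {}"
 using partition_onD3[OF P] by blast

lemma sym_diagramI:
 "B \<in> D ==> Top ` B \<union> Bot ` B \<in> sym_diagram_of P D"
 "B \<in> P ==> B \<notin> D ==> Top ` B \<in> sym_diagram_of P D"
 "B \<in> P ==> B \<notin> D ==> Bot ` B \<in> sym_diagram_of P D"
 unfolding sym_diagram_of_def by auto

lemma sym_diagramE:
 assumes "X \<in> sym_diagram_of P D"
 obtains B where "B \<in> P" "B \<in> D" "X = Top ` B \<union> Bot ` B"
 | B where "B \<in> P" "B \<notin> D" "X = Top ` B"
 | B where "B \<in> P" "B \<notin> D" "X = Bot ` B"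
 using assms D unfolding sym_diagram_of_def by auto

lemma sym_diagram_in: "sym_diagram_of P D \<in> all_diagrams k"
proof (rule all_diagramsI)
 have PU: "\<Union> P = {1..k}" using partition_onD1[OF P] ..
 fix B u assume "B \<in> sym_diagram_of P D" "u \<in> B"
 moreover have "i \<in> {1..k}" if "i \<in> C" "C \<in> P" for i C using PU that by blast
 ultimately show "u \<in> verts k" by (elim sym_diagramE) auto
next
 fix u assume u: "u \<in> verts k"
 obtain i where i: "u = Top i \<or> u = Bot i" by (cases u) auto
 with u have "i \<in> {1..k}" by auto
 then obtain B where B: "B \<in> P" "i \<in> B" using partition_onD1[OF P] by blast
 show "\<exists>B\<in>sym_diagram_of P D. u \<in> B"
 proof (cases "B \<in> D")
  case True
  hence "Top ` B \<union> Bot ` B \<in> sym_diagram_of P D" by (rule sym_diagramI)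
  moreover have "u \<in> Top ` B \<union> Bot ` B" using i B by auto
  ultimately show ?thesis by metis
 next
  case False
  hence "Top ` B \<in> sym_diagram_of P D" "Bot ` B \<in> sym_diagram_of P D"
   using sym_diagramI B by simp_all
  moreover have "u \<in> Top ` B \<or> u \<in> Bot ` B" using i B by auto
  ultimately show ?thesis by metis
 qed
next
 fix B assume "B \<in> sym_diagram_of P D"
 thus "B \<noteq> {}" by (elim sym_diagramE) (auto dest: P_ne)
next
 fix B C u assume "B \<in> sym_diagram_of P D" "C \<in> sym_diagram_of P D" "u \<in> B" "u \<in> C"
 thus "B = C"
  by (elim sym_diagramE) (auto dest: P_unique)
qed

lemma tops_sym: "tops (sym_diagram_of P D) = P"
proof -
 have "B \<in> tops (sym_diagram_of P D)" if "B \<in> P" for B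
 proof (cases "B \<in> D")
  case True
  hence "Top ` B \<union> Bot ` B \<in> sym_diagram_of P D" by (rule sym_diagramI)
  thus ?thesis unfolding tops_def using P_ne[OF that] tp_Top(5) by fastforce
 next
  case False
  hence "Top ` B \<in> sym_diagram_of P D" using that sym_diagramI by simp
  thus ?thesis unfolding tops_def using P_ne[OF that] tp_Top(1) by fastforce
 qed
 moreover have "B \<in> P" if "B \<in> tops (sym_diagram_of P D)" for B
  using that unfolding tops_def by (auto elim!: sym_diagramE)
 ultimately show ?thesis by blast
qed

lemma dtop_sym: "dtop (sym_diagram_of P D) = D"
proof -
 have "B \<in> dtop (sym_diagram_of P D)" if "B \<in> D" for B
 proof -
  have "Top ` B \<union> Bot ` B \<in> sym_diagram_of P D" using that by (rule sym_diagramI)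
  hence "Top ` B \<union> Bot ` B \<in> props (sym_diagram_of P D)"
   using P_ne that D by (auto simp: props_def propagating_def)
  thus ?thesis unfolding dtop_def using tp_Top(5) by (metis image_eqI)
 qed
 moreover have "B \<in> D" if "B \<in> dtop (sym_diagram_of P D)" for B
  using that unfolding dtop_def props_def propagating_def by (auto elim!: sym_diagramE)
 ultimately show ?thesis by blast
qed

lemma same_symD:
 "B \<in> P ==> i \<in> B ==> j \<in> B ==> same (sym_diagram_of P D) (Top i) (Top j)"
 "B \<in> P ==> i \<in> B ==> j \<in> B ==> same (sym_diagram_of P D) (Bot i) (Bot j)"
 "B \<in> D ==> i \<in> B ==> j \<in> B ==> same (sym_diagram_of P D) (Top i) (Bot j)"
proof -
 show "same (sym_diagram_of P D) (Top i) (Bot j)" if "B \<in> D" "i \<in> B" "j \<in> B"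
  by (rule sameI[OF sym_diagramI(1)[OF that(1)]]) (simp_all add: that)
 show "same (sym_diagram_of P D) (Top i) (Top j)" if "B \<in> P" "i \<in> B" "j \<in> B"
 proof (cases "B \<in> D")
  case True show ?thesis by (rule sameI[OF sym_diagramI(1)[OF True]]) (simp_all add: that)
 next
  case False show ?thesis by (rule sameI[OF sym_diagramI(2)[OF that(1) False]]) (simp_all add: that)
 qed
 show "same (sym_diagram_of P D) (Bot i) (Bot j)" if "B \<in> P" "i \<in> B" "j \<in> B"
 proof (cases "B \<in> D")
  case True show ?thesis by (rule sameI[OF sym_diagramI(1)[OF True]]) (simp_all add: that)
 next
  case False show ?thesis by (rule sameI[OF sym_diagramI(3)[OF that(1) False]]) (simp_all add: that)
 qed
qed

lemma rel_sym: "(x, y) \<in> rel (sym_diagram_of P D) \<longleftrightarrow>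
  (\<forall>B\<in>P. \<forall>i\<in>B. \<forall>j\<in>B. x i = x j \<and> y i = y j) \<and> (\<forall>B\<in>D. \<forall>i\<in>B. x i = y i)"
proof
 assume *: "(x, y) \<in> rel (sym_diagram_of P D)"
 note r = relD[OF *]
 show "(\<forall>B\<in>P. \<forall>i\<in>B. \<forall>j\<in>B. x i = x j \<and> y i = y j) \<and> (\<forall>B\<in>D. \<forall>i\<in>B. x i = y i)"
 proof (intro conjI ballI)
  fix B i j assume B: "B \<in> P" "i \<in> B" "j \<in> B"
  show "x i = x j" using r[OF same_symD(1)[OF B]] by simp
  show "y i = y j" using r[OF same_symD(2)[OF B]] by simp
 next
  fix B i assume B: "B \<in> D" "i \<in> B"
  show "x i = y i" using r[OF same_symD(3)[OF B B(2)]] by simp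
 qed
next
 assume *: "(\<forall>B\<in>P. \<forall>i\<in>B. \<forall>j\<in>B. x i = x j \<and> y i = y j) \<and> (\<forall>B\<in>D. \<forall>i\<in>B. x i = y i)"
 from * have Px: "x i = x j" "y i = y j" if "B \<in> P" "i \<in> B" "j \<in> B" for B i j
  using that by blast+
 from * have Dx: "x i = y i" if "B \<in> D" "i \<in> B" for B i
  using that by blast
 show "(x, y) \<in> rel (sym_diagram_of P D)"
 proof (rule relI)
  fix u v assume "same (sym_diagram_of P D) u v"
  then obtain X where X: "X \<in> sym_diagram_of P D" "u \<in> X" "v \<in> X"
   unfolding same_def by metis
  show "vl x y u = vl x y v" using X(1)
  proof (cases rule: sym_diagramE)
   case (1 B)
   case (1 B)
   obtain i j where "i \<in> B" "j \<in> B" "u = Top i \<or> u = Bot i" "v = Top j \<or> v = Bot j"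
    using X(2,3) 1(3) by auto
   thus ?thesis using Px[OF 1(1), of i j] Dx[OF 1(2), of i] Dx[OF 1(2), of j] by auto
  next
   case (2 B)
   obtain i j where "i \<in> B" "j \<in> B" "u = Top i" "v = Top j"
    using X(2,3) 2(3) by auto
   thus ?thesis using Px(1)[OF 2(1), of i j] by simp
  next
   case (3 B)
   obtain i j where "i \<in> B" "j \<in> B" "u = Bot i" "v = Bot j"
    using X(2,3) 3(3) by auto
   thus ?thesis using Px(2)[OF 3(1), of i j] by simp
  qed
 qed
qed

lemma transp_sym: "transp (sym_diagram_of P D) = sym_diagram_of P D"
proof (rule rel_inj[of _ k])
 show "rel (transp (sym_diagram_of P D)) = rel (sym_diagram_of P D)"
 proof -
  have "(y, x) \<in> rel (sym_diagram_of P D)" if h: "(x, y) \<in> rel (sym_diagram_of P D)" for x y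
  proof -
   note h1 = h[unfolded rel_sym, THEN conjunct1, rule_format]
   note h2 = h[unfolded rel_sym, THEN conjunct2, rule_format]
   show ?thesis unfolding rel_sym
   proof (intro conjI ballI)
    fix B i j assume B: "B \<in> P" "i \<in> B" "j \<in> B"
    show "y i = y j" "x i = x j" using h1[OF B] by simp_all
   next
    fix B i assume B: "B \<in> D" "i \<in> B"
    show "y i = x i" using h2[OF B] by (rule sym)
   qed
  qed
  thus ?thesis unfolding rel_transp by auto
 qed
qed (simp_all add: sym_diagram_in transp_in)

end

text \<open>Reflecting d below itself erases its lower half: two top rows have a common partner
  below exactly if both respect the upper partition and agree on its propagating classes. Equality
  of upper halves can thus be expressed as the equation
  \<open>a \<cdot> transp a = b \<cdot> transp b\<close>.\<close>

lemma compose_transp_eq_sym: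
 assumes d: "d \<in> all_diagrams k"
 shows "d \<cdot> transp d = sym_diagram_of (tops d) (dtop d)"
proof (rule rel_inj[of _ k])
 note P = tops_partition[OF d] and D = dtop_sub_tops[of d]
 show "rel (d \<cdot> transp d) = rel (sym_diagram_of (tops d) (dtop d))"
 proof (intro set_eqI, clarify)
  fix x y :: "nat => nat"
  have "(\<exists>z. (x, z) \<in> rel d \<and> (y, z) \<in> rel d) \<longleftrightarrow>
   (\<forall>B\<in>tops d. \<forall>i\<in>B. \<forall>j\<in>B. x i = x j \<and> y i = y j) \<and> (\<forall>B\<in>dtop d. \<forall>i\<in>B. x i = y i)"
   (is "?L \<longleftrightarrow> ?R")
  proof
   assume ?L
   then obtain z where z: "\<And>u v. same d u v ==> vl x z u = vl x z v"
    "\<And>u v. same d u v ==> vl y z u = vl y z v" using relD by metis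
   have "x i = x j \<and> y i = y j" if "B \<in> tops d" "i \<in> B" "j \<in> B" for B i j
   proof -
    have "same d (Top i) (Top j)" unfolding same_Top_iff using that by blast
    thus ?thesis using z[of "Top i" "Top j"] by simp
   qed
   moreover have "x i = y i" if "B \<in> dtop d" "i \<in> B" for B i
   proof -
    have "i \<in> \<Union>(dtop d)" using that by blast
    then obtain j where "same d (Top i) (Bot j)" unfolding prop_iff_same by blast
    thus ?thesis using z[of "Top i" "Bot j"] by simp
   qed
   ultimately show ?R by blast
  next
   assume R: ?R
   have xt: "x i = x j \<and> y i = y j" if "same d (Top i) (Top j)" for i j
    using R that unfolding same_Top_iff by blast
   have xp: "x i = y i" if "same d (Top i) (Bot j)" for i j
    using R that prop_iff_same[of i d] by blast
   \<comment> \<open>The common lower row: a bottom vertex takes the colour of any top vertex joined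
     to it, and 0 if there is none.\<close>
   define z where "z j = (if \<exists>i. same d (Top i) (Bot j) then x (SOME i. same d (Top i) (Bot j)) else 0)" for j
   have zt: "z j = x i" if "same d (Top i) (Bot j)" for i j
   proof -
    have "same d (Top (SOME i. same d (Top i) (Bot j))) (Bot j)" using that by (rule someI)
    hence "same d (Top (SOME i. same d (Top i) (Bot j))) (Top i)"
     using that same_sym same_trans[OF d] by blast
    thus ?thesis using that xt unfolding z_def by auto
   qed
   have zb: "z j = z j'" if s: "same d (Bot j) (Bot j')" for j j'
   proof -
    have e: "same d (Top i) (Bot j) \<longleftrightarrow> same d (Top i) (Bot j')" for i
     using same_trans[OF d] s same_sym by meson
    show ?thesis unfolding z_def e ..
   qed
   have "vl x z u = vl x z v \<and> vl y z u = vl y z v" if s: "same d u v" for u v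
   proof (cases u)
    case u: (Top i)
    show ?thesis
    proof (cases v)
     case (Top j) thus ?thesis using s u xt by simp
    next
     case (Bot j) thus ?thesis using s u zt[of i j] xp[of i j] by simp
    qed
   next
    case u: (Bot i)
    show ?thesis
    proof (cases v)
     case (Top j) thus ?thesis using same_sym[OF s] u zt[of j i] xp[of j i] by simp
    next
     case (Bot j) thus ?thesis using s u zb by simp
    qed
   qed
   hence "(x, z) \<in> rel d" "(y, z) \<in> rel d" by (simp_all add: relI)
   thus ?L by blast
  qed
  note eq1 = this
  have eq2: "(x, y) \<in> rel (d \<cdot> transp d) \<longleftrightarrow> (\<exists>z. (x, z) \<in> rel d \<and> (y, z) \<in> rel d)"
   unfolding rel_compose[OF d transp_in[OF d]] rel_transp by (simp add: relcomp_unfold)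
  show "(x, y) \<in> rel (d \<cdot> transp d) \<longleftrightarrow> (x, y) \<in> rel (sym_diagram_of (tops d) (dtop d))"
   unfolding rel_sym[OF P D] eq2 by (rule eq1)
 qed
qed (simp_all add: d compose_in transp_in sym_diagram_in[OF tops_partition[OF d] dtop_sub_tops])

lemma compose_transp_eq_iff:
 assumes "a \<in> all_diagrams k" "b \<in> all_diagrams k"
 shows "a \<cdot> transp a = b \<cdot> transp b \<longleftrightarrow> tops a = tops b \<and> dtop a = dtop b"
 unfolding compose_transp_eq_sym[OF assms(1)] compose_transp_eq_sym[OF assms(2)]
 using tops_sym[OF tops_partition dtop_sub_tops] dtop_sym[OF tops_partition dtop_sub_tops] assms by metis

section \<open>Projections\<close>

definition is_proj :: "diagram => bool" where
 "is_proj p \<longleftrightarrow> transp p = p \<and> p \<cdot> p = p"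

lemma proj_compose_transp:
 assumes "d \<in> all_diagrams k" shows "is_proj (d \<cdot> transp d)"
 unfolding is_proj_def
proof
 note t = transp_in[OF assms]
 show "transp (d \<cdot> transp d) = d \<cdot> transp d"
  using transp_compose[OF assms t] by simp
 show "d \<cdot> transp d \<cdot> (d \<cdot> transp d) = d \<cdot> transp d"
  using compose_assoc[OF compose_in[OF assms t] assms t] compose_regular[OF assms] by simp
qed

lemma proj_sym:
 assumes P: "partition_on {1..k} P" and D: "D \<subseteq> P"
 shows "is_proj (sym_diagram_of P D)"
proof -
 let ?s = "sym_diagram_of P D"
 have s: "?s \<in> all_diagrams k" by (rule sym_diagram_in[OF P D])
 have "?s \<cdot> transp ?s = ?s"
  unfolding compose_transp_eq_sym[OF s] tops_sym[OF P D] dtop_sym[OF P D] ..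
 thus ?thesis unfolding is_proj_def using transp_sym[OF P D] by simp
qed

lemma dtop_compose_transp:
 assumes "d \<in> all_diagrams k"
 shows "tops (d \<cdot> transp d) = tops d" "dtop (d \<cdot> transp d) = dtop d"
 unfolding compose_transp_eq_sym[OF assms]
 using tops_sym[OF tops_partition[OF assms] dtop_sub_tops]
  dtop_sym[OF tops_partition[OF assms] dtop_sub_tops] by simp_all

lemma pn_compose_transp: "d \<in> all_diagrams k ==> pn (d \<cdot> transp d) = pn d"
 by (metis card_dtop compose_in dtop_compose_transp(2) transp_in)

section \<open>Counting colourings\<close>

text \<open>Such a colouring amounts to a free choice of one colour for each block in N, the
  remaining blocks being prescribed by \<open>y0\<close>. The lemma is used for the images and
  fibres of \<open>rel d\<close> and for the middle rows of a stack.\<close>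

lemma card_blockwise_constant:
 fixes Q N :: "nat set set" and y0 :: "nat => nat"
 assumes Q: "partition_on M Q" "finite M" and N: "N \<subseteq> Q"
  and y0: "\<And>B i j. B \<in> Q ==> i \<in> B ==> j \<in> B ==> y0 i = y0 j" "\<And>i. i \<in> M ==> y0 i < n"
 shows "card {y \<in> M \<rightarrow>\<^sub>E {..<n}. (\<forall>B\<in>Q. \<forall>i\<in>B. \<forall>j\<in>B. y i = y j) \<and> (\<forall>B\<in>Q - N. \<forall>i\<in>B. y i = y0 i)} = n ^ card N"
  (is "card ?S = _")
proof -
 have finQ: "finite Q" using finite_elements[OF Q(2,1)] .
 have finN: "finite N" using finite_subset[OF N finQ] .
 have QU: "\<Union> Q = M" using partition_onD1[OF Q(1)] by simp
 have Qd: "B = C" if "B \<in> Q" "C \<in> Q" "i \<in> B" "i \<in> C" for B C i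
  using disjointD[OF partition_onD2[OF Q(1)] that(1,2)] that(3,4) by blast
 have Qne: "B \<noteq> {}" if "B \<in> Q" for B using partition_onD3[OF Q(1)] that by blast
 define pt where "pt B = (SOME i. i \<in> B)" for B :: "nat set"
 have pt: "pt B \<in> B" if "B \<in> Q" for B
  unfolding pt_def using Qne[OF that] by (simp add: some_in_eq)
 define bk where "bk i = (THE B. B \<in> Q \<and> i \<in> B)" for i
 have bk_eq: "bk i = B" if "B \<in> Q" "i \<in> B" for i B
  unfolding bk_def using that Qd by (intro the_equality) auto
 have bk: "bk i \<in> Q" "i \<in> bk i" if i: "i \<in> M" for i
 proof -
  obtain B where "B \<in> Q" "i \<in> B" using i QU by blast
  thus "bk i \<in> Q" "i \<in> bk i" using bk_eq by simp_all
 qed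
 define ex where "ex g = (\<lambda>i\<in>M. if bk i \<in> N then g (bk i) else y0 i)" for g :: "nat set => nat"
 have inM: "i \<in> M" if "B \<in> Q" "i \<in> B" for B i using that QU by blast
 have "bij_betw ex (N \<rightarrow>\<^sub>E {..<n}) ?S"
 proof (rule bij_betwI[where g = "\<lambda>y. \<lambda>B\<in>N. y (pt B)"])
  show "ex \<in> (N \<rightarrow>\<^sub>E {..<n}) \<rightarrow> ?S"
  proof
   fix g assume g: "g \<in> N \<rightarrow>\<^sub>E {..<n}"
   have "ex g i < n" if "i \<in> M" for i
    using g y0(2)[OF that] that by (auto simp: ex_def PiE_iff)
   hence "ex g \<in> M \<rightarrow>\<^sub>E {..<n}" by (auto simp: ex_def)
   moreover have "ex g i = ex g j" if "B \<in> Q" "i \<in> B" "j \<in> B" for B i j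
    using bk_eq[OF that(1,2)] bk_eq[OF that(1,3)] y0(1)[OF that] inM[OF that(1,2)] inM[OF that(1,3)]
    by (simp add: ex_def)
   moreover have "ex g i = y0 i" if "B \<in> Q - N" "i \<in> B" for B i
    using that bk_eq[of B i] inM[of B i] by (simp add: ex_def)
   ultimately show "ex g \<in> ?S" by blast
  qed
  show "(\<lambda>y. \<lambda>B\<in>N. y (pt B)) \<in> ?S \<rightarrow> (N \<rightarrow>\<^sub>E {..<n})"
  proof
   fix y assume "y \<in> ?S"
   hence "y \<in> M \<rightarrow>\<^sub>E {..<n}" by blast
   hence "y (pt B) < n" if "B \<in> N" for B
    using inM[OF _ pt] that N by (auto simp: PiE_iff)
   thus "(\<lambda>B\<in>N. y (pt B)) \<in> N \<rightarrow>\<^sub>E {..<n}" by simp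
  qed
  show "(\<lambda>B\<in>N. ex g (pt B)) = g" if "g \<in> N \<rightarrow>\<^sub>E {..<n}" for g
  proof
   fix B show "(\<lambda>B\<in>N. ex g (pt B)) B = g B"
   proof (cases "B \<in> N")
    case True
    hence "B \<in> Q" using N by blast
    thus ?thesis using True bk_eq[OF _ pt] inM[OF _ pt] by (simp add: ex_def)
   qed (use that in \<open>auto simp: PiE_iff extensional_def\<close>)
  qed
  show "ex (\<lambda>B\<in>N. y (pt B)) = y" if y: "y \<in> ?S" for y
  proof
   fix i show "ex (\<lambda>B\<in>N. y (pt B)) i = y i"
   proof (cases "i \<in> M")
    case True
    have c: "y i = y j" if "B \<in> Q" "i \<in> B" "j \<in> B" for B j using y that by blast
    have d: "y i = y0 i" if "bk i \<in> Q - N" using y that bk[OF True] by blast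
    show ?thesis
     using True c[OF bk[OF True] pt[OF bk(1)[OF True]]] d bk[OF True] by (auto simp: ex_def)
   qed (use y in \<open>auto simp: ex_def PiE_iff extensional_def\<close>)
  qed
 qed
 hence "card ?S = card (N \<rightarrow>\<^sub>E {..<n})" by (simp add: bij_betw_same_card)
 also have "\<dots> = n ^ card N" using finN by (simp add: card_PiE)
 finally show ?thesis .
qed

section \<open>Propagating number and lower half read off from two-colourings\<close>

definition colourings :: "nat => nat => (nat => nat) set" where
 "colourings k n = {1..k} \<rightarrow>\<^sub>E {..<n}"

lemma finite_colourings [simp]: "finite (colourings k n)"
 by (simp add: finite_PiE colourings_def)

text \<open>\<open>range2\<close> is the image of the relation in two colours, and
  \<open>mult2\<close>, the rows related to the zero row, measures its indeterminacy. Their sizes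
  are powers of 2 whose exponents count all bottom classes and the non-propagating ones;
  \<open>pn d\<close> is the difference of the exponents.\<close>

definition range2 :: "nat => diagram => (nat => nat) set" where
 "range2 k d = {y \<in> colourings k 2. \<exists>x. (x, y) \<in> rel d}"

definition mult2 :: "nat => diagram => (nat => nat) set" where
 "mult2 k d = {y \<in> colourings k 2. ((\<lambda>_. 0), y) \<in> rel d}"

definition bots :: "diagram => nat set set" where "bots d = tops (transp d)"
definition dbot :: "diagram => nat set set" where "dbot d = dtop (transp d)"

lemma same_Bot_iff: "same d (Bot i) (Bot j) \<longleftrightarrow> (\<exists>B\<in>bots d. i \<in> B \<and> j \<in> B)"
 using same_Top_iff[of "transp d" i j] by (simp add: same_transp bots_def)

lemma dbot_iff_same: "i \<in> \<Union>(dbot d) \<longleftrightarrow> (\<exists>j. same d (Top j) (Bot i))"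
 using prop_iff_same[of i "transp d"] same_sym by (auto simp: same_transp dbot_def)

lemma
 assumes d: "d \<in> all_diagrams k"
 shows bots_partition: "partition_on {1..k} (bots d)"
  and dbot_sub_bots: "dbot d \<subseteq> bots d"
  and card_dbot: "card (dbot d) = pn d"
  and finite_bots: "finite (bots d)"
  and finite_dbot: "finite (dbot d)"
 unfolding bots_def dbot_def
 using tops_partition[OF transp_in[OF d]] dtop_sub_tops card_dtop[OF transp_in[OF d]]
  finite_tops[OF transp_in[OF d]] finite_dtop[OF transp_in[OF d]] by auto

lemma bots_unique:
 assumes "d \<in> all_diagrams k" "B \<in> bots d" "C \<in> bots d" "i \<in> B" "i \<in> C"
 shows "B = C"
 using tops_unique[OF transp_in[OF assms(1)]] assms(2-) unfolding bots_def by blast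

lemma rel_zero_iff:
 assumes d: "d \<in> all_diagrams k"
 shows "((\<lambda>_. 0), y) \<in> rel d \<longleftrightarrow>
  (\<forall>B\<in>bots d. \<forall>i\<in>B. \<forall>j\<in>B. y i = y j) \<and> (\<forall>B\<in>dbot d. \<forall>i\<in>B. y i = 0)" (is "_ \<longleftrightarrow> ?R")
proof
 assume r: "((\<lambda>_. 0), y) \<in> rel d"
 show ?R
 proof (intro conjI ballI)
  fix B i j assume "B \<in> bots d" "i \<in> B" "j \<in> B"
  hence "same d (Bot i) (Bot j)" using same_Bot_iff by blast
  thus "y i = y j" using relD[OF r] by fastforce
 next
  fix B i assume "B \<in> dbot d" "i \<in> B"
  hence "i \<in> \<Union>(dbot d)" by blast
  then obtain j where "same d (Top j) (Bot i)" unfolding dbot_iff_same by blast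
  thus "y i = 0" using relD[OF r] by fastforce
 qed
next
 assume R: ?R
 have b: "y i = y j" if "same d (Bot i) (Bot j)" for i j using R that unfolding same_Bot_iff by blast
 have t: "y i = 0" if "same d (Top j) (Bot i)" for i j using R that dbot_iff_same[of i d] by blast
 show "((\<lambda>_. 0), y) \<in> rel d"
 proof (rule relI)
  fix u v assume s: "same d u v"
  show "vl (\<lambda>_. 0) y u = vl (\<lambda>_. 0) y v"
  proof (cases u)
   case u: (Top i)
   show ?thesis
   proof (cases v)
    case (Bot j) thus ?thesis using t[of i j] s u by simp
   qed (use u in simp)
  next
   case u: (Bot i)
   show ?thesis
   proof (cases v)
    case (Top j) thus ?thesis using t[of j i] same_sym[OF s] u by simp
   next
    case (Bot j) thus ?thesis using b[of i j] s u by simp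
   qed
  qed
 qed
qed

lemma range_iff:
 assumes d: "d \<in> all_diagrams k"
 shows "(\<exists>x. (x, y) \<in> rel d) \<longleftrightarrow> (\<forall>B\<in>bots d. \<forall>i\<in>B. \<forall>j\<in>B. y i = y j)" (is "?L \<longleftrightarrow> ?R")
proof
 assume ?L
 then obtain x where r: "(x, y) \<in> rel d" by blast
 show ?R
 proof (intro ballI)
  fix B i j assume "B \<in> bots d" "i \<in> B" "j \<in> B"
  hence "same d (Bot i) (Bot j)" using same_Bot_iff by blast
  thus "y i = y j" using relD[OF r] by fastforce
 qed
next
 assume ?R
 hence "(y, y) \<in> rel (transp d \<cdot> transp (transp d))"
  unfolding compose_transp_eq_sym[OF transp_in[OF d]]
   rel_sym[OF tops_partition[OF transp_in[OF d]] dtop_sub_tops] bots_def by blast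
 thus ?L unfolding rel_compose[OF transp_in[OF d] transp_in[OF transp_in[OF d]]] by auto
qed

lemma card_range2:
 assumes d: "d \<in> all_diagrams k" shows "card (range2 k d) = 2 ^ card (bots d)"
proof -
 have "range2 k d = {y \<in> colourings k 2. (\<forall>B\<in>bots d. \<forall>i\<in>B. \<forall>j\<in>B. y i = y j) \<and>
   (\<forall>B\<in>bots d - bots d. \<forall>i\<in>B. y i = 0)}"
  unfolding range2_def range_iff[OF d] by simp
 thus ?thesis
  using card_blockwise_constant[OF bots_partition[OF d], of "bots d" "\<lambda>_. 0" 2]
  by (simp add: colourings_def)
qed

lemma card_mult2:
 assumes d: "d \<in> all_diagrams k" shows "card (mult2 k d) = 2 ^ (card (bots d) - pn d)"
proof -
 have "bots d - (bots d - dbot d) = dbot d" using dbot_sub_bots[OF d] by blast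
 hence "mult2 k d = {y \<in> colourings k 2. (\<forall>B\<in>bots d. \<forall>i\<in>B. \<forall>j\<in>B. y i = y j) \<and>
   (\<forall>B\<in>bots d - (bots d - dbot d). \<forall>i\<in>B. y i = 0)}"
  unfolding mult2_def rel_zero_iff[OF d] by simp
 moreover have "card (bots d - dbot d) = card (bots d) - pn d"
  using card_Diff_subset[OF finite_dbot[OF d] dbot_sub_bots[OF d]] card_dbot[OF d] by simp
 ultimately show ?thesis
  using card_blockwise_constant[OF bots_partition[OF d], of "bots d - dbot d" "\<lambda>_. 0" 2]
  by (simp add: colourings_def)
qed

lemma pn_le_card_bots: "d \<in> all_diagrams k ==> pn d \<le> card (bots d)"
 using card_mono[OF finite_bots dbot_sub_bots] card_dbot by metis

lemma indicator_colouring: "(\<lambda>i\<in>{1..k}. if i \<in> B then 1 else 0) \<in> colourings k (2::nat)"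
 by (auto simp: colourings_def)

text \<open>Indicator functions of blocks suffice. The indicator of a block C of one diagram lies in
  the common range, so a block of the other diagram meeting C is contained in C; by symmetry the
  partitions agree. The indicator of a non-propagating block lies in \<open>mult2\<close>, that of a
  propagating one does not.\<close>

lemma bots_eqI:
 assumes d: "d \<in> all_diagrams k" and e: "e \<in> all_diagrams k"
  and R: "range2 k d = range2 k e" and K: "mult2 k d = mult2 k e"
 shows "bots d = bots e" "dbot d = dbot e"
proof -
 have sub: "\<exists>C\<in>bots b. B \<subseteq> C"
  if a: "a \<in> all_diagrams k" and b: "b \<in> all_diagrams k" and R: "range2 k a = range2 k b" and B: "B \<in> bots a" for a b B
 proof -
  obtain i where i: "i \<in> B" using B partition_onD3[OF bots_partition[OF a]] by fastforce
  hence "i \<in> {1..k}" using partition_onD1[OF bots_partition[OF a]] B by blast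
  then obtain C where C: "C \<in> bots b" "i \<in> C" using partition_onD1[OF bots_partition[OF b]] by blast
  let ?y = "\<lambda>i\<in>{1..k}. if i \<in> C then 1 else 0 :: nat"
  have Ck: "D \<subseteq> {1..k}" if "D \<in> bots b" for D using that partition_onD1[OF bots_partition[OF b]] by blast
  have "?y p = ?y q" if "D \<in> bots b" "p \<in> D" "q \<in> D" for D p q
   using bots_unique[OF b that(1) C(1)] that Ck[OF that(1)] by auto
  hence "?y \<in> range2 k b" unfolding range2_def range_iff[OF b] using indicator_colouring by blast
  hence y: "?y p = ?y q" if "p \<in> B" "q \<in> B" for p q
   using R B that unfolding range2_def range_iff[OF a] by blast
  have "j \<in> C" if "j \<in> B" for j
  proof -
   have "i \<in> {1..k}" "j \<in> {1..k}" using partition_onD1[OF bots_partition[OF a]] B i that by blast+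
   thus ?thesis using y[OF i that] C(2) by (simp split: if_splits)
  qed
  thus ?thesis using C(1) by blast
 qed
 have sub2: "bots a \<subseteq> bots b"
  if a: "a \<in> all_diagrams k" and b: "b \<in> all_diagrams k" and R: "range2 k a = range2 k b" for a b
 proof
  fix B assume B: "B \<in> bots a"
  then obtain C where C: "C \<in> bots b" "B \<subseteq> C" using sub[OF a b R] by blast
  then obtain B' where B': "B' \<in> bots a" "C \<subseteq> B'" using sub[OF b a R[symmetric]] by blast
  obtain i where "i \<in> B" using B partition_onD3[OF bots_partition[OF a]] by fastforce
  hence "B = B'" using bots_unique[OF a B B'(1)] C B' by blast
  thus "B \<in> bots b" using C B' by auto
 qed
 show be: "bots d = bots e" using sub2[OF d e R] sub2[OF e d R[symmetric]] by blast
 have sub3: "dbot a \<subseteq> dbot b"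
  if a: "a \<in> all_diagrams k" and b: "b \<in> all_diagrams k" and K: "mult2 k a = mult2 k b"
   and ab: "bots a = bots b" for a b
 proof
  fix B assume B: "B \<in> dbot a"
  hence Ba: "B \<in> bots a" using dbot_sub_bots[OF a] by blast
  obtain i where i: "i \<in> B" using Ba partition_onD3[OF bots_partition[OF a]] by fastforce
  hence ik: "i \<in> {1..k}" using partition_onD1[OF bots_partition[OF a]] Ba by blast
  show "B \<in> dbot b"
  proof (rule ccontr)
   assume nB: "B \<notin> dbot b"
   let ?y = "\<lambda>i\<in>{1..k}. if i \<in> B then 1 else 0 :: nat"
   have Ck: "D \<subseteq> {1..k}" if "D \<in> bots b" for D using that partition_onD1[OF bots_partition[OF b]] by blast
   have "?y p = ?y q" if "D \<in> bots b" "p \<in> D" "q \<in> D" for D p q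
    using bots_unique[OF b that(1)] Ba[unfolded ab] that Ck[OF that(1)] by auto
   moreover have "?y p = 0" if "D \<in> dbot b" "p \<in> D" for D p
   proof -
    have D: "D \<in> bots b" using dbot_sub_bots[OF b] that(1) by blast
    have "p \<notin> B" using bots_unique[OF b D Ba[unfolded ab] that(2)] nB that(1) by blast
    thus ?thesis using Ck[OF D] that(2) by auto
   qed
   ultimately have "?y \<in> mult2 k b" unfolding mult2_def rel_zero_iff[OF b] using indicator_colouring by blast
   hence "?y \<in> mult2 k a" using K by simp
   hence "\<forall>B\<in>dbot a. \<forall>i\<in>B. ?y i = 0" unfolding mult2_def rel_zero_iff[OF a] by blast
   hence "?y i = 0" using B i by blast
   thus False using i ik by simp
  qed
 qed
 show "dbot d = dbot e"
  using sub3[OF d e K be] sub3[OF e d K[symmetric] be[symmetric]] by blast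
qed

lemma transp_compose_eq_iff:
 assumes "a \<in> all_diagrams k" "b \<in> all_diagrams k"
 shows "transp a \<cdot> a = transp b \<cdot> b \<longleftrightarrow> bots a = bots b \<and> dbot a = dbot b"
 using compose_transp_eq_iff[OF transp_in[OF assms(1)] transp_in[OF assms(2)]]
 by (simp add: bots_def dbot_def)

text \<open>Composition from the left can only shrink \<open>range2\<close> and enlarge
  \<open>mult2\<close>, so the difference of the exponents does not grow. If it stays the same, both
  cardinalities and hence both sets are unchanged, and they determine the lower half.\<close>

lemma pn_stable:
 assumes a: "a \<in> all_diagrams k" and b: "b \<in> all_diagrams k"
 shows pn_compose_le2: "pn (a \<cdot> b) \<le> pn b"
  and pn_stable_bot: "pn (a \<cdot> b) = pn b ==> transp (a \<cdot> b) \<cdot> (a \<cdot> b) = transp b \<cdot> b"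
proof -
 note ab = compose_in[OF a b]
 have R: "range2 k (a \<cdot> b) \<subseteq> range2 k b"
  unfolding range2_def rel_compose[OF a b] by auto
 have K: "mult2 k b \<subseteq> mult2 k (a \<cdot> b)"
  unfolding mult2_def rel_compose[OF a b] using rel_const[of 0 a] by blast
 have fin: "finite (range2 k b)" "finite (mult2 k (a \<cdot> b))"
  unfolding range2_def mult2_def by auto
 have le1: "card (bots (a \<cdot> b)) \<le> card (bots b)"
  using card_mono[OF fin(1) R] card_range2[OF ab] card_range2[OF b] by simp
 have le2: "card (bots b) - pn b \<le> card (bots (a \<cdot> b)) - pn (a \<cdot> b)"
  using card_mono[OF fin(2) K] card_mult2[OF ab] card_mult2[OF b] by simp
 note le3 = pn_le_card_bots[OF b] and le4 = pn_le_card_bots[OF ab]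
 show "pn (a \<cdot> b) \<le> pn b" using le1 le2 le3 le4 by linarith
 assume eq: "pn (a \<cdot> b) = pn b"
 hence e: "card (bots (a \<cdot> b)) = card (bots b)" using le1 le2 le3 le4 by linarith
 have "range2 k (a \<cdot> b) = range2 k b"
  by (rule card_subset_eq[OF fin(1) R]) (simp add: card_range2[OF ab] card_range2[OF b] e)
 moreover have "mult2 k b = mult2 k (a \<cdot> b)"
  by (rule card_subset_eq[OF fin(2) K]) (simp add: card_mult2[OF ab] card_mult2[OF b] e eq)
 ultimately show "transp (a \<cdot> b) \<cdot> (a \<cdot> b) = transp b \<cdot> b"
  unfolding transp_compose_eq_iff[OF ab b] using bots_eqI[OF ab b] by simp
qed

lemma pn_compose_le1:
 assumes a: "a \<in> all_diagrams k" and b: "b \<in> all_diagrams k"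
 shows "pn (a \<cdot> b) \<le> pn a"
 using pn_compose_le2[OF transp_in[OF b] transp_in[OF a]] transp_compose[OF a b] pn_transp by metis

lemma pn_stable_top:
 assumes a: "a \<in> all_diagrams k" and b: "b \<in> all_diagrams k" and eq: "pn (a \<cdot> b) = pn a"
 shows "(a \<cdot> b) \<cdot> transp (a \<cdot> b) = a \<cdot> transp a"
 using pn_stable_bot[OF transp_in[OF b] transp_in[OF a]] transp_compose[OF a b] eq
 by (metis pn_transp transp_transp)

section \<open>The number of discarded components\<close>

text \<open>A middle row between fixed outer rows is a colouring of the components of the stack:
  those reaching an outer row are forced, and each discarded one has n free colours.\<close>

lemma card_middle:
 assumes a: "a \<in> all_diagrams k" and b: "b \<in> all_diagrams k"
  and xz: "(x, z) \<in> rel (a \<cdot> b)" and xn: "\<And>i. i \<in> {1..k} ==> x i < n" "\<And>i. i \<in> {1..k} ==> z i < n"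
  and n: "n > 0"
 shows "card {y \<in> colourings k n. (x, y) \<in> rel a \<and> (y, z) \<in> rel b} = n ^ ell a b"
proof -
 interpret stack k "[a, b]" using a b by (simp add: stack_def)
 have xz': "(x, z) \<in> rel (outer_diagram [a, b])" using xz unfolding compose_eq_outer .
 have len: "length [a, b] = 2" by simp
 have resp2: "resp f \<longleftrightarrow> ((\<lambda>i. f (0, i)), (\<lambda>i. f (1, i))) \<in> rel a \<and> ((\<lambda>i. f (1, i)), (\<lambda>i. f (2, i))) \<in> rel b" for f
  unfolding resp_def by (auto simp: less_Suc_eq numeral_2_eq_2)
 define mid where "mid C = {i. (1::nat, i) \<in> C}" for C :: "(nat \<times> nat) set"
 define Q where "Q = {mid C |C. C \<in> comps [a, b] \<and> mid C \<noteq> {}}"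
 define Z where "Z = {C \<in> comps [a, b]. outer_at 2 C = {}}"
 define NN where "NN = mid ` Z"
 \<comment> \<open>The forced colour of a middle vertex; on discarded components it is 0, but these
   are the free blocks \<open>NN\<close>.\<close>
 define y0 where "y0 i = extend (\<lambda>_. 0) x z (1, i)" for i
 have nodes: "p \<in> N ==> (\<exists>u\<in>verts k. p = outv 2 u) \<or> (\<exists>i\<in>{1..k}. p = (1, i))" for p
 proof -
  assume "p \<in> N"
  then obtain r i where p: "p = (r, i)" "r \<le> 2" "i \<in> {1..k}" by auto
  then consider "r = 0" | "r = 1" | "r = 2" by linarith
  thus ?thesis
  proof cases
   case 1 thus ?thesis using p by (intro disjI1 bexI[of _ "Top i"]) auto
  next
   case 2 thus ?thesis using p by blast
  next
   case 3 thus ?thesis using p by (intro disjI1 bexI[of _ "Bot i"]) auto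
  qed
 qed
 have midE: "i \<in> mid C ==> C \<in> comps [a, b] ==> i \<in> {1..k}" for i C
  using comps_N unfolding mid_def by fastforce
 have Qp: "partition_on {1..k} Q"
 proof (rule partition_onI)
  show "\<Union> Q = {1..k}"
  proof
   show "\<Union> Q \<subseteq> {1..k}" unfolding Q_def using midE by blast
   show "{1..k} \<subseteq> \<Union> Q"
   proof
    fix i assume "i \<in> {1..k}"
    hence "(1, i) \<in> N" by simp
    then obtain C where "C \<in> comps [a, b]" "(1, i) \<in> C" using comps_ex by blast
    thus "i \<in> \<Union> Q" unfolding Q_def mid_def by blast
   qed
  qed
  fix p q assume "p \<in> Q" "q \<in> Q" "p \<noteq> q"
  then obtain C C' where C: "C \<in> comps [a, b]" "C' \<in> comps [a, b]" "p = mid C" "q = mid C'"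
   unfolding Q_def by blast
  hence "C \<noteq> C'" using \<open>p \<noteq> q\<close> by blast
  hence "C \<inter> C' = {}" using comps_memD[OF C(1)] comps_memD[OF C(2)] by blast
  thus "disjnt p q" unfolding C disjnt_def mid_def by blast
 qed (auto simp: Q_def)
 have Zmid: "mid C \<noteq> {}" if "C \<in> Z" for C
 proof -
  have C: "C \<in> comps [a, b]" "\<And>u. outv 2 u \<notin> C"
   using that unfolding Z_def outer_at_eq by auto
  obtain p where p: "p \<in> C" using comps_nonempty[OF C(1)] by blast
  hence pN: "p \<in> N" using comps_N[OF C(1)] by blast
  have "\<exists>i. p = (1, i)" using nodes[OF pN] C(2) p by metis
  thus ?thesis unfolding mid_def using p by blast
 qed
 have NNQ: "NN \<subseteq> Q" unfolding NN_def Q_def using Zmid Z_def by blast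
 have midinj: "C = C'" if "C \<in> comps [a, b]" "C' \<in> comps [a, b]" "i \<in> mid C" "i \<in> mid C'" for C C' i
  using comps_memD[OF that(1), of "(1, i)"] comps_memD[OF that(2), of "(1, i)"] that(3,4) unfolding mid_def by blast
 have cardNN: "card NN = ell a b"
 proof -
  have "inj_on mid Z"
  proof (rule inj_onI)
   fix C C' assume CC: "C \<in> Z" "C' \<in> Z" "mid C = mid C'"
   obtain i where "i \<in> mid C" using Zmid[OF CC(1)] by blast
   thus "C = C'" using midinj[of C C' i] CC unfolding Z_def by blast
  qed
  thus ?thesis unfolding NN_def ell_def Z_def by (simp add: card_image)
 qed
 have y0E: "y0 i = y0 j" if "((1, i), (1, j)) \<in> E" for i j
  using extend_resp[OF xz', of "\<lambda>_. 0"] that unfolding resp_iff y0_def by blast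
 have midEE: "((1, i), (1, j)) \<in> E" if "C \<in> comps [a, b]" "i \<in> mid C" "j \<in> mid C" for C i j
  using comps_memD[OF that(1), of "(1, i)"] that(2,3) unfolding mid_def by blast
 have y0c: "y0 i = y0 j" if B: "B \<in> Q" "i \<in> B" "j \<in> B" for B i j
 proof -
  obtain C where C: "C \<in> comps [a, b]" "B = mid C" using B(1) unfolding Q_def by blast
  thus ?thesis using y0E[OF midEE[OF C(1), of i j]] B(2,3) by blast
 qed
 have y0n: "y0 i < n" for i
 proof (cases "\<exists>u. ((1, i), outv (length [a, b]) u) \<in> E")
  case True
  then obtain u where u: "((1, i), outv (length [a, b]) u) \<in> E" by blast
  hence "u \<in> verts k" using E_N outv_N by blast
  thus ?thesis unfolding y0_def extend_outer[OF xz' u] using xn by (cases u) auto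
 qed (auto simp: y0_def extend_def n)
 have key: "(x, y) \<in> rel a \<and> (y, z) \<in> rel b \<longleftrightarrow>
   (\<forall>B\<in>Q. \<forall>i\<in>B. \<forall>j\<in>B. y i = y j) \<and> (\<forall>B\<in>Q - NN. \<forall>i\<in>B. y i = y0 i)" (is "?L \<longleftrightarrow> ?R") for y
 proof
  assume L: ?L
  define f where "f = (\<lambda>(r :: nat, i). if r = 0 then x i else if r = 1 then y i else z i)"
  have "resp f" unfolding resp2 f_def using L by simp
  hence fE: "f p = f q" if "(p, q) \<in> E" for p q using that unfolding resp_iff by blast
  have fo: "f (outv 2 u) = vl x z u" for u by (cases u) (auto simp: f_def)
  have fm: "f (1, i) = y i" for i by (simp add: f_def)
  show ?R
  proof (intro conjI ballI)
   fix B i j assume "B \<in> Q" "i \<in> B" "j \<in> B"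
   hence "((1, i), (1, j)) \<in> E" using midEE unfolding Q_def by blast
   thus "y i = y j" using fE fm by metis
  next
   fix B i assume B: "B \<in> Q - NN" "i \<in> B"
   then obtain C where C: "C \<in> comps [a, b]" "B = mid C" unfolding Q_def by blast
   hence "C \<notin> Z" using B unfolding NN_def by blast
   then obtain u where "outv 2 u \<in> C" using C unfolding Z_def outer_at_eq by blast
   hence u: "((1, i), outv (length [a, b]) u) \<in> E"
    using comps_memD[OF C(1), of "(1, i)"] B(2) C(2) unfolding mid_def len by blast
   show "y i = y0 i" unfolding y0_def extend_outer[OF xz' u] using fE[OF u] fm fo len by metis
  qed
 next
  assume R: ?R
  define g where "g p = (if fst p = 1 then y (snd p) else 0)" for p :: "nat \<times> nat"
  have yE: "y i = y j" if ij: "((1, i), (1, j)) \<in> E" for i j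
  proof -
   obtain C where C: "C \<in> comps [a, b]" "(1, i) \<in> C" using comps_ex E_N[OF ij] by blast
   hence "i \<in> mid C" "j \<in> mid C" using comps_memD[OF C] ij by (auto simp: mid_def)
   moreover from this have "mid C \<in> Q" unfolding Q_def using C by blast
   ultimately show ?thesis using R by blast
  qed
  have r: "resp (extend g x z)"
  proof (rule extend_resp[OF xz'])
   fix p q assume pq: "(p, q) \<in> E" and no: "\<nexists>u. (p, outv (length [a, b]) u) \<in> E"
   have "\<nexists>u. p = outv 2 u" "\<nexists>u. q = outv 2 u" using no pq E_refl E_N[OF pq] len by metis+
   then obtain i j where "p = (1, i)" "q = (1, j)" using nodes E_N[OF pq] by blast
   thus "g p = g q" using yE pq by (simp add: g_def)
  qed
  have mid: "extend g x z (1, i) = y i" if i: "i \<in> {1..k}" for i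
  proof (cases "\<exists>u. ((1, i), outv (length [a, b]) u) \<in> E")
   case True
   then obtain u where u: "((1, i), outv (length [a, b]) u) \<in> E" by blast
   obtain C where C: "C \<in> comps [a, b]" "(1, i) \<in> C" using comps_ex E_N[OF u] by blast
   have "((1, i), outv 2 u) \<in> E" using u unfolding len .
   hence Cu: "outv 2 u \<in> C" using comps_memD[OF C] by blast
   have iC: "i \<in> mid C" using C by (simp add: mid_def)
   have "mid C \<notin> NN"
   proof
    assume "mid C \<in> NN"
    then obtain C' where C': "C' \<in> Z" "mid C = mid C'" unfolding NN_def by blast
    hence "C' = C" using midinj[of C' C i] iC C unfolding Z_def by blast
    thus False using C'(1) Cu unfolding Z_def outer_at_eq by blast
   qed
   moreover have "mid C \<in> Q" unfolding Q_def using C iC by blast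
   ultimately have "y i = y0 i" using R iC by blast
   thus ?thesis unfolding y0_def extend_outer[OF xz' u] by simp
  qed (simp add: extend_def g_def)
  have out: "extend g x z (outv 2 u) = vl x z u" if "u \<in> verts k" for u
  proof -
   have "(outv 2 u, outv (length [a, b]) u) \<in> E" using E_refl outv_N[of u] that len by metis
   thus ?thesis by (rule extend_outer[OF xz'])
  qed
  have t: "extend g x z (0, i) = x i" "extend g x z (2, i) = z i" if "i \<in> {1..k}" for i
   using out[of "Top i"] out[of "Bot i"] that by auto
  from r have r1: "((\<lambda>i. extend g x z (0, i)), (\<lambda>i. extend g x z (1, i))) \<in> rel a"
   and r2: "((\<lambda>i. extend g x z (1, i)), (\<lambda>i. extend g x z (2, i))) \<in> rel b"
   unfolding resp2 by auto
  show ?L using rel_cong[OF a r1, of x y] rel_cong[OF b r2, of y z] t mid by blast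
 qed
 have "card {y \<in> colourings k n. (\<forall>B\<in>Q. \<forall>i\<in>B. \<forall>j\<in>B. y i = y j) \<and> (\<forall>B\<in>Q - NN. \<forall>i\<in>B. y i = y0 i)} = n ^ card NN"
  unfolding colourings_def by (rule card_blockwise_constant[OF Qp finite_atLeastAtMost NNQ y0c y0n])
 thus ?thesis unfolding key cardNN colourings_def .
qed

lemma ell_count:
 assumes "a \<in> all_diagrams k" "b \<in> all_diagrams k"
 shows "card {y \<in> colourings k 2. ((\<lambda>_. 0), y) \<in> rel a \<and> (y, (\<lambda>_. 0)) \<in> rel b} = 2 ^ ell a b"
 by (rule card_middle[OF assms]) auto

lemma rel_zero_cong:
 assumes "a \<in> all_diagrams k" "a' \<in> all_diagrams k" "transp a \<cdot> a = transp a' \<cdot> a'"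
 shows "((\<lambda>_. 0), y) \<in> rel a \<longleftrightarrow> ((\<lambda>_. 0), y) \<in> rel a'"
 using assms(3) unfolding transp_compose_eq_iff[OF assms(1,2)] rel_zero_iff[OF assms(1)] rel_zero_iff[OF assms(2)]
 by simp

text \<open>The two-colour count of \<open>ell_count\<close> depends on a only through the rows
  related to 0 from above, that is its lower half, and dually on b only through its upper
  half.\<close>

lemma ell_cong:
 assumes "a \<in> all_diagrams k" "a' \<in> all_diagrams k" "transp a \<cdot> a = transp a' \<cdot> a'"
  and "b \<in> all_diagrams k" "b' \<in> all_diagrams k" "b \<cdot> transp b = b' \<cdot> transp b'"
 shows "ell a b = ell a' b'"
proof -
 have b: "(y, (\<lambda>_. 0)) \<in> rel b \<longleftrightarrow> (y, (\<lambda>_. 0)) \<in> rel b'" for y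
  using rel_zero_cong[OF transp_in[OF assms(4)] transp_in[OF assms(5)], of y] assms(6)
  by (simp add: rel_transp)
 have "(2::nat) ^ ell a b = 2 ^ ell a' b'"
  unfolding ell_count[OF assms(1,4), symmetric] ell_count[OF assms(2,5), symmetric]
   b rel_zero_cong[OF assms(1-3)] ..
 thus ?thesis by simp
qed

text \<open>Both sides are the binary logarithm of the number of pairs of inner rows in the stack of
  a, b, c with zero outer rows, summed over the two inner rows in either order.\<close>

lemma ell_assoc:
 assumes a: "a \<in> all_diagrams k" and b: "b \<in> all_diagrams k" and c: "c \<in> all_diagrams k"
 shows "ell a b + ell (a \<cdot> b) c = ell b c + ell a (b \<cdot> c)"
proof -
 let ?X = "colourings k 2" and ?z = "(\<lambda>_. 0) :: nat => nat"
 have fn: "y i < 2" if "y \<in> ?X" "i \<in> {1..k}" for y i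
  using that by (auto simp: PiE_iff colourings_def)
 have L: "card {y \<in> ?X. (?z, y) \<in> rel a \<and> (y, w) \<in> rel b} = (if (?z, w) \<in> rel (a \<cdot> b) then 2 ^ ell a b else 0)"
  if "w \<in> ?X" for w
 proof (cases "(?z, w) \<in> rel (a \<cdot> b)")
  case True
  thus ?thesis using card_middle[OF a b True, of 2] fn[OF that] by simp
 next
  case False
  hence "{y \<in> ?X. (?z, y) \<in> rel a \<and> (y, w) \<in> rel b} = {}" unfolding rel_compose[OF a b] by blast
  thus ?thesis using False by simp
 qed
 have R: "card {y \<in> ?X. (w, y) \<in> rel b \<and> (y, ?z) \<in> rel c} = (if (w, ?z) \<in> rel (b \<cdot> c) then 2 ^ ell b c else 0)"
  if "w \<in> ?X" for w
 proof (cases "(w, ?z) \<in> rel (b \<cdot> c)")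
  case True
  thus ?thesis using card_middle[OF b c True, of 2] fn[OF that] by simp
 next
  case False
  hence "{y \<in> ?X. (w, y) \<in> rel b \<and> (y, ?z) \<in> rel c} = {}" unfolding rel_compose[OF b c] by blast
  thus ?thesis using False by simp
 qed
 have sc: "(\<Sum>y\<in>?X. if P y then 1 else 0) = card {y \<in> ?X. P y}" for P
  by (simp add: sum.If_cases Int_def)
 define f where "f y w = (if (?z, y) \<in> rel a \<and> (y, w) \<in> rel b \<and> (w, ?z) \<in> rel c then 1 else 0 :: nat)" for y w
 have "(\<Sum>w\<in>?X. \<Sum>y\<in>?X. f y w) = (\<Sum>w\<in>?X. if (w, ?z) \<in> rel c then card {y \<in> ?X. (?z, y) \<in> rel a \<and> (y, w) \<in> rel b} else 0)"
  by (intro sum.cong refl) (auto simp: f_def simp flip: sc)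
 also have "\<dots> = (\<Sum>w\<in>?X. if (?z, w) \<in> rel (a \<cdot> b) \<and> (w, ?z) \<in> rel c then 2 ^ ell a b else 0)"
  by (intro sum.cong refl) (auto simp: L)
 also have "\<dots> = 2 ^ ell a b * card {w \<in> ?X. (?z, w) \<in> rel (a \<cdot> b) \<and> (w, ?z) \<in> rel c}"
  by (simp add: sum.If_cases Int_def)
 also have "\<dots> = 2 ^ (ell a b + ell (a \<cdot> b) c)"
  by (simp add: ell_count[OF compose_in[OF a b] c] power_add)
 finally have 1: "(\<Sum>w\<in>?X. \<Sum>y\<in>?X. f y w) = 2 ^ (ell a b + ell (a \<cdot> b) c)" .
 have "(\<Sum>y\<in>?X. \<Sum>w\<in>?X. f y w) = (\<Sum>y\<in>?X. if (?z, y) \<in> rel a then card {w \<in> ?X. (y, w) \<in> rel b \<and> (w, ?z) \<in> rel c} else 0)"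
  by (intro sum.cong refl) (auto simp: f_def simp flip: sc)
 also have "\<dots> = (\<Sum>y\<in>?X. if (?z, y) \<in> rel a \<and> (y, ?z) \<in> rel (b \<cdot> c) then 2 ^ ell b c else 0)"
  by (intro sum.cong refl) (auto simp: R)
 also have "\<dots> = 2 ^ ell b c * card {y \<in> ?X. (?z, y) \<in> rel a \<and> (y, ?z) \<in> rel (b \<cdot> c)}"
  by (simp add: sum.If_cases Int_def)
 also have "\<dots> = 2 ^ (ell b c + ell a (b \<cdot> c))"
  by (simp add: ell_count[OF a compose_in[OF b c]] power_add)
 finally have "(\<Sum>y\<in>?X. \<Sum>w\<in>?X. f y w) = 2 ^ (ell b c + ell a (b \<cdot> c))" .
 hence "(2::nat) ^ (ell a b + ell (a \<cdot> b) c) = 2 ^ (ell b c + ell a (b \<cdot> c))"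
  using 1 sum.swap[of f ?X ?X] by simp
 thus ?thesis by simp
qed

section \<open>The permutation of a diagram\<close>

definition rk :: "nat set set => nat set => nat" where
 "rk D B = Suc (card {C \<in> D. Max C < Max B})"

lemma rank_bij:
 fixes f :: "'a => nat"
 assumes "finite S" "inj_on f S"
 shows "bij_betw (\<lambda>s. Suc (card {t \<in> S. f t < f s})) S {1..card S}"
proof -
 let ?r = "\<lambda>s. Suc (card {t \<in> S. f t < f s})"
 have mono: "?r s < ?r s'" if "s \<in> S" "s' \<in> S" "f s < f s'" for s s'
 proof -
  have "{t \<in> S. f t < f s} \<subset> {t \<in> S. f t < f s'}" using that by auto
  thus ?thesis using assms(1) by (simp add: psubset_card_mono)
 qed
 have inj: "inj_on ?r S"
 proof (rule inj_onI, rule ccontr)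
  fix s s' assume s: "s \<in> S" "s' \<in> S" "?r s = ?r s'" "s \<noteq> s'"
  hence "f s \<noteq> f s'" using assms(2) inj_onD by metis
  thus False using mono[OF s(1,2)] mono[OF s(2,1)] s(3) by linarith
 qed
 have "?r s \<in> {1..card S}" if "s \<in> S" for s
 proof -
  have "{t \<in> S. f t < f s} \<subset> S" using that by auto
  hence "card {t \<in> S. f t < f s} < card S" using assms(1) by (simp add: psubset_card_mono)
  thus ?thesis by simp
 qed
 hence "?r ` S \<subseteq> {1..card S}" by blast
 moreover have "card (?r ` S) = card {1..card S}" using card_image[OF inj] by simp
 ultimately have "?r ` S = {1..card S}" by (simp add: card_subset_eq)
 thus ?thesis using inj by (simp add: bij_betw_def)
qed

lemma inj_Max_partition:
 fixes P :: "nat set set"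
 assumes P: "partition_on {1..k} P" shows "inj_on Max P"
proof (rule inj_onI)
 fix B C assume BC: "B \<in> P" "C \<in> P" "Max B = Max C"
 have "finite X \<and> X \<noteq> {}" if X: "X \<in> P" for X
 proof
  have "X \<subseteq> {1..k}" using X partition_onD1[OF P] by blast
  thus "finite X" by (rule finite_subset) simp
  show "X \<noteq> {}" using X partition_onD3[OF P] by blast
 qed
 hence "Max B \<in> B" "Max C \<in> C" using BC Max_in by blast+
 thus "B = C" using disjointD[OF partition_onD2[OF P] BC(1,2)] BC(3) by auto
qed

lemma rk_bij:
 assumes "partition_on {1..k} P" "D \<subseteq> P"
 shows "bij_betw (rk D) D {1..card D}"
 unfolding rk_def
 by (rule rank_bij)
  (use assms finite_elements[OF _ assms(1)] finite_subset inj_on_subset[OF inj_Max_partition] in blast)+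

lemma bt_in_dbot: "B \<in> props d ==> bt B \<in> dbot d"
 unfolding dbot_def dtop_transp by blast

lemma tp_in_dtop: "B \<in> props d ==> tp B \<in> dtop d"
 unfolding dtop_def by blast

lemma dbot_props: "B \<in> dbot d ==> \<exists>X\<in>props d. bt X = B"
 unfolding dbot_def dtop_transp by blast

lemma dtop_prop: "B \<in> dtop d ==> \<exists>X\<in>props d. tp X = B"
 unfolding dtop_def by blast

definition rank_top :: "diagram => vert set => nat" where "rank_top d B = rk (dtop d) (tp B)"
definition rank_bot :: "diagram => vert set => nat" where "rank_bot d B = rk (dbot d) (bt B)"

lemma rank_top_bij:
 assumes d: "d \<in> all_diagrams k" shows "bij_betw (rank_top d) (props d) {1..pn d}"
proof -
 have "bij_betw tp (props d) (dtop d)"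
  using inj_tp_props[OF d] by (simp add: bij_betw_def dtop_def)
 hence "bij_betw (rk (dtop d) \<circ> tp) (props d) {1..pn d}"
  using rk_bij[OF tops_partition[OF d] dtop_sub_tops] card_dtop[OF d] bij_betw_trans by metis
 thus ?thesis by (simp add: rank_top_def[abs_def] comp_def)
qed

lemma rank_bot_bij:
 assumes d: "d \<in> all_diagrams k" shows "bij_betw (rank_bot d) (props d) {1..pn d}"
proof -
 have "bij_betw bt (props d) (dbot d)"
  using inj_bt_props[OF d] by (simp add: bij_betw_def dbot_def dtop_transp)
 hence "bij_betw (rk (dbot d) \<circ> bt) (props d) {1..pn d}"
  using rk_bij[OF bots_partition[OF d] dbot_sub_bots[OF d]] card_dbot[OF d] bij_betw_trans by metis
 thus ?thesis by (simp add: rank_bot_def[abs_def] comp_def)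
qed

text \<open>Blocks are followed from bottom to top, so that the composite of diagrams gives the
  composite of permutations in the same order; outside \<open>{1..pn d}\<close> the identity is
  chosen in order to obtain a permutation in the sense of \<open>permutes\<close>.\<close>

definition perm :: "diagram => nat => nat" where
 "perm d i = (if i \<in> {1..pn d} then rank_top d (the_inv_into (props d) (rank_bot d) i) else i)"

lemma perm_rank_bot:
 assumes d: "d \<in> all_diagrams k" and B: "B \<in> props d"
 shows "perm d (rank_bot d B) = rank_top d B"
proof -
 have "rank_bot d B \<in> {1..pn d}" using bij_betwE[OF rank_bot_bij[OF d]] B by blast
 moreover have "the_inv_into (props d) (rank_bot d) (rank_bot d B) = B"
  using the_inv_into_f_f rank_bot_bij[OF d] B unfolding bij_betw_def by metis
 ultimately show ?thesis by (simp add: perm_def)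
qed

lemma perm_permutes:
 assumes d: "d \<in> all_diagrams k" shows "perm d permutes {1..pn d}"
proof (rule bij_imp_permutes)
 have "bij_betw (rank_top d \<circ> the_inv_into (props d) (rank_bot d)) {1..pn d} {1..pn d}"
  using bij_betw_trans[OF bij_betw_the_inv_into[OF rank_bot_bij[OF d]] rank_top_bij[OF d]] .
 thus "bij_betw (perm d) {1..pn d} {1..pn d}"
  by (rule bij_betw_cong[THEN iffD1, rotated]) (simp add: perm_def)
qed (auto simp: perm_def)

lemma perm_eqI:
 assumes d: "d \<in> all_diagrams k" and s: "s permutes {1..pn d}"
  and "\<And>B. B \<in> props d ==> s (rank_bot d B) = rank_top d B"
 shows "perm d = s"
proof
 fix i show "perm d i = s i"
 proof (cases "i \<in> {1..pn d}")
  case True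
  then obtain B where "B \<in> props d" "i = rank_bot d B"
   using rank_bot_bij[OF d] unfolding bij_betw_def by blast
  thus ?thesis using assms(3) perm_rank_bot[OF d] by simp
 next
  case False
  thus ?thesis using permutes_not_in[OF s] permutes_not_in[OF perm_permutes[OF d]] by simp
 qed
qed

section \<open>Composition of diagrams with matching halves\<close>

text \<open>The inner factor \<open>b \<cdot> transp b\<close> equals
  \<open>transp a \<cdot> a\<close> and is absorbed by regularity. Matching diagrams thus behave
  like composable arrows: the composite keeps the outer halves.\<close>

lemma linked_top:
 assumes a: "a \<in> all_diagrams k" and b: "b \<in> all_diagrams k"
  and ab: "transp a \<cdot> a = b \<cdot> transp b"
 shows "(a \<cdot> b) \<cdot> transp (a \<cdot> b) = a \<cdot> transp a"
proof -
 note ta = transp_in[OF a] and tb = transp_in[OF b]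
 have "(a \<cdot> b) \<cdot> transp (a \<cdot> b) = a \<cdot> (b \<cdot> transp b) \<cdot> transp a"
  unfolding transp_compose[OF a b]
  by (simp add: compose_assoc[of _ k] a b ta tb compose_in)
 also have "\<dots> = a \<cdot> transp a \<cdot> a \<cdot> transp a"
  unfolding ab[symmetric] by (simp add: compose_assoc[of _ k] a b ta tb compose_in)
 finally show ?thesis unfolding compose_regular[OF a] .
qed

lemma linked_bot:
 assumes a: "a \<in> all_diagrams k" and b: "b \<in> all_diagrams k"
  and ab: "transp a \<cdot> a = b \<cdot> transp b"
 shows "transp (a \<cdot> b) \<cdot> (a \<cdot> b) = transp b \<cdot> b"
 using linked_top[OF transp_in[OF b] transp_in[OF a]] ab
 by (simp add: transp_compose[OF a b, symmetric])

lemma pn_transp_compose: "d \<in> all_diagrams k ==> pn (transp d \<cdot> d) = pn d"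
 using pn_compose_transp[OF transp_in] pn_transp by simp

lemma pn_linked:
 assumes a: "a \<in> all_diagrams k" and b: "b \<in> all_diagrams k"
  and ab: "transp a \<cdot> a = b \<cdot> transp b"
 shows "pn (a \<cdot> b) = pn a" "pn (a \<cdot> b) = pn b"
 using pn_compose_transp[OF compose_in[OF a b]] pn_compose_transp[OF a] linked_top[OF assms]
  pn_compose_transp[OF b] pn_transp_compose[OF a] ab by metis+

lemma linked_dbot:
 assumes a: "a \<in> all_diagrams k" and b: "b \<in> all_diagrams k"
  and ab: "transp a \<cdot> a = b \<cdot> transp b"
 shows "bots a = tops b" "dbot a = dtop b"
 using compose_transp_eq_iff[OF transp_in[OF a] b] ab by (simp_all add: bots_def dbot_def)

lemma same_composeI:
 assumes a: "a \<in> all_diagrams k" and b: "b \<in> all_diagrams k"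
  and "same a (Top i) (Bot l)" "same b (Top l) (Bot j)"
 shows "same (a \<cdot> b) (Top i) (Bot j)"
proof -
 have v: "Top i \<in> verts k" "Bot j \<in> verts k"
  using same_verts[OF a assms(3)] same_verts[OF b assms(4)] by blast+
 have "x i = z j" if "(x, y) \<in> rel a" "(y, z) \<in> rel b" for x y z
  using relD[OF that(1) assms(3)] relD[OF that(2) assms(4)] by simp
 thus ?thesis
  unfolding same_iff_rel[OF compose_in[OF a b] v] rel_compose[OF a b] by auto
qed

text \<open>A propagating block of the composite consists of one of b and one of a that share a
  middle class. As this class has the same rank as a bottom class of a and as a top class of b, the
  ranks compose.\<close>

lemma perm_compose:
 assumes a: "a \<in> all_diagrams k" and b: "b \<in> all_diagrams k"
  and ab: "transp a \<cdot> a = b \<cdot> transp b"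
 shows "perm (a \<cdot> b) = perm a \<circ> perm b"
proof (rule perm_eqI)
 note c = compose_in[OF a b]
 note pns = pn_linked[OF assms]
 show "a \<cdot> b \<in> all_diagrams k" by (rule c)
 show "(perm a \<circ> perm b) permutes {1..pn (a \<cdot> b)}"
  using permutes_compose[OF perm_permutes[OF b] perm_permutes[OF a, folded pns(1), unfolded pns(2)]]
  unfolding pns(2) .
 fix B assume B: "B \<in> props (a \<cdot> b)"
 have dt: "tops (a \<cdot> b) = tops a" "dtop (a \<cdot> b) = dtop a"
  using linked_top[OF assms] compose_transp_eq_iff[OF c a] by blast+
 have db: "bots (a \<cdot> b) = bots b" "dbot (a \<cdot> b) = dbot b"
  using linked_bot[OF assms] transp_compose_eq_iff[OF c b] by blast+
 have "bt B \<in> dbot b" using bt_in_dbot[OF B] db by simp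
 then obtain B2 where B2: "B2 \<in> props b" "bt B2 = bt B" using dbot_props by blast
 have "tp B2 \<in> dbot a" using tp_in_dtop[OF B2(1)] linked_dbot[OF assms] by simp
 then obtain B1 where B1: "B1 \<in> props a" "bt B1 = tp B2" using dbot_props by blast
 obtain i where i: "i \<in> tp B1" using propsD(2)[OF B1(1)] by blast
 obtain l where l: "l \<in> tp B2" using propsD(2)[OF B2(1)] by blast
 obtain j where j: "j \<in> bt B2" using propsD(3)[OF B2(1)] by blast
 have s1: "same a (Top i) (Bot l)"
  by (rule sameI[OF propsD(1)[OF B1(1)]]) (use i l B1(2) in \<open>auto simp: set_eq_iff\<close>)
 have s2: "same b (Top l) (Bot j)"
  by (rule sameI[OF propsD(1)[OF B2(1)]]) (use l j in auto)
 obtain B' where B': "B' \<in> a \<cdot> b" "Top i \<in> B'" "Bot j \<in> B'"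
  using same_composeI[OF a b s1 s2] unfolding same_def by blast
 have "j \<in> bt B" using j B2(2) by simp
 hence "B' = B" using block_unique[OF c B'(1) propsD(1)[OF B] B'(3)] by simp
 hence iB: "i \<in> tp B" using B' by simp
 have "tp B \<in> tops a" "tp B1 \<in> tops a"
  using tp_in_dtop[OF B] tp_in_dtop[OF B1(1)] dt dtop_sub_tops[of a] by auto
 hence tpB: "tp B = tp B1" by (rule tops_unique[OF a _ _ iB i])
 have "rank_bot (a \<cdot> b) B = rank_bot b B2" by (simp add: rank_bot_def db B2)
 hence "(perm a \<circ> perm b) (rank_bot (a \<cdot> b) B) = perm a (rank_top b B2)"
  by (simp add: perm_rank_bot[OF b B2(1)])
 also have "rank_top b B2 = rank_bot a B1"
  by (simp add: rank_top_def rank_bot_def B1 linked_dbot[OF assms])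
 also have "perm a (rank_bot a B1) = rank_top (a \<cdot> b) B"
  by (simp add: perm_rank_bot[OF a B1(1)] rank_top_def tpB dt)
 finally show "(perm a \<circ> perm b) (rank_bot (a \<cdot> b) B) = rank_top (a \<cdot> b) B" .
qed

text \<open>An idempotent permutation is the identity.\<close>

lemma perm_proj:
 assumes w: "w \<in> all_diagrams k" and p: "is_proj w"
 shows "perm w = id"
proof -
 have "perm w \<circ> perm w = perm w"
  using perm_compose[OF w w] p unfolding is_proj_def by simp
 hence "inv (perm w) \<circ> (perm w \<circ> perm w) = inv (perm w) \<circ> perm w" by simp
 thus ?thesis using permutes_inv_o(2)[OF perm_permutes[OF w]] by (simp add: o_assoc)
qed

lemma block_split: "B = Top ` tp B \<union> Bot ` bt B"
proof -
 have "u \<in> B \<longleftrightarrow> u \<in> Top ` tp B \<union> Bot ` bt B" for u by (cases u) auto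
 thus ?thesis by blast
qed

text \<open>The non-propagating blocks can be read off from the two halves, and the permutation
  tells which propagating top class is joined to which bottom class.\<close>

lemma diagram_determined:
 assumes d: "d \<in> all_diagrams k" and e: "e \<in> all_diagrams k"
  and t: "d \<cdot> transp d = e \<cdot> transp e" and b: "transp d \<cdot> d = transp e \<cdot> e"
  and p: "perm d = perm e"
 shows "d = e"
proof -
 have sub: "d \<subseteq> e"
  if d: "d \<in> all_diagrams k" and e: "e \<in> all_diagrams k"
  and td: "tops d = tops e" "dtop d = dtop e" and bd: "bots d = bots e" "dbot d = dbot e" and p: "perm d = perm e"
  for d e
 proof
  fix B assume B: "B \<in> d"
  have rkinj: "B = C" if "B \<in> dtop e" "C \<in> dtop e" "rk (dtop e) B = rk (dtop e) C" for B C
   using rk_bij[OF tops_partition[OF e] dtop_sub_tops] that unfolding bij_betw_def inj_on_def by blast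
  have np: "B' \<notin> props e" if B': "B' \<in> e" "tp B' = tp B" "B \<notin> props d" "tp B \<noteq> {}" for B'
  proof
   assume "B' \<in> props e"
   hence "tp B \<in> dtop d" using tp_in_dtop B' td by metis
   then obtain B'' where "B'' \<in> props d" "tp B'' = tp B" using dtop_prop by blast
   thus False using inj_tp[OF d] propsD[of B'' d] B B'(3,4) unfolding inj_on_def by blast
  qed
  have npb: "B' \<notin> props e" if B': "B' \<in> e" "bt B' = bt B" "B \<notin> props d" "bt B \<noteq> {}" for B'
  proof
   assume "B' \<in> props e"
   hence "bt B \<in> dbot d" using bt_in_dbot B' bd by metis
   then obtain B'' where B'': "B'' \<in> props d" "bt B'' = bt B" using dbot_props by blast
   obtain j where "j \<in> bt B" using B'(4) by blast
   hence "j \<in> bt B" "j \<in> bt B''" using B''(2) by simp_all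
   hence "Bot j \<in> B" "Bot j \<in> B''" by simp_all
   hence "B = B''" using block_unique[OF d B propsD(1)[OF B''(1)]] by blast
   thus False using B'' B' by blast
  qed
  consider "B \<in> props d" | "B \<notin> props d" "tp B \<noteq> {}" | "B \<notin> props d" "tp B = {}" by blast
  thus "B \<in> e"
  proof cases
   case 1
   then obtain B' where B': "B' \<in> props e" "bt B' = bt B" using bt_in_dbot bd dbot_props by metis
   have "rank_bot e B' = rank_bot d B" by (simp add: rank_bot_def B' bd)
   hence "rank_top e B' = rank_top d B"
    using perm_rank_bot[OF d 1] perm_rank_bot[OF e B'(1)] p by simp
   hence "tp B' = tp B"
    using rkinj[OF tp_in_dtop[OF B'(1)]] tp_in_dtop[OF 1] td unfolding rank_top_def by simp
   hence "B' = B" using B'(2) block_split by metis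
   thus ?thesis using propsD(1)[OF B'(1)] by simp
  next
   case 2
   hence bB: "bt B = {}" using B unfolding props_def propagating_def by blast
   have "tp B \<in> tops e" using B 2 td unfolding tops_def by blast
   then obtain B' where B': "B' \<in> e" "tp B' = tp B" unfolding tops_def by auto
   hence "bt B' = {}" using np[OF B' 2] 2 unfolding props_def propagating_def by auto
   hence "B' = B" using B' bB block_split by metis
   thus ?thesis using B' by simp
  next
   case 3
   hence bB: "bt B \<noteq> {}" using block_split[of B] block_nonempty[OF d B] by auto
   have "bt B \<in> bots e" using B bB bd unfolding bots_def tops_transp by blast
   then obtain B' where B': "B' \<in> e" "bt B' = bt B" unfolding bots_def tops_transp by auto
   hence "tp B' = {}" using npb[OF B' 3(1) bB] bB unfolding props_def propagating_def by auto
   hence "B' = B" using B' 3 block_split by metis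
   thus ?thesis using B' by simp
  qed
 qed
 have "tops d = tops e" "dtop d = dtop e" "bots d = bots e" "dbot d = dbot e"
  using t b unfolding compose_transp_eq_iff[OF d e] transp_compose_eq_iff[OF d e] by blast+
 thus ?thesis using sub[OF d e] sub[OF e d] p by auto
qed

subsection \<open>Twists\<close>

text \<open>The twist is defined through components of the stack of three diagrams, whereas the
  monoid product is binary; this lemma connects the two.\<close>

lemma compose3_eq_outer:
 assumes a: "a \<in> all_diagrams k" and b: "b \<in> all_diagrams k" and c: "c \<in> all_diagrams k"
 shows "a \<cdot> b \<cdot> c = outer_diagram [a, b, c]"
proof (rule rel_inj[of _ k])
 interpret stack k "[a, b, c]" using a b c by (simp add: stack_def)
 have len: "length [a, b, c] = 3" by simp
 have r: "resp f \<longleftrightarrow> ((\<lambda>i. f (0, i)), (\<lambda>i. f (1, i))) \<in> rel a \<and>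
   ((\<lambda>i. f (1, i)), (\<lambda>i. f (2, i))) \<in> rel b \<and> ((\<lambda>i. f (2, i)), (\<lambda>i. f (3, i))) \<in> rel c" for f
  unfolding resp_def by (auto simp: less_Suc_eq numeral_2_eq_2 numeral_3_eq_3)
 show "outer_diagram [a, b, c] \<in> all_diagrams k" by (rule outer_diagram_in)
 have "(x, z) \<in> rel (outer_diagram [a, b, c]) \<longleftrightarrow> (x, z) \<in> (rel a O rel b) O rel c" for x z
 proof
  assume "(x, z) \<in> rel (outer_diagram [a, b, c])"
  then obtain f where f: "resp f" "\<forall>u\<in>verts k. f (outv 3 u) = vl x z u"
   unfolding rel_outer len by blast
  have o: "f (0, i) = x i" "f (3, i) = z i" if "i \<in> {1..k}" for i
   using f(2)[rule_format, of "Top i"] f(2)[rule_format, of "Bot i"] that by auto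
  from f(1) have r1: "((\<lambda>i. f (0, i)), (\<lambda>i. f (1, i))) \<in> rel a"
   and r2: "((\<lambda>i. f (1, i)), (\<lambda>i. f (2, i))) \<in> rel b"
   and r3: "((\<lambda>i. f (2, i)), (\<lambda>i. f (3, i))) \<in> rel c" unfolding r by auto
  have "(x, (\<lambda>i. f (1, i))) \<in> rel a" by (rule rel_cong[OF a r1]) (auto simp: o)
  moreover have "((\<lambda>i. f (2, i)), z) \<in> rel c" by (rule rel_cong[OF c r3]) (auto simp: o)
  ultimately show "(x, z) \<in> (rel a O rel b) O rel c" using r2 by blast
 next
  assume "(x, z) \<in> (rel a O rel b) O rel c"
  then obtain y y' where y: "(x, y) \<in> rel a" "(y, y') \<in> rel b" "(y', z) \<in> rel c" by blast
  define f where "f = (\<lambda>(r :: nat, i). if r = 0 then x i else if r = 1 then y i else if r = 2 then y' i else z i)"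
  have "f (outv 3 u) = vl x z u" for u by (cases u) (auto simp: f_def)
  moreover have "resp f" unfolding r using y by (simp add: f_def)
  ultimately show "(x, z) \<in> rel (outer_diagram [a, b, c])" unfolding rel_outer len by blast
 qed
 thus "rel (a \<cdot> b \<cdot> c) = rel (outer_diagram [a, b, c])"
  unfolding rel_compose[OF compose_in[OF a b] c] rel_compose[OF a b] by auto
qed (simp add: a b c compose_in)

lemma prop_rank_eq:
 assumes d: "d \<in> all_diagrams k" shows "prop_rank d X = rank_top d X"
proof -
 have "{C \<in> dtop d. Max C < Max (tp X)} = tp ` {Y \<in> props d. Max (tp Y) < Max (tp X)}"
  by (auto simp: dtop_def)
 moreover have "inj_on tp {Y \<in> props d. Max (tp Y) < Max (tp X)}"
  by (rule inj_on_subset[OF inj_tp_props[OF d]]) auto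
 ultimately show ?thesis by (simp add: prop_rank_def rank_top_def rk_def card_image)
qed

lemma proj_eq_sym:
 assumes w: "w \<in> all_diagrams k" and p: "is_proj w"
 shows "w = sym_diagram_of (tops w) (dtop w)"
 using compose_transp_eq_sym[OF w] p by (simp add: is_proj_def)

lemma proj_props_bt:
 assumes w: "w \<in> all_diagrams k" and p: "is_proj w" and X: "X \<in> props w"
 shows "bt X = tp X"
proof -
 have "X \<in> sym_diagram_of (tops w) (dtop w)" using propsD(1)[OF X] proj_eq_sym[OF w p] by simp
 thus ?thesis
  by (rule sym_diagramE[OF tops_partition[OF w] dtop_sub_tops])
   (use propsD(2,3)[OF X] in \<open>auto simp: tp_def bt_def\<close>)
qed

lemma conj_proj:
 assumes d: "d \<in> all_diagrams k" and w: "w \<in> all_diagrams k" and p: "is_proj w"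
 shows "d \<cdot> w \<cdot> transp d = (d \<cdot> w) \<cdot> transp (d \<cdot> w)"
proof -
 have "(d \<cdot> w) \<cdot> transp (d \<cdot> w) = d \<cdot> (w \<cdot> w) \<cdot> transp d"
  unfolding transp_compose[OF d w] p[unfolded is_proj_def, THEN conjunct1]
  by (simp only: compose_assoc[of _ k] d w transp_in compose_in)
 thus ?thesis using p by (simp add: is_proj_def)
qed

lemma pn_conj:
 assumes d: "d \<in> all_diagrams k" and w: "w \<in> all_diagrams k" and p: "is_proj w"
 shows "pn (d \<cdot> w \<cdot> transp d) = pn (d \<cdot> w)"
 unfolding conj_proj[OF assms] by (rule pn_compose_transp[OF compose_in[OF d w]])

text \<open>The diagrams \<open>d \<cdot> w\<close> and \<open>d \<cdot> w \<cdot> transp d\<close>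
  have the same upper half, hence the same ranks at the top, and by stability the lower half of
  \<open>d \<cdot> w\<close> is that of w. Following a block of w upwards in the triple stack is
  therefore following it in \<open>d \<cdot> w\<close>.\<close>

lemma twist_eq_perm:
 assumes d: "d \<in> all_diagrams k" and w: "w \<in> all_diagrams k" and p: "is_proj w"
  and m: "pn w = m" "pn (d \<cdot> w) = m"
 shows "twist d w m = perm (d \<cdot> w)"
proof
 fix i
 let ?e = "d \<cdot> w" let ?f = "d \<cdot> w \<cdot> transp d"
 note td = transp_in[OF d] and e = compose_in[OF d w]
 note f = compose_in[OF e td]
 interpret S: stack k "[d, w, transp d]" using d w td by (simp add: stack_def)
 interpret S2: stack k "[d, w]" using d w by (simp add: stack_def)
 show "twist d w m i = perm ?e i"
 proof (cases "i \<in> {1..m}")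
  case False
  thus ?thesis using permutes_not_in[OF perm_permutes[OF e]] m by (auto simp: twist_def)
 next
  case True
  have ft: "tops ?f = tops ?e" "dtop ?f = dtop ?e"
   unfolding conj_proj[OF d w p] by (rule dtop_compose_transp[OF e])+
  have "transp ?e \<cdot> ?e = transp w \<cdot> w" using pn_stable_bot[OF d w] m by simp
  hence eb: "dbot ?e = dtop w"
   unfolding transp_compose_eq_iff[OF e w] using p by (simp add: dbot_def is_proj_def)
  have "rank_bot ?e ` props ?e = {1..m}"
   using rank_bot_bij[OF e] unfolding bij_betw_def m(2) by blast
  hence "i \<in> rank_bot ?e ` props ?e" using True by simp
  then obtain B where B: "B \<in> props ?e" "rank_bot ?e B = i" by blast
  have "bt B \<in> dtop w" using bt_in_dbot[OF B(1)] eb by simp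
  then obtain X where X: "X \<in> props w" "tp X = bt B" using dtop_prop by blast
  have rX: "prop_rank w X = i"
   using B X eb by (simp add: prop_rank_eq[OF w] rank_top_def rank_bot_def)
  have Xuniq: "X' = X" if "X' \<in> props w" "prop_rank w X' = i" for X'
   using that X(1) rX rank_top_bij[OF w] unfolding prop_rank_eq[OF w] bij_betw_def inj_on_def by metis
  obtain i0 where i0: "i0 \<in> tp B" using propsD(2)[OF B(1)] by blast
  obtain x where x: "x \<in> bt B" using propsD(3)[OF B(1)] by blast
  have "x \<in> tp X" "x \<in> bt X" using x X(2) proj_props_bt[OF w p X(1)] by simp_all
  hence xX: "Top x \<in> X" "Bot x \<in> X" by simp_all
  have "same ?e (Top i0) (Bot x)"
   by (rule sameI[OF propsD(1)[OF B(1)]]) (use i0 x in auto)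
  hence "((0, i0), (2, x)) \<in> (stack_rel [d, w])\<^sup>+"
   unfolding compose_eq_outer S2.same_outer by (simp add: numeral_2_eq_2)
  \<comment> \<open>A path in the stack of two diagrams remains a path after the third one is
    attached below.\<close>
  moreover have "stack_rel [d, w] \<subseteq> stack_rel [d, w, transp d]"
  proof clarify
   fix r i r' i' assume "((r, i), (r', i')) \<in> stack_rel [d, w]"
   then obtain j u v where j: "j < 2" "same ([d, w] ! j) u v" "(r, i) = emb j u" "(r', i') = emb j v"
    unfolding stack_rel_same by (auto simp: numeral_2_eq_2)
   hence "same ([d, w, transp d] ! j) u v" by (auto simp: less_Suc_eq numeral_2_eq_2)
   thus "((r, i), (r', i')) \<in> stack_rel [d, w, transp d]"
    unfolding stack_rel_same using j by (intro exI[of _ j]) auto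
  qed
  ultimately have 1: "((0, i0), (2, x)) \<in> S.E" using trancl_mono by blast
  have inX: "(emb 1 u, emb 1 v) \<in> S.E" if "u \<in> X" "v \<in> X" for u v
  proof -
   have "same ([d, w, transp d] ! 1) u v" using sameI[OF propsD(1)[OF X(1)] that] by simp
   hence "(emb 1 u, emb 1 v) \<in> stack_rel [d, w, transp d]"
    unfolding stack_rel_same by (intro exI[of _ 1]) auto
   thus ?thesis by blast
  qed
  have 2: "((0, i0), (1, x)) \<in> S.E"
   using S.E_trans[OF 1, of "(1, x)"] inX[OF xX(2,1)] by (simp add: numeral_2_eq_2)
  define C where "C = S.E `` {(1, x)}"
  have C: "C \<in> comps [d, w, transp d]"
   unfolding C_def S.comps_eq using S.E_N[OF 2] by blast
  have XC: "emb 1 ` X \<subseteq> C" unfolding C_def using inX[OF xX(1)] by auto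
  define Y where "Y = outer_at 3 C"
  have i0Y: "Top i0 \<in> Y" unfolding Y_def outer_at_eq C_def using S.E_sym[OF 2] by simp
  have "Y \<in> outer_diagram [d, w, transp d]"
  proof -
   have l: "length [d, w, transp d] = 3" by simp
   show ?thesis unfolding outer_diagram_def l using C i0Y Y_def by blast
  qed
  hence Yf: "Y \<in> ?f" unfolding compose3_eq_outer[OF d w td] .
  have "i0 \<in> tp Y" using i0Y by simp
  hence "tp Y \<noteq> {}" by blast
  hence "tp Y \<in> tops ?f" using Yf unfolding tops_def by blast
  hence "tp Y \<in> tops ?e" unfolding ft(1) .
  hence tpY: "tp Y = tp B"
   using tops_unique[OF e _ _ _ i0, of "tp Y"] tp_in_dtop[OF B(1)] dtop_sub_tops[of ?e] i0Y by auto
  have "tp Y \<in> dtop ?f" using tpY tp_in_dtop[OF B(1)] ft by simp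
  then obtain Y' where Y': "Y' \<in> props ?f" "tp Y' = tp Y" using dtop_prop by blast
  hence "i0 \<in> tp Y'" using i0Y by simp
  hence "Top i0 \<in> Y'" by simp
  hence "Y' = Y" using block_unique[OF f propsD(1)[OF Y'(1)] Yf] i0Y by blast
  hence Yp: "Y \<in> props ?f" using Y' by simp
  have rY: "prop_rank ?f Y = perm ?e i"
   using perm_rank_bot[OF e B(1)] B(2) by (simp add: prop_rank_eq[OF f] rank_top_def ft tpY)
  have "(THE j. \<exists>X\<in>props w. \<exists>Y\<in>props ?f. prop_rank w X = i \<and> prop_rank ?f Y = j \<and>
     (\<exists>C\<in>comps [d, w, transp d]. emb 1 ` X \<subseteq> C \<and> outer_at 3 C = Y)) = perm ?e i"
  proof (rule the_equality)
   show "\<exists>X\<in>props w. \<exists>Y\<in>props ?f. prop_rank w X = i \<and> prop_rank ?f Y = perm ?e i \<and>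
     (\<exists>C\<in>comps [d, w, transp d]. emb 1 ` X \<subseteq> C \<and> outer_at 3 C = Y)"
    using X(1) Yp rX rY C XC Y_def by blast
   fix j assume "\<exists>X\<in>props w. \<exists>Y\<in>props ?f. prop_rank w X = i \<and> prop_rank ?f Y = j \<and>
     (\<exists>C\<in>comps [d, w, transp d]. emb 1 ` X \<subseteq> C \<and> outer_at 3 C = Y)"
   then obtain X' Y' C' where j: "X' \<in> props w" "prop_rank w X' = i" "prop_rank ?f Y' = j"
    "C' \<in> comps [d, w, transp d]" "emb 1 ` X' \<subseteq> C'" "outer_at 3 C' = Y'" by blast
   hence "emb 1 (Top x) \<in> C'" using Xuniq xX(1) by blast
   hence "C' = C" using S.comps_memD[OF j(4)] unfolding C_def by simp
   thus "j = perm ?e i" using j rY Y_def by simp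
  qed
  thus ?thesis using True by (simp add: twist_def)
 qed
qed

subsection \<open>Diagrams with prescribed halves\<close>

text \<open>Existence in addition to the uniqueness of \<open>diagram_determined\<close>. The
  description of the blocks by those of p and q is what later places the diagram in each of the
  seven monoids.\<close>

lemma ex_diagram:
 assumes p: "p \<in> all_diagrams k" "is_proj p" "pn p = m"
  and q: "q \<in> all_diagrams k" "is_proj q" "pn q = m" and s: "s permutes {1..m}"
 shows "\<exists>d\<in>all_diagrams k. d \<cdot> transp d = p \<and> transp d \<cdot> d = q \<and> perm d = s \<and>
  (\<forall>X\<in>d. (X \<in> props d \<and> Top ` tp X \<union> Bot ` tp X \<in> p \<and> Top ` bt X \<union> Bot ` bt X \<in> q) \<or>
    X \<in> p \<and> bt X = {} \<or> X \<in> q \<and> tp X = {})"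
proof -
 define P D P0 D0 where "P = tops p" and "D = dtop p" and "P0 = tops q" and "D0 = dtop q"
 have P: "partition_on {1..k} P" "D \<subseteq> P" "partition_on {1..k} P0" "D0 \<subseteq> P0"
  using tops_partition[OF p(1)] tops_partition[OF q(1)] dtop_sub_tops by (auto simp: P_def D_def P0_def D0_def)
 have pe: "p = sym_diagram_of P D" and qe: "q = sym_diagram_of P0 D0"
  using proj_eq_sym p q by (auto simp: P_def D_def P0_def D0_def)
 have cD: "card D = m" "card D0 = m" using card_dtop p q by (auto simp: D_def D0_def)
 have bD: "bij_betw (rk D) D {1..m}" and bD0: "bij_betw (rk D0) D0 {1..m}"
  using rk_bij[OF P(1,2)] rk_bij[OF P(3,4)] cD by simp_all
 \<comment> \<open>The bottom class of rank i is joined to the top class of rank s i.\<close>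
 define \<beta> where "\<beta> = the_inv_into D (rk D) \<circ> (s \<circ> rk D0)"
 have b\<beta>: "bij_betw \<beta> D0 D"
  unfolding \<beta>_def
  by (rule bij_betw_trans[OF bij_betw_trans[OF bD0 permutes_imp_bij[OF s]] bij_betw_the_inv_into[OF bD]])
 have rk\<beta>: "rk D (\<beta> B) = s (rk D0 B)" if "B \<in> D0" for B
 proof -
  have "s (rk D0 B) \<in> {1..m}" using bij_betwE[OF bD0] that permutes_in_image[OF s] by blast
  thus ?thesis unfolding \<beta>_def using f_the_inv_into_f_bij_betw[OF bD] by simp
 qed
 have \<beta>D: "\<beta> B \<in> D" if "B \<in> D0" for B using bij_betwE[OF b\<beta>] that by blast
 have U: "\<Union> P = {1..k}" "\<Union> P0 = {1..k}" using partition_onD1 P by metis+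
 have ne: "B \<noteq> {}" if "B \<in> P \<or> B \<in> P0" for B using that partition_onD3 P by metis
 have uP: "B = C" if "B \<in> P" "C \<in> P" "i \<in> B" "i \<in> C" for B C i
  using disjointD[OF partition_onD2[OF P(1)] that(1,2)] that(3,4) by blast
 have uP0: "B = C" if "B \<in> P0" "C \<in> P0" "i \<in> B" "i \<in> C" for B C i
  using disjointD[OF partition_onD2[OF P(3)] that(1,2)] that(3,4) by blast
 define d where "d = {Top ` \<beta> B \<union> Bot ` B |B. B \<in> D0} \<union> {Top ` B |B. B \<in> P - D} \<union> {Bot ` B |B. B \<in> P0 - D0}"
 have dE: "(\<exists>B\<in>D0. X = Top ` \<beta> B \<union> Bot ` B) \<or> (\<exists>B\<in>P - D. X = Top ` B) \<or> (\<exists>B\<in>P0 - D0. X = Bot ` B)"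
  if "X \<in> d" for X using that unfolding d_def by auto
 have dI: "B \<in> D0 ==> Top ` \<beta> B \<union> Bot ` B \<in> d" "B \<in> P - D ==> Top ` B \<in> d" "B \<in> P0 - D0 ==> Bot ` B \<in> d" for B
  unfolding d_def by auto
 have tbs: "tp (Top ` B \<union> Bot ` C) = B" "bt (Top ` B \<union> Bot ` C) = C" "tp (Top ` B) = B" "bt (Top ` B) = {}"
   "tp (Bot ` B) = {}" "bt (Bot ` B) = B" for B C
  by (auto simp: tp_def bt_def)
 have dall: "d \<in> all_diagrams k"
 proof (rule all_diagramsI)
  fix X u assume X: "X \<in> d" "u \<in> X"
  have k: "i \<in> {1..k}" if "i \<in> B" "B \<in> P \<or> B \<in> P0" for i B using that U by blast
  have \<beta>P: "\<beta> B \<in> P" if "B \<in> D0" for B using \<beta>D[OF that] P(2) by blast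
  have "\<exists>i B. i \<in> B \<and> (B \<in> P \<or> B \<in> P0) \<and> (u = Top i \<or> u = Bot i)"
   using dE[OF X(1)]
  proof (elim disjE bexE)
   fix B assume "B \<in> D0" "X = Top ` \<beta> B \<union> Bot ` B"
   thus ?thesis using X(2) \<beta>P[of B] P(4) by blast
  qed (use X(2) in blast)+
  thus "u \<in> verts k" using k by auto
 next
  fix u assume u: "u \<in> verts k"
  show "\<exists>B\<in>d. u \<in> B"
  proof (cases u)
   case (Top i)
   hence "i \<in> \<Union> P" using u U by simp
   then obtain B where B: "B \<in> P" "i \<in> B" by blast
   show ?thesis
   proof (cases "B \<in> D")
    case True
    then obtain B0 where "B0 \<in> D0" "\<beta> B0 = B" using b\<beta> unfolding bij_betw_def by blast
    thus ?thesis using dI(1)[of B0] B Top by (intro bexI[of _ "Top ` \<beta> B0 \<union> Bot ` B0"]) auto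
   qed (use dI(2)[of B] B Top in \<open>intro bexI[of _ "Top ` B"]; auto\<close>)
  next
   case (Bot i)
   hence "i \<in> \<Union> P0" using u U by simp
   then obtain B where B: "B \<in> P0" "i \<in> B" by blast
   show ?thesis
   proof (cases "B \<in> D0")
    case True
    thus ?thesis using dI(1)[of B] B Bot by (intro bexI[of _ "Top ` \<beta> B \<union> Bot ` B"]) auto
   qed (use dI(3)[of B] B Bot in \<open>intro bexI[of _ "Bot ` B"]; auto\<close>)
  qed
 next
  fix B assume B: "B \<in> d"
  show "B \<noteq> {}" using dE[OF B] ne P(4) by auto
 next
  fix X Y u assume XY: "X \<in> d" "Y \<in> d" "u \<in> X" "u \<in> Y"
  have \<gamma>: "the_inv_into D0 \<beta> (\<beta> B) = B" if "B \<in> D0" for B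
   using b\<beta> that unfolding bij_betw_def by (simp add: the_inv_into_f_f)
  have cT: "X = (if tp X \<in> D then Top ` tp X \<union> Bot ` the_inv_into D0 \<beta> (tp X) else Top ` tp X)"
   if "X \<in> d" "tp X \<noteq> {}" for X
   using dE[OF that(1)] that(2) by (elim disjE bexE) (simp_all add: tbs \<gamma> \<beta>D)
  have cB: "X = (if bt X \<in> D0 then Top ` \<beta> (bt X) \<union> Bot ` bt X else Bot ` bt X)"
   if "X \<in> d" "bt X \<noteq> {}" for X
   using dE[OF that(1)] that(2) by (elim disjE bexE) (simp_all add: tbs)
  have \<beta>P: "\<beta> B \<in> P" if "B \<in> D0" for B using \<beta>D[OF that] P(2) by blast
  show "X = Y"
  proof (cases u)
   case (Top i)
   have t: "tp X \<in> P" "tp Y \<in> P" "i \<in> tp X" "i \<in> tp Y"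
    using dE[OF XY(1)] dE[OF XY(2)] XY(3,4) Top \<beta>P by (auto simp: tbs)
   hence eq: "tp X = tp Y" by (rule uP)
   show ?thesis using cT[OF XY(1)] cT[OF XY(2)] t(3,4) unfolding eq by (metis empty_iff)
  next
   case (Bot i)
   have t: "bt X \<in> P0" "bt Y \<in> P0" "i \<in> bt X" "i \<in> bt Y"
    using dE[OF XY(1)] dE[OF XY(2)] XY(3,4) Bot P(4) by (auto simp: tbs)
   hence eq: "bt X = bt Y" by (rule uP0)
   show ?thesis using cB[OF XY(1)] cB[OF XY(2)] t(3,4) unfolding eq by (metis empty_iff)
  qed
 qed
 have pr: "props d = {Top ` \<beta> B \<union> Bot ` B |B. B \<in> D0}"
 proof
  show "props d \<subseteq> {Top ` \<beta> B \<union> Bot ` B |B. B \<in> D0}"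
  proof
   fix X assume X: "X \<in> props d"
   show "X \<in> {Top ` \<beta> B \<union> Bot ` B |B. B \<in> D0}"
    using dE[OF propsD(1)[OF X]] propsD(2,3)[OF X] by (auto simp: tbs)
  qed
  have "\<beta> B \<noteq> {} \<and> B \<noteq> {}" if "B \<in> D0" for B using ne \<beta>D[OF that] P(2,4) that by blast
  thus "{Top ` \<beta> B \<union> Bot ` B |B. B \<in> D0} \<subseteq> props d"
   using dI(1) by (auto simp: props_def propagating_def tbs)
 qed
 hence pri: "props d = (\<lambda>B. Top ` \<beta> B \<union> Bot ` B) ` D0" by blast
 have dt: "dtop d = D" "dbot d = D0"
 proof -
  have "dtop d = \<beta> ` D0" unfolding dtop_def pri image_image tbs ..
  thus "dtop d = D" using b\<beta> unfolding bij_betw_def by simp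
  show "dbot d = D0" unfolding dbot_def dtop_transp pri image_image tbs by simp
 qed
 have tops: "tops d = P"
 proof (rule set_eqI)
  fix B show "B \<in> tops d \<longleftrightarrow> B \<in> P"
  proof
   assume "B \<in> tops d"
   then obtain X where "X \<in> d" "B = tp X" "tp X \<noteq> {}" unfolding tops_def by blast
   moreover have "\<beta> B \<in> P" if "B \<in> D0" for B using \<beta>D[OF that] P(2) by blast
   ultimately show "B \<in> P" using dE[of X] by (auto simp: tbs)
  next
   assume B: "B \<in> P"
   show "B \<in> tops d"
   proof (cases "B \<in> D")
    case True thus ?thesis using dt dtop_sub_tops by blast
   next
    case False
    hence "Top ` B \<in> d" using dI(2) B by blast
    thus ?thesis unfolding tops_def using ne[of B] B tbs(3)[of B] by (metis (mono_tags, lifting) mem_Collect_eq)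
   qed
  qed
 qed
 have bots: "bots d = P0"
 proof (rule set_eqI)
  fix B show "B \<in> bots d \<longleftrightarrow> B \<in> P0"
  proof
   assume "B \<in> bots d"
   then obtain X where "X \<in> d" "B = bt X" "bt X \<noteq> {}" unfolding bots_def tops_transp by blast
   thus "B \<in> P0" using dE[of X] P(4) by (auto simp: tbs)
  next
   assume B: "B \<in> P0"
   show "B \<in> bots d"
   proof (cases "B \<in> D0")
    case True thus ?thesis using dt dbot_sub_bots[OF dall] by blast
   next
    case False
    hence "Bot ` B \<in> d" using dI(3) B by blast
    thus ?thesis unfolding bots_def tops_transp using ne[of B] B tbs(6)[of B] by (metis (mono_tags, lifting) mem_Collect_eq)
   qed
  qed
 qed
 have "d \<cdot> transp d = p" unfolding compose_transp_eq_sym[OF dall] tops dt pe ..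
 moreover have "transp d \<cdot> d = q"
  using compose_transp_eq_sym[OF transp_in[OF dall]] bots dt qe by (simp add: bots_def dbot_def)
 moreover have "perm d = s"
 proof (rule perm_eqI[OF dall])
  show "s permutes {1..pn d}" using card_dtop[OF dall] dt cD s by simp
  show "s (rank_bot d X) = rank_top d X" if "X \<in> props d" for X
   using that unfolding pr by (auto simp: rank_bot_def rank_top_def tbs dt rk\<beta>)
 qed
 moreover have "(X \<in> props d \<and> Top ` tp X \<union> Bot ` tp X \<in> p \<and> Top ` bt X \<union> Bot ` bt X \<in> q) \<or>
    X \<in> p \<and> bt X = {} \<or> X \<in> q \<and> tp X = {}" if X: "X \<in> d" for X
  using dE[OF X]
 proof (elim disjE bexE)
  fix B assume B: "B \<in> D0" "X = Top ` \<beta> B \<union> Bot ` B"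
  hence "X \<in> props d" unfolding pr by blast
  moreover have "Top ` \<beta> B \<union> Bot ` \<beta> B \<in> p" unfolding pe by (rule sym_diagramI(1)[OF P(1,2) \<beta>D[OF B(1)]])
  moreover have "Top ` B \<union> Bot ` B \<in> q" unfolding qe by (rule sym_diagramI(1)[OF P(3,4) B(1)])
  ultimately show ?thesis unfolding B(2) tbs by blast
 next
  fix B assume B: "B \<in> P - D" "X = Top ` B"
  hence "Top ` B \<in> p" unfolding pe using sym_diagramI(2)[OF P(1,2)] by blast
  thus ?thesis unfolding B(2) tbs by blast
 next
  fix B assume B: "B \<in> P0 - D0" "X = Bot ` B"
  hence "Bot ` B \<in> q" unfolding qe using sym_diagramI(3)[OF P(3,4)] by blast
  thus ?thesis unfolding B(2) tbs by blast
 qed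
 ultimately show ?thesis using dall by blast
qed

section \<open>The seven diagram monoids are closed under composition\<close>

text \<open>The composite is obtained from the disjoint union of the two diagrams by gluing the vertex
 pairs (j', j) one after the other. The invariants below refer only to the vertices not glued
 so far; in the cyclic order of these the next pair to be glued is adjacent.\<close>

definition merge :: "('a => 'a => bool) => 'a => 'a => 'a => 'a => bool" where
 "merge E p q x y \<longleftrightarrow> E x y \<or> E x p \<and> E q y \<or> E x q \<and> E p y"

definition per :: "('a => 'a => bool) => bool" where
 "per E \<longleftrightarrow> (\<forall>x y. E x y --> E y x) \<and> (\<forall>x y z. E x y --> E y z --> E x z)"

lemma per_merge: "per E ==> per (merge E p q)"
 unfolding per_def merge_def by meson

definition noncrossing :: "'a set => ('a => nat) => ('a => 'a => bool) => bool" where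
 "noncrossing S pos E \<longleftrightarrow> (\<forall>x\<in>S. \<forall>y\<in>S. \<forall>z\<in>S. \<forall>w\<in>S.
   pos x < pos y \<and> pos y < pos z \<and> pos z < pos w \<and> E x z \<and> E y w --> E x y)"

definition atmost2 :: "'a set => ('a => 'a => bool) => bool" where
 "atmost2 S E \<longleftrightarrow> (\<forall>x\<in>S. \<forall>y\<in>S. \<forall>z\<in>S. E x y \<and> E x z \<and> x \<noteq> y \<and> x \<noteq> z --> y = z)"

definition partnered :: "'a set => ('a => 'a => bool) => bool" where
 "partnered S E \<longleftrightarrow> (\<forall>x\<in>S. \<exists>y\<in>S. y \<noteq> x \<and> E x y)"

definition polar :: "'a set => ('a => bool) => ('a => 'a => bool) => bool" where
 "polar S pol E \<longleftrightarrow> (\<forall>x\<in>S. \<forall>y\<in>S. E x y \<and> x \<noteq> y --> pol x \<noteq> pol y)"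

text \<open>E is a partial matching on S. Gluing p and q makes the partners of p and q, as far as
  they exist, partners of each other and changes nothing else.\<close>

lemma atmost2_merge:
 assumes per: "per E" and a: "atmost2 S E" and pq: "p \<in> S" "q \<in> S" "p \<noteq> q"
 shows "atmost2 (S - {p, q}) (merge E p q)"
proof -
 have sym: "E y x" if "E x y" for x y using per that unfolding per_def by blast
 have A: "y = z" if "x \<in> S" "y \<in> S" "z \<in> S" "E x y" "E x z" "x \<noteq> y" "x \<noteq> z" for x y z
  using a that unfolding atmost2_def by blast
 show ?thesis
  unfolding atmost2_def
 proof (intro ballI impI, elim conjE)
  fix x y z assume S: "x \<in> S - {p, q}" "y \<in> S - {p, q}" "z \<in> S - {p, q}" "x \<noteq> y" "x \<noteq> z"
   and E: "merge E p q x y" "merge E p q x z"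
  hence S': "x \<in> S" "y \<in> S" "z \<in> S" "x \<noteq> p" "x \<noteq> q" "y \<noteq> p" "y \<noteq> q" "z \<noteq> p" "z \<noteq> q" by auto
  have n: "\<not> (E x y \<and> E x p)" "\<not> (E x y \<and> E x q)" "\<not> (E x z \<and> E x p)" "\<not> (E x z \<and> E x q)"
   "\<not> (E x p \<and> E x q)"
   using A[of x y p] A[of x y q] A[of x z p] A[of x z q] A[of x p q] S S' pq by blast+
  have m: "E x y \<and> E x z --> y = z" "E p y \<and> E p z --> y = z" "E q y \<and> E q z --> y = z"
   using A[of x y z] A[of p y z] A[of q y z] S S' pq by blast+
  show "y = z" using E n m unfolding merge_def by blast
 qed
qed

text \<open>A vertex that loses its partner p receives the partner of q instead, and vice versa;
  uniqueness of partners keeps these apart.\<close>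

lemma partnered_merge:
 assumes per: "per E" and a: "atmost2 S E" and b: "partnered S E" and pq: "p \<in> S" "q \<in> S" "p \<noteq> q"
 shows "partnered (S - {p, q}) (merge E p q)"
proof -
 have sym: "E y x" if "E x y" for x y using per that unfolding per_def by blast
 have A: "y = z" if "x \<in> S" "y \<in> S" "z \<in> S" "E x y" "E x z" "x \<noteq> y" "x \<noteq> z" for x y z
  using a that unfolding atmost2_def by blast
 have B: "\<exists>y\<in>S. y \<noteq> x \<and> E x y" if "x \<in> S" for x using b that unfolding partnered_def by blast
 show ?thesis
  unfolding partnered_def
 proof
  fix x assume x: "x \<in> S - {p, q}"
  obtain y where y: "y \<in> S" "y \<noteq> x" "E x y" using B x by blast
  obtain p' where p': "p' \<in> S" "p' \<noteq> p" "E p p'" using B pq by blast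
  obtain q' where q': "q' \<in> S" "q' \<noteq> q" "E q q'" using B pq by blast
  consider "y \<noteq> p" "y \<noteq> q" | "y = p" | "y = q" by blast
  thus "\<exists>y\<in>S - {p, q}. y \<noteq> x \<and> merge E p q x y"
  proof cases
   case 1 thus ?thesis using y unfolding merge_def by blast
  next
   case 2
   have "q' \<noteq> p" using A[of p q x] 2 y q' sym pq x by blast
   moreover have "q' \<noteq> x" using A[of x p q] 2 y q' sym pq x by blast
   ultimately show ?thesis using q' y 2 unfolding merge_def by blast
  next
   case 3
   have "p' \<noteq> q" using A[of q p x] 3 y p' sym pq x by blast
   moreover have "p' \<noteq> x" using A[of x p q] 3 y p' sym pq x by blast
   ultimately show ?thesis using p' y 3 unfolding merge_def by blast
  qed
 qed
qed

text \<open>A new connection runs from x to p, across to q and on to y. The polarity changes at each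
  of the three passages, hence also from x to y.\<close>

lemma polar_merge:
 assumes per: "per E" and a: "polar S pol E" and pq: "p \<in> S" "q \<in> S" "pol p \<noteq> pol q"
 shows "polar (S - {p, q}) pol (merge E p q)"
proof -
 have sym: "E y x" if "E x y" for x y using per that unfolding per_def by blast
 have A: "pol x \<noteq> pol y" if "x \<in> S" "y \<in> S" "E x y" "x \<noteq> y" for x y
  using a that unfolding polar_def by blast
 show ?thesis
  unfolding polar_def
 proof (intro ballI impI, elim conjE)
  fix x y assume S: "x \<in> S - {p, q}" "y \<in> S - {p, q}" "x \<noteq> y" and E: "merge E p q x y"
  hence S': "x \<in> S" "y \<in> S" "x \<noteq> p" "x \<noteq> q" "y \<noteq> p" "y \<noteq> q" by auto
  show "pol x \<noteq> pol y"
   using E unfolding merge_def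
   by (elim disjE conjE)
    (use A[of x y] A[of x p] A[of x q] A[of p y] A[of q y] S S' pq in auto)
 qed
qed

text \<open>Since p and q are neighbours, every other vertex lies on the same side of both. A block
  of the glued relation that crosses another one thus yields a crossing before gluing, with p or q
  as one of the four vertices. If both crossing connections use the glued pair, they already belong
  to one class.\<close>

lemma noncrossing_merge:
 assumes per: "per E" and a: "noncrossing S pos E" and inj: "inj_on pos S"
  and pq: "p \<in> S" "q \<in> S" "pos p < pos q" and adj: "\<And>n. n \<in> S ==> \<not> (pos p < pos n \<and> pos n < pos q)"
 shows "noncrossing (S - {p, q}) pos (merge E p q)"
proof -
 have sym: "E y x" if "E x y" for x y using per that unfolding per_def by blast
 have tr: "E x z" if "E x y" "E y z" for x y z using per that unfolding per_def by blast
 have A: "E x y" if "x \<in> S" "y \<in> S" "z \<in> S" "w \<in> S" "pos x < pos y" "pos y < pos z" "pos z < pos w" "E x z" "E y w" for x y z w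
  using a that unfolding noncrossing_def by blast
 have side: "pos n < pos p \<and> pos n < pos q \<or> pos p < pos n \<and> pos q < pos n" if "n \<in> S - {p, q}" for n
 proof -
  have "pos n \<noteq> pos p" "pos n \<noteq> pos q" using that pq inj unfolding inj_on_def by blast+
  thus ?thesis using adj[of n] that pq(3) by force
 qed
 \<comment> \<open>a glued pair straddling the block of u and v would already cross it before gluing\<close>
 have cross: "E u r" if S: "u \<in> S - {p, q}" "v \<in> S - {p, q}" "r \<in> S - {p, q}" "t \<in> S - {p, q}"
  and ord: "pos u < pos r" "pos r < pos v" "pos t < pos u \<or> pos v < pos t" and E: "E u v"
  and rt: "E r s" "E s' t" "{s, s'} = {p, q}" and ns: "\<not> E u t" for u v r t s s'
 proof -
  have "s \<in> {p, q}" "s' \<in> {p, q}" using rt(3) by blast+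
  hence S': "u \<in> S" "v \<in> S" "r \<in> S" "t \<in> S" "s \<in> S" "s' \<in> S" using S pq by blast+
  have s1: "pos u < pos s \<longleftrightarrow> pos u < pos s'" "pos v < pos s \<longleftrightarrow> pos v < pos s'"
   using side[OF S(1)] side[OF S(2)] rt(3) by (auto simp: doubleton_eq_iff)
  have s2: "pos u \<noteq> pos s" "pos v \<noteq> pos s" "pos u \<noteq> pos s'" "pos v \<noteq> pos s'"
   using side[OF S(1)] side[OF S(2)] rt(3) by (auto simp: doubleton_eq_iff)
  show ?thesis
  proof (cases "pos u < pos s \<and> pos s < pos v")
   case True
   hence "pos u < pos s'" "pos s' < pos v" using s1 s2 by linarith+
   note s' = this
   have "E u t" using ord(3)
   proof
    assume "pos v < pos t"
    hence "E u s'" using A[of u s' v t] S' s' E rt(2) by blast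
    thus ?thesis using rt(2) tr by blast
   next
    assume "pos t < pos u"
    hence "E t u" using A[of t u s' v] S' s' E sym[OF rt(2)] by blast
    thus ?thesis by (rule sym)
   qed
   thus ?thesis using ns by blast
  next
   case False
   then consider "pos s < pos u" | "pos v < pos s" using s2 by linarith
   thus ?thesis
   proof cases
    case 1
    have "E s u" using A[of s u r v] S' ord(1,2) 1 sym[OF rt(1)] E by blast
    thus ?thesis using sym tr rt(1) by blast
   next
    case 2 thus ?thesis using A[of u r v s] S' ord E rt(1) by blast
   qed
  qed
 qed
 show ?thesis
  unfolding noncrossing_def
 proof (intro ballI impI, elim conjE)
  fix x y z w assume S: "x \<in> S - {p, q}" "y \<in> S - {p, q}" "z \<in> S - {p, q}" "w \<in> S - {p, q}"
   and ord: "pos x < pos y" "pos y < pos z" "pos z < pos w"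
   and E: "merge E p q x z" "merge E p q y w"
  have S': "x \<in> S" "y \<in> S" "z \<in> S" "w \<in> S" using S by auto
  obtain s s' where yw: "E y w \<or> E y s \<and> E s' w" "{s, s'} = {p, q}" using E(2) unfolding merge_def by blast
  obtain t t' where xz: "E x z \<or> E x t \<and> E t' z" "{t, t'} = {p, q}" using E(1) unfolding merge_def by blast
  show "merge E p q x y"
  proof (rule ccontr)
   assume n: "\<not> merge E p q x y"
   hence nE: "\<not> E x y" unfolding merge_def by blast
   consider (a) "E x z" "E y w" | (b) "E x z" "E y s" "E s' w" | (c) "E x t" "E t' z" "E y w"
    | (d) "E x t" "E t' z" "E y s" "E s' w" using xz yw by blast
   thus False
   proof cases
    case a thus False using A[OF S' ord] nE by blast
   next
    case b
    have "\<not> E x w" using b yw(2) n sym tr unfolding merge_def by (metis doubleton_eq_iff)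
    thus False using cross[OF S(1,3,2,4) ord(1,2) _ b(1,2,3) yw(2)] ord nE by linarith
   next
    case c
    have "\<not> E y x" using nE sym by blast
    hence "E y z"
     using cross[of y w z x t' t] S ord c sym xz(2) by (metis insert_commute)
    thus False using c n xz(2) sym tr unfolding merge_def by (metis doubleton_eq_iff)
   next
    case d
    thus False using n xz(2) yw(2) sym tr unfolding merge_def by (metis doubleton_eq_iff)
   qed
  qed
 qed
qed

section \<open>The composite as an iterated gluing of the disjoint union\<close>

type_synonym node = "bool \<times> vert"

definition base :: "diagram => diagram => node => node => bool" where
 "base a b x y \<longleftrightarrow> fst x = fst y \<and> same (if fst x then b else a) (snd x) (snd y)"

fun glue :: "diagram => diagram => nat => node => node => bool" where
 "glue a b 0 = base a b"
| "glue a b (Suc j) = merge (glue a b j) (False, Bot (Suc j)) (True, Top (Suc j))"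

definition alive :: "nat => nat => node set" where
 "alive k j = {(s, u). u \<in> verts k \<and>
   (case u of Top i => s --> j < i | Bot i => \<not> s --> j < i)}"

fun onode :: "vert => node" where
 "onode (Top i) = (False, Top i)" | "onode (Bot i) = (True, Bot i)"

lemma alive_Suc: "j < k ==> alive k (Suc j) = alive k j - {(False, Bot (Suc j)), (True, Top (Suc j))}"
 unfolding alive_def by (auto split: vert.splits)

lemma glued_alive: "j < k ==> (False, Bot (Suc j)) \<in> alive k j \<and> (True, Top (Suc j)) \<in> alive k j"
 unfolding alive_def by simp

lemma onode_alive: "u \<in> verts k ==> onode u \<in> alive k k"
 unfolding alive_def by (cases u) auto

lemma onode_inj: "onode u = onode v \<longleftrightarrow> u = v"
 by (cases u; cases v) auto

lemma alive_onode: "x \<in> alive k k ==> \<exists>u\<in>verts k. x = onode u"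
proof -
 assume x: "x \<in> alive k k"
 obtain s u where su: "x = (s, u)" by (cases x)
 have u: "u \<in> verts k" using x su unfolding alive_def by simp
 have "x = onode u" using x su by (cases u; cases s) (auto simp: alive_def)
 thus ?thesis using u by blast
qed

lemma per_glue:
 assumes "a \<in> all_diagrams k" "b \<in> all_diagrams k" shows "per (glue a b j)"
proof (induction j)
 case 0
 show ?case unfolding glue.simps per_def base_def
 proof (intro conjI allI impI)
  fix x y z :: node
  assume "fst x = fst y \<and> same (if fst x then b else a) (snd x) (snd y)"
  thus "fst y = fst x" "same (if fst y then b else a) (snd y) (snd x)"
   by (auto intro: same_sym)
 next
  fix x y z :: node
  assume 1: "fst x = fst y \<and> same (if fst x then b else a) (snd x) (snd y)"
   and 2: "fst y = fst z \<and> same (if fst y then b else a) (snd y) (snd z)"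
  thus "fst x = fst z" by simp
  have "(if fst x then b else a) \<in> all_diagrams k" using assms by simp
  thus "same (if fst x then b else a) (snd x) (snd z)"
   using same_trans 1[THEN conjunct2] 2[THEN conjunct2, folded 1[THEN conjunct1]] by blast
 qed
next
 case (Suc j) thus ?case by (simp add: per_merge)
qed

lemma glue_mono: "i \<le> j ==> glue a b i x y ==> glue a b j x y"
proof (induction j)
 case (Suc j) thus ?case by (cases "i = Suc j") (auto simp: merge_def)
qed auto

lemma glue_colour:
 assumes "glue a b j x y" and "\<And>x y. base a b x y ==> f x = f y"
  and "\<And>i. i \<in> {1..j} ==> f (False, Bot i) = f (True, Top i)"
 shows "f x = f y"
 using assms(1,3)
proof (induction j arbitrary: x y)
 case 0 thus ?case using assms(2) by simp
next
 case (Suc j)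
 have IH: "f x = f y" if "glue a b j x y" for x y using Suc that by simp
 have "f (False, Bot (Suc j)) = f (True, Top (Suc j))" using Suc.prems(2) by simp
 thus ?case using Suc.prems(1) IH unfolding glue.simps merge_def by metis
qed

lemma base_refl:
 assumes "a \<in> all_diagrams k" "b \<in> all_diagrams k" "u \<in> verts k"
 shows "base a b (s, u) (s, u)"
 using same_refl[OF assms(1,3)] same_refl[OF assms(2,3)] by (simp add: base_def)

text \<open>Compatible colourings that agree on the middle row are constant on glued classes.
  Conversely the indicator of a glued class restricts to colourings compatible with a and b and
  agreeing on the middle row.\<close>

lemma same_compose_glue:
 assumes a: "a \<in> all_diagrams k" and b: "b \<in> all_diagrams k" and uv: "u \<in> verts k" "v \<in> verts k"
 shows "same (a \<cdot> b) u v \<longleftrightarrow> glue a b k (onode u) (onode v)"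
proof
 assume g: "glue a b k (onode u) (onode v)"
 have "vl x z u = vl x z v" if xy: "(x, y) \<in> rel a" and yz: "(y, z) \<in> rel b" for x y z
 proof -
  define f where "f n = (if fst n then vl y z (snd n) else vl x y (snd n))" for n
  have "f m = f n" if "base a b m n" for m n
   using that relD[OF xy, of "snd m" "snd n"] relD[OF yz, of "snd m" "snd n"] unfolding base_def f_def by auto
  moreover have "f (False, Bot i) = f (True, Top i)" for i by (simp add: f_def)
  ultimately have "f (onode u) = f (onode v)" using glue_colour[OF g] by blast
  moreover have "f (onode w) = vl x z w" for w by (cases w) (auto simp: f_def)
  ultimately show ?thesis by simp
 qed
 thus "same (a \<cdot> b) u v"
  unfolding same_iff_rel[OF compose_in[OF a b] uv] rel_compose[OF a b] by auto
next
 assume s: "same (a \<cdot> b) u v"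
 have per: "per (glue a b k)" by (rule per_glue[OF a b])
 define f :: "node => nat" where "f n = (if glue a b k (onode u) n then 1 else 0)" for n
 have fE: "f m = f n" if "glue a b k m n" for m n
  using that per unfolding per_def f_def by metis
 have fB: "f m = f n" if "base a b m n" for m n
  using fE glue_mono[of 0 k a b m n] that by simp
 \<comment> \<open>Both copies of the middle row are kept, because they agree only on
   \<open>{1..k}\<close>; \<open>rel_cong\<close> replaces one by the other.\<close>
 define x y y' z where "x i = f (False, Top i)" and "y i = f (False, Bot i)"
  and "y' i = f (True, Top i)" and "z i = f (True, Bot i)" for i
 have e: "vl x y w = f (False, w)" "vl y' z w = f (True, w)" "vl x z w = f (onode w)" for w
  by (cases w; simp add: x_def y_def y'_def z_def)+
 have "(x, y) \<in> rel a" by (rule relI) (auto simp: e base_def intro!: fB)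
 moreover have "(y', z) \<in> rel b" by (rule relI) (auto simp: e base_def intro!: fB)
 moreover have "y i = y' i" if i: "i \<in> {1..k}" for i
 proof -
  obtain j where j: "i = Suc j" "Suc j \<le> k" using i by (cases i) auto
  have "glue a b j (False, Bot i) (False, Bot i)" "glue a b j (True, Top i) (True, Top i)"
   using glue_mono[of 0 j a b] base_refl[OF a b, of "Bot i" False] base_refl[OF a b, of "Top i" True] i by auto
  hence "glue a b (Suc j) (False, Bot i) (True, Top i)" using j by (simp add: merge_def)
  thus ?thesis unfolding y_def y'_def using fE glue_mono[OF j(2)] by blast
 qed
 ultimately have "(x, z) \<in> rel (a \<cdot> b)"
  unfolding rel_compose[OF a b] using rel_cong[OF b, of y' z y z] by auto
 hence "f (onode u) = f (onode v)" using relD[OF _ s] e by metis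
 moreover have "glue a b k (onode u) (onode u)"
  using glue_mono[of 0 k a b] base_refl[OF a b uv(1)] by (cases u) auto
 ultimately show "glue a b k (onode u) (onode v)" unfolding f_def by (simp split: if_splits)
qed

subsection \<open>The defining conditions in terms of connectedness\<close>

fun is_Top :: "vert => bool" where "is_Top (Top i) = True" | "is_Top (Bot i) = False"

lemma rookbrauer_iff:
 assumes d: "d \<in> all_diagrams k"
 shows "rookbrauer_diag d \<longleftrightarrow> atmost2 (verts k) (same d)"
proof
 assume r: "rookbrauer_diag d"
 show "atmost2 (verts k) (same d)"
  unfolding atmost2_def
 proof (intro ballI impI, elim conjE, rule ccontr)
  fix x y z assume s: "same d x y" "same d x z" "x \<noteq> y" "x \<noteq> z" "y \<noteq> z"
  obtain B where B: "B \<in> d" "x \<in> B" "y \<in> B" using s(1) unfolding same_def by blast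
  obtain C where C: "C \<in> d" "x \<in> C" "z \<in> C" using s(2) unfolding same_def by blast
  have "z \<in> B" using block_unique[OF d B(1) C(1) B(2) C(2)] C(3) by simp
  hence "card {x, y, z} \<le> card B" using B finite_block[OF d B(1)] by (intro card_mono) auto
  thus False using s r B(1) unfolding rookbrauer_diag_def by fastforce
 qed
next
 assume r: "atmost2 (verts k) (same d)"
 show "rookbrauer_diag d"
  unfolding rookbrauer_diag_def
 proof
  fix B assume B: "B \<in> d"
  obtain x where x: "x \<in> B" using block_nonempty[OF d B] by blast
  show "card B = 1 \<or> card B = 2"
  proof (cases "B = {x}")
   case False
   then obtain y where y: "y \<in> B" "y \<noteq> x" using x by blast
   have "z = y" if "z \<in> B" "z \<noteq> x" for z
    using r block_sub[OF d B] sameI[OF B x] x y that unfolding atmost2_def by metis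
   hence "B = {x, y}" using x y by blast
   thus ?thesis using y by simp
  qed simp
 qed
qed

lemma brauer_iff:
 assumes d: "d \<in> all_diagrams k"
 shows "brauer_diag d \<longleftrightarrow> atmost2 (verts k) (same d) \<and> partnered (verts k) (same d)"
proof
 assume r: "brauer_diag d"
 hence "rookbrauer_diag d" unfolding brauer_diag_def rookbrauer_diag_def by blast
 moreover have "partnered (verts k) (same d)"
  unfolding partnered_def
 proof
  fix x assume "x \<in> verts k"
  then obtain B where B: "B \<in> d" "x \<in> B" using block_ex[OF d] by blast
  hence "card B = 2" using r unfolding brauer_diag_def by blast
  hence "B \<noteq> {x}" by auto
  then obtain y where "y \<in> B" "y \<noteq> x" using B by blast
  thus "\<exists>y\<in>verts k. y \<noteq> x \<and> same d x y" using sameI[OF B] block_sub[OF d B(1)] by blast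
 qed
 ultimately show "atmost2 (verts k) (same d) \<and> partnered (verts k) (same d)"
  using rookbrauer_iff[OF d] by blast
next
 assume r: "atmost2 (verts k) (same d) \<and> partnered (verts k) (same d)"
 show "brauer_diag d"
  unfolding brauer_diag_def
 proof
  fix B assume B: "B \<in> d"
  hence "card B = 1 \<or> card B = 2" using r rookbrauer_iff[OF d] unfolding rookbrauer_diag_def by blast
  moreover have "card B \<noteq> 1"
  proof
   assume "card B = 1"
   then obtain x where x: "B = {x}" by (auto simp: card_1_singleton_iff)
   hence "x \<in> verts k" using block_sub[OF d B] by simp
   then obtain y where y: "y \<noteq> x" "same d x y" using r unfolding partnered_def by blast
   hence "y \<in> B" using block_eq_same[OF d B, of x] x by blast
   thus False using x y by simp
  qed
  ultimately show "card B = 2" by blast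
 qed
qed

lemma rook_iff:
 assumes d: "d \<in> all_diagrams k"
 shows "rook_diag d \<longleftrightarrow> polar (verts k) is_Top (same d)"
proof -
 have fin: "finite (tp B)" "finite (bt B)" if "B \<in> d" for B
 proof -
  have "tp B \<subseteq> {1..k}" "bt B \<subseteq> {1..k}" using block_sub[OF d that] by fastforce+
  thus "finite (tp B)" "finite (bt B)" using finite_subset by blast+
 qed
 have "rook_diag d \<longleftrightarrow> (\<forall>B\<in>d. (\<forall>i\<in>tp B. \<forall>j\<in>tp B. i = j) \<and> (\<forall>i\<in>bt B. \<forall>j\<in>bt B. i = j))"
  unfolding rook_diag_def using fin card_le_Suc0_iff_eq by (metis One_nat_def)
 also have "\<dots> \<longleftrightarrow> polar (verts k) is_Top (same d)"
 proof
  assume r: "\<forall>B\<in>d. (\<forall>i\<in>tp B. \<forall>j\<in>tp B. i = j) \<and> (\<forall>i\<in>bt B. \<forall>j\<in>bt B. i = j)"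
  show "polar (verts k) is_Top (same d)"
   unfolding polar_def
  proof (intro ballI impI, elim conjE)
   fix x y assume "same d x y" "x \<noteq> y"
   then obtain B where B: "B \<in> d" "x \<in> B" "y \<in> B" unfolding same_def by blast
   thus "is_Top x \<noteq> is_Top y" using r[rule_format, OF B(1)] \<open>x \<noteq> y\<close>
    by (cases x; cases y) auto
  qed
 next
  assume p: "polar (verts k) is_Top (same d)"
  have P: "is_Top u \<noteq> is_Top v" if "B \<in> d" "u \<in> B" "v \<in> B" "u \<noteq> v" for B u v
   using p sameI[OF that(1-3)] block_sub[OF d that(1)] that unfolding polar_def by blast
  show "\<forall>B\<in>d. (\<forall>i\<in>tp B. \<forall>j\<in>tp B. i = j) \<and> (\<forall>i\<in>bt B. \<forall>j\<in>bt B. i = j)"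
  proof (intro ballI conjI)
   fix B i j assume "B \<in> d" "i \<in> tp B" "j \<in> tp B"
   thus "i = j" using P[of B "Top i" "Top j"] by auto
  next
   fix B i j assume "B \<in> d" "i \<in> bt B" "j \<in> bt B"
   thus "i = j" using P[of B "Bot i" "Bot j"] by auto
  qed
 qed
 finally show ?thesis .
qed

lemma planar_iff:
 assumes d: "d \<in> all_diagrams k"
 shows "planar k d \<longleftrightarrow> noncrossing (verts k) (bpos k) (same d)"
proof
 assume p: "planar k d"
 show "noncrossing (verts k) (bpos k) (same d)"
  unfolding noncrossing_def
 proof (intro ballI impI, elim conjE, rule ccontr)
  fix x y z w assume o: "bpos k x < bpos k y" "bpos k y < bpos k z" "bpos k z < bpos k w"
   and s: "same d x z" "same d y w" "\<not> same d x y"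
  obtain B where B: "B \<in> d" "x \<in> B" "z \<in> B" using s(1) unfolding same_def by blast
  obtain C where C: "C \<in> d" "y \<in> C" "w \<in> C" using s(2) unfolding same_def by blast
  have "B \<noteq> C" using s(3) sameI[OF B(1,2)] C(2) by blast
  thus False using p o B C unfolding planar_def by metis
 qed
next
 assume nc: "noncrossing (verts k) (bpos k) (same d)"
 show "planar k d"
  unfolding planar_def
 proof (intro notI, elim bexE conjE)
  fix B C a c b e
  assume B: "B \<in> d" "a \<in> B" "c \<in> B" and C: "C \<in> d" "b \<in> C" "e \<in> C" "B \<noteq> C"
   and o: "bpos k a < bpos k b" "bpos k b < bpos k c" "bpos k c < bpos k e"
  have "same d a b"
   using nc o sameI[OF B] sameI[OF C(1-3)] block_sub[OF d B(1)] block_sub[OF d C(1)] B C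
   unfolding noncrossing_def by blast
  hence "b \<in> B" using block_eq_same[OF d B(1,2)] by blast
  thus False using block_unique[OF d B(1) C(1)] C by blast
 qed
qed

text \<open>The boundary order of a followed by that of b. The bottom row of a is passed from k down
  to 1 and then the top row of b from 1 up to k, so once the pairs 1, ..., j are glued the next pair
  is innermost, hence adjacent.\<close>

definition npos :: "nat => node => nat" where
 "npos k n = (if fst n then 2 * k else 0) + bpos k (snd n)"

lemma bpos_verts: "u \<in> verts k ==> 1 \<le> bpos k u \<and> bpos k u \<le> 2 * k"
 by (cases u) auto

lemma bpos_inj: "u \<in> verts k ==> v \<in> verts k ==> bpos k u = bpos k v ==> u = v"
 by (cases u; cases v) auto

lemma npos_inj: "inj_on (npos k) (alive k j)"
proof (rule inj_onI)
 fix x y assume "x \<in> alive k j" "y \<in> alive k j" and e: "npos k x = npos k y"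
 hence v: "snd x \<in> verts k" "snd y \<in> verts k" unfolding alive_def by auto
 have "fst x = fst y" using e bpos_verts[OF v(1)] bpos_verts[OF v(2)] unfolding npos_def by (auto split: if_splits)
 moreover from this have "snd x = snd y" using e bpos_inj[OF v] unfolding npos_def by auto
 ultimately show "x = y" by (simp add: prod_eq_iff)
qed

lemma npos_onode:
 "u \<in> verts k ==> v \<in> verts k ==> bpos k u < bpos k v ==> npos k (onode u) < npos k (onode v)"
 by (cases u; cases v) (auto simp: npos_def)

context
 fixes k a b assumes a: "a \<in> all_diagrams k" and b: "b \<in> all_diagrams k"
begin

lemma alive_verts: "x \<in> alive k 0 ==> snd x \<in> verts k"
 unfolding alive_def by auto

lemma atmost2_glue:
 assumes "atmost2 (verts k) (same a)" "atmost2 (verts k) (same b)"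
 shows "j \<le> k ==> atmost2 (alive k j) (glue a b j)"
proof (induction j)
 case 0
 show ?case
  unfolding atmost2_def glue.simps
 proof (intro ballI impI, elim conjE)
  fix x y z assume v: "x \<in> alive k 0" "y \<in> alive k 0" "z \<in> alive k 0"
   and s: "base a b x y" "base a b x z" "x \<noteq> y" "x \<noteq> z"
  have "snd x \<noteq> snd y" "snd x \<noteq> snd z" using s unfolding base_def by (auto simp: prod_eq_iff)
  hence "snd y = snd z"
   using assms alive_verts[OF v(1)] alive_verts[OF v(2)] alive_verts[OF v(3)] s(1,2)
   unfolding atmost2_def base_def by (metis (full_types))
  thus "y = z" using s unfolding base_def by (simp add: prod_eq_iff)
 qed
next
 case (Suc j)
 thus ?case using atmost2_merge[OF per_glue[OF a b]] glued_alive[of j k]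
  by (simp add: alive_Suc)
qed

lemma partnered_glue:
 assumes A: "atmost2 (verts k) (same a)" "atmost2 (verts k) (same b)"
  and "partnered (verts k) (same a)" "partnered (verts k) (same b)"
 shows "j \<le> k ==> partnered (alive k j) (glue a b j)"
proof (induction j)
 case 0
 show ?case
  unfolding partnered_def glue.simps
 proof
  fix x assume x: "x \<in> alive k 0"
  have "partnered (verts k) (same (if fst x then b else a))" using assms by simp
  then obtain v where v: "v \<in> verts k" "v \<noteq> snd x" "same (if fst x then b else a) (snd x) v"
   using alive_verts[OF x] unfolding partnered_def by blast
  have "(fst x, v) \<in> alive k 0" using v(1) unfolding alive_def by (auto split: vert.splits)
  moreover have "(fst x, v) \<noteq> x" using v(2) by (metis snd_conv)
  moreover have "base a b x (fst x, v)" using v(3) by (simp add: base_def)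
  ultimately show "\<exists>y\<in>alive k 0. y \<noteq> x \<and> base a b x y" by blast
 qed
next
 case (Suc j)
 thus ?case
  using partnered_merge[OF per_glue[OF a b] atmost2_glue[OF A]] glued_alive[of j k]
  by (simp add: alive_Suc)
qed

lemma polar_glue:
 assumes "polar (verts k) is_Top (same a)" "polar (verts k) is_Top (same b)"
 shows "j \<le> k ==> polar (alive k j) (\<lambda>n. is_Top (snd n)) (glue a b j)"
proof (induction j)
 case 0
 show ?case
  unfolding polar_def glue.simps
 proof (intro ballI impI, elim conjE)
  fix x y assume v: "x \<in> alive k 0" "y \<in> alive k 0" and s: "base a b x y" "x \<noteq> y"
  have ne: "snd x \<noteq> snd y" using s unfolding base_def by (auto simp: prod_eq_iff)
  have "polar (verts k) is_Top (same (if fst x then b else a))" using assms by simp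
  thus "is_Top (snd x) \<noteq> is_Top (snd y)"
   using alive_verts[OF v(1)] alive_verts[OF v(2)] s(1) ne unfolding polar_def base_def by blast
 qed
next
 case (Suc j)
 thus ?case using polar_merge[OF per_glue[OF a b], of "alive k j" "\<lambda>n. is_Top (snd n)"] glued_alive[of j k]
  by (simp add: alive_Suc)
qed

lemma noncrossing_glue:
 assumes "noncrossing (verts k) (bpos k) (same a)" "noncrossing (verts k) (bpos k) (same b)"
 shows "j \<le> k ==> noncrossing (alive k j) (npos k) (glue a b j)"
proof (induction j)
 case 0
 show ?case
  unfolding noncrossing_def glue.simps
 proof (intro ballI impI, elim conjE)
  fix x y z w assume v: "x \<in> alive k 0" "y \<in> alive k 0" "z \<in> alive k 0" "w \<in> alive k 0"
   and o: "npos k x < npos k y" "npos k y < npos k z" "npos k z < npos k w"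
   and s: "base a b x z" "base a b y w"
  note bd = bpos_verts[OF alive_verts[OF v(1)]] bpos_verts[OF alive_verts[OF v(2)]]
   bpos_verts[OF alive_verts[OF v(3)]] bpos_verts[OF alive_verts[OF v(4)]]
  have f: "fst x = fst z" "fst y = fst w" using s unfolding base_def by auto
  hence f2: "fst x = fst y" using o bd unfolding npos_def by (auto split: if_splits)
  hence o': "bpos k (snd x) < bpos k (snd y)" "bpos k (snd y) < bpos k (snd z)" "bpos k (snd z) < bpos k (snd w)"
   using o f unfolding npos_def by auto
  have nc: "noncrossing (verts k) (bpos k) (same (if fst x then b else a))" using assms by simp
  hence "same (if fst x then b else a) (snd x) (snd y)"
  proof -
   have "same (if fst x then b else a) (snd x) (snd z)" "same (if fst x then b else a) (snd y) (snd w)"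
    using s f2 unfolding base_def by auto
   thus ?thesis
    using nc o' v[THEN alive_verts] unfolding noncrossing_def by blast
  qed
  thus "base a b x y" using f2 unfolding base_def by simp
 qed
next
 case (Suc j)
 have adj: "\<not> (npos k (False, Bot (Suc j)) < npos k n \<and> npos k n < npos k (True, Top (Suc j)))" if "n \<in> alive k j" for n
 proof -
  obtain s u where n: "n = (s, u)" by (cases n)
  show ?thesis using that Suc.prems unfolding n by (cases u; cases s) (auto simp: alive_def npos_def)
 qed
 have "npos k (False, Bot (Suc j)) < npos k (True, Top (Suc j))" using Suc.prems by (simp add: npos_def)
 thus ?case
  using Suc noncrossing_merge[OF per_glue[OF a b] _ npos_inj _ _ _ adj] glued_alive[of j k]
  by (simp add: alive_Suc)
qed

lemma glue_same: "u \<in> verts k ==> v \<in> verts k ==> glue a b k (onode u) (onode v) \<longleftrightarrow> same (a \<cdot> b) u v"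
 using same_compose_glue[OF a b] by blast

lemma rookbrauer_compose:
 assumes "rookbrauer_diag a" "rookbrauer_diag b" shows "rookbrauer_diag (a \<cdot> b)"
 unfolding rookbrauer_iff[OF compose_in[OF a b]] atmost2_def
proof (intro ballI impI, elim conjE)
 fix x y z assume v: "x \<in> verts k" "y \<in> verts k" "z \<in> verts k"
  and s: "same (a \<cdot> b) x y" "same (a \<cdot> b) x z" "x \<noteq> y" "x \<noteq> z"
 have "atmost2 (alive k k) (glue a b k)"
  using atmost2_glue[of k] assms unfolding rookbrauer_iff[OF a] rookbrauer_iff[OF b] by blast
 hence "onode y = onode z"
  using v[THEN onode_alive] s(1)[folded glue_same[OF v(1,2)]] s(2)[folded glue_same[OF v(1,3)]] s(3,4)
  unfolding atmost2_def onode_inj[symmetric, of x] by blast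
 thus "y = z" by (simp add: onode_inj)
qed

lemma brauer_compose:
 assumes "brauer_diag a" "brauer_diag b" shows "brauer_diag (a \<cdot> b)"
proof -
 have A: "atmost2 (verts k) (same a)" "atmost2 (verts k) (same b)"
  and B: "partnered (verts k) (same a)" "partnered (verts k) (same b)"
  using assms unfolding brauer_iff[OF a] brauer_iff[OF b] by auto
 have "atmost2 (verts k) (same (a \<cdot> b))"
  using rookbrauer_compose A
  unfolding rookbrauer_iff[OF a] rookbrauer_iff[OF b] rookbrauer_iff[OF compose_in[OF a b]] by blast
 moreover have "partnered (verts k) (same (a \<cdot> b))"
  unfolding partnered_def
 proof
  fix u assume u: "u \<in> verts k"
  obtain y where y: "y \<in> alive k k" "y \<noteq> onode u" "glue a b k (onode u) y"
   using partnered_glue[OF A B, of k] onode_alive[OF u] unfolding partnered_def by blast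
  obtain v where v: "v \<in> verts k" "y = onode v" using alive_onode[OF y(1)] by blast
  hence "same (a \<cdot> b) u v" using y(3) glue_same[OF u v(1)] by simp
  moreover have "v \<noteq> u" using v(2) y(2) by metis
  ultimately show "\<exists>v\<in>verts k. v \<noteq> u \<and> same (a \<cdot> b) u v" using v(1) by metis
 qed
 ultimately show ?thesis unfolding brauer_iff[OF compose_in[OF a b]] by blast
qed

lemma rook_compose:
 assumes "rook_diag a" "rook_diag b" shows "rook_diag (a \<cdot> b)"
proof -
 have p: "polar (alive k k) (\<lambda>n. is_Top (snd n)) (glue a b k)"
  using polar_glue[of k] assms unfolding rook_iff[OF a] rook_iff[OF b] by blast
 have t: "is_Top (snd (onode u)) = is_Top u" for u by (cases u) auto
 show ?thesis
  unfolding rook_iff[OF compose_in[OF a b]] polar_def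
  using p onode_alive glue_same onode_inj t unfolding polar_def by metis
qed

lemma planar_compose:
 assumes "planar k a" "planar k b" shows "planar k (a \<cdot> b)"
proof -
 have p: "noncrossing (alive k k) (npos k) (glue a b k)"
  using noncrossing_glue[of k] assms unfolding planar_iff[OF a] planar_iff[OF b] by blast
 show ?thesis
  unfolding planar_iff[OF compose_in[OF a b]] noncrossing_def
 proof (intro ballI impI, elim conjE)
  fix x y z w assume v: "x \<in> verts k" "y \<in> verts k" "z \<in> verts k" "w \<in> verts k"
   and o: "bpos k x < bpos k y" "bpos k y < bpos k z" "bpos k z < bpos k w"
   and s: "same (a \<cdot> b) x z" "same (a \<cdot> b) y w"
  have "glue a b k (onode x) (onode y)"
   using p onode_alive v npos_onode[OF v(1,2) o(1)] npos_onode[OF v(2,3) o(2)] npos_onode[OF v(3,4) o(3)]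
    s[folded glue_same[OF v(1,3)] glue_same[OF v(2,4)]]
   unfolding noncrossing_def by meson
  thus "same (a \<cdot> b) x y" using glue_same v by blast
 qed
qed

end

section \<open>The seven bases: reflection, identity and symmetric elements\<close>

lemma bpos_flip: "u \<in> verts k ==> bpos k (flipv u) = 2 * k + 1 - bpos k u"
 by (cases u) auto

lemma rookbrauer_transp:
 assumes d: "d \<in> all_diagrams k" and r: "rookbrauer_diag d" shows "rookbrauer_diag (transp d)"
 using r unfolding rookbrauer_diag_def transp_def
 by (auto simp: card_image inj_on_def) (metis card_image flipv_flipv inj_onI)+

lemma brauer_transp: "brauer_diag d ==> brauer_diag (transp d)"
 unfolding brauer_diag_def transp_def by (auto simp: card_image inj_on_def) (metis card_image flipv_flipv inj_onI)

lemma rook_transp: "rook_diag d ==> rook_diag (transp d)"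
 unfolding rook_diag_def transp_def by auto

lemma planar_transp:
 assumes d: "d \<in> all_diagrams k" and p: "planar k d" shows "planar k (transp d)"
 unfolding planar_iff[OF transp_in[OF d]] noncrossing_def
proof (intro ballI impI, elim conjE)
 fix x y z w assume v: "x \<in> verts k" "y \<in> verts k" "z \<in> verts k" "w \<in> verts k"
  and o: "bpos k x < bpos k y" "bpos k y < bpos k z" "bpos k z < bpos k w"
  and s: "same (transp d) x z" "same (transp d) y w"
 have r: "bpos k (flipv b) < bpos k (flipv a)" if "a \<in> verts k" "b \<in> verts k" "bpos k a < bpos k b" for a b
  using that bpos_verts[OF that(1)] bpos_verts[OF that(2)] by (simp add: bpos_flip)
 have "same d (flipv w) (flipv z)"
  using p r[OF v(1,2) o(1)] r[OF v(2,3) o(2)] r[OF v(3,4) o(3)] v s same_sym[of d]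
  unfolding planar_iff[OF d] noncrossing_def same_transp by (metis flipv_verts)
 thus "same (transp d) x y"
  using s same_sym same_trans[OF d] unfolding same_transp by metis
qed

lemma same_id: "same (id_diagram k) u v \<longleftrightarrow> (\<exists>i\<in>{1..k}. u \<in> {Top i, Bot i} \<and> v \<in> {Top i, Bot i})"
 unfolding same_def id_diagram_def by blast

lemma planar_id: "planar k (id_diagram k)"
 unfolding planar_iff[OF id_in] noncrossing_def
proof (intro ballI impI, elim conjE)
 fix x y z w assume v: "x \<in> verts k" "y \<in> verts k" "z \<in> verts k" "w \<in> verts k"
  and o: "bpos k x < bpos k y" "bpos k y < bpos k z" "bpos k z < bpos k w"
  and s: "same (id_diagram k) x z" "same (id_diagram k) y w"
 show "same (id_diagram k) x y"
  using s o v by (auto simp: same_id)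
qed

lemma basis_sub: "d \<in> diag_basis A k ==> d \<in> all_diagrams k"
 by (cases A) auto

lemma finite_basis [simp]: "finite (diag_basis A k)"
 by (rule finite_subset[OF _ finite_all_diagrams[of k]]) (auto dest: basis_sub)

lemma basis_compose: "a \<in> diag_basis A k ==> b \<in> diag_basis A k ==> a \<cdot> b \<in> diag_basis A k"
 by (cases A) (auto intro: compose_in rook_compose brauer_compose rookbrauer_compose planar_compose)

lemma basis_transp: "a \<in> diag_basis A k ==> transp a \<in> diag_basis A k"
 by (cases A) (auto intro: transp_in rook_transp brauer_transp rookbrauer_transp planar_transp)

lemma basis_id: "id_diagram k \<in> diag_basis A k"
proof -
 have t: "tp {Top i, Bot i} = {i}" "bt {Top i, Bot i} = {i}" for i by (auto simp: tp_def bt_def)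
 have "rook_diag (id_diagram k)" unfolding rook_diag_def id_diagram_def by (auto simp: t)
 moreover have "brauer_diag (id_diagram k)" "rookbrauer_diag (id_diagram k)"
  unfolding brauer_diag_def rookbrauer_diag_def id_diagram_def by auto
 ultimately show ?thesis using planar_id id_in by (cases A) auto
qed

lemma pn_id: "pn (id_diagram k) = k"
proof -
 have "props (id_diagram k) = (\<lambda>i. {Top i, Bot i}) ` {1..k}"
  unfolding props_def propagating_def id_diagram_def by (auto simp: tp_def bt_def)
 moreover have "inj_on (\<lambda>i. {Top i, Bot i}) {1..k}" by (rule inj_onI) (simp add: doubleton_eq_iff)
 ultimately show ?thesis unfolding pn_def by (simp add: card_image)
qed

lemma pn_le_k: "d \<in> all_diagrams k ==> pn d \<le> k"
 using pn_compose_le1[OF id_in, of d k] id_compose[of d k] pn_id[of k] by simp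

text \<open>A projection is the symmetric diagram built from its own upper half, so symmetric
  diagrams can be handled through the two equations of \<open>is_proj\<close>.\<close>

lemma symW_iff: "w \<in> symW A k m \<longleftrightarrow> w \<in> diag_basis A k \<and> is_proj w \<and> pn w = m"
proof
 assume "w \<in> symW A k m"
 then obtain P D where w: "w \<in> diag_basis A k" "w = sym_diagram_of P D"
  and P: "partition_on {1..k} P" "D \<subseteq> P" "card D = m" unfolding symW_def by blast
 have "pn w = m" using card_dtop[OF basis_sub[OF w(1)]] dtop_sym[OF P(1,2)] w(2) P(3) by simp
 thus "w \<in> diag_basis A k \<and> is_proj w \<and> pn w = m" using w proj_sym[OF P(1,2)] by simp
next
 assume w: "w \<in> diag_basis A k \<and> is_proj w \<and> pn w = m"
 hence wa: "w \<in> all_diagrams k" using basis_sub by blast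
 have "w = sym_diagram_of (tops w) (dtop w)" using proj_eq_sym[OF wa] w by blast
 moreover have "card (dtop w) = m" using card_dtop[OF wa] w by simp
 ultimately show "w \<in> symW A k m"
  unfolding symW_def using w tops_partition[OF wa] dtop_sub_tops[of w] by blast
qed

definition planar_kind :: "alg_kind => bool" where
 "planar_kind A \<longleftrightarrow> A \<in> {TemperleyLieb, Motzkin, PlanarRook}"

lemma planar_kindD: "planar_kind A ==> d \<in> diag_basis A k ==> planar k d"
 unfolding planar_kind_def by auto

text \<open>The permutations realised by basis diagrams of propagating number m:
  \<open>perm_diag_perms\<close> shows that no others occur and \<open>ex_diagram_basis\<close> that
  all of these do, with any prescribed halves in the algebra.\<close>

definition diag_perms :: "alg_kind => nat => (nat => nat) set" where
 "diag_perms A m = (if planar_kind A then {id} else {s. s permutes {1..m}})"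

lemma diag_perms_permutes: "s \<in> diag_perms A m ==> s permutes {1..m}"
 by (auto simp: diag_perms_def permutes_id split: if_splits)

lemma rank_bot_eq:
 assumes d: "d \<in> all_diagrams k"
 shows "rank_bot d X = Suc (card {Y \<in> props d. Max (bt Y) < Max (bt X)})"
proof -
 have "{C \<in> dbot d. Max C < Max (bt X)} = bt ` {Y \<in> props d. Max (bt Y) < Max (bt X)}"
  by (auto simp: dbot_def dtop_transp)
 moreover have "inj_on bt {Y \<in> props d. Max (bt Y) < Max (bt X)}"
  by (rule inj_on_subset[OF inj_bt_props[OF d]]) auto
 ultimately show ?thesis by (simp add: rank_bot_def rk_def card_image)
qed

lemma Max_tp_bt:
 assumes d: "d \<in> all_diagrams k" and B: "B \<in> props d"
 shows "Top (Max (tp B)) \<in> B" "Bot (Max (bt B)) \<in> B" "finite (tp B)" "finite (bt B)"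
proof -
 have s: "tp B \<subseteq> {1..k}" "bt B \<subseteq> {1..k}" using block_sub[OF d propsD(1)[OF B]] by fastforce+
 thus f: "finite (tp B)" "finite (bt B)" using finite_subset by blast+
 have "Max (tp B) \<in> tp B" "Max (bt B) \<in> bt B"
  using f propsD(2,3)[OF B] by (auto intro!: Max_in simp del: tp_iff bt_iff)
 thus "Top (Max (tp B)) \<in> B" "Bot (Max (bt B)) \<in> B" by simp_all
qed

text \<open>Since the boundary order runs through the bottom row backwards, two propagating blocks
  in opposite order at top and bottom would interleave.\<close>

lemma planar_Max_less_iff:
 assumes d: "d \<in> all_diagrams k" and p: "planar k d" and B: "B \<in> props d" and C: "C \<in> props d"
 shows "Max (tp B) < Max (tp C) \<longleftrightarrow> Max (bt B) < Max (bt C)"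
proof -
 have imp: False if B: "B \<in> props d" and C: "C \<in> props d"
  and l: "Max (tp B) < Max (tp C)" "Max (bt C) < Max (bt B)" for B C
 proof -
  have v: "Top (Max (tp B)) \<in> verts k" "Top (Max (tp C)) \<in> verts k"
   "Bot (Max (bt B)) \<in> verts k" "Bot (Max (bt C)) \<in> verts k"
   using block_sub[OF d propsD(1)] Max_tp_bt[OF d] B C by blast+
  have "B \<noteq> C" using l by blast
  moreover have "bpos k (Top (Max (tp B))) < bpos k (Top (Max (tp C)))"
   "bpos k (Top (Max (tp C))) < bpos k (Bot (Max (bt B)))"
   "bpos k (Bot (Max (bt B))) < bpos k (Bot (Max (bt C)))" using v l by auto
  ultimately show False
   using p propsD(1)[OF B] propsD(1)[OF C] Max_tp_bt(1,2)[OF d B] Max_tp_bt(1,2)[OF d C]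
   unfolding planar_def by metis
 qed
 have eqt: "B = C" if "Max (tp B) = Max (tp C)"
  using block_unique[OF d propsD(1)[OF B] propsD(1)[OF C]] Max_tp_bt(1)[OF d B] Max_tp_bt(1)[OF d C] that by metis
 have eqb: "B = C" if "Max (bt B) = Max (bt C)"
  using block_unique[OF d propsD(1)[OF B] propsD(1)[OF C]] Max_tp_bt(2)[OF d B] Max_tp_bt(2)[OF d C] that by metis
 show ?thesis
 proof (cases "B = C")
  case False
  hence "Max (tp B) \<noteq> Max (tp C)" "Max (bt B) \<noteq> Max (bt C)" using eqt eqb by blast+
  thus ?thesis using imp[OF B C] imp[OF C B] unfolding nat_neq_iff by blast
 qed simp
qed

lemma perm_planar:
 assumes d: "d \<in> all_diagrams k" and p: "planar k d"
 shows "perm d = id"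
proof (rule perm_eqI[OF d])
 fix B assume B: "B \<in> props d"
 have "{Y \<in> props d. Max (bt Y) < Max (bt B)} = {Y \<in> props d. Max (tp Y) < Max (tp B)}"
  using planar_Max_less_iff[OF d p _ B] by blast
 thus "id (rank_bot d B) = rank_top d B"
  unfolding rank_bot_eq[OF d] prop_rank_eq[OF d, symmetric] prop_rank_def by simp
qed (simp add: permutes_id)

lemma perm_diag_perms: "d \<in> diag_basis A k ==> perm d \<in> diag_perms A (pn d)"
 unfolding diag_perms_def
 using perm_planar[OF basis_sub planar_kindD] perm_permutes[OF basis_sub] by auto

lemma same_top_half:
 assumes d: "d \<in> all_diagrams k"
 shows "same (d \<cdot> transp d) (Top i) (Top j) \<longleftrightarrow> same d (Top i) (Top j)"
  and "same d (Top i) (Bot l) ==> same (d \<cdot> transp d) (Top i) (Bot i)"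
proof -
 show "same (d \<cdot> transp d) (Top i) (Top j) \<longleftrightarrow> same d (Top i) (Top j)"
  unfolding same_Top_iff dtop_compose_transp[OF d] ..
 show "same (d \<cdot> transp d) (Top i) (Bot i)" if s: "same d (Top i) (Bot l)"
  by (rule same_composeI[OF d transp_in[OF d] s]) (simp add: same_transp same_sym[OF s])
qed

lemma rank_top_less:
 assumes d: "d \<in> all_diagrams k" and B: "B \<in> props d" and l: "Max (tp B) < Max (tp C)"
 shows "rank_top d B < rank_top d C"
proof -
 have "{Y \<in> props d. Max (tp Y) < Max (tp B)} \<subset> {Y \<in> props d. Max (tp Y) < Max (tp C)}"
  using B l by auto
 thus ?thesis unfolding prop_rank_eq[OF d, symmetric] prop_rank_def
  using dtop_props[OF d] by (simp add: psubset_card_mono)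
qed

text \<open>In a planar top half the propagating blocks are not nested, so any pair of elements detects
 the order of two propagating blocks.\<close>
lemma planar_top_order:
 assumes d: "d \<in> all_diagrams k" and p: "planar k (d \<cdot> transp d)"
  and B: "B \<in> props d" and C: "C \<in> props d" and ne: "B \<noteq> C"
  and ij: "Top i \<in> B" "Top j \<in> C" "i < j"
 shows "rank_top d B < rank_top d C"
proof (rule rank_top_less[OF d B], rule ccontr)
 let ?p = "d \<cdot> transp d"
 note pin = compose_in[OF d transp_in[OF d]]
 assume "\<not> Max (tp B) < Max (tp C)"
 moreover have "j \<le> Max (tp C)" using ij(2) Max_tp_bt[OF d C] by (intro Max_ge) auto
 ultimately have "j \<le> Max (tp B)" by simp
 moreover have M: "Top (Max (tp B)) \<in> B" by (rule Max_tp_bt(1)[OF d B])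
 moreover have "j \<noteq> Max (tp B)"
  using block_unique[OF d propsD(1)[OF B] propsD(1)[OF C]] ij(2) M ne by blast
 ultimately have l: "j < Max (tp B)" by simp
 have v: "Top i \<in> verts k" "Top j \<in> verts k" "Top (Max (tp B)) \<in> verts k"
  using block_sub[OF d] propsD(1) B C ij M by blast+
 obtain l' where "Bot l' \<in> C" using propsD(3)[OF C] by (auto simp: bt_def)
 hence sj: "same ?p (Top j) (Bot j)"
  using same_top_half(2)[OF d sameI[OF propsD(1)[OF C] ij(2)]] by blast
 have si: "same ?p (Top i) (Top (Max (tp B)))"
  using same_top_half(1)[OF d] sameI[OF propsD(1)[OF B] ij(1) M] by blast
 have "same ?p (Top i) (Top j)"
  using p v si sj l ij(3) unfolding planar_iff[OF pin] noncrossing_def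
  by (elim ballE[of _ _ "Top i"] ballE[of _ _ "Top j"] ballE[of _ _ "Top (Max (tp B))"] ballE[of _ _ "Bot j"]) auto
 hence "same d (Top i) (Top j)" using same_top_half(1)[OF d] by blast
 thus False
  using ne block_eq_same[OF d propsD(1)[OF B] ij(1)] block_unique[OF d propsD(1)[OF B] propsD(1)[OF C] _ ij(2)]
  by blast
qed

text \<open>If at least three of the four vertices of a crossing lie in one row, it shows up in the
  corresponding half, where a vertex of the other row is replaced by a mirror image in
  \<open>d \<cdot> transp d\<close> or \<open>transp d \<cdot> d\<close>. A crossing with two
  vertices in each row reverses the order of two propagating blocks, which a trivial permutation
  excludes.\<close>

lemma planar_of_halves:
 assumes d: "d \<in> all_diagrams k" and p: "planar k (d \<cdot> transp d)" and q: "planar k (transp d \<cdot> d)"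
  and id: "perm d = id"
 shows "planar k d"
 unfolding planar_iff[OF d] noncrossing_def
proof (intro ballI impI, elim conjE)
 fix x y z w assume v: "x \<in> verts k" "y \<in> verts k" "z \<in> verts k" "w \<in> verts k"
  and o: "bpos k x < bpos k y" "bpos k y < bpos k z" "bpos k z < bpos k w"
  and s: "same d x z" "same d y w"
 let ?p = "d \<cdot> transp d" and ?q = "transp d \<cdot> d"
 note td = transp_in[OF d]
 note pin = compose_in[OF d td] and qin = compose_in[OF td d]
 have P: "same ?p a b" if "a \<in> verts k" "b \<in> verts k" "c \<in> verts k" "e \<in> verts k"
  "bpos k a < bpos k b" "bpos k b < bpos k c" "bpos k c < bpos k e" "same ?p a c" "same ?p b e" for a b c e
  using p that unfolding planar_iff[OF pin] noncrossing_def by blast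
 have Q: "same ?q a b" if "a \<in> verts k" "b \<in> verts k" "c \<in> verts k" "e \<in> verts k"
  "bpos k a < bpos k b" "bpos k b < bpos k c" "bpos k c < bpos k e" "same ?q a c" "same ?q b e" for a b c e
  using q that unfolding planar_iff[OF qin] noncrossing_def by blast
 have qt: "same ?q (Top i) (Top j) \<longleftrightarrow> same d (Bot i) (Bot j)" for i j
  using same_top_half(1)[OF td, of i j] by (simp add: same_transp)
 have qb: "same ?q (Top i) (Bot i)" if "same d (Bot i) (Top l)" for i l
  using same_top_half(2)[OF td, of i l] that by (simp add: same_transp)
 have botlt: "\<not> bpos k (Bot i) < bpos k (Top j)" if "Bot i \<in> verts k" "Top j \<in> verts k" for i j
  using that by auto
 show "same d x y"
 proof (rule ccontr)
  assume n: "\<not> same d x y"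
  show False
  proof (cases x)
   case x: (Bot a)
   obtain b where y: "y = Bot b" using botlt[of a] v(1,2) o(1) x by (cases y) auto
   obtain c where z: "z = Bot c" using botlt[of b] v(2,3) o(2) y by (cases z) auto
   obtain e where w: "w = Bot e" using botlt[of c] v(3,4) o(3) z by (cases w) auto
   note yzw = y z w
   have "same ?q (Top e) (Top b)" "same ?q (Top c) (Top a)"
    using s[THEN same_sym] x yzw by (simp_all add: qt)
   \<comment> \<open>In \<open>transp d \<cdot> d\<close> the bottom row of d appears as the top
     row, so the four vertices are read backwards.\<close>
   hence "same ?q (Top e) (Top c)"
    by (intro Q[of "Top e" "Top c" "Top b" "Top a"]) (use v o x yzw in auto)
   hence "same d w z" using yzw qt by simp
   thus False using n s same_sym same_trans[OF d] by metis
  next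
   case x: (Top a)
   show False
   proof (cases y)
    case y: (Bot b)
    obtain c e where zw: "z = Bot c" "w = Bot e" using botlt v o y by (cases z; cases w) auto
    have "same ?q (Top e) (Top b)" "same ?q (Top c) (Bot c)"
     using same_sym[OF s(2)] qb[of c a] same_sym[OF s(1)] x y zw by (simp_all add: qt)
    hence "same ?q (Top e) (Top c)"
     by (intro Q[of "Top e" "Top c" "Top b" "Bot c"]) (use v o x y zw in auto)
    hence "same d w z" using zw qt by simp
    thus False using n s same_sym same_trans[OF d] by metis
   next
    case y: (Top b)
    show False
    proof (cases z)
     case z: (Bot c)
     obtain e where w: "w = Bot e" using botlt v o z by (cases w) auto
     obtain B where B: "B \<in> d" "Top a \<in> B" "Bot c \<in> B" using s(1) x z unfolding same_def by blast
     obtain C where C: "C \<in> d" "Top b \<in> C" "Bot e \<in> C" using s(2) y w unfolding same_def by blast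
     have BC: "B \<in> props d" "C \<in> props d" using B C unfolding props_def propagating_def tp_def bt_def by blast+
     have ne: "B \<noteq> C" using n x y sameI[OF B(1,2)] C(2) by blast
     have "a < b" "e < c" using o x y z w v by auto
     hence 1: "rank_top d B < rank_top d C"
      by (intro planar_top_order[OF d p BC ne B(2) C(2)])
     have BC': "flipv ` B \<in> props (transp d)" "flipv ` C \<in> props (transp d)"
      using BC by (auto simp: props_transp)
     have "flipv ` C \<noteq> flipv ` B" using ne inj_flip_image by (simp add: inj_eq)
     moreover have "Top e \<in> flipv ` C" "Top c \<in> flipv ` B" using B C by (auto simp: flip_image_mem)
     ultimately have "rank_top (transp d) (flipv ` C) < rank_top (transp d) (flipv ` B)"
      using planar_top_order[OF td _ BC'(2,1)] q \<open>e < c\<close> by simp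
     hence "rank_bot d C < rank_bot d B"
      by (simp add: rank_top_def rank_bot_def dbot_def)
     thus False using 1 perm_rank_bot[OF d BC(1)] perm_rank_bot[OF d BC(2)] id by simp
    next
     case z: (Top c)
     have "same ?p x y"
     proof (cases w)
      case (Top e)
      show ?thesis
       by (rule P[OF v o]) (use s x y z Top same_top_half(1)[OF d] in auto)
     next
      case (Bot e)
      show ?thesis
       by (rule P[of _ _ z "Bot b"])
        (use v o s x y z Bot same_top_half[OF d] in auto)
     qed
     thus False using n x y same_top_half(1)[OF d] by simp
    qed
   qed
  qed
 qed
qed

lemma card_sym_block: "card (Top ` B \<union> Bot ` B) = 2 * card B"
proof (cases "finite B")
 case True
 have "card (Top ` B \<union> Bot ` B) = card (Top ` B) + card (Bot ` B)"
  by (rule card_Un_disjoint) (use True in auto)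
 thus ?thesis by (simp add: card_image inj_on_def)
next
 case False
 hence "infinite (Top ` B)" using finite_imageD[of Top B] by (auto simp: inj_on_def)
 thus ?thesis using False by simp
qed

text \<open>The blocks given by \<open>ex_diagram\<close> inherit the size conditions: a symmetric
  propagating block over T has 2|T| elements, so if it has at most two, then |T| = 1. In the planar
  cases the permutation is trivial and \<open>planar_of_halves\<close> applies.\<close>

lemma ex_diagram_basis:
 assumes p: "p \<in> symW A k m" and q: "q \<in> symW A k m" and s: "s \<in> diag_perms A m"
 shows "\<exists>d\<in>diag_basis A k. d \<cdot> transp d = p \<and> transp d \<cdot> d = q \<and> perm d = s"
proof -
 have p': "p \<in> diag_basis A k" "is_proj p" "pn p = m" and q': "q \<in> diag_basis A k" "is_proj q" "pn q = m"
  using p q unfolding symW_iff by auto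
 obtain d where d: "d \<in> all_diagrams k" "d \<cdot> transp d = p" "transp d \<cdot> d = q" "perm d = s"
  and bl: "\<And>X. X \<in> d ==> (X \<in> props d \<and> Top ` tp X \<union> Bot ` tp X \<in> p \<and> Top ` bt X \<union> Bot ` bt X \<in> q) \<or>
    X \<in> p \<and> bt X = {} \<or> X \<in> q \<and> tp X = {}"
  using ex_diagram[OF basis_sub[OF p'(1)] p'(2,3) basis_sub[OF q'(1)] q'(2,3) diag_perms_permutes[OF s]] by blast
 have sp: "card X = card (tp X) + card (bt X)" if "X \<in> props d" for X
 proof -
  have "card X = card (Top ` tp X \<union> Bot ` bt X)" using block_split by metis
  also have "\<dots> = card (Top ` tp X) + card (Bot ` bt X)"
   by (rule card_Un_disjoint) (use Max_tp_bt[OF d(1) that] in auto)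
  finally show ?thesis by (simp add: card_image inj_on_def)
 qed
 have two: "card (tp X) = 1" if "card (Top ` tp X \<union> Bot ` tp X) = 1 \<or> card (Top ` tp X \<union> Bot ` tp X) = 2" for X
  using that unfolding card_sym_block by presburger
 have two': "card (bt X) = 1" if "card (Top ` bt X \<union> Bot ` bt X) = 1 \<or> card (Top ` bt X \<union> Bot ` bt X) = 2" for X
  using that unfolding card_sym_block by presburger
 have rb: "rookbrauer_diag d" if "rookbrauer_diag p" "rookbrauer_diag q"
  unfolding rookbrauer_diag_def
 proof
  fix X assume X: "X \<in> d"
  show "card X = 1 \<or> card X = 2"
   using bl[OF X] that two[of X] two'[of X] sp[of X] unfolding rookbrauer_diag_def by fastforce
 qed
 have br: "brauer_diag d" if "brauer_diag p" "brauer_diag q"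
  unfolding brauer_diag_def
 proof
  fix X assume X: "X \<in> d"
  show "card X = 2"
   using bl[OF X] that two[of X] two'[of X] sp[of X] unfolding brauer_diag_def by fastforce
 qed
 have rk: "rook_diag d" if "rook_diag p" "rook_diag q"
  unfolding rook_diag_def
 proof
  fix X assume X: "X \<in> d"
  have t: "tp (Top ` tp X \<union> Bot ` tp X) = tp X" "tp (Top ` bt X \<union> Bot ` bt X) = bt X" by simp_all
  have h: "card (tp Y) \<le> 1 \<and> card (bt Y) \<le> 1" if "Y \<in> p \<or> Y \<in> q" for Y
   using that \<open>rook_diag p\<close> \<open>rook_diag q\<close> unfolding rook_diag_def by blast
  show "card (tp X) \<le> 1 \<and> card (bt X) \<le> 1"
   using bl[OF X] h[of X] h[of "Top ` tp X \<union> Bot ` tp X"] h[of "Top ` bt X \<union> Bot ` bt X"] unfolding t by blast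
 qed
 have pl: "planar k d" if "planar_kind A"
  using planar_of_halves[OF d(1)] planar_kindD[OF that p'(1)] planar_kindD[OF that q'(1)] d s that
  by (simp add: diag_perms_def)
 have "d \<in> diag_basis A k"
  using p'(1) q'(1) d(1) rb br rk pl by (cases A) (auto simp: planar_kind_def)
 thus ?thesis using d by blast
qed

section \<open>Specht modules\<close>

lemma sum_distinct_nat_ge:
 fixes X :: "nat set"
 assumes "finite X"
 shows "\<Sum>{..<card X} \<le> \<Sum>X" and "\<Sum>X = \<Sum>{..<card X} ==> X = {..<card X}"
proof -
 have "\<Sum>{..<card X} \<le> \<Sum>X \<and> (\<Sum>X = \<Sum>{..<card X} --> X = {..<card X})"
  using assms
 proof (induction "card X" arbitrary: X)
  case 0
  thus ?case by simp
 next
  case (Suc c)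
  define x where "x = Max X"
  have ne: "X \<noteq> {}" using Suc.hyps(2) by auto
  have x: "x \<in> X" unfolding x_def using Max_in[OF Suc.prems ne] .
  have c: "card (X - {x}) = c" using Suc.hyps(2) x Suc.prems by simp
  have sub: "X \<subseteq> {..x}" unfolding x_def using Suc.prems by auto
  have "card X \<le> Suc x" using card_mono[OF _ sub] by simp
  hence cx: "c \<le> x" using Suc.hyps(2) by simp
  have IH: "\<Sum>{..<c} \<le> \<Sum>(X - {x})" "\<Sum>(X - {x}) = \<Sum>{..<c} ==> X - {x} = {..<c}"
   using Suc.hyps(1)[of "X - {x}"] Suc.prems c by auto
  have s: "\<Sum>X = x + \<Sum>(X - {x})" using sum.remove[OF Suc.prems x, of "\<lambda>i. i"] by simp
  have t: "\<Sum>{..<Suc c} = c + \<Sum>{..<c}" by (simp add: lessThan_Suc)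
  show ?case unfolding Suc.hyps(2)[symmetric]
  proof
   show "\<Sum>{..<Suc c} \<le> \<Sum>X" unfolding s t using IH(1) cx by simp
   show "\<Sum>X = \<Sum>{..<Suc c} --> X = {..<Suc c}"
   proof
    assume "\<Sum>X = \<Sum>{..<Suc c}"
    hence "x = c" "\<Sum>(X - {x}) = \<Sum>{..<c}" unfolding s t using IH(1) cx by simp_all
    thus "X = {..<Suc c}" using IH(2) x by (auto simp: lessThan_Suc)
   qed
  qed
 qed
 thus "\<Sum>{..<card X} \<le> \<Sum>X" "\<Sum>X = \<Sum>{..<card X} ==> X = {..<card X}" by blast+
qed

text \<open>For a filling of a shape with row labels R and column labels C that separates entries, the
 sum of the row labels is minimal exactly if every column carries the labels 0, 1, 2, ...\<close>
lemma sum_labels_ge: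
 fixes R C :: "nat => nat"
 assumes S: "finite S" and inj: "\<And>a b. a \<in> S ==> b \<in> S ==> R a = R b ==> C a = C b ==> a = b"
 shows "(\<Sum>j\<in>C ` S. \<Sum>{..<card {a \<in> S. C a = j}}) \<le> (\<Sum>a\<in>S. R a)"
  and "(\<Sum>a\<in>S. R a) = (\<Sum>j\<in>C ` S. \<Sum>{..<card {a \<in> S. C a = j}}) ==>
   j \<in> C ` S ==> R ` {a \<in> S. C a = j} = {..<card {a \<in> S. C a = j}}"
proof -
 have fin: "finite {a \<in> S. C a = j}" for j using S by simp
 have injR: "inj_on R {a \<in> S. C a = j}" for j using inj by (auto simp: inj_on_def)
 have col: "(\<Sum>a\<in>{a \<in> S. C a = j}. R a) = \<Sum>(R ` {a \<in> S. C a = j})" for j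
  using sum.reindex[OF injR, of "\<lambda>i. i"] by simp
 have cc: "card (R ` {a \<in> S. C a = j}) = card {a \<in> S. C a = j}" for j by (rule card_image[OF injR])
 have ge: "\<Sum>{..<card {a \<in> S. C a = j}} \<le> (\<Sum>a\<in>{a \<in> S. C a = j}. R a)" for j
  using sum_distinct_nat_ge(1)[of "R ` {a \<in> S. C a = j}"] fin unfolding col cc by simp
 have tot: "(\<Sum>a\<in>S. R a) = (\<Sum>j\<in>C ` S. \<Sum>a\<in>{a \<in> S. C a = j}. R a)"
  by (rule sum.image_gen[OF S])
 show "(\<Sum>j\<in>C ` S. \<Sum>{..<card {a \<in> S. C a = j}}) \<le> (\<Sum>a\<in>S. R a)"
  unfolding tot by (rule sum_mono) (rule ge)
 assume eq: "(\<Sum>a\<in>S. R a) = (\<Sum>j\<in>C ` S. \<Sum>{..<card {a \<in> S. C a = j}})" and j: "j \<in> C ` S"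
 have "(\<Sum>a\<in>{a \<in> S. C a = j}. R a) = \<Sum>{..<card {a \<in> S. C a = j}}"
 proof (rule ccontr)
  assume "(\<Sum>a\<in>{a \<in> S. C a = j}. R a) \<noteq> \<Sum>{..<card {a \<in> S. C a = j}}"
  hence "\<Sum>{..<card {a \<in> S. C a = j}} < (\<Sum>a\<in>{a \<in> S. C a = j}. R a)" using ge[of j] by simp
  hence "(\<Sum>j\<in>C ` S. \<Sum>{..<card {a \<in> S. C a = j}}) < (\<Sum>j\<in>C ` S. \<Sum>a\<in>{a \<in> S. C a = j}. R a)"
   using ge j S by (intro sum_strict_mono_ex1) auto
  thus False using eq tot by simp
 qed
 thus "R ` {a \<in> S. C a = j} = {..<card {a \<in> S. C a = j}}"
  using sum_distinct_nat_ge(2)[of "R ` {a \<in> S. C a = j}"] fin unfolding col cc by simp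
qed

section \<open>Tableaux, column stabilisers and polytabloids\<close>

lemma perm_act_comp: "perm_act s (perm_act t f) = perm_act (s \<circ> t) f"
 by (simp add: perm_act_def fun_eq_iff comp_assoc)

lemma perm_act_sum: "perm_act s (\<lambda>T. \<Sum>i\<in>I. c i * f i T) = (\<lambda>T. \<Sum>i\<in>I. c i * perm_act s (f i) T)"
 by (simp add: perm_act_def)

lemma finite_cells [simp]: "finite (cells mu)"
proof -
 have "cells mu = (\<Union>r\<in>{..<length mu}. {r} \<times> {..<mu ! r})" by (auto simp: cells_def)
 thus ?thesis by simp
qed

lemma card_cells: "card (cells mu) = sum_list mu"
proof -
 have e: "cells mu = (SIGMA r:{..<length mu}. {..<mu ! r})" by (auto simp: cells_def)
 have "card (cells mu) = (\<Sum>r<length mu. mu ! r)"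
  unfolding e by (subst card_SigmaI) auto
 thus ?thesis by (simp add: sum_list_sum_nth atLeast0LessThan)
qed

locale tableau =
 fixes mu :: "nat list" and t :: "nat \<times> nat => nat"
 assumes t: "t \<in> tableaux mu"
begin

abbreviation "M \<equiv> {1..sum_list mu}"
abbreviation "R \<equiv> tabloid_of mu t"
abbreviation "C \<equiv> col_of mu t"
abbreviation "pos \<equiv> the_inv_into (cells mu) t"

lemma bij: "bij_betw t (cells mu) M" using t by (simp add: tableaux_def)

lemma pos: "j \<in> M ==> pos j \<in> cells mu" "j \<in> M ==> t (pos j) = j" "x \<in> cells mu ==> pos (t x) = x"
 using bij_betwE[OF bij_betw_the_inv_into[OF bij]] f_the_inv_into_f_bij_betw[OF bij]
  the_inv_into_f_f[OF bij_betw_imp_inj_on[OF bij]] by blast+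

lemma pos_eq: "j \<in> M ==> pos j = (R j, C j)"
 by (simp add: tabloid_of_def col_of_def)

lemma R_out: "j \<notin> M ==> R j = 0"
 by (auto simp: tabloid_of_def)

lemma tM: "x \<in> cells mu ==> t x \<in> M"
 using bij_betwE[OF bij] by blast

lemma R_t: "(r, c) \<in> cells mu ==> R (t (r, c)) = r" "(r, c) \<in> cells mu ==> C (t (r, c)) = c"
 using pos(3)[of "(r, c)"] pos_eq[OF tM, of "(r, c)"] by auto

lemma cell_RC: "j \<in> M ==> (R j, C j) \<in> cells mu" "j \<in> M ==> t (R j, C j) = j"
 using pos pos_eq by metis+

lemma RC_inj: "a \<in> M ==> b \<in> M ==> R a = R b ==> C a = C b ==> a = b"
 using cell_RC(2) by metis

lemma row_card: "r < length mu ==> card {j \<in> M. R j = r} = mu ! r"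
proof -
 assume r: "r < length mu"
 have "bij_betw C {j \<in> M. R j = r} {..<mu ! r}"
 proof (rule bij_betwI[where g = "\<lambda>c. t (r, c)"])
  show "C \<in> {j \<in> M. R j = r} \<rightarrow> {..<mu ! r}" using cell_RC(1) by (auto simp: cells_def)
  show "(\<lambda>c. t (r, c)) \<in> {..<mu ! r} \<rightarrow> {j \<in> M. R j = r}"
   using R_t(1) tM r by (auto simp: cells_def)
  show "t (r, C x) = x" if "x \<in> {j \<in> M. R j = r}" for x using that cell_RC(2) by auto
  show "C (t (r, y)) = y" if "y \<in> {..<mu ! r}" for y using that R_t(2) r by (auto simp: cells_def)
 qed
 thus ?thesis using bij_betw_same_card by fastforce
qed

lemma comp_tableau:
 assumes s: "s permutes M"
 shows "s \<circ> t \<in> tableaux mu" "tabloid_of mu (s \<circ> t) = R \<circ> inv s"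
  "j \<in> M ==> col_of mu (s \<circ> t) j = C (inv s j)"
proof -
 have b: "bij_betw (s \<circ> t) (cells mu) M" using bij_betw_trans[OF bij permutes_imp_bij[OF s]] .
 have "s 0 = 0" using permutes_not_in[OF s] by simp
 thus st: "s \<circ> t \<in> tableaux mu" using b t by (simp add: tableaux_def)
 have p: "the_inv_into (cells mu) (s \<circ> t) j = pos (inv s j)" if j: "j \<in> M" for j
 proof (rule the_inv_into_f_eq)
  show "inj_on (s \<circ> t) (cells mu)" using b bij_betw_def by blast
  have i: "inv s j \<in> M" using permutes_in_image[OF permutes_inv[OF s]] j by blast
  thus "pos (inv s j) \<in> cells mu" by (rule pos)
  show "(s \<circ> t) (pos (inv s j)) = j" using pos(2)[OF i] permutes_inverses(1)[OF s] by simp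
 qed
 show "tabloid_of mu (s \<circ> t) = R \<circ> inv s"
 proof
  fix j show "tabloid_of mu (s \<circ> t) j = (R \<circ> inv s) j"
  proof (cases "j \<in> M")
   case True
   hence "inv s j \<in> M" using permutes_in_image[OF permutes_inv[OF s]] by blast
   thus ?thesis using True p[OF True] by (simp add: tabloid_of_def)
  next
   case False
   hence "inv s j = j" using permutes_not_in[OF permutes_inv[OF s]] by blast
   thus ?thesis using False by (auto simp: tabloid_of_def)
  qed
 qed
 show "col_of mu (s \<circ> t) j = C (inv s j)" if "j \<in> M" using p[OF that] by (simp add: col_of_def)
qed

lemma col_stab_permutes: "p \<in> col_stab mu t ==> p permutes M"
 by (simp add: col_stab_def)

lemma col_stab_C: "p \<in> col_stab mu t ==> j \<in> M ==> C (p j) = C j"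
 by (simp add: col_stab_def)

lemma finite_col_stab: "finite (col_stab mu t)"
 by (rule finite_subset[OF _ finite_permutations[of M]]) (auto simp: col_stab_def)

lemma id_col_stab: "id \<in> col_stab mu t"
 by (simp add: col_stab_def permutes_id)

lemma comp_col_stab: "p \<in> col_stab mu t ==> q \<in> col_stab mu t ==> p \<circ> q \<in> col_stab mu t"
proof -
 assume p: "p \<in> col_stab mu t" and q: "q \<in> col_stab mu t"
 have "C ((p \<circ> q) j) = C j" if "j \<in> M" for j
 proof -
  have "q j \<in> M" using permutes_in_image[OF col_stab_permutes[OF q]] that by blast
  thus ?thesis using col_stab_C[OF p] col_stab_C[OF q that] by simp
 qed
 thus ?thesis
  unfolding col_stab_def using permutes_compose[OF col_stab_permutes[OF q] col_stab_permutes[OF p]] by blast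
qed

lemma inv_col_stab: "p \<in> col_stab mu t ==> inv p \<in> col_stab mu t"
proof -
 assume p: "p \<in> col_stab mu t"
 note pp = col_stab_permutes[OF p]
 have "C (inv p j) = C j" if "j \<in> M" for j
 proof -
  have "inv p j \<in> M" using permutes_in_image[OF permutes_inv[OF pp]] that by blast
  thus ?thesis using col_stab_C[OF p, of "inv p j"] permutes_inverses(1)[OF pp] by simp
 qed
 thus ?thesis unfolding col_stab_def using permutes_inv[OF pp] by simp
qed

lemma col_stab_bij: "p \<in> col_stab mu t ==> bij_betw (\<lambda>q. p \<circ> q) (col_stab mu t) (col_stab mu t)"
proof -
 assume p: "p \<in> col_stab mu t"
 note pp = col_stab_permutes[OF p]
 show ?thesis
  by (rule bij_betwI[where g = "\<lambda>q. inv p \<circ> q"])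
   (use comp_col_stab[OF p] comp_col_stab[OF inv_col_stab[OF p]] permutes_inv_o[OF pp] in \<open>auto simp: o_assoc\<close>)
qed

lemma sign_inv_perm: "p permutes M ==> sign (inv p) = sign p"
 by (meson finite_atLeastAtMost permutation_permutes sign_inverse)

lemma sign_comp_perm: "p permutes M ==> q permutes M ==> sign (p \<circ> q) = sign p * sign q"
 by (meson finite_atLeastAtMost permutation_permutes sign_compose)

definition alternating :: "((nat => nat) => complex) => bool" where
 "alternating f \<longleftrightarrow> (\<forall>p\<in>col_stab mu t. perm_act p f = (\<lambda>T. of_int (sign p) * f T))"

text \<open>The column antisymmetriser of t. Applied to the indicator of the tabloid of t it gives
  the polytabloid, see \<open>polytabloid_kappa\<close>.\<close>

definition kappa :: "((nat => nat) => complex) => ((nat => nat) => complex)" where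
 "kappa f = (\<lambda>T. \<Sum>p\<in>col_stab mu t. of_int (sign p) * perm_act p f T)"

lemma kappa_alternating: "alternating (kappa f)"
 unfolding alternating_def
proof
 fix p assume p: "p \<in> col_stab mu t"
 have "perm_act p (kappa f) = (\<lambda>T. \<Sum>q\<in>col_stab mu t. of_int (sign q) * perm_act (p \<circ> q) f T)"
  unfolding kappa_def perm_act_sum perm_act_comp ..
 also have "\<dots> = (\<lambda>T. \<Sum>q\<in>col_stab mu t. of_int (sign p) * (of_int (sign (p \<circ> q)) * perm_act (p \<circ> q) f T))"
 proof (intro ext sum.cong refl)
  fix T q assume q: "q \<in> col_stab mu t"
  have "sign p * sign (p \<circ> q) = sign q"
   using sign_comp_perm[OF col_stab_permutes[OF p] col_stab_permutes[OF q]]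
   by (simp add: sign_def)
  hence "complex_of_int (sign q) = of_int (sign p) * of_int (sign (p \<circ> q))"
   by (metis of_int_mult)
  thus "of_int (sign q) * perm_act (p \<circ> q) f T = of_int (sign p) * (of_int (sign (p \<circ> q)) * perm_act (p \<circ> q) f T)"
   by simp
 qed
 also have "\<dots> = (\<lambda>T. of_int (sign p) * (\<Sum>q\<in>col_stab mu t. of_int (sign q) * perm_act q f T))"
 proof
  fix T
  show "(\<Sum>q\<in>col_stab mu t. of_int (sign p) * (of_int (sign (p \<circ> q)) * perm_act (p \<circ> q) f T)) =
    of_int (sign p) * (\<Sum>q\<in>col_stab mu t. of_int (sign q) * perm_act q f T)"
   unfolding sum_distrib_left[symmetric]
   using sum.reindex_bij_betw[OF col_stab_bij[OF p], of "\<lambda>q. of_int (sign q) * perm_act q f T"] by simp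
 qed
 finally show "perm_act p (kappa f) = (\<lambda>T. of_int (sign p) * kappa f T)" by (simp add: kappa_def)
qed

lemma R_eq_id: "p \<in> col_stab mu t ==> R \<circ> p = R ==> p = id"
proof
 fix j assume p: "p \<in> col_stab mu t" "R \<circ> p = R"
 show "p j = id j"
 proof (cases "j \<in> M")
  case True
  hence "p j \<in> M" using permutes_in_image[OF col_stab_permutes[OF p(1)]] by blast
  moreover have "R (p j) = R j" using p(2) by (metis comp_apply)
  ultimately show ?thesis using RC_inj True col_stab_C[OF p(1) True] by simp
 next
  case False
  thus ?thesis using permutes_not_in[OF col_stab_permutes[OF p(1)]] by simp
 qed
qed

lemma polytabloid_eq: "polytabloid mu t T = (\<Sum>p\<in>col_stab mu t. if R \<circ> inv p = T then of_int (sign p) else 0)"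
 unfolding polytabloid_def
 by (intro sum.cong refl) (simp add: comp_tableau(2)[OF col_stab_permutes])

lemma polytabloid_kappa: "polytabloid mu t = kappa (\<lambda>T. if T = R then 1 else 0)"
proof
 fix T
 have "R \<circ> inv p = T \<longleftrightarrow> T \<circ> p = R" if "p \<in> col_stab mu t" for p
  using permutes_inv_o[OF col_stab_permutes[OF that]] by (metis comp_assoc comp_id)
 thus "polytabloid mu t T = kappa (\<lambda>T. if T = R then 1 else 0) T"
  unfolding polytabloid_eq kappa_def perm_act_def by (intro sum.cong refl) auto
qed

lemma polytabloid_self: "polytabloid mu t R = 1"
proof -
 have "(if R \<circ> inv p = R then of_int (sign p) else 0) = (if p = id then 1 else (0::complex))"
  if p: "p \<in> col_stab mu t" for p
 proof (cases "R \<circ> inv p = R")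
  case True
  hence "inv p = id" using R_eq_id[OF inv_col_stab[OF p]] by blast
  hence "p = id" using permutes_inv_inv[OF col_stab_permutes[OF p]] by simp
  thus ?thesis using True by (simp add: sign_id)
 next
  case False
  hence "p \<noteq> id" by auto
  thus ?thesis using False by simp
 qed
 thus ?thesis unfolding polytabloid_eq
  using finite_col_stab id_col_stab by (simp add: sum.delta)
qed

text \<open>The transposition of a and b preserves the columns and fixes T, but multiplies an
  alternating vector by -1.\<close>

lemma alternating_vanish:
 assumes f: "alternating f" and ab: "a \<in> M" "b \<in> M" "a \<noteq> b" "T a = T b" "C a = C b"
 shows "f T = 0"
proof -
 let ?p = "transpose a b"
 have p: "?p \<in> col_stab mu t"
  unfolding col_stab_def using ab permutes_swap_id[of a M b] by (auto simp: transpose_def)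
 have "T \<circ> ?p = T" using ab by (auto simp: transpose_def fun_eq_iff)
 hence "f T = perm_act ?p f T" by (simp add: perm_act_def)
 also have "\<dots> = of_int (sign ?p) * f T" using f p unfolding alternating_def by metis
 also have "\<dots> = - f T" using ab by (simp add: sign_swap_id)
 finally show ?thesis by simp
qed

lemma sum_rows: "(\<Sum>a\<in>M. R a) = (\<Sum>r<length mu. r * mu ! r)"
proof -
 have im: "R ` M \<subseteq> {..<length mu}" using cell_RC(1) by (auto simp: cells_def)
 have "(\<Sum>a\<in>M. R a) = (\<Sum>r<length mu. \<Sum>a\<in>{a \<in> M. R a = r}. R a)"
  by (rule sum.group[symmetric]) (use im in auto)
 also have "\<dots> = (\<Sum>r<length mu. r * mu ! r)"
 proof (rule sum.cong[OF refl])
  fix r assume "r \<in> {..<length mu}"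
  thus "(\<Sum>a\<in>{a \<in> M. R a = r}. R a) = r * mu ! r" using row_card[of r] by simp
 qed
 finally show ?thesis .
qed

lemma row_card': "card {a \<in> M. R a = r} = (if r < length mu then mu ! r else 0)"
proof (cases "r < length mu")
 case True thus ?thesis using row_card by simp
next
 case False
 hence "{a \<in> M. R a = r} = {}" using cell_RC(1) by (auto simp: cells_def)
 thus ?thesis using False by simp
qed

text \<open>Row lengths decrease weakly, so with a cell (r, j) the diagram contains all cells above
  it, and column j occupies an initial segment of rows.\<close>

lemma column_rows:
 assumes mu: "sorted_wrt (\<ge>) mu"
 shows "R ` {a \<in> M. C a = j} = {..<card {a \<in> M. C a = j}}"
proof -
 have mono: "mu ! r' \<le> mu ! r" if "r \<le> r'" "r' < length mu" for r r'
  using sorted_wrt_nth_less[OF mu, of r r'] that by (cases "r = r'") auto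
 have down: "r' \<in> R ` {a \<in> M. C a = j}" if rr: "r \<in> R ` {a \<in> M. C a = j}" "r' \<le> r" for r r'
 proof -
  obtain a where a: "a \<in> M" "C a = j" "R a = r" using rr by blast
  hence "(r, j) \<in> cells mu" using cell_RC(1) by blast
  hence "(r', j) \<in> cells mu" using mono[OF rr(2)] rr(2) by (auto simp: cells_def)
  thus ?thesis using R_t tM by (intro image_eqI[of _ _ "t (r', j)"]) auto
 qed
 have inj: "inj_on R {a \<in> M. C a = j}" using RC_inj by (auto simp: inj_on_def)
 let ?X = "R ` {a \<in> M. C a = j}"
 have fX: "finite ?X" by simp
 have "?X = {..<card ?X}"
 proof (cases "?X = {}")
  case False
  have "?X \<subseteq> {..Max ?X}" using Max_ge[OF fX] by blast
  moreover have "{..Max ?X} \<subseteq> ?X" using down[OF Max_in[OF fX False]] by blast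
  ultimately obtain x where x: "?X = {..x}" by blast
  show ?thesis unfolding x by (simp add: lessThan_Suc_atMost)
 qed (metis card.empty lessThan_0)
 thus ?thesis using card_image[OF inj] by simp
qed

text \<open>The rows of t attain the lower bound of \<open>sum_labels_ge\<close> for the columns of
  t; any tabloid of the same shape has the same label sum and so falls under the equality
  case.\<close>

lemma sum_columns:
 assumes mu: "sorted_wrt (\<ge>) mu"
 shows "(\<Sum>a\<in>M. R a) = (\<Sum>j\<in>C ` M. \<Sum>{..<card {a \<in> M. C a = j}})"
proof -
 have "(\<Sum>a\<in>M. R a) = (\<Sum>j\<in>C ` M. \<Sum>a\<in>{a \<in> M. C a = j}. R a)" by (rule sum.image_gen) simp
 also have "\<dots> = (\<Sum>j\<in>C ` M. \<Sum>{..<card {a \<in> M. C a = j}})"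
 proof (rule sum.cong[OF refl])
  fix j
  have "inj_on R {a \<in> M. C a = j}" using RC_inj by (auto simp: inj_on_def)
  hence "(\<Sum>a\<in>{a \<in> M. C a = j}. R a) = \<Sum>(R ` {a \<in> M. C a = j})"
   using sum.reindex[of R _ "\<lambda>i. i"] by simp
  thus "(\<Sum>a\<in>{a \<in> M. C a = j}. R a) = \<Sum>{..<card {a \<in> M. C a = j}}" unfolding column_rows[OF mu] .
 qed
 finally show ?thesis .
qed

text \<open>A tabloid whose row labels differ along every column of t is a column permutation of t,
 because its row labels then fill every column from the top.\<close>
lemma separated_tabloid:
 assumes t': "t' \<in> tableaux mu" and sep: "\<And>a b. a \<in> M ==> b \<in> M ==> tabloid_of mu t' a = tabloid_of mu t' b ==> C a = C b ==> a = b"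
  and mu: "sorted_wrt (\<ge>) mu"
 shows "\<exists>q\<in>col_stab mu t. tabloid_of mu t' = R \<circ> q"
proof -
 interpret t': tableau mu t' using t' by unfold_locales
 let ?T = "tabloid_of mu t'"
 have colT: "?T ` {a \<in> M. C a = j} = {..<card {a \<in> M. C a = j}}" if "j \<in> C ` M" for j
  by (rule sum_labels_ge(2)[OF _ sep]) (use that sum_columns[OF mu] sum_rows t'.sum_rows in auto)
 have cT: "(?T a, C a) \<in> cells mu" if a: "a \<in> M" for a
 proof -
  have "?T a \<in> R ` {b \<in> M. C b = C a}" unfolding column_rows[OF mu] colT[OF imageI[OF a], symmetric] using a by blast
  then obtain b where "b \<in> M" "C b = C a" "R b = ?T a" by auto
  thus ?thesis using cell_RC(1)[of b] by simp
 qed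
 \<comment> \<open>Within its own column, a is moved to the entry of t whose row is the label of
   a.\<close>
 define q where "q a = (if a \<in> M then t (?T a, C a) else a)" for a
 have q: "q a \<in> M" "R (q a) = ?T a" "C (q a) = C a" if "a \<in> M" for a
  using that R_t[OF cT] tM[OF cT] by (simp_all add: q_def)
 have inj: "inj_on q M" using sep q(2,3) by (metis inj_onI)
 have "q ` M \<subseteq> M" using q(1) by blast
 hence "q ` M = M" by (rule endo_inj_surj[OF finite_atLeastAtMost _ inj])
 hence "bij_betw q M M" using inj by (simp add: bij_betw_def)
 hence "q permutes M" by (rule bij_imp_permutes) (auto simp: q_def)
 hence "q \<in> col_stab mu t" unfolding col_stab_def using q(3) by blast
 moreover have "?T = R \<circ> q"
 proof
  fix a show "?T a = (R \<circ> q) a"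
   using q(2)[of a] t'.R_out[of a] R_out[of a] by (cases "a \<in> M") (auto simp: q_def)
 qed
 ultimately show ?thesis by blast
qed

end

section \<open>Functions on tabloids\<close>

definition tabloids :: "nat list => (nat => nat) set" where
 "tabloids mu = tabloid_of mu ` tableaux mu"

definition tabloid_fun :: "nat list => ((nat => nat) => complex) => bool" where
 "tabloid_fun mu f \<longleftrightarrow> (\<forall>T. f T \<noteq> 0 --> T \<in> tabloids mu)"

lemma tabloids_comp: "s permutes {1..sum_list mu} ==> T \<in> tabloids mu ==> T \<circ> s \<in> tabloids mu"
proof -
 assume s: "s permutes {1..sum_list mu}" and T: "T \<in> tabloids mu"
 then obtain t where t0: "t \<in> tableaux mu" "T = tabloid_of mu t" unfolding tabloids_def by blast
 interpret tableau mu t using t0 by unfold_locales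
 have "tabloid_of mu (inv s \<circ> t) = R \<circ> inv (inv s)" by (rule comp_tableau(2)[OF permutes_inv[OF s]])
 hence "T \<circ> s = tabloid_of mu (inv s \<circ> t)" unfolding t0(2) permutes_inv_inv[OF s] by (rule sym)
 thus ?thesis unfolding tabloids_def using comp_tableau(1)[OF permutes_inv[OF s]] by blast
qed

lemma tabloid_fun_perm_act:
 assumes s: "s permutes {1..sum_list mu}" and f: "tabloid_fun mu f"
 shows "tabloid_fun mu (perm_act s f)"
 unfolding tabloid_fun_def perm_act_def
proof (intro allI impI)
 fix T assume "f (T \<circ> s) \<noteq> 0"
 hence "T \<circ> s \<in> tabloids mu" using f unfolding tabloid_fun_def by blast
 hence "T \<circ> s \<circ> inv s \<in> tabloids mu" by (rule tabloids_comp[OF permutes_inv[OF s]])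
 thus "T \<in> tabloids mu" using permutes_inv_o(1)[OF s] by (simp add: comp_assoc)
qed

context tableau
begin

lemma tabloid_fun_kappa: "tabloid_fun mu f ==> tabloid_fun mu (kappa f)"
proof -
 assume f: "tabloid_fun mu f"
 show ?thesis unfolding tabloid_fun_def
 proof (intro allI impI)
  fix T assume "kappa f T \<noteq> 0"
  then obtain p where "p \<in> col_stab mu t" "perm_act p f T \<noteq> 0"
   unfolding kappa_def using sum.not_neutral_contains_not_neutral[of "\<lambda>p. of_int (sign p) * perm_act p f T"] by force
  thus "T \<in> tabloids mu"
   using tabloid_fun_perm_act[OF col_stab_permutes f] unfolding tabloid_fun_def by blast
 qed
qed

lemma tabloid_fun_polytabloid: "tabloid_fun mu (polytabloid mu t)"
 unfolding polytabloid_kappa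
 by (rule tabloid_fun_kappa) (use t in \<open>auto simp: tabloid_fun_def tabloids_def\<close>)

text \<open>An alternating function vanishes on tabloids with two equal labels in a column of t. The
  other tabloids are column permutations of t, where its value is the sign times its value at t. So
  alternating functions form the line of the polytabloid.\<close>

lemma alternating_eq:
 assumes mu: "sorted_wrt (\<ge>) mu" and f: "alternating f" "tabloid_fun mu f"
 shows "f = (\<lambda>T. f R * polytabloid mu t T)"
proof
 fix T
 note e = kappa_alternating[of "\<lambda>T. if T = R then 1 else 0", folded polytabloid_kappa]
 show "f T = f R * polytabloid mu t T"
 proof (cases "T \<in> tabloids mu")
  case False
  thus ?thesis using f(2) tabloid_fun_polytabloid unfolding tabloid_fun_def by force
 next
  case True
  then obtain t' where t': "t' \<in> tableaux mu" "T = tabloid_of mu t'" unfolding tabloids_def by blast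
  show ?thesis
  proof (cases "\<forall>a\<in>M. \<forall>b\<in>M. T a = T b --> C a = C b --> a = b")
   case False
   then obtain a b where "a \<in> M" "b \<in> M" "a \<noteq> b" "T a = T b" "C a = C b" by blast
   thus ?thesis using alternating_vanish[OF f(1)] alternating_vanish[OF e] by simp
  next
   case True
   then obtain q where q: "q \<in> col_stab mu t" "T = R \<circ> q"
    using separated_tabloid[OF t'(1) _ mu] t'(2) by blast
   have "f T = of_int (sign q) * f R"
    using f(1) q unfolding alternating_def by (metis perm_act_def)
   moreover have "polytabloid mu t T = of_int (sign q) * polytabloid mu t R"
    using e q unfolding alternating_def by (metis perm_act_def)
   ultimately show ?thesis by (simp add: polytabloid_self)
  qed
 qed
qed

text \<open>The column stabiliser of \<open>s \<circ> t\<close> is the conjugate by s of that of t,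
  and conjugation preserves signs.\<close>

lemma perm_act_polytabloid:
 assumes s: "s permutes M"
 shows "perm_act s (polytabloid mu t) = polytabloid mu (s \<circ> t)"
proof
 fix T
 interpret st: tableau mu "s \<circ> t" using comp_tableau(1)[OF s] by unfold_locales
 have ib: "bij_betw (\<lambda>p. s \<circ> p \<circ> inv s) (col_stab mu t) (col_stab mu (s \<circ> t))"
 proof (rule bij_betwI[where g = "\<lambda>p. inv s \<circ> p \<circ> s"])
  have im: "s j \<in> M" "inv s j \<in> M" if "j \<in> M" for j
   using permutes_in_image[OF s] permutes_in_image[OF permutes_inv[OF s]] that by blast+
  show "(\<lambda>p. s \<circ> p \<circ> inv s) \<in> col_stab mu t \<rightarrow> col_stab mu (s \<circ> t)"
  proof
   fix p assume p: "p \<in> col_stab mu t"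
   have "s \<circ> p \<circ> inv s permutes M"
    using permutes_compose[OF permutes_inv[OF s] permutes_compose[OF col_stab_permutes[OF p] s]] .
   moreover have "col_of mu (s \<circ> t) ((s \<circ> p \<circ> inv s) j) = col_of mu (s \<circ> t) j" if j: "j \<in> M" for j
   proof -
    have "p (inv s j) \<in> M" using im(2)[OF j] permutes_in_image[OF col_stab_permutes[OF p]] by blast
    hence "col_of mu (s \<circ> t) (s (p (inv s j))) = C (inv s (s (p (inv s j))))"
     using im(1) comp_tableau(3)[OF s] by blast
    also have "\<dots> = C (inv s j)" using permutes_inverses(2)[OF s] col_stab_C[OF p im(2)[OF j]] by simp
    finally show ?thesis using comp_tableau(3)[OF s j] by simp
   qed
   ultimately show "s \<circ> p \<circ> inv s \<in> col_stab mu (s \<circ> t)" unfolding col_stab_def by blast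
  qed
  show "(\<lambda>p. inv s \<circ> p \<circ> s) \<in> col_stab mu (s \<circ> t) \<rightarrow> col_stab mu t"
  proof
   fix p assume p: "p \<in> col_stab mu (s \<circ> t)"
   have "inv s \<circ> p \<circ> s permutes M"
    using permutes_compose[OF s permutes_compose[OF st.col_stab_permutes[OF p] permutes_inv[OF s]]] .
   moreover have "C ((inv s \<circ> p \<circ> s) j) = C j" if j: "j \<in> M" for j
   proof -
    have "p (s j) \<in> M" using im(1)[OF j] permutes_in_image[OF st.col_stab_permutes[OF p]] by blast
    hence "C (inv s (p (s j))) = col_of mu (s \<circ> t) (p (s j))" using comp_tableau(3)[OF s] by simp
    also have "\<dots> = col_of mu (s \<circ> t) (s j)" by (rule st.col_stab_C[OF p im(1)[OF j]])
    also have "\<dots> = C j" using comp_tableau(3)[OF s im(1)[OF j]] permutes_inverses(2)[OF s] by simp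
    finally show ?thesis by simp
   qed
   ultimately show "inv s \<circ> p \<circ> s \<in> col_stab mu t" unfolding col_stab_def by blast
  qed
  show "inv s \<circ> (s \<circ> p \<circ> inv s) \<circ> s = p" for p
   using permutes_inv_o(2)[OF s] by (simp add: fun_eq_iff permutes_inverses[OF s])
  show "s \<circ> (inv s \<circ> p \<circ> s) \<circ> inv s = p" for p
   by (simp add: fun_eq_iff permutes_inverses[OF s])
 qed
 have "polytabloid mu (s \<circ> t) T = (\<Sum>p\<in>col_stab mu t. if st.R \<circ> inv (s \<circ> p \<circ> inv s) = T then of_int (sign (s \<circ> p \<circ> inv s)) else 0)"
  unfolding st.polytabloid_eq by (rule sum.reindex_bij_betw[OF ib, symmetric])
 also have "\<dots> = (\<Sum>p\<in>col_stab mu t. if R \<circ> inv p = T \<circ> s then of_int (sign p) else 0)"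
 proof (intro sum.cong refl)
  fix p assume p: "p \<in> col_stab mu t"
  note pp = col_stab_permutes[OF p] and si = permutes_inv[OF s]
  have sg: "sign (s \<circ> p \<circ> inv s) = sign p"
   using sign_comp_perm[OF permutes_compose[OF pp s] si] sign_comp_perm[OF s pp] sign_inv_perm[OF s]
   by (simp add: sign_def)
  have "inv (s \<circ> p \<circ> inv s) = s \<circ> inv p \<circ> inv s"
   using permutes_inv_inv[OF s] permutes_bij[OF s] permutes_bij[OF pp] permutes_bij[OF si]
   by (simp add: o_inv_distrib bij_comp comp_assoc)
  hence "st.R \<circ> inv (s \<circ> p \<circ> inv s) = R \<circ> inv p \<circ> inv s"
   using comp_tableau(2)[OF s] by (simp add: fun_eq_iff permutes_inverses[OF s])
  moreover have "R \<circ> inv p \<circ> inv s = T \<longleftrightarrow> R \<circ> inv p = T \<circ> s"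
  proof
   assume "R \<circ> inv p \<circ> inv s = T"
   hence "T \<circ> s = R \<circ> inv p \<circ> (inv s \<circ> s)" by (auto simp: fun_eq_iff)
   thus "R \<circ> inv p = T \<circ> s" using permutes_inv_o(2)[OF s] by simp
  next
   assume "R \<circ> inv p = T \<circ> s"
   hence "R \<circ> inv p \<circ> inv s = T \<circ> (s \<circ> inv s)" by (simp add: comp_assoc)
   thus "R \<circ> inv p \<circ> inv s = T" using permutes_inv_o(1)[OF s] by simp
  qed
  ultimately show "(if st.R \<circ> inv (s \<circ> p \<circ> inv s) = T then of_int (sign (s \<circ> p \<circ> inv s)) else 0)
    = (if R \<circ> inv p = T \<circ> s then of_int (sign p) else (0 :: complex))"
   using sg by simp
 qed
 finally show "perm_act s (polytabloid mu t) T = polytabloid mu (s \<circ> t) T"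
  by (simp add: perm_act_def polytabloid_eq)
qed

end

section \<open>Specht modules and their irreducibility\<close>

lemma sum_fun_apply: "(\<Sum>i\<in>I. f i) x = (\<Sum>i\<in>I. f i x)"
 by (induction I rule: infinite_finite_induct) auto

lemma finite_tableaux: "finite (tableaux mu)"
proof -
 have "tableaux mu \<subseteq> {t. \<forall>x. (x \<in> cells mu --> t x \<in> {..sum_list mu}) \<and> (x \<notin> cells mu --> t x = 0)}"
  unfolding tableaux_def by (auto dest!: bij_betwE)
 moreover have "finite {t. \<forall>x. (x \<in> cells mu --> t x \<in> {..sum_list mu}) \<and> (x \<notin> cells mu --> t x = 0)}"
  by (rule finite_set_of_finite_funs) auto
 ultimately show ?thesis by (rule finite_subset)
qed

lemma tableaux_nonempty: "\<exists>t. t \<in> tableaux mu"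
proof -
 have "card (cells mu) = card {1..sum_list mu}" by (simp add: card_cells)
 then obtain t where t: "bij_betw t (cells mu) {1..sum_list mu}"
  using finite_same_card_bij[OF finite_cells finite_atLeastAtMost] by blast
 let ?t = "\<lambda>x. if x \<in> cells mu then t x else 0"
 have "bij_betw ?t (cells mu) {1..sum_list mu}" using t by (rule bij_betw_cong[THEN iffD1, rotated]) simp
 thus ?thesis unfolding tableaux_def by (intro exI[of _ ?t]) simp
qed

lemma spechtI: "(\<lambda>T. \<Sum>t\<in>tableaux mu. c t * polytabloid mu t T) \<in> specht mu"
 unfolding specht_def by blast

lemma spechtE:
 assumes "f \<in> specht mu"
 obtains c where "f = (\<lambda>T. \<Sum>t\<in>tableaux mu. c t * polytabloid mu t T)"
 using assms unfolding specht_def by blast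

lemma specht_zero: "(\<lambda>_. 0) \<in> specht mu" "0 \<in> specht mu"
 using spechtI[where mu = mu and c = "\<lambda>_. 0"] by (simp_all add: zero_fun_def)

lemma specht_add: "f \<in> specht mu ==> g \<in> specht mu ==> f + g \<in> specht mu"
proof -
 assume f: "f \<in> specht mu" and g: "g \<in> specht mu"
 obtain c where f: "f = (\<lambda>T. \<Sum>t\<in>tableaux mu. c t * polytabloid mu t T)" using spechtE[OF f] .
 obtain e where g: "g = (\<lambda>T. \<Sum>t\<in>tableaux mu. e t * polytabloid mu t T)" using spechtE[OF g] .
 have "f + g = (\<lambda>T. \<Sum>t\<in>tableaux mu. (c t + e t) * polytabloid mu t T)"
  unfolding f g by (rule ext) (simp add: sum.distrib distrib_right)
 thus ?thesis using spechtI[where mu = mu and c = "\<lambda>t. c t + e t"] by simp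
qed

lemma specht_scale: "f \<in> specht mu ==> (\<lambda>T. a * f T) \<in> specht mu"
proof -
 assume f: "f \<in> specht mu"
 obtain c where f: "f = (\<lambda>T. \<Sum>t\<in>tableaux mu. c t * polytabloid mu t T)" using spechtE[OF f] .
 have "(\<lambda>T. a * f T) = (\<lambda>T. \<Sum>t\<in>tableaux mu. (a * c t) * polytabloid mu t T)"
  unfolding f by (simp add: sum_distrib_left mult.assoc)
 thus ?thesis using spechtI[where mu = mu and c = "\<lambda>t. a * c t"] by simp
qed

lemma specht_sum: "(\<And>i. i \<in> I ==> f i \<in> specht mu) ==> (\<lambda>T. \<Sum>i\<in>I. a i * f i T) \<in> specht mu"
proof (induction I rule: infinite_finite_induct)
 case (insert i I)
 have "(\<lambda>T. a i * f i T) + (\<lambda>T. \<Sum>i\<in>I. a i * f i T) \<in> specht mu"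
  using insert by (intro specht_add specht_scale) auto
 thus ?case using insert by (simp add: plus_fun_def)
qed (simp_all add: specht_zero)

lemma polytabloid_specht: "t \<in> tableaux mu ==> polytabloid mu t \<in> specht mu"
proof -
 assume t: "t \<in> tableaux mu"
 have "(\<Sum>s\<in>tableaux mu. (if s = t then 1 else 0) * polytabloid mu s T) = polytabloid mu t T" for T
 proof -
  have "(\<Sum>s\<in>tableaux mu. (if s = t then 1 else 0) * polytabloid mu s T) =
    (\<Sum>s\<in>tableaux mu. if s = t then polytabloid mu s T else 0)"
   by (rule sum.cong[OF refl]) simp
  also have "\<dots> = polytabloid mu t T" using sum.delta[OF finite_tableaux[of mu], of t] t by simp
  finally show ?thesis .
 qed
 thus ?thesis using spechtI[where mu = mu and c = "\<lambda>s. if s = t then 1 else 0"] by simp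
qed

lemma specht_perm_act:
 assumes s: "s permutes {1..sum_list mu}" and f: "f \<in> specht mu"
 shows "perm_act s f \<in> specht mu"
proof -
 obtain c where f: "f = (\<lambda>T. \<Sum>t\<in>tableaux mu. c t * polytabloid mu t T)" using spechtE[OF f] .
 have "perm_act s f = (\<lambda>T. \<Sum>t\<in>tableaux mu. c t * polytabloid mu (s \<circ> t) T)"
  unfolding f perm_act_sum
  by (intro ext sum.cong refl) (simp add: tableau.perm_act_polytabloid[OF _ s] tableau_def)
 moreover have "s \<circ> t \<in> tableaux mu" if "t \<in> tableaux mu" for t
  using tableau.comp_tableau(1)[OF _ s] that by (simp add: tableau_def)
 ultimately show ?thesis
  using specht_sum[where I = "tableaux mu" and f = "\<lambda>t. polytabloid mu (s \<circ> t)" and mu = mu and a = c]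
   polytabloid_specht by simp
qed

lemma specht_nontrivial: "\<exists>f\<in>specht mu. f \<noteq> 0"
proof -
 obtain t where t: "t \<in> tableaux mu" using tableaux_nonempty by blast
 then interpret tableau mu t by unfold_locales
 have "polytabloid mu t \<noteq> 0" using polytabloid_self by (metis zero_fun_apply zero_neq_one)
 thus ?thesis using polytabloid_specht[OF t] by blast
qed

lemma specht_tabloid_fun: "f \<in> specht mu ==> tabloid_fun mu f"
proof -
 assume "f \<in> specht mu"
 then obtain c where f: "f = (\<lambda>T. \<Sum>t\<in>tableaux mu. c t * polytabloid mu t T)" by (rule spechtE)
 show ?thesis unfolding tabloid_fun_def
 proof (intro allI impI)
  fix T assume "f T \<noteq> 0"
  then obtain t where t0: "t \<in> tableaux mu" "c t * polytabloid mu t T \<noteq> 0"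
   unfolding f using sum.not_neutral_contains_not_neutral[of "\<lambda>t. c t * polytabloid mu t T"] by blast
  then interpret tableau mu t by unfold_locales
  show "T \<in> tabloids mu" using tabloid_fun_polytabloid t0(2) unfolding tabloid_fun_def by auto
 qed
qed

lemma finite_tabloids: "finite (tabloids mu)"
 unfolding tabloids_def using finite_tableaux by simp

text \<open>Evaluating the antisymmetrised function at the tabloid of t is pairing with the
  polytabloid, because the antisymmetriser is self-adjoint (substitute p by its inverse).\<close>

lemma (in tableau) kappa_at_R: "kappa f R = (\<Sum>T\<in>tabloids mu. polytabloid mu t T * f T)"
 if f: "tabloid_fun mu f"
proof -
 have "kappa f R = (\<Sum>p\<in>col_stab mu t. of_int (sign p) * f (R \<circ> p))"
  by (simp add: kappa_def perm_act_def)
 also have "\<dots> = (\<Sum>p\<in>col_stab mu t. of_int (sign p) * f (R \<circ> inv p))"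
 proof (rule sum.reindex_bij_witness[where i = inv and j = inv])
  fix p assume p: "p \<in> col_stab mu t"
  note pp = col_stab_permutes[OF p]
  show "inv (inv p) = p" using permutes_inv_inv[OF pp] .
  show "inv p \<in> col_stab mu t" by (rule inv_col_stab[OF p])
  show "of_int (sign (inv p)) * f (R \<circ> inv (inv p)) = of_int (sign p) * f (R \<circ> p)"
   using permutes_inv_inv[OF pp] sign_inv_perm[OF pp] by simp
  show "inv (inv p) = p" using permutes_inv_inv[OF pp] .
  show "inv p \<in> col_stab mu t" by (rule inv_col_stab[OF p])
 qed
 also have "\<dots> = (\<Sum>p\<in>col_stab mu t. \<Sum>T\<in>tabloids mu. (if R \<circ> inv p = T then of_int (sign p) else 0) * f T)"
 proof (intro sum.cong refl)
  fix p assume p: "p \<in> col_stab mu t"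
  have "R \<in> tabloids mu" using t unfolding tabloids_def by blast
  hence "R \<circ> inv p \<in> tabloids mu" by (rule tabloids_comp[OF col_stab_permutes[OF inv_col_stab[OF p]]])
  thus "of_int (sign p) * f (R \<circ> inv p) = (\<Sum>T\<in>tabloids mu. (if R \<circ> inv p = T then of_int (sign p) else 0) * f T)"
   using finite_tabloids by (simp add: if_distrib[of "\<lambda>c. c * _"] sum.delta' cong: if_cong)
 qed
 also have "\<dots> = (\<Sum>T\<in>tabloids mu. polytabloid mu t T * f T)"
  unfolding polytabloid_eq by (subst sum.swap) (simp add: sum_distrib_right)
 finally show ?thesis .
qed

lemma (in tableau) polytabloid_real: "cnj (polytabloid mu t T) = polytabloid mu t T"
 unfolding polytabloid_eq cnj_sum by (intro sum.cong refl) auto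

text \<open>If every \<open>kappa\<close> killed f, then f would be orthogonal to all polytabloids,
  which are real, and so to itself. Hence some \<open>kappa\<close> of f is nonzero; by
  \<open>alternating_eq\<close> it is a multiple of a polytabloid, whose translates span the Specht
  module.\<close>

lemma specht_irreducible:
 assumes mu: "sorted_wrt (\<ge>) mu" and f: "f \<in> specht mu" "f \<noteq> 0" and g: "g \<in> specht mu"
 shows "\<exists>c. g = (\<lambda>T. \<Sum>s | s permutes {1..sum_list mu}. c s * perm_act s f T)"
proof -
 let ?G = "{s. s permutes {1..sum_list mu}}"
 note ft = specht_tabloid_fun[OF f(1)]
 obtain c where fc: "f = (\<lambda>T. \<Sum>t\<in>tableaux mu. c t * polytabloid mu t T)" using spechtE[OF f(1)] .
 have finG: "finite ?G" by (simp add: finite_permutations)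
 have "\<exists>t\<in>tableaux mu. tableau.kappa mu t f \<noteq> 0"
 proof (rule ccontr)
  assume "\<not> (\<exists>t\<in>tableaux mu. tableau.kappa mu t f \<noteq> 0)"
  hence k: "tableau.kappa mu t f = 0" if "t \<in> tableaux mu" for t using that by blast
  have z: "(\<Sum>T\<in>tabloids mu. polytabloid mu t T * f T) = 0" if t: "t \<in> tableaux mu" for t
  proof -
   interpret tableau mu t using t by unfold_locales
   show ?thesis using kappa_at_R[OF ft] k[OF t] by simp
  qed
  have "(\<Sum>T\<in>tabloids mu. cnj (f T) * f T) = (\<Sum>T\<in>tabloids mu. \<Sum>t\<in>tableaux mu. cnj (c t) * (polytabloid mu t T * f T))"
  proof (intro sum.cong refl)
   fix T
   have "cnj (f T) = (\<Sum>t\<in>tableaux mu. cnj (c t) * polytabloid mu t T)"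
    by (subst fc) (auto simp: tableau.polytabloid_real tableau_def intro!: sum.cong)
   thus "cnj (f T) * f T = (\<Sum>t\<in>tableaux mu. cnj (c t) * (polytabloid mu t T * f T))"
    by (simp add: sum_distrib_right mult.assoc)
  qed
  also have "\<dots> = (\<Sum>t\<in>tableaux mu. cnj (c t) * (\<Sum>T\<in>tabloids mu. polytabloid mu t T * f T))"
   by (subst sum.swap) (simp add: sum_distrib_left)
  also have "\<dots> = 0" using z by simp
  finally have "(\<Sum>T\<in>tabloids mu. complex_of_real ((cmod (f T))\<^sup>2)) = 0"
   by (simp only: mult.commute[of "cnj _"] complex_norm_square)
  hence "(\<Sum>T\<in>tabloids mu. (cmod (f T))\<^sup>2) = 0"
   unfolding of_real_sum[symmetric] of_real_eq_0_iff .
  hence "f T = 0" if "T \<in> tabloids mu" for T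
   using that finite_tabloids by (simp add: sum_nonneg_eq_0_iff)
  hence "f = 0" using ft unfolding tabloid_fun_def by (auto simp: fun_eq_iff)
  thus False using f(2) by blast
 qed
 then obtain t where t0: "t \<in> tableaux mu" "tableau.kappa mu t f \<noteq> 0" by blast
 interpret tableau mu t using t0(1) by unfold_locales
 define a where "a = kappa f R"
 have ka: "kappa f = (\<lambda>T. a * polytabloid mu t T)"
  unfolding a_def by (rule alternating_eq[OF mu kappa_alternating tabloid_fun_kappa[OF ft]])
 hence a0: "a \<noteq> 0" using t0(2) by (auto simp: zero_fun_def)
 have gen: "\<exists>e. polytabloid mu u = (\<lambda>T. \<Sum>s\<in>?G. e s * perm_act s f T)" if u: "u \<in> tableaux mu" for u
 proof -
  interpret u: tableau mu u using u by unfold_locales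
  define s where "s j = (if j \<in> M then u (pos j) else j)" for j
  have "bij_betw (u \<circ> pos) M M" by (rule bij_betw_trans[OF bij_betw_the_inv_into[OF bij] u.bij])
  hence "bij_betw s M M" by (rule bij_betw_cong[THEN iffD1, rotated]) (simp add: s_def)
  hence s: "s permutes M" by (rule bij_imp_permutes) (auto simp: s_def)
  have "s \<circ> t = u"
  proof
   fix x show "(s \<circ> t) x = u x"
   proof (cases "x \<in> cells mu")
    case True thus ?thesis using tM pos(3) by (simp add: s_def)
   next
    case False
    hence "t x = 0" "u x = 0" using t0(1) u unfolding tableaux_def by blast+
    thus ?thesis by (simp add: s_def)
   qed
  qed
  hence "polytabloid mu u = perm_act s (polytabloid mu t)" using perm_act_polytabloid[OF s] by simp
  also have "polytabloid mu t = (\<lambda>T. \<Sum>p\<in>col_stab mu t. (of_int (sign p) / a) * perm_act p f T)"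
   using ka a0 by (simp add: kappa_def fun_eq_iff field_simps flip: sum_divide_distrib)
  finally have 1: "polytabloid mu u = (\<lambda>T. \<Sum>p\<in>col_stab mu t. (of_int (sign p) / a) * perm_act (s \<circ> p) f T)"
   unfolding perm_act_sum perm_act_comp .
  \<comment> \<open>The coefficients, given on the coset of s by the column stabiliser, are extended
    by 0 to the whole group.\<close>
  let ?e = "\<lambda>q :: nat => nat. if inv s \<circ> q \<in> col_stab mu t then of_int (sign (inv s \<circ> q)) / a else 0"
  have "polytabloid mu u T = (\<Sum>s\<in>?G. ?e s * perm_act s f T)" for T
  proof -
   have "(\<Sum>q\<in>?G. ?e q * perm_act q f T) = (\<Sum>q\<in>{q \<in> ?G. inv s \<circ> q \<in> col_stab mu t}. (of_int (sign (inv s \<circ> q)) / a) * perm_act q f T)"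
    by (rule sum.mono_neutral_cong_right[OF finG]) auto
   also have "\<dots> = (\<Sum>p\<in>col_stab mu t. (of_int (sign p) / a) * perm_act (s \<circ> p) f T)"
   proof (rule sum.reindex_bij_witness[where i = "\<lambda>p. s \<circ> p" and j = "\<lambda>q. inv s \<circ> q"])
    fix q :: "nat => nat"
    show "s \<circ> (inv s \<circ> q) = q" using permutes_inv_o(1)[OF s] by (simp add: o_assoc)
    show "of_int (sign (inv s \<circ> q)) / a * perm_act (s \<circ> (inv s \<circ> q)) f T = of_int (sign (inv s \<circ> q)) / a * perm_act q f T"
     using permutes_inv_o(1)[OF s] by (simp add: o_assoc)
   next
    fix p assume p: "p \<in> col_stab mu t"
    show e: "inv s \<circ> (s \<circ> p) = p" using permutes_inv_o(2)[OF s] by (simp add: o_assoc)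
    show "s \<circ> p \<in> {q \<in> ?G. inv s \<circ> q \<in> col_stab mu t}"
     unfolding mem_Collect_eq e using p permutes_compose[OF col_stab_permutes[OF p] s] by blast
   qed auto
   finally show ?thesis unfolding 1 by simp
  qed
  thus ?thesis by (intro exI[of _ ?e]) (simp add: fun_eq_iff)
 qed
 define e where "e u = (SOME e. polytabloid mu u = (\<lambda>T. \<Sum>s\<in>?G. e s * perm_act s f T))" for u
 have e: "polytabloid mu u = (\<lambda>T. \<Sum>s\<in>?G. e u s * perm_act s f T)" if "u \<in> tableaux mu" for u
  unfolding e_def by (rule someI_ex[OF gen[OF that]])
 obtain b where gb: "g = (\<lambda>T. \<Sum>u\<in>tableaux mu. b u * polytabloid mu u T)" using spechtE[OF g] .
 have "g = (\<lambda>T. \<Sum>s\<in>?G. (\<Sum>u\<in>tableaux mu. b u * e u s) * perm_act s f T)"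
 proof
  fix T
  have "g T = (\<Sum>u\<in>tableaux mu. b u * (\<Sum>s\<in>?G. e u s * perm_act s f T))"
   unfolding gb by (intro sum.cong refl) (simp add: e)
  also have "\<dots> = (\<Sum>s\<in>?G. \<Sum>u\<in>tableaux mu. b u * (e u s * perm_act s f T))"
   unfolding sum_distrib_left by (rule sum.swap)
  also have "\<dots> = (\<Sum>s\<in>?G. (\<Sum>u\<in>tableaux mu. b u * e u s) * perm_act s f T)"
   by (simp add: sum_distrib_right mult.assoc)
  finally show "g T = (\<Sum>s\<in>?G. (\<Sum>u\<in>tableaux mu. b u * e u s) * perm_act s f T)" .
 qed
 thus ?thesis by (rule exI[of _ "\<lambda>s. \<Sum>u\<in>tableaux mu. b u * e u s"])
qed

section \<open>The shape is determined by the isomorphism class\<close>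

lemma partition_eqI:
 fixes la mu :: "nat list"
 assumes pos: "\<forall>x\<in>set la. 0 < x" "\<forall>x\<in>set mu. 0 < x"
  and c: "\<And>r. (if r < length la then la ! r else 0) = (if r < length mu then mu ! r else 0)"
 shows "la = mu"
proof -
 have len: "r < length l \<longleftrightarrow> (if r < length l then l ! r else 0) \<noteq> 0" if "\<forall>x\<in>set l. 0 < x" for r and l :: "nat list"
  using that nth_mem[of r l] by auto
 have "r < length la \<longleftrightarrow> r < length mu" for r using len[OF pos(1), of r] len[OF pos(2), of r] c[of r] by simp
 hence L: "length la = length mu" by (meson linorder_neqE_nat less_irrefl)
 show ?thesis
 proof (rule nth_equalityI[OF L])
  fix r assume "r < length la"
  thus "la ! r = mu ! r" using c[of r] L by simp
 qed
qed

text \<open>An alternating vector for the columns of a tableau of shape la can only be supported on tabloids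
 of shape mu that separate these columns, which bounds the sum of the row labels of mu from below.\<close>
lemma alternating_tabloid_fun_le:
 assumes la: "sorted_wrt (\<ge>) la" and sz: "sum_list la = sum_list mu"
  and t: "t \<in> tableaux la" and f: "tableau.alternating la t f" "tabloid_fun mu f" "f \<noteq> 0"
 shows "(\<Sum>r<length la. r * la ! r) \<le> (\<Sum>r<length mu. r * mu ! r)"
  and "(\<Sum>r<length la. r * la ! r) = (\<Sum>r<length mu. r * mu ! r) ==>
   (if r < length la then la ! r else 0) = (if r < length mu then mu ! r else 0)"
proof -
 interpret tableau la t using t by unfold_locales
 obtain T where T: "f T \<noteq> 0" using f(3) by (auto simp: fun_eq_iff)
 then obtain t' where t': "t' \<in> tableaux mu" "T = tabloid_of mu t'"
  using f(2) unfolding tabloid_fun_def tabloids_def by blast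
 interpret t': tableau mu t' using t'(1) by unfold_locales
 have sep: "a = b" if "a \<in> M" "b \<in> M" "T a = T b" "C a = C b" for a b
  using alternating_vanish[OF f(1) that(1,2) _ that(3,4)] T by blast
 have sT: "(\<Sum>a\<in>M. T a) = (\<Sum>r<length mu. r * mu ! r)" using t'.sum_rows t' sz by simp
 have sR: "(\<Sum>j\<in>C ` M. \<Sum>{..<card {a \<in> M. C a = j}}) = (\<Sum>r<length la. r * la ! r)"
  using sum_columns[OF la] sum_rows by simp
 show "(\<Sum>r<length la. r * la ! r) \<le> (\<Sum>r<length mu. r * mu ! r)"
  using sum_labels_ge(1)[of M T C] sep unfolding sT sR by blast
 assume eq: "(\<Sum>r<length la. r * la ! r) = (\<Sum>r<length mu. r * mu ! r)"
 have col: "T ` {a \<in> M. C a = j} = R ` {a \<in> M. C a = j}" if "j \<in> C ` M" for j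
  unfolding column_rows[OF la] by (rule sum_labels_ge(2)[OF _ sep]) (use that eq sT sR in auto)
 \<comment> \<open>Entries with label r lie in distinct columns, so they are counted by the columns
   in which r occurs.\<close>
 have cnt: "card {a \<in> M. f a = r} = card {j \<in> C ` M. r \<in> f ` {a \<in> M. C a = j}}"
  if inj: "\<And>a b. a \<in> M ==> b \<in> M ==> f a = f b ==> C a = C b ==> a = b" for f :: "nat => nat"
 proof -
  have im: "C ` {a \<in> M. f a = r} = {j \<in> C ` M. r \<in> f ` {a \<in> M. C a = j}}"
  proof (intro set_eqI iffI)
   fix j assume "j \<in> {j \<in> C ` M. r \<in> f ` {a \<in> M. C a = j}}"
   then obtain a where "a \<in> M" "C a = j" "f a = r" by blast
   thus "j \<in> C ` {a \<in> M. f a = r}" by blast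
  qed blast
  have "inj_on C {a \<in> M. f a = r}" using inj by (auto simp: inj_on_def)
  thus ?thesis unfolding im[symmetric] by (rule card_image[symmetric])
 qed
 have e: "{j \<in> C ` M. r \<in> T ` {a \<in> M. C a = j}} = {j \<in> C ` M. r \<in> R ` {a \<in> M. C a = j}}"
  by (rule Collect_cong) (use col in blast)
 have "card {a \<in> M. T a = r} = card {j \<in> C ` M. r \<in> T ` {a \<in> M. C a = j}}"
  by (rule cnt) (rule sep)
 moreover have "card {a \<in> M. R a = r} = card {j \<in> C ` M. r \<in> R ` {a \<in> M. C a = j}}"
  by (rule cnt) (rule RC_inj)
 ultimately have "card {a \<in> M. T a = r} = card {a \<in> M. R a = r}"
  unfolding e by simp
 thus "(if r < length la then la ! r else 0) = (if r < length mu then mu ! r else 0)"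
  using t'.row_card'[of r] row_card'[of r] t'(2) sz by simp
qed

definition perm_linear :: "nat list => (((nat => nat) => complex) => ((nat => nat) => complex)) => bool" where
 "perm_linear la f \<longleftrightarrow> (\<forall>x\<in>specht la. \<forall>y\<in>specht la. f (x + y) = f x + f y)
   \<and> (\<forall>c. \<forall>x\<in>specht la. f (\<lambda>T. c * x T) = (\<lambda>T. c * f x T))
   \<and> (\<forall>s. s permutes {1..sum_list la} --> (\<forall>x\<in>specht la. f (perm_act s x) = perm_act s (f x)))"

text \<open>The polytabloid of a tableau of shape \<open>la\<close> has nonzero image, and this
  image is again alternating for the same tableau.\<close>

lemma specht_hom_le:
 assumes la: "sorted_wrt (\<ge>) la" and sz: "sum_list la = sum_list mu"
  and f: "perm_linear la f" "\<And>x. x \<in> specht la ==> f x \<in> specht mu" "\<And>x. x \<in> specht la ==> f x = 0 ==> x = 0"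
 shows "(\<Sum>r<length la. r * la ! r) \<le> (\<Sum>r<length mu. r * mu ! r)"
  and "(\<Sum>r<length la. r * la ! r) = (\<Sum>r<length mu. r * mu ! r) ==>
   (if r < length la then la ! r else 0) = (if r < length mu then mu ! r else 0)"
proof -
 obtain t where t: "t \<in> tableaux la" using tableaux_nonempty by blast
 interpret tableau la t using t by unfold_locales
 let ?e = "polytabloid la t"
 have e: "?e \<in> specht la" using polytabloid_specht[OF t] .
 have "perm_act p (f ?e) = (\<lambda>T. of_int (sign p) * f ?e T)" if p: "p \<in> col_stab la t" for p
 proof -
  have "\<forall>s. s permutes M --> (\<forall>x\<in>specht la. f (perm_act s x) = perm_act s (f x))"
   using f(1) unfolding perm_linear_def by (elim conjE)
  hence "perm_act p (f ?e) = f (perm_act p ?e)" using col_stab_permutes[OF p] e by simp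
  also have "perm_act p ?e = (\<lambda>T. of_int (sign p) * ?e T)"
   using kappa_alternating p unfolding polytabloid_kappa alternating_def by blast
  also have "f \<dots> = (\<lambda>T. of_int (sign p) * f ?e T)"
   using f(1) e unfolding perm_linear_def by blast
  finally show ?thesis .
 qed
 hence 1: "alternating (f ?e)" unfolding alternating_def by blast
 have 2: "tabloid_fun mu (f ?e)" using specht_tabloid_fun f(2)[OF e] .
 have "?e \<noteq> 0" using polytabloid_self by (metis zero_fun_apply zero_neq_one)
 hence 3: "f ?e \<noteq> 0" using f(3)[OF e] by blast
 show "(\<Sum>r<length la. r * la ! r) \<le> (\<Sum>r<length mu. r * mu ! r)"
  by (rule alternating_tabloid_fun_le(1)[OF la sz t 1 2 3])
 show "(\<Sum>r<length la. r * la ! r) = (\<Sum>r<length mu. r * mu ! r) ==>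
   (if r < length la then la ! r else 0) = (if r < length mu then mu ! r else 0)"
  by (rule alternating_tabloid_fun_le(2)[OF la sz t 1 2 3])
qed

text \<open>The inequality of \<open>specht_hom_le\<close> for f and its inverse gives equality of
  the label sums, and in the equality case the row lengths agree.\<close>

lemma specht_iso_eq:
 assumes la: "is_int_partition la m" and mu: "is_int_partition mu m"
  and f: "bij_betw f (specht la) (specht mu)" "perm_linear la f"
 shows "la = mu"
proof -
 have s: "sorted_wrt (\<ge>) la" "sorted_wrt (\<ge>) mu" "sum_list la = m" "sum_list mu = m"
  and pos: "\<forall>x\<in>set la. 0 < x" "\<forall>x\<in>set mu. 0 < x"
  using la mu by (auto simp: is_int_partition_def)
 have add: "f (x + y) = f x + f y" if "x \<in> specht la" "y \<in> specht la" for x y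
  using f(2) that unfolding perm_linear_def by blast
 have sc: "f (\<lambda>T. c * x T) = (\<lambda>T. c * f x T)" if "x \<in> specht la" for x c
  using f(2) that unfolding perm_linear_def by blast
 have pa: "f (perm_act p x) = perm_act p (f x)" if "p permutes {1..m}" "x \<in> specht la" for p x
  using f(2) that s unfolding perm_linear_def by simp
 have f0: "f 0 = 0"
  using sc[OF specht_zero(2), of 0] by (simp add: zero_fun_def)
 have inj: "x = y" if "x \<in> specht la" "y \<in> specht la" "f x = f y" for x y
  using f(1) that unfolding bij_betw_def inj_on_def by blast
 have img: "f x \<in> specht mu" if "x \<in> specht la" for x using bij_betwE[OF f(1)] that by blast
 define g where "g = the_inv_into (specht la) f"
 have g: "g y \<in> specht la" "f (g y) = y" if "y \<in> specht mu" for y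
  using bij_betwE[OF bij_betw_the_inv_into[OF f(1)]] f_the_inv_into_f_bij_betw[OF f(1)] that
  unfolding g_def by blast+
 have gl: "perm_linear mu g"
  unfolding perm_linear_def
 proof (intro conjI ballI allI impI)
  fix x y assume "x \<in> specht mu" "y \<in> specht mu"
  thus "g (x + y) = g x + g y"
   by - (rule inj, simp_all add: g add specht_add)
 next
  fix c x assume x: "x \<in> specht mu"
  thus "g (\<lambda>T. c * x T) = (\<lambda>T. c * g x T)"
   by - (rule inj, simp_all add: g sc specht_scale)
 next
  fix p x assume p: "p permutes {1..sum_list mu}" and x: "x \<in> specht mu"
  have p': "p permutes {1..m}" using p s by simp
  have px: "perm_act p x \<in> specht mu" by (rule specht_perm_act[OF p x])
  have "perm_act p (g x) \<in> specht la" by (rule specht_perm_act) (use p s g(1)[OF x] in simp_all)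
  thus "g (perm_act p x) = perm_act p (g x)"
   by (rule inj[OF g(1)[OF px]]) (simp add: g[OF px] g[OF x] pa[OF p' g(1)[OF x]])
 qed
 have inj0: "x = 0" if "x \<in> specht la" "f x = 0" for x using inj[OF that(1) specht_zero(2)] that(2) f0 by simp
 have inj0': "y = 0" if "y \<in> specht mu" "g y = 0" for y using g(2)[OF that(1)] that(2) f0 by simp
 have "(\<Sum>r<length la. r * la ! r) \<le> (\<Sum>r<length mu. r * mu ! r)"
  by (rule specht_hom_le(1)[OF s(1) _ f(2) img inj0]) (simp_all add: s)
 moreover have "(\<Sum>r<length mu. r * mu ! r) \<le> (\<Sum>r<length la. r * la ! r)"
  by (rule specht_hom_le(1)[OF s(2) _ gl g(1) inj0']) (simp_all add: s)
 ultimately have eq: "(\<Sum>r<length la. r * la ! r) = (\<Sum>r<length mu. r * mu ! r)" by simp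
 show ?thesis
 proof (rule partition_eqI[OF pos])
  show "(if r < length la then la ! r else 0) = (if r < length mu then mu ! r else 0)" for r
   by (rule specht_hom_le(2)[OF s(1) _ f(2) img inj0 eq]) (simp_all add: s)
 qed
qed

subsection \<open>Every irreducible representation of a symmetric group is a Specht module\<close>

text \<open>Irreducibility is encoded as spanning by the orbit of any nonzero vector, which is the
  form in which it is both available from and returned to the diagram modules.\<close>

locale perm_rep =
 fixes m :: nat and V :: "'v::ab_group_add set" and sc :: "complex => 'v => 'v" and ac :: "(nat => nat) => 'v => 'v"
 assumes V0: "0 \<in> V" and Vadd: "x \<in> V ==> y \<in> V ==> x + y \<in> V"
  and sc_in: "x \<in> V ==> sc a x \<in> V" and ac_in: "p permutes {1..m} ==> x \<in> V ==> ac p x \<in> V"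
  and sc_add: "x \<in> V ==> sc (a + b) x = sc a x + sc b x"
  and sc_dist: "x \<in> V ==> y \<in> V ==> sc a (x + y) = sc a x + sc a y"
  and sc_mult: "x \<in> V ==> sc (a * b) x = sc a (sc b x)" and sc_one: "x \<in> V ==> sc 1 x = x"
  and ac_add: "p permutes {1..m} ==> x \<in> V ==> y \<in> V ==> ac p (x + y) = ac p x + ac p y"
  and ac_sc: "p permutes {1..m} ==> x \<in> V ==> ac p (sc a x) = sc a (ac p x)"
  and ac_comp: "p permutes {1..m} ==> q permutes {1..m} ==> x \<in> V ==> ac (p \<circ> q) x = ac p (ac q x)"
  and ac_id: "x \<in> V ==> ac id x = x"
  and irred: "x \<in> V ==> x \<noteq> 0 ==> y \<in> V ==> \<exists>c. y = (\<Sum>p | p permutes {1..m}. sc (c p) (ac p x))"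
  and nontriv: "\<exists>x\<in>V. x \<noteq> 0"
begin

abbreviation "M \<equiv> {1..m}"
abbreviation "S \<equiv> {p. p permutes {1..m}}"

lemma finS [simp]: "finite S" by (simp add: finite_permutations)

lemma sc_zero_right [simp]: "sc a 0 = 0"
 using sc_dist[OF V0 V0, of a] by simp

lemma sc_zero_left: "x \<in> V ==> sc 0 x = 0"
 using sc_add[of x 0 0] by simp

lemma ac_zero: "p permutes M ==> ac p 0 = 0"
 using ac_add[OF _ V0 V0, of p] by simp

lemma sum_in: "(\<And>i. i \<in> I ==> f i \<in> V) ==> (\<Sum>i\<in>I. f i) \<in> V"
 by (induction I rule: infinite_finite_induct) (auto intro: V0 Vadd)

lemma sc_sum: "(\<And>i. i \<in> I ==> f i \<in> V) ==> sc a (\<Sum>i\<in>I. f i) = (\<Sum>i\<in>I. sc a (f i))"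
 by (induction I rule: infinite_finite_induct) (auto simp: sc_dist sum_in)

lemma ac_sum: "p permutes M ==> (\<And>i. i \<in> I ==> f i \<in> V) ==> ac p (\<Sum>i\<in>I. f i) = (\<Sum>i\<in>I. ac p (f i))"
 by (induction I rule: infinite_finite_induct) (auto simp: ac_add sum_in ac_zero)

lemma ac_sum2:
 assumes p: "p permutes M" and f: "\<And>i j. i \<in> I ==> j \<in> J ==> f i j \<in> V"
 shows "ac p (\<Sum>i\<in>I. \<Sum>j\<in>J. f i j) = (\<Sum>i\<in>I. \<Sum>j\<in>J. ac p (f i j))"
proof -
 have "ac p (\<Sum>i\<in>I. \<Sum>j\<in>J. f i j) = (\<Sum>i\<in>I. ac p (\<Sum>j\<in>J. f i j))"
  by (rule ac_sum[OF p]) (rule sum_in, rule f)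
 also have "\<dots> = (\<Sum>i\<in>I. \<Sum>j\<in>J. ac p (f i j))"
  by (rule sum.cong[OF refl]) (rule ac_sum[OF p], rule f)
 finally show ?thesis .
qed

lemma sc_sum2:
 assumes f: "\<And>i j. i \<in> I ==> j \<in> J ==> f i j \<in> V"
 shows "sc a (\<Sum>i\<in>I. \<Sum>j\<in>J. f i j) = (\<Sum>i\<in>I. \<Sum>j\<in>J. sc a (f i j))"
proof -
 have "sc a (\<Sum>i\<in>I. \<Sum>j\<in>J. f i j) = (\<Sum>i\<in>I. sc a (\<Sum>j\<in>J. f i j))"
  by (rule sc_sum) (rule sum_in, rule f)
 also have "\<dots> = (\<Sum>i\<in>I. \<Sum>j\<in>J. sc a (f i j))"
  by (rule sum.cong[OF refl]) (rule sc_sum, rule f)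
 finally show ?thesis .
qed

lemma sc_sum_left: "x \<in> V ==> sc (\<Sum>i\<in>I. a i) x = (\<Sum>i\<in>I. sc (a i) x)"
 by (induction I rule: infinite_finite_induct) (auto simp: sc_add sc_zero_left)

lemma sum_const_sc: "x \<in> V ==> (\<Sum>i\<in>I. x) = sc (of_nat (card I)) x"
 using sc_sum_left[of x "\<lambda>_. 1" I] by (simp add: sc_one)

lemma sc_minus: "x \<in> V ==> sc (- a) x = - sc a x"
 using sc_add[of x a "- a"] sc_zero_left[of x] by (simp add: eq_neg_iff_add_eq_0 add.commute)

lemma sc_eq_0: "x \<in> V ==> sc a x = 0 ==> a \<noteq> 0 ==> x = 0"
 using sc_mult[of x "1 / a" a] sc_one[of x] by simp

section \<open>The eigenvalue of the sum of transpositions\<close>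

lemma trans_perm: "a \<in> M ==> b \<in> M ==> transpose a b permutes M"
 by (rule permutes_swap_id)

text \<open>The sum runs over ordered pairs including a = b, so this is m times the identity plus
  twice the class sum of the transpositions, a central element.\<close>

definition tsum :: "'v => 'v" where
 "tsum x = (\<Sum>a\<in>M. \<Sum>b\<in>M. ac (transpose a b) x)"

text \<open>Invariance under the Young subgroup that preserves the labels, thought of as
  rows.\<close>

definition fixes_labels :: "(nat => nat) => 'v => bool" where
 "fixes_labels T v \<longleftrightarrow> v \<in> V \<and> (\<forall>p. p permutes M --> T \<circ> p = T --> ac p v = v)"

definition labels :: "(nat => nat) set" where
 "labels = {T. \<forall>j. (j \<in> M --> T j \<in> {..<m}) \<and> (j \<notin> M --> T j = 0)}"

lemma tsum_comm:
 assumes s: "s permutes M" and x: "x \<in> V"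
 shows "ac s (tsum x) = tsum (ac s x)"
proof -
 have "ac s (tsum x) = (\<Sum>a\<in>M. \<Sum>b\<in>M. ac s (ac (transpose a b) x))"
  unfolding tsum_def by (rule ac_sum2[OF s]) (rule ac_in[OF trans_perm x])
 also have "\<dots> = (\<Sum>a\<in>M. \<Sum>b\<in>M. ac (transpose (s a) (s b)) (ac s x))"
 proof (intro sum.cong[OF refl])
  fix a b assume ab: "a \<in> M" "b \<in> M"
  have sab: "s a \<in> M" "s b \<in> M" using ab permutes_in_image[OF s] by blast+
  have "s \<circ> transpose a b = transpose (s a) (s b) \<circ> s"
   using transpose_comp_eq[of s] permutes_bij[OF s]
   by (auto simp: fun_eq_iff transpose_def permutes_inj[OF s, THEN inj_eq])
  thus "ac s (ac (transpose a b) x) = ac (transpose (s a) (s b)) (ac s x)"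
   using ac_comp[OF s trans_perm[OF ab] x] ac_comp[OF trans_perm[OF sab] s x] by simp
 qed
 also have "\<dots> = (\<Sum>a\<in>M. \<Sum>b\<in>M. ac (transpose a b) (ac s x))"
 proof -
  have b: "bij_betw s M M" by (rule permutes_imp_bij[OF s])
  have "(\<Sum>b\<in>M. ac (transpose (s a) (s b)) (ac s x)) = (\<Sum>b\<in>M. ac (transpose (s a) b) (ac s x))" for a
   using sum.reindex_bij_betw[OF b, of "\<lambda>b. ac (transpose (s a) b) (ac s x)"] .
  thus ?thesis
   using sum.reindex_bij_betw[OF b, of "\<lambda>a. \<Sum>b\<in>M. ac (transpose a b) (ac s x)"] by simp
 qed
 finally show ?thesis by (simp add: tsum_def)
qed

text \<open>Moving b to an earlier row i: symmetrising over the enlarged row gives a vector fixed by the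
 row stabiliser of the new labelling.\<close>
lemma raise_fixed:
 assumes v: "fixes_labels T v" and b: "b \<in> M"
 shows "fixes_labels (T(b := i)) (\<Sum>a\<in>{a \<in> M. T a = i \<or> a = b}. ac (transpose a b) v)"
 unfolding fixes_labels_def
proof (intro conjI allI impI)
 let ?X = "{a \<in> M. T a = i \<or> a = b}" and ?T = "T(b := i)"
 have vV: "v \<in> V" using v unfolding fixes_labels_def by blast
 have aV: "ac (transpose a b) v \<in> V" if "a \<in> ?X" for a using that b vV ac_in trans_perm by simp
 show "(\<Sum>a\<in>?X. ac (transpose a b) v) \<in> V" using aV by (rule sum_in)
 fix p assume p: "p permutes M" and Tp: "?T \<circ> p = ?T"
 have Tp': "?T (p c) = ?T c" for c using Tp by (metis comp_apply)
 have inj: "p c = p d \<longleftrightarrow> c = d" for c d using permutes_inj[OF p] by (simp add: inj_eq)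
 have pX: "p a \<in> ?X" if "a \<in> ?X" for a
 proof -
  have "p a \<in> M" using that permutes_in_image[OF p] by blast
  moreover have "?T (p a) = i" using Tp'[of a] that by auto
  ultimately show ?thesis by (auto split: if_splits)
 qed
 have "ac p (\<Sum>a\<in>?X. ac (transpose a b) v) = (\<Sum>a\<in>?X. ac p (ac (transpose a b) v))"
  using aV by (rule ac_sum[OF p])
 also have "\<dots> = (\<Sum>a\<in>?X. ac (transpose (p a) b) v)"
 proof (rule sum.cong[OF refl])
  fix a assume a: "a \<in> ?X"
  \<comment> \<open>Chosen so that p after the transposition of a and b equals the transposition of
    p a and b after \<open>h\<close>. It preserves the old labels T and therefore fixes v.\<close>
  define h where "h = transpose (p a) b \<circ> (p \<circ> transpose a b)"
  have aM: "a \<in> M" and paM: "p a \<in> M" using a pX[OF a] by blast+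
  have h: "h permutes M"
   unfolding h_def by (intro permutes_compose trans_perm p aM paM b)
  have Ta: "?T a = i" "?T (p a) = i" using a Tp'[of a] by auto
  have "T (h c) = T c" for c
  proof -
   consider "c = b" | "c = a" "a \<noteq> b" | "c \<noteq> a" "c \<noteq> b" by blast
   thus ?thesis
   proof cases
    case 1
    thus ?thesis by (simp add: h_def)
   next
    case 2
    have "T a = i" using Ta(1) 2 by simp
    moreover have "T (h a) = i"
    proof (cases "p b = b")
     case True
     hence "p a \<noteq> b" using inj 2 by metis
     thus ?thesis using Ta(2) True by (simp add: h_def)
    next
     case False
     have "?T (p b) = i" using Tp'[of b] by simp
     moreover have "p b \<noteq> p a" using inj 2 by metis
     ultimately show ?thesis using False by (simp add: h_def transpose_def)
    qed
    ultimately show ?thesis using 2 by simp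
   next
    case 3
    hence pca: "p c \<noteq> p a" using inj by metis
    have e: "?T (p c) = T c" using Tp'[of c] 3 by simp
    show ?thesis
    proof (cases "p c = b")
     case True
     hence "T c = i" using e by simp
     moreover have "p a \<noteq> b" using True pca by metis
     ultimately show ?thesis using 3 True Ta(2) by (simp add: h_def transpose_def)
    next
     case False
     thus ?thesis using 3 e pca by (simp add: h_def transpose_def)
    qed
   qed
  qed
  hence "ac h v = v" using v h unfolding fixes_labels_def by (simp add: fun_eq_iff)
  moreover have "p \<circ> transpose a b = transpose (p a) b \<circ> h"
   by (simp add: h_def fun_eq_iff)
  ultimately show "ac p (ac (transpose a b) v) = ac (transpose (p a) b) v"
   using ac_comp[OF p trans_perm[OF aM b] vV] ac_comp[OF trans_perm[OF paM b] h vV] by simp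
 qed
 also have "\<dots> = (\<Sum>a\<in>?X. ac (transpose a b) v)"
 proof -
  have ij: "inj_on p ?X" using permutes_inj[OF p] inj_on_subset by blast
  have "p ` ?X \<subseteq> ?X" using pX by blast
  hence "p ` ?X = ?X" using endo_inj_surj[OF _ _ ij] by simp
  thus ?thesis using sum.reindex[OF ij, of "\<lambda>a. ac (transpose a b) v"] by simp
 qed
 finally show "ac p (\<Sum>a\<in>?X. ac (transpose a b) v) = (\<Sum>a\<in>?X. ac (transpose a b) v)" .
qed

text \<open>Take T with least label sum among the labellings whose Young subgroup fixes a nonzero v.
  Then \<open>raise_fixed\<close> yields 0 for every move to an earlier row, so the transpositions
  of b with row i add up to -1 on v. Together with the transpositions inside rows, which fix v, this
  computes \<open>tsum v\<close>; centrality and cyclicity extend the scalar to V. The scalar is m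
  plus twice the sum of the contents of the cells (i, 0), (i, 1), ... filling row i.\<close>

lemma content_eigenvalue:
 "\<exists>T\<in>labels. \<exists>v. v \<noteq> 0 \<and> fixes_labels T v \<and>
   (\<forall>x\<in>V. tsum x = sc (of_nat (\<Sum>a\<in>M. card {b \<in> M. T b = T a}) - 2 * of_nat (\<Sum>a\<in>M. T a)) x)"
proof -
 define L where "L = {T \<in> labels. \<exists>v. v \<noteq> 0 \<and> fixes_labels T v}"
 have "finite labels" unfolding labels_def by (rule finite_set_of_finite_funs) auto
 hence finL: "finite L" unfolding L_def by simp
 obtain v0 where v0: "v0 \<in> V" "v0 \<noteq> 0" using nontriv by blast
 \<comment> \<open>Every entry has its own row, so the Young subgroup is trivial and any vector
   qualifies; entries start at 1 but labels at 0.\<close>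
 define T0 where "T0 j = (if j \<in> M then j - 1 else 0)" for j
 have "fixes_labels T0 v0"
  unfolding fixes_labels_def
 proof (intro conjI allI impI)
  fix p assume p: "p permutes M" "T0 \<circ> p = T0"
  have "p j = j" for j
  proof (cases "j \<in> M")
   case True
   hence "p j \<in> M" using permutes_in_image[OF p(1)] by blast
   moreover have "T0 (p j) = T0 j" using p(2) by (metis comp_apply)
   ultimately show ?thesis using True by (auto simp: T0_def)
  qed (use permutes_not_in[OF p(1)] in blast)
  hence "p = id" by auto
  thus "ac p v0 = v0" using ac_id[OF v0(1)] by simp
 qed (rule v0)
 moreover have "T0 \<in> labels" unfolding labels_def T0_def by auto
 ultimately have "T0 \<in> L" unfolding L_def using v0 by blast
 then obtain T where T: "T \<in> L" and min: "\<And>T'. T' \<in> L ==> (\<Sum>a\<in>M. T a) \<le> (\<Sum>a\<in>M. T' a)"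
  using ex_min_if_finite[of "(\<lambda>T. \<Sum>a\<in>M. T a) ` L"] finL by (auto simp: not_less)
 then obtain v where v: "v \<noteq> 0" "fixes_labels T v" unfolding L_def by blast
 have Tl: "T \<in> labels" using T unfolding L_def by blast
 have vV: "v \<in> V" using v(2) unfolding fixes_labels_def by blast
 \<comment> \<open>The summand a = b is v itself, since the transposition is then the identity; the
   others must cancel it.\<close>
 have raise: "(\<Sum>a\<in>{a \<in> M. T a = i}. ac (transpose a b) v) = - v" if b: "b \<in> M" and i: "i < T b" for b i
 proof -
  let ?T = "T(b := i)"
  have "?T \<in> labels" using Tl b i unfolding labels_def by fastforce
  moreover have "(\<Sum>a\<in>M. ?T a) < (\<Sum>a\<in>M. T a)"
   by (rule sum_strict_mono_ex1) (use b i in auto)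
  ultimately have z: "w = 0" if "fixes_labels ?T w" for w using min[of ?T] that unfolding L_def by fastforce
  have "{a \<in> M. T a = i \<or> a = b} = insert b {a \<in> M. T a = i}" using b by auto
  hence "0 = (\<Sum>a\<in>insert b {a \<in> M. T a = i}. ac (transpose a b) v)"
   using z[OF raise_fixed[OF v(2) b, of i]] by simp
  also have "\<dots> = v + (\<Sum>a\<in>{a \<in> M. T a = i}. ac (transpose a b) v)"
   using i by (subst sum.insert) (auto simp: ac_id[OF vV])
  finally show ?thesis by (simp add: eq_neg_iff_add_eq_0 add.commute)
 qed
 let ?g = "\<lambda>a b. ac (transpose a b) v"
 \<comment> \<open>Each of the T b earlier rows contributes -v.\<close>
 have lo: "(\<Sum>b\<in>M. \<Sum>a\<in>{a \<in> M. T a < T b}. ?g a b) = sc (- of_nat (\<Sum>a\<in>M. T a)) v"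
 proof -
  have "(\<Sum>a\<in>{a \<in> M. T a < T b}. ?g a b) = sc (- of_nat (T b)) v" if b: "b \<in> M" for b
  proof -
   have "(\<Sum>a\<in>{a \<in> M. T a < T b}. ?g a b) = (\<Sum>i<T b. \<Sum>a\<in>{a \<in> {a \<in> M. T a < T b}. T a = i}. ?g a b)"
    by (rule sum.group[symmetric]) auto
   also have "\<dots> = (\<Sum>i<T b. - v)"
   proof (rule sum.cong[OF refl])
    fix i assume i: "i \<in> {..<T b}"
    hence "{a \<in> {a \<in> M. T a < T b}. T a = i} = {a \<in> M. T a = i}" by auto
    thus "(\<Sum>a\<in>{a \<in> {a \<in> M. T a < T b}. T a = i}. ?g a b) = - v" using raise[OF b] i by simp
   qed
   also have "\<dots> = - (\<Sum>i<T b. v)" by (simp only: sum_negf)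
   finally show ?thesis using sum_const_sc[OF vV, of "{..<T b}"] sc_minus[OF vV] by simp
  qed
  hence "(\<Sum>b\<in>M. \<Sum>a\<in>{a \<in> M. T a < T b}. ?g a b) = (\<Sum>b\<in>M. sc (- of_nat (T b)) v)" by simp
  also have "\<dots> = sc (- of_nat (\<Sum>a\<in>M. T a)) v"
   using sc_sum_left[OF vV, of "\<lambda>b. - of_nat (T b)" M] by (simp add: sum_negf)
  finally show ?thesis .
 qed
 have eq: "?g a b = v" if ab: "a \<in> M" "b \<in> M" "T a = T b" for a b
  using v(2) trans_perm[OF ab(1,2)] ab(3) unfolding fixes_labels_def by (auto simp: fun_eq_iff transpose_def)
 have diag: "(\<Sum>b\<in>M. \<Sum>a\<in>{a \<in> M. T a = T b}. ?g a b) = sc (of_nat (\<Sum>a\<in>M. card {b \<in> M. T b = T a})) v"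
 proof -
  have "(\<Sum>a\<in>{a \<in> M. T a = T b}. ?g a b) = sc (of_nat (card {a \<in> M. T a = T b})) v" if "b \<in> M" for b
  proof -
   have "(\<Sum>a\<in>{a \<in> M. T a = T b}. ?g a b) = (\<Sum>a\<in>{a \<in> M. T a = T b}. v)"
    by (rule sum.cong[OF refl]) (use eq that in blast)
   thus ?thesis using sum_const_sc[OF vV] by simp
  qed
  thus ?thesis using sc_sum_left[OF vV, of "\<lambda>b. of_nat (card {a \<in> M. T a = T b})" M] by simp
 qed
 have split: "(\<Sum>a\<in>M. f a) = (\<Sum>a\<in>{a \<in> M. T a < T b}. f a) + (\<Sum>a\<in>{a \<in> M. T b < T a}. f a) + (\<Sum>a\<in>{a \<in> M. T a = T b}. f a)" for f :: "nat => 'v" and b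
 proof -
  have "M = {a \<in> M. T a < T b} \<union> {a \<in> M. T b < T a} \<union> {a \<in> M. T a = T b}" by auto
  hence "(\<Sum>a\<in>M. f a) = (\<Sum>a\<in>{a \<in> M. T a < T b} \<union> {a \<in> M. T b < T a} \<union> {a \<in> M. T a = T b}. f a)"
   by (rule arg_cong)
  also have "\<dots> = (\<Sum>a\<in>{a \<in> M. T a < T b} \<union> {a \<in> M. T b < T a}. f a) + (\<Sum>a\<in>{a \<in> M. T a = T b}. f a)"
   by (rule sum.union_disjoint) auto
  also have "(\<Sum>a\<in>{a \<in> M. T a < T b} \<union> {a \<in> M. T b < T a}. f a) = (\<Sum>a\<in>{a \<in> M. T a < T b}. f a) + (\<Sum>a\<in>{a \<in> M. T b < T a}. f a)"
   by (rule sum.union_disjoint) auto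
  finally show ?thesis .
 qed
 have hi: "(\<Sum>b\<in>M. \<Sum>a\<in>{a \<in> M. T b < T a}. ?g a b) = (\<Sum>b\<in>M. \<Sum>a\<in>{a \<in> M. T a < T b}. ?g a b)"
 proof -
  have "(\<Sum>b\<in>M. \<Sum>a\<in>{a \<in> M. T b < T a}. ?g a b) = (\<Sum>a\<in>M. \<Sum>b\<in>{b \<in> M. T b < T a}. ?g a b)"
   by (rule sum.swap_restrict) simp_all
  thus ?thesis by (simp add: transpose_commute)
 qed
 have "tsum v = (\<Sum>b\<in>M. \<Sum>a\<in>M. ?g a b)" unfolding tsum_def by (rule sum.swap)
 also have "\<dots> = (\<Sum>b\<in>M. \<Sum>a\<in>{a \<in> M. T a < T b}. ?g a b) + (\<Sum>b\<in>M. \<Sum>a\<in>{a \<in> M. T b < T a}. ?g a b)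
   + (\<Sum>b\<in>M. \<Sum>a\<in>{a \<in> M. T a = T b}. ?g a b)"
  unfolding sum.distrib[symmetric] by (rule sum.cong[OF refl]) (rule split)
 also have "\<dots> = sc (- of_nat (\<Sum>a\<in>M. T a)) v + sc (- of_nat (\<Sum>a\<in>M. T a)) v + sc (of_nat (\<Sum>a\<in>M. card {b \<in> M. T b = T a})) v"
  unfolding hi lo diag ..
 also have "\<dots> = sc (of_nat (\<Sum>a\<in>M. card {b \<in> M. T b = T a}) - 2 * of_nat (\<Sum>a\<in>M. T a)) v"
  using sc_add[OF vV] by (simp only: sc_add[OF vV, symmetric]) (simp add: algebra_simps)
 finally have tv: "tsum v = sc (of_nat (\<Sum>a\<in>M. card {b \<in> M. T b = T a}) - 2 * of_nat (\<Sum>a\<in>M. T a)) v" (is "_ = sc ?\<alpha> v") .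
 have "tsum x = sc ?\<alpha> x" if x: "x \<in> V" for x
 proof -
  obtain c where c: "x = (\<Sum>p\<in>S. sc (c p) (ac p v))" using irred[OF vV v(1) x] by blast
  have pv: "ac p v \<in> V" if "p \<in> S" for p using that ac_in vV by blast
  have t_add: "tsum (\<Sum>i\<in>I. f i) = (\<Sum>i\<in>I. tsum (f i))" if "\<And>i. i \<in> I ==> f i \<in> V" for I and f :: "(nat => nat) => 'v"
  proof -
   have "tsum (\<Sum>i\<in>I. f i) = (\<Sum>a\<in>M. \<Sum>b\<in>M. \<Sum>i\<in>I. ac (transpose a b) (f i))"
    unfolding tsum_def by (intro sum.cong[OF refl] ac_sum trans_perm that)
   also have "\<dots> = (\<Sum>a\<in>M. \<Sum>i\<in>I. \<Sum>b\<in>M. ac (transpose a b) (f i))"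
    by (rule sum.cong[OF refl]) (rule sum.swap)
   also have "\<dots> = (\<Sum>i\<in>I. \<Sum>a\<in>M. \<Sum>b\<in>M. ac (transpose a b) (f i))" by (rule sum.swap)
   finally show ?thesis by (simp add: tsum_def)
  qed
  have t_sc: "tsum (sc a y) = sc a (tsum y)" if y: "y \<in> V" for a y
  proof -
   have "sc a (tsum y) = (\<Sum>i\<in>M. \<Sum>j\<in>M. sc a (ac (transpose i j) y))"
    unfolding tsum_def by (rule sc_sum2) (rule ac_in[OF trans_perm y])
   also have "\<dots> = tsum (sc a y)"
    unfolding tsum_def by (intro sum.cong[OF refl] ac_sc[symmetric] trans_perm y)
   finally show ?thesis by simp
  qed
  have "tsum x = (\<Sum>p\<in>S. sc (c p) (tsum (ac p v)))"
   unfolding c using t_add[of S "\<lambda>p. sc (c p) (ac p v)"] t_sc pv sc_in by simp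
  also have "\<dots> = (\<Sum>p\<in>S. sc (c p) (ac p (sc ?\<alpha> v)))"
   by (rule sum.cong[OF refl]) (use tsum_comm[OF _ vV] tv in simp)
  also have "\<dots> = (\<Sum>p\<in>S. sc ?\<alpha> (sc (c p) (ac p v)))"
  proof (rule sum.cong[OF refl])
   fix p assume p: "p \<in> S"
   show "sc (c p) (ac p (sc ?\<alpha> v)) = sc ?\<alpha> (sc (c p) (ac p v))"
    using p ac_sc[OF _ vV, of p ?\<alpha>] sc_mult[OF pv[OF p], of "c p" ?\<alpha>] sc_mult[OF pv[OF p], of ?\<alpha> "c p"]
    by (simp add: mult.commute)
  qed
  also have "\<dots> = sc ?\<alpha> x" unfolding c using sc_sum[of S "\<lambda>p. sc (c p) (ac p v)"] pv sc_in by simp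
  finally show ?thesis .
 qed
 thus ?thesis using Tl v by blast
qed

text \<open>The twist of V by the sign is again an irreducible representation; the labels it
  provides will serve as columns.\<close>

lemma sign_rep: "perm_rep m V sc (\<lambda>p x. sc (of_int (sign p)) (ac p x))"
proof
 have fin: "finite M" by simp
 have perm: "permutation p" if "p permutes M" for p using that fin permutation_permutes by blast
 fix p q x y a assume p: "p permutes {1..m}"
 show "x \<in> V ==> sc (of_int (sign p)) (ac p x) \<in> V" using p ac_in sc_in by simp
 show "x \<in> V ==> y \<in> V ==> sc (of_int (sign p)) (ac p (x + y)) = sc (of_int (sign p)) (ac p x) + sc (of_int (sign p)) (ac p y)"
  using p by (simp add: ac_add sc_dist ac_in)
 show "x \<in> V ==> sc (of_int (sign p)) (ac p (sc a x)) = sc a (sc (of_int (sign p)) (ac p x))"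
  using p by (simp add: ac_sc ac_in mult.commute flip: sc_mult)
 assume q: "q permutes {1..m}"
 show "sc (of_int (sign (p \<circ> q))) (ac (p \<circ> q) x) = sc (of_int (sign p)) (ac p (sc (of_int (sign q)) (ac q x)))" if x: "x \<in> V"
  using p q x by (simp add: ac_comp ac_sc ac_in sign_compose[OF perm[OF p] perm[OF q]] flip: sc_mult)
next
 fix x y assume x: "x \<in> V" "x \<noteq> 0" "y \<in> V"
 obtain c where c: "y = (\<Sum>p\<in>S. sc (c p) (ac p x))" using irred[OF x] by blast
 have "sc (c p) (ac p x) = sc (c p * of_int (sign p)) (sc (of_int (sign p)) (ac p x))" if "p \<in> S" for p
  using that x(1) by (simp add: ac_in sign_def flip: sc_mult)
 hence "y = (\<Sum>p\<in>S. sc (c p * of_int (sign p)) (sc (of_int (sign p)) (ac p x)))" unfolding c by simp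
 thus "\<exists>c. y = (\<Sum>p | p permutes {1..m}. sc (c p) (sc (of_int (sign p)) (ac p x)))"
  by (intro exI[of _ "\<lambda>p. c p * of_int (sign p)"])
qed (use V0 Vadd sc_in sc_add sc_dist sc_mult sc_one ac_id nontriv in \<open>simp_all add: sign_id\<close>)

text \<open>The points (T a, Y a) are distinct, and every row and every column of them is an initial
  segment. Hence they form a Young diagram, with as many rows as the first column has
  entries.\<close>

lemma young_diagram_of_labels:
 fixes T Y :: "nat => nat"
 assumes inj: "\<And>a b. a \<in> M ==> b \<in> M ==> T a = T b ==> Y a = Y b ==> a = b"
  and row: "\<And>a. a \<in> M ==> Y ` {b \<in> M. T b = T a} = {..<card {b \<in> M. T b = T a}}"
  and col: "\<And>a. a \<in> M ==> T ` {b \<in> M. Y b = Y a} = {..<card {b \<in> M. Y b = Y a}}"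
  and T0: "\<And>j. j \<notin> M ==> T j = 0"
 shows "\<exists>la t. is_int_partition la m \<and> t \<in> tableaux la \<and> tabloid_of la t = T \<and> (\<forall>a\<in>M. col_of la t a = Y a)"
proof -
 define x where "x r = card {b \<in> M. T b = r}" for r
 define l where "l = card {b \<in> M. Y b = 0}"
 define la where "la = map x [0..<l]"
 have r: "(\<exists>b\<in>M. T b = T a \<and> Y b = c) \<longleftrightarrow> c < x (T a)" if "a \<in> M" for a c
 proof -
  have "(\<exists>b\<in>M. T b = T a \<and> Y b = c) \<longleftrightarrow> c \<in> Y ` {b \<in> M. T b = T a}" by blast
  thus ?thesis unfolding row[OF that] x_def by simp
 qed
 have c: "(\<exists>b\<in>M. Y b = Y a \<and> T b = r) \<longleftrightarrow> r < card {b \<in> M. Y b = Y a}" if "a \<in> M" for a r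
 proof -
  have "(\<exists>b\<in>M. Y b = Y a \<and> T b = r) \<longleftrightarrow> r \<in> T ` {b \<in> M. Y b = Y a}" by blast
  thus ?thesis unfolding col[OF that] by simp
 qed
 have xpos: "0 < x (T a)" if "a \<in> M" for a
  using r[OF that, of "Y a"] that by fastforce
 have zero: "r < l \<longleftrightarrow> (\<exists>b\<in>M. T b = r)" for r
 proof
  assume "r < l"
  hence "{b \<in> M. Y b = 0} \<noteq> {}" unfolding l_def by (metis card.empty not_less_zero)
  then obtain a where a: "a \<in> M" "Y a = 0" by blast
  thus "\<exists>b\<in>M. T b = r" using c[OF a(1), of r] \<open>r < l\<close> unfolding l_def by auto
 next
  assume "\<exists>b\<in>M. T b = r"
  then obtain b where b: "b \<in> M" "T b = r" by blast
  then obtain b' where b': "b' \<in> M" "T b' = r" "Y b' = 0" using r[OF b(1), of 0] xpos[OF b(1)] by auto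
  thus "r < l" using c[OF b'(1), of r] unfolding l_def by auto
 qed
 have cells: "(r', c') \<in> cells la \<longleftrightarrow> (\<exists>b\<in>M. T b = r' \<and> Y b = c')" for r' c'
 proof -
  have "(r', c') \<in> cells la \<longleftrightarrow> r' < l \<and> c' < x r'" by (auto simp: cells_def la_def)
  also have "\<dots> \<longleftrightarrow> (\<exists>b\<in>M. T b = r' \<and> Y b = c')"
  proof
   assume "r' < l \<and> c' < x r'"
   then obtain a where "a \<in> M" "T a = r'" using zero by blast
   thus "\<exists>b\<in>M. T b = r' \<and> Y b = c'" using r[of a c'] \<open>r' < l \<and> c' < x r'\<close> by auto
  next
   assume "\<exists>b\<in>M. T b = r' \<and> Y b = c'"
   then obtain b where "b \<in> M" "T b = r'" "Y b = c'" by blast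
   thus "r' < l \<and> c' < x r'" using zero r[of b c'] by blast
  qed
  finally show ?thesis .
 qed
 have mono: "x r2 \<le> x r1" if "r1 < r2" "r2 < l" for r1 r2
 proof -
  have "c < x r1" if c': "c < x r2" for c
  proof -
   have "(r2, c) \<in> cells la" using c' \<open>r2 < l\<close> by (auto simp: cells_def la_def)
   then obtain b where b: "b \<in> M" "T b = r2" "Y b = c" using cells by blast
   hence "r1 < card {b' \<in> M. Y b' = Y b}" using c[OF b(1), of r2] \<open>r1 < r2\<close> by auto
   then obtain b' where b': "b' \<in> M" "Y b' = c" "T b' = r1" using c[OF b(1), of r1] b(3) by auto
   thus "c < x r1" using r[OF b'(1), of c] by blast
  qed
  thus ?thesis by (meson not_less order_refl)
 qed
 have srt: "sorted_wrt (\<ge>) la" unfolding la_def sorted_wrt_iff_nth_less using mono by simp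
 have posi: "\<forall>y\<in>set la. 0 < y"
  unfolding la_def using zero xpos by auto
 have bij: "bij_betw (\<lambda>a. (T a, Y a)) M (cells la)"
  unfolding bij_betw_def
 proof
  show "inj_on (\<lambda>a. (T a, Y a)) M" using inj by (auto simp: inj_on_def)
  show "(\<lambda>a. (T a, Y a)) ` M = cells la" using cells by auto
 qed
 have sm: "sum_list la = m" using bij_betw_same_card[OF bij] card_cells[of la] by simp
 define t where "t z = (if z \<in> cells la then the_inv_into M (\<lambda>a. (T a, Y a)) z else 0)" for z
 have tb: "bij_betw t (cells la) M"
  by (rule bij_betw_cong[THEN iffD1, OF _ bij_betw_the_inv_into[OF bij]]) (simp add: t_def)
 have tt: "t \<in> tableaux la" unfolding tableaux_def using tb sm by (simp add: t_def)
 have pos: "the_inv_into (cells la) t a = (T a, Y a)" if a: "a \<in> M" for a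
 proof (rule the_inv_into_f_eq[OF bij_betw_imp_inj_on[OF tb]])
  have z: "(T a, Y a) \<in> cells la" using cells a by blast
  show "t (T a, Y a) = a"
   using z the_inv_into_f_f[OF bij_betw_imp_inj_on[OF bij] a] by (simp add: t_def)
  show "(T a, Y a) \<in> cells la" by (rule z)
 qed
 have "tabloid_of la t = T"
 proof
  fix j show "tabloid_of la t j = T j"
   unfolding tabloid_of_def sm using pos[of j] T0[of j] by simp
 qed
 moreover have "\<forall>a\<in>M. col_of la t a = Y a" unfolding col_of_def using pos by simp
 moreover have "is_int_partition la m" unfolding is_int_partition_def using srt posi sm by blast
 ultimately show ?thesis using tt by blast
qed

text \<open>Let T be labels from V and Y labels from the sign twist. After a translation, v survives
  antisymmetrisation along Y, so T and Y separate entries and \<open>sum_labels_ge\<close> bounds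
  each label sum below by the class sizes of the other labelling. The relation between the two
  eigenvalues of \<open>tsum\<close> leaves no room: both bounds are equalities, so T and Y are the
  rows and columns of a tableau.\<close>

lemma separating_vector:
 "\<exists>la t v. is_int_partition la m \<and> t \<in> tableaux la \<and> v \<in> V \<and>
   (\<forall>p. p permutes M --> tabloid_of la t \<circ> p = tabloid_of la t --> ac p v = v) \<and>
   (\<Sum>p\<in>col_stab la t. sc (of_int (sign p)) (ac p v)) \<noteq> 0"
proof -
 let ?sac = "\<lambda>p x. sc (of_int (sign p)) (ac p x)"
 interpret s: perm_rep m V sc ?sac by (rule sign_rep)
 have perm: "permutation p" if "p permutes M" for p using that finite_atLeastAtMost permutation_permutes by blast
 let ?N = "\<lambda>T. \<Sum>a\<in>M. card {b \<in> M. T b = T a}"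
 obtain T v where T: "T \<in> labels" and v: "v \<noteq> 0" "fixes_labels T v"
  and tv: "\<And>x. x \<in> V ==> tsum x = sc (of_nat (?N T) - 2 * of_nat (\<Sum>a\<in>M. T a)) x"
  using content_eigenvalue by blast
 obtain Y u where Y: "Y \<in> labels" and u: "u \<noteq> 0" "s.fixes_labels Y u"
  and tu: "\<And>x. x \<in> V ==> s.tsum x = sc (of_nat (?N Y) - 2 * of_nat (\<Sum>a\<in>M. Y a)) x"
  using s.content_eigenvalue by blast
 have vV: "v \<in> V" using v(2) unfolding fixes_labels_def by blast
 have uV: "u \<in> V" using u(2) unfolding s.fixes_labels_def by blast
 \<comment> \<open>The twist negates the transpositions with distinct a and b, but not the m
   identity terms, whence the correction 2m.\<close>
 have "s.tsum v = sc (2 * of_nat m) v - tsum v"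
 proof -
  have e: "?sac (transpose a b) v = (if b = a then sc 2 v else 0) - ac (transpose a b) v" if "a \<in> M" "b \<in> M" for a b
  proof (cases "a = b")
   case True
   have "sc 2 v = v + v" using sc_add[OF vV, of 1 1] sc_one[OF vV] by simp
   thus ?thesis using True by (simp add: sign_id sc_one[OF vV] ac_id[OF vV])
  next
   case False
   thus ?thesis
    using sc_minus[OF ac_in[OF trans_perm[OF that] vV], of 1] sc_one[OF ac_in[OF trans_perm[OF that] vV]]
    by (simp add: sign_swap_id)
  qed
  have "s.tsum v = (\<Sum>a\<in>M. \<Sum>b\<in>M. (if b = a then sc 2 v else 0) - ac (transpose a b) v)"
   unfolding s.tsum_def by (intro sum.cong[OF refl] e)
  also have "\<dots> = (\<Sum>a\<in>M. \<Sum>b\<in>M. if b = a then sc 2 v else 0) - tsum v"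
   unfolding tsum_def by (simp only: sum_subtractf)
  also have "(\<Sum>a\<in>M. \<Sum>b\<in>M. if b = a then sc 2 v else 0) = (\<Sum>a\<in>M. sc 2 v)"
   by (rule sum.cong[OF refl]) (simp add: sum.delta)
  also have "\<dots> = sc (of_nat m) (sc 2 v)" using sum_const_sc[OF sc_in[OF vV, of 2], of M] by simp
  also have "\<dots> = sc (2 * of_nat m) v" using sc_mult[OF vV, of "of_nat m" 2] by (simp add: mult.commute)
  finally show ?thesis .
 qed
 hence "s.tsum v + tsum v - sc (2 * of_nat m) v = 0" by simp
 hence "sc (of_nat (?N Y) - 2 * of_nat (\<Sum>a\<in>M. Y a) + (of_nat (?N T) - 2 * of_nat (\<Sum>a\<in>M. T a)) + - (2 * of_nat m)) v = 0"
  unfolding tu[OF vV] tv[OF vV] sc_add[OF vV] sc_minus[OF vV] by simp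
 hence "of_nat (?N Y) - 2 * of_nat (\<Sum>a\<in>M. Y a) + (of_nat (?N T) - 2 * of_nat (\<Sum>a\<in>M. T a)) + - (2 * of_nat m) = (0::complex)"
  using sc_eq_0[OF vV] v(1) by blast
 hence "(of_nat (?N Y + ?N T) :: complex) = of_nat (2 * (\<Sum>a\<in>M. Y a) + 2 * (\<Sum>a\<in>M. T a) + 2 * m)"
  by (simp add: algebra_simps)
 hence NYT: "?N Y + ?N T = 2 * (\<Sum>a\<in>M. Y a) + 2 * (\<Sum>a\<in>M. T a) + 2 * m"
  unfolding of_nat_eq_iff .
 \<comment> \<open>This will turn out to be the column stabiliser. Its signed sum \<open>kap\<close>
   multiplies u by the order of \<open>CY\<close>, so \<open>kap u\<close> is nonzero.\<close>
 define CY where "CY = {p. p permutes M \<and> Y \<circ> p = Y}"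
 have CYfin: "finite CY" unfolding CY_def by (rule finite_subset[OF _ finS]) auto
 have CYp: "p permutes M" if "p \<in> CY" for p using that by (simp add: CY_def)
 define kap where "kap x = (\<Sum>p\<in>CY. ?sac p x)" for x
 have sV: "?sac p x \<in> V" if "p permutes M" "x \<in> V" for p x using that ac_in sc_in by blast
 have kap_sum: "kap (\<Sum>i\<in>I. sc (c i) (f i)) = (\<Sum>i\<in>I. sc (c i) (kap (f i)))"
  if "\<And>i. i \<in> I ==> f i \<in> V" for I :: "(nat => nat) set" and c f
 proof -
  have "kap (\<Sum>i\<in>I. sc (c i) (f i)) = (\<Sum>p\<in>CY. \<Sum>i\<in>I. ?sac p (sc (c i) (f i)))"
   unfolding kap_def by (rule sum.cong[OF refl]) (rule s.ac_sum, use CYp that sc_in in auto)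
  also have "\<dots> = (\<Sum>i\<in>I. \<Sum>p\<in>CY. ?sac p (sc (c i) (f i)))" by (rule sum.swap)
  also have "\<dots> = (\<Sum>i\<in>I. \<Sum>p\<in>CY. sc (c i) (?sac p (f i)))"
   by (intro sum.cong[OF refl] s.ac_sc CYp that)
  also have "\<dots> = (\<Sum>i\<in>I. sc (c i) (kap (f i)))"
   unfolding kap_def by (intro sum.cong[OF refl] sc_sum[symmetric]) (use CYp that sV in blast)
  finally show ?thesis .
 qed
 have "kap u = (\<Sum>p\<in>CY. u)"
  unfolding kap_def by (rule sum.cong[OF refl]) (use u(2) in \<open>simp add: s.fixes_labels_def CY_def\<close>)
 also have "\<dots> = sc (of_nat (card CY)) u" by (rule sum_const_sc[OF uV])
 finally have ku: "kap u = sc (of_nat (card CY)) u" .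
 have "id \<in> CY" by (simp add: CY_def permutes_id)
 hence "card CY \<noteq> 0" using CYfin by auto
 hence "of_nat (card CY) \<noteq> (0 :: complex)" by simp
 hence ku0: "kap u \<noteq> 0" using ku sc_eq_0[OF uV] u(1) by metis
 obtain c where c: "u = (\<Sum>p\<in>S. sc (c p) (ac p v))" using irred[OF vV v(1) uV] by blast
 have "kap u = (\<Sum>p\<in>S. sc (c p) (kap (ac p v)))"
  by (subst c, rule kap_sum) (use ac_in vV in blast)
 hence "(\<Sum>p\<in>S. sc (c p) (kap (ac p v))) \<noteq> 0" using ku0 by simp
 \<comment> \<open>The translates of v span V and in particular u, so \<open>kap\<close> cannot kill
   all of them.\<close>
 then obtain g where "g \<in> S" "sc (c g) (kap (ac g v)) \<noteq> 0"
  by (rule sum.not_neutral_contains_not_neutral)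
 hence g: "g permutes M" "kap (ac g v) \<noteq> 0" by auto
 define v' where "v' = ac g v"
 define T' where "T' = T \<circ> inv g"
 have v'V: "v' \<in> V" unfolding v'_def using ac_in g vV by blast
 note ig = permutes_inv[OF g(1)]
 have fix': "ac p v' = v'" if p: "p permutes M" "T' \<circ> p = T'" for p
 proof -
  let ?q = "inv g \<circ> (p \<circ> g)"
  have q: "?q permutes M" by (intro permutes_compose ig g p)
  have "T \<circ> ?q = T' \<circ> p \<circ> g" by (simp add: T'_def comp_assoc)
  also have "\<dots> = T' \<circ> g" unfolding p(2) ..
  also have "\<dots> = T" unfolding T'_def using permutes_inv_o(2)[OF g(1)] by (simp add: comp_assoc)
  finally have Tq: "T \<circ> ?q = T" .
  hence "ac ?q v = v" using v(2) q unfolding fixes_labels_def by blast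
  moreover have "p \<circ> g = g \<circ> ?q" using permutes_inv_o(1)[OF g(1)] by (simp add: o_assoc)
  ultimately show ?thesis
   unfolding v'_def using ac_comp[OF p(1) g(1) vV] ac_comp[OF g(1) q vV] by simp
 qed
 \<comment> \<open>A transposition of two entries with equal row and equal column labels would fix
   \<open>v'\<close> and reverse the sign of \<open>kap v'\<close>.\<close>
 have sep: "a = b" if ab: "a \<in> M" "b \<in> M" "T' a = T' b" "Y a = Y b" for a b
 proof (rule ccontr)
  assume ne: "a \<noteq> b"
  let ?t = "transpose a b"
  note tp = trans_perm[OF ab(1,2)]
  have tc: "?t \<in> CY" unfolding CY_def using tp ab(4) by (auto simp: fun_eq_iff transpose_def)
  have "T' \<circ> ?t = T'" using ab(3) by (auto simp: fun_eq_iff transpose_def)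
  hence tv': "ac ?t v' = v'" using fix' tp by blast
  have "kap v' = (\<Sum>p\<in>CY. ?sac (p \<circ> ?t) v')"
   unfolding kap_def
  proof (rule sum.reindex_bij_witness[where i = "\<lambda>p. p \<circ> ?t" and j = "\<lambda>p. p \<circ> ?t"])
   fix p assume p: "p \<in> CY"
   show "p \<circ> ?t \<circ> ?t = p" "p \<circ> ?t \<circ> ?t = p" by (simp_all add: comp_assoc)
   have "Y \<circ> (p \<circ> ?t) = Y" using p tc unfolding CY_def by (metis (mono_tags, lifting) comp_assoc mem_Collect_eq)
   thus "p \<circ> ?t \<in> CY" "p \<circ> ?t \<in> CY" using permutes_compose[OF tp CYp[OF p]] unfolding CY_def by blast+
   show "?sac (p \<circ> ?t \<circ> ?t) v' = ?sac p v'" by (simp add: comp_assoc)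
  qed
  also have "\<dots> = (\<Sum>p\<in>CY. - ?sac p v')"
  proof (rule sum.cong[OF refl])
   fix p assume p: "p \<in> CY"
   have "sign (p \<circ> ?t) = - sign p"
    using sign_compose[OF perm[OF CYp[OF p]] perm[OF tp]] ne by (simp add: sign_swap_id)
   thus "?sac (p \<circ> ?t) v' = - ?sac p v'"
    using ac_comp[OF CYp[OF p] tp v'V] tv' sc_minus[OF ac_in[OF CYp[OF p] v'V]] by simp
  qed
  also have "\<dots> = - kap v'" by (simp add: kap_def sum_negf)
  finally have "kap v' = - kap v'" .
  hence "kap v' + kap v' = 0" by (simp only: eq_neg_iff_add_eq_0)
  moreover have kV: "kap v' \<in> V" unfolding kap_def by (rule sum_in) (use CYp sV v'V in blast)
  ultimately have "sc 2 (kap v') = 0" using sc_add[OF kV, of 1 1] sc_one[OF kV] by simp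
  thus False using sc_eq_0[OF kV, of 2] g(2) v'_def by simp
 qed
 have bg: "bij_betw (inv g) M M" by (rule permutes_imp_bij[OF ig])
 have sT': "(\<Sum>a\<in>M. T' a) = (\<Sum>a\<in>M. T a)"
  unfolding T'_def comp_def by (rule sum.reindex_bij_betw[OF bg])
 have cT': "card {b \<in> M. T' b = r} = card {b \<in> M. T b = r}" for r
 proof (rule bij_betw_same_card[of "inv g"])
  have "inv g ` {b \<in> M. T' b = r} = {b \<in> M. T b = r}"
  proof
   show "inv g ` {b \<in> M. T' b = r} \<subseteq> {b \<in> M. T b = r}"
    using permutes_in_image[OF ig] by (auto simp: T'_def simp del: atLeastAtMost_iff)
   show "{b \<in> M. T b = r} \<subseteq> inv g ` {b \<in> M. T' b = r}"
   proof
    fix b assume b: "b \<in> {b \<in> M. T b = r}"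
    hence "g b \<in> {b \<in> M. T' b = r}"
     using permutes_in_image[OF g(1)] permutes_inverses(2)[OF g(1)] by (simp add: T'_def del: atLeastAtMost_iff)
    moreover have "b = inv g (g b)" using permutes_inverses(2)[OF g(1)] by simp
    ultimately show "b \<in> inv g ` {b \<in> M. T' b = r}" by blast
   qed
  qed
  moreover have "inj_on (inv g) {b \<in> M. T' b = r}" using permutes_inj[OF ig] inj_on_subset by blast
  ultimately show "bij_betw (inv g) {b \<in> M. T' b = r} {b \<in> M. T b = r}" by (simp add: bij_betw_def)
 qed
 have N': "?N T' = ?N T"
  unfolding cT' unfolding T'_def comp_def
  by (rule sum.reindex_bij_betw[OF bg, of "\<lambda>a. card {b \<in> M. T b = T a}"])
 \<comment> \<open>Twice a binomial coefficient plus x is a square; this translates the squares of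
   class sizes in the eigenvalues into the minimal label sums.\<close>
 have tri: "2 * \<Sum>{..<x} + x = x * x" for x :: nat
  by (induction x) (auto simp: lessThan_Suc)
 have gen: "2 * (\<Sum>j\<in>L ` M. \<Sum>{..<card {a \<in> M. L a = j}}) + m = ?N L" for L :: "nat => nat"
 proof -
  have "?N L = (\<Sum>j\<in>L ` M. \<Sum>a\<in>{a \<in> M. L a = j}. card {b \<in> M. L b = L a})"
   by (rule sum.image_gen) simp
  also have "\<dots> = (\<Sum>j\<in>L ` M. card {a \<in> M. L a = j} * card {a \<in> M. L a = j})"
   by (rule sum.cong[OF refl]) simp
  also have "\<dots> = (\<Sum>j\<in>L ` M. 2 * \<Sum>{..<card {a \<in> M. L a = j}} + card {a \<in> M. L a = j})"
   by (simp only: tri)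
  also have "\<dots> = 2 * (\<Sum>j\<in>L ` M. \<Sum>{..<card {a \<in> M. L a = j}}) + (\<Sum>j\<in>L ` M. card {a \<in> M. L a = j})"
   by (simp only: sum.distrib sum_distrib_left)
  also have "(\<Sum>j\<in>L ` M. card {a \<in> M. L a = j}) = m"
  proof -
   have "card M = (\<Sum>j\<in>L ` M. card {a \<in> M. L a = j})"
    unfolding card_eq_sum by (rule sum.image_gen) simp
   thus ?thesis by simp
  qed
  finally show ?thesis by simp
 qed
 have finM: "finite M" by simp
 have le1: "(\<Sum>j\<in>T' ` M. \<Sum>{..<card {a \<in> M. T' a = j}}) \<le> (\<Sum>a\<in>M. Y a)"
  by (rule sum_labels_ge(1)[OF finM]) (use sep in blast)
 have le2: "(\<Sum>j\<in>Y ` M. \<Sum>{..<card {a \<in> M. Y a = j}}) \<le> (\<Sum>a\<in>M. T' a)"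
  by (rule sum_labels_ge(1)[OF finM]) (use sep in blast)
 have eq1: "(\<Sum>a\<in>M. Y a) = (\<Sum>j\<in>T' ` M. \<Sum>{..<card {a \<in> M. T' a = j}})"
  and eq2: "(\<Sum>a\<in>M. T' a) = (\<Sum>j\<in>Y ` M. \<Sum>{..<card {a \<in> M. Y a = j}})"
  using gen[of T'] gen[of Y] NYT N' sT' le1 le2 by linarith+
 have row: "Y ` {b \<in> M. T' b = T' a} = {..<card {b \<in> M. T' b = T' a}}" if "a \<in> M" for a
  by (rule sum_labels_ge(2)[OF finM _ eq1]) (use sep that in blast)+
 have col: "T' ` {b \<in> M. Y b = Y a} = {..<card {b \<in> M. Y b = Y a}}" if "a \<in> M" for a
  by (rule sum_labels_ge(2)[OF finM _ eq2]) (use sep that in blast)+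
 have T'0: "T' j = 0" if "j \<notin> M" for j
  using T that permutes_not_in[OF ig that] unfolding labels_def by (auto simp: T'_def)
 obtain la t where la: "is_int_partition la m" "t \<in> tableaux la" "tabloid_of la t = T'" "\<forall>a\<in>M. col_of la t a = Y a"
  using young_diagram_of_labels[OF sep row col T'0] by blast
 have sm: "sum_list la = m" using la(1) by (simp add: is_int_partition_def)
 have "col_stab la t = CY"
 proof (intro set_eqI iffI)
  fix p assume p: "p \<in> col_stab la t"
  hence pp: "p permutes M" unfolding col_stab_def sm by blast
  have "Y (p j) = Y j" for j
  proof (cases "j \<in> M")
   case True
   hence "p j \<in> M" using permutes_in_image[OF pp] by blast
   thus ?thesis using p True la(4) unfolding col_stab_def sm by (metis (mono_tags, lifting) mem_Collect_eq)
  next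
   case False thus ?thesis using permutes_not_in[OF pp False] by simp
  qed
  thus "p \<in> CY" unfolding CY_def using pp by (simp add: fun_eq_iff)
 next
  fix p assume p: "p \<in> CY"
  have "col_of la t (p j) = col_of la t j" if "j \<in> M" for j
  proof -
   have "p j \<in> M" using permutes_in_image[OF CYp[OF p]] that by blast
   moreover have "Y (p j) = Y j" using p unfolding CY_def by (metis (mono_tags, lifting) comp_apply mem_Collect_eq)
   ultimately show ?thesis using la(4) that by metis
  qed
  thus "p \<in> col_stab la t" unfolding col_stab_def sm using CYp[OF p] by blast
 qed
 hence "(\<Sum>p\<in>col_stab la t. ?sac p v') \<noteq> 0" using g(2) unfolding kap_def v'_def by simp
 thus ?thesis using la v'V fix' by blast
qed

text \<open>As v is fixed by the row stabiliser, sending the tabloid of t to a multiple of v defines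
  an equivariant map on functions of tabloids. It does not kill the polytabloid, because the
  antisymmetrised v is nonzero. Irreducibility of the Specht module gives injectivity, that of V
  surjectivity.\<close>

theorem irreducible_is_specht:
 "\<exists>la f. is_int_partition la m \<and> bij_betw f (specht la) V \<and>
   (\<forall>x\<in>specht la. \<forall>y\<in>specht la. f (x + y) = f x + f y) \<and>
   (\<forall>c. \<forall>x\<in>specht la. f (\<lambda>T. c * x T) = sc c (f x)) \<and>
   (\<forall>s. s permutes M --> (\<forall>x\<in>specht la. f (perm_act s x) = ac s (f x)))"
proof -
 obtain la t v where la: "is_int_partition la m" and t: "t \<in> tableaux la" and v: "v \<in> V"
  and fix_v: "\<And>p. p permutes M ==> tabloid_of la t \<circ> p = tabloid_of la t ==> ac p v = v"
  and kap: "(\<Sum>p\<in>col_stab la t. sc (of_int (sign p)) (ac p v)) \<noteq> 0"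
  using separating_vector by blast
 have sm: "sum_list la = m" and srt: "sorted_wrt (\<ge>) la" using la by (auto simp: is_int_partition_def)
 interpret tb: tableau la t using t by unfold_locales
 have Mt: "tb.M = M" using sm by simp
 define f where "f x = (\<Sum>g\<in>S. sc (x (tb.R \<circ> inv g)) (ac g v))" for x :: "(nat => nat) => complex"
 have gV: "ac g v \<in> V" if "g \<in> S" for g using that ac_in v by blast
 have fV: "f x \<in> V" for x unfolding f_def by (rule sum_in) (use gV sc_in in blast)
 have f_add: "f (x + y) = f x + f y" for x y
  unfolding f_def sum.distrib[symmetric] by (rule sum.cong[OF refl]) (simp add: sc_add gV)
 have f_sc: "f (\<lambda>T. c * x T) = sc c (f x)" for c x
 proof -
  have "sc c (f x) = (\<Sum>g\<in>S. sc c (sc (x (tb.R \<circ> inv g)) (ac g v)))"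
   unfolding f_def by (rule sc_sum) (use gV sc_in in blast)
  also have "\<dots> = f (\<lambda>T. c * x T)"
   unfolding f_def by (rule sum.cong[OF refl]) (simp add: sc_mult gV)
  finally show ?thesis by simp
 qed
 have f_ac: "f (perm_act s x) = ac s (f x)" if s: "s permutes M" for s x
 proof -
  have "ac s (f x) = (\<Sum>g\<in>S. ac s (sc (x (tb.R \<circ> inv g)) (ac g v)))"
   unfolding f_def by (rule ac_sum[OF s]) (use gV sc_in in blast)
  also have "\<dots> = (\<Sum>g\<in>S. sc (x (tb.R \<circ> inv g)) (ac (s \<circ> g) v))"
  proof (rule sum.cong[OF refl])
   fix g assume g: "g \<in> S"
   thus "ac s (sc (x (tb.R \<circ> inv g)) (ac g v)) = sc (x (tb.R \<circ> inv g)) (ac (s \<circ> g) v)"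
    using ac_sc[OF s gV[OF g]] ac_comp[OF s _ v, of g] by simp
  qed
  also have "\<dots> = (\<Sum>h\<in>S. sc (x (tb.R \<circ> inv h \<circ> s)) (ac h v))"
  proof (rule sum.reindex_bij_witness[where i = "\<lambda>h. inv s \<circ> h" and j = "\<lambda>g. s \<circ> g"])
   fix g assume g: "g \<in> S"
   have gp: "g permutes M" using g by blast
   show "inv s \<circ> (s \<circ> g) = g" using permutes_inv_o(2)[OF s] by (simp add: o_assoc)
   show "s \<circ> g \<in> S" using permutes_compose[OF gp s] by blast
   have "inv (s \<circ> g) = inv g \<circ> inv s" using o_inv_distrib permutes_bij[OF s] permutes_bij[OF gp] by blast
   hence "tb.R \<circ> inv (s \<circ> g) \<circ> s = tb.R \<circ> inv g"
    by (simp add: fun_eq_iff permutes_inverses[OF s])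
   thus "sc (x (tb.R \<circ> inv (s \<circ> g) \<circ> s)) (ac (s \<circ> g) v) = sc (x (tb.R \<circ> inv g)) (ac (s \<circ> g) v)" by simp
  next
   fix h assume h: "h \<in> S"
   hence hp: "h permutes M" by blast
   show "s \<circ> (inv s \<circ> h) = h" using permutes_inv_o(1)[OF s] by (simp add: o_assoc)
   show "inv s \<circ> h \<in> S" using permutes_compose[OF hp permutes_inv[OF s]] by blast
  qed
  finally show ?thesis by (simp add: f_def perm_act_def)
 qed
 let ?e = "polytabloid la t"
 have e: "?e \<in> specht la" by (rule polytabloid_specht[OF t])
 \<comment> \<open>The row stabiliser of t: f sums over group elements rather than tabloids, so
   every tabloid is counted |H| times.\<close>
 define H where "H = {r \<in> S. tb.R \<circ> r = tb.R}"
 have Hfin: "finite H" unfolding H_def by (rule finite_subset[OF _ finS]) blast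
 have "id \<in> H" unfolding H_def by (simp add: permutes_id)
 hence H0: "card H \<noteq> 0" using Hfin by auto
 have pV: "sc (of_int (sign p)) (ac p v) \<in> V" if "p \<in> col_stab la t" for p
  using sc_in ac_in[OF _ v] tb.col_stab_permutes[OF that] unfolding Mt by blast
 have fe: "f ?e = sc (of_nat (card H)) (\<Sum>p\<in>col_stab la t. sc (of_int (sign p)) (ac p v))"
 proof -
  have "f ?e = (\<Sum>g\<in>S. \<Sum>p\<in>col_stab la t. sc (if tb.R \<circ> inv p = tb.R \<circ> inv g then of_int (sign p) else 0) (ac g v))"
   unfolding f_def tb.polytabloid_eq by (intro sum.cong[OF refl] sc_sum_left gV)
  also have "\<dots> = (\<Sum>p\<in>col_stab la t. \<Sum>g\<in>S. sc (if tb.R \<circ> inv p = tb.R \<circ> inv g then of_int (sign p) else 0) (ac g v))"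
   by (rule sum.swap)
  also have "\<dots> = (\<Sum>p\<in>col_stab la t. sc (of_nat (card H)) (sc (of_int (sign p)) (ac p v)))"
  proof (rule sum.cong[OF refl])
   fix p assume p: "p \<in> col_stab la t"
   have pp: "p permutes M" using tb.col_stab_permutes[OF p] unfolding Mt .
   have "(\<Sum>g\<in>S. sc (if tb.R \<circ> inv p = tb.R \<circ> inv g then of_int (sign p) else 0) (ac g v))
    = (\<Sum>g\<in>{g \<in> S. tb.R \<circ> inv p = tb.R \<circ> inv g}. sc (of_int (sign p)) (ac g v))"
    by (rule sum.mono_neutral_cong_right[OF finS]) (auto simp: sc_zero_left gV)
   also have "\<dots> = (\<Sum>r\<in>H. sc (of_int (sign p)) (ac p v))"
   proof (rule sum.reindex_bij_witness[where i = "\<lambda>r. p \<circ> r" and j = "\<lambda>g. inv p \<circ> g"])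
    fix g assume g: "g \<in> {g \<in> S. tb.R \<circ> inv p = tb.R \<circ> inv g}"
    hence gp: "g permutes M" and ge: "tb.R \<circ> inv p = tb.R \<circ> inv g" by blast+
    show pg: "p \<circ> (inv p \<circ> g) = g" using permutes_inv_o(1)[OF pp] by (simp add: o_assoc)
    have q: "inv p \<circ> g permutes M" by (rule permutes_compose[OF gp permutes_inv[OF pp]])
    have "tb.R \<circ> (inv p \<circ> g) = tb.R \<circ> inv g \<circ> g" using ge by (simp add: o_assoc)
    hence R: "tb.R \<circ> (inv p \<circ> g) = tb.R" using permutes_inv_o(2)[OF gp] by (simp add: comp_assoc)
    thus "inv p \<circ> g \<in> H" unfolding H_def using q by blast
    have "ac g v = ac p (ac (inv p \<circ> g) v)" using ac_comp[OF pp q v] pg by simp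
    thus "sc (of_int (sign p)) (ac p v) = sc (of_int (sign p)) (ac g v)" using fix_v[OF q R] by simp
   next
    fix r assume r: "r \<in> H"
    hence rp: "r permutes M" and rR: "tb.R \<circ> r = tb.R" unfolding H_def by blast+
    show "inv p \<circ> (p \<circ> r) = r" using permutes_inv_o(2)[OF pp] by (simp add: o_assoc)
    have i: "inv (p \<circ> r) = inv r \<circ> inv p" using o_inv_distrib permutes_bij[OF pp] permutes_bij[OF rp] by blast
    have "tb.R \<circ> inv r = tb.R \<circ> r \<circ> inv r" unfolding rR ..
    hence "tb.R \<circ> inv r = tb.R" using permutes_inv_o(1)[OF rp] by (simp add: comp_assoc)
    hence "tb.R \<circ> inv p = tb.R \<circ> inv (p \<circ> r)" unfolding i by (simp add: o_assoc)
    thus "p \<circ> r \<in> {g \<in> S. tb.R \<circ> inv p = tb.R \<circ> inv g}" using permutes_compose[OF rp pp] by blast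
   qed
   also have "\<dots> = sc (of_nat (card H)) (sc (of_int (sign p)) (ac p v))"
    by (rule sum_const_sc[OF sc_in[OF ac_in[OF pp v]]])
   finally show "(\<Sum>g\<in>S. sc (if tb.R \<circ> inv p = tb.R \<circ> inv g then of_int (sign p) else 0) (ac g v)) =
    sc (of_nat (card H)) (sc (of_int (sign p)) (ac p v))" .
  qed
  also have "\<dots> = sc (of_nat (card H)) (\<Sum>p\<in>col_stab la t. sc (of_int (sign p)) (ac p v))"
   by (rule sc_sum[symmetric]) (rule pV)
  finally show ?thesis .
 qed
 have kV: "(\<Sum>p\<in>col_stab la t. sc (of_int (sign p)) (ac p v)) \<in> V"
  by (rule sum_in) (rule pV)
 have "of_nat (card H) \<noteq> (0 :: complex)" using H0 by simp
 hence fe0: "f ?e \<noteq> 0" unfolding fe using sc_eq_0[OF kV] kap by metis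
 have f_span: "f (\<lambda>T. \<Sum>s\<in>S. c s * perm_act s x T) = (\<Sum>s\<in>S. sc (c s) (ac s (f x)))" for c x
 proof -
  have f0: "f (\<lambda>_. 0) = 0" using f_sc[of 0 "\<lambda>_. 0"] sc_zero_left[OF fV] by simp
  have f_sum: "f (\<lambda>T. \<Sum>s\<in>I. h s T) = (\<Sum>s\<in>I. f (h s))" if "finite I" for I :: "(nat => nat) set" and h
   using that
  proof (induction I rule: finite_induct)
   case (insert s I)
   have "f (\<lambda>T. \<Sum>s\<in>insert s I. h s T) = f (h s + (\<lambda>T. \<Sum>s\<in>I. h s T))"
    using insert by (simp add: plus_fun_def)
   thus ?case using insert f_add by simp
  qed (simp add: f0)
  have "f (\<lambda>T. \<Sum>s\<in>S. c s * perm_act s x T) = (\<Sum>s\<in>S. f (\<lambda>T. c s * perm_act s x T))"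
   by (rule f_sum[OF finS])
  also have "\<dots> = (\<Sum>s\<in>S. sc (c s) (ac s (f x)))"
   by (rule sum.cong[OF refl]) (simp add: f_sc f_ac)
  finally show ?thesis .
 qed
 have span: "\<exists>c. y = (\<lambda>T. \<Sum>s\<in>S. c s * perm_act s x T)" if "x \<in> specht la" "x \<noteq> 0" "y \<in> specht la" for x y
  using specht_irreducible[OF srt that] unfolding sm .
 have ker: "x = 0" if x: "x \<in> specht la" "f x = 0" for x
 proof (rule ccontr)
  assume "x \<noteq> 0"
  then obtain c where "?e = (\<lambda>T. \<Sum>s\<in>S. c s * perm_act s x T)" using span[OF x(1) _ e] by blast
  hence "f ?e = (\<Sum>s\<in>S. sc (c s) (ac s (f x)))" using f_span by simp
  also have "\<dots> = 0" by (rule sum.neutral) (simp add: x(2) ac_zero)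
  finally show False using fe0 by blast
 qed
 have inj: "inj_on f (specht la)"
 proof (rule inj_onI)
  fix x y assume xy: "x \<in> specht la" "y \<in> specht la" "f x = f y"
  let ?my = "\<lambda>T. (- 1) * y T"
  have my: "?my \<in> specht la" by (rule specht_scale[OF xy(2)])
  have "f (x + ?my) = f x - f y"
   using f_add[of x ?my] f_sc[of "- 1" y] sc_minus[OF fV, of 1 y] sc_one[OF fV, of y] by simp
  hence "x + ?my = 0" using ker[OF specht_add[OF xy(1) my]] xy(3) by simp
  thus "x = y" by (simp add: fun_eq_iff)
 qed
 have surj: "y \<in> f ` specht la" if y: "y \<in> V" for y
 proof -
  obtain c where c: "y = (\<Sum>s\<in>S. sc (c s) (ac s (f ?e)))" using irred[OF fV fe0 y] by blast
  have "(\<lambda>T. \<Sum>s\<in>S. c s * perm_act s ?e T) \<in> specht la"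
   by (rule specht_sum) (use specht_perm_act[OF _ e] sm in simp)
  moreover have "y = f (\<lambda>T. \<Sum>s\<in>S. c s * perm_act s ?e T)" unfolding c f_span ..
  ultimately show ?thesis by blast
 qed
 have "bij_betw f (specht la) V" unfolding bij_betw_def using inj surj fV by blast
 thus ?thesis using la f_add f_sc f_ac by blast
qed

end

section \<open>The representation on tensor space and the positive form\<close>

definition rho :: "diagram => (nat => nat) => (nat => nat) => complex" where
 "rho d x y = (if (x, y) \<in> rel d then 1 else 0)"

definition delta :: "diagram => diagram => complex" where
 "delta d = (\<lambda>e. if e = d then 1 else 0)"

text \<open>Next to the identity diagram the middle row must repeat the zero outer row, so the count
  of \<open>ell_count\<close> is 1.\<close>

lemma ell_id:
 assumes d: "d \<in> all_diagrams k" shows "ell (id_diagram k) d = 0" "ell d (id_diagram k) = 0"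
proof -
 define z where "z = (\<lambda>i\<in>{1..k}. 0 :: nat)"
 have zero: "y = z" if "y \<in> colourings k 2" "\<And>i. i \<in> {1..k} ==> y i = 0" for y
  using that by (auto simp: z_def colourings_def PiE_iff extensional_def fun_eq_iff)
 have zc: "z \<in> colourings k 2" by (auto simp: z_def colourings_def)
 have zd: "(z, (\<lambda>_. 0)) \<in> rel d" "((\<lambda>_. 0), z) \<in> rel d"
  by (rule rel_cong[OF d rel_const[of 0]]; simp add: z_def)+
 have "{y \<in> colourings k 2. ((\<lambda>_. 0), y) \<in> rel (id_diagram k) \<and> (y, (\<lambda>_. 0)) \<in> rel d} = {z}"
 proof (intro set_eqI iffI)
  fix y assume "y \<in> {y \<in> colourings k 2. ((\<lambda>_. 0), y) \<in> rel (id_diagram k) \<and> (y, (\<lambda>_. 0)) \<in> rel d}"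
  hence "y \<in> colourings k 2" "\<And>i. i \<in> {1..k} ==> y i = 0" unfolding rel_id by auto
  thus "y \<in> {z}" using zero by blast
 next
  fix y assume "y \<in> {z}"
  moreover have "((\<lambda>_. 0), z) \<in> rel (id_diagram k)" unfolding rel_id by (simp add: z_def)
  ultimately show "y \<in> {y \<in> colourings k 2. ((\<lambda>_. 0), y) \<in> rel (id_diagram k) \<and> (y, (\<lambda>_. 0)) \<in> rel d}"
   using zc zd(1) by blast
 qed
 hence "(2::nat) ^ ell (id_diagram k) d = 1" using ell_count[OF id_in d] by simp
 thus "ell (id_diagram k) d = 0" by (cases "ell (id_diagram k) d") simp_all
 have "{y \<in> colourings k 2. ((\<lambda>_. 0), y) \<in> rel d \<and> (y, (\<lambda>_. 0)) \<in> rel (id_diagram k)} = {z}"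
 proof (intro set_eqI iffI)
  fix y assume "y \<in> {y \<in> colourings k 2. ((\<lambda>_. 0), y) \<in> rel d \<and> (y, (\<lambda>_. 0)) \<in> rel (id_diagram k)}"
  hence "y \<in> colourings k 2" "\<And>i. i \<in> {1..k} ==> y i = 0" unfolding rel_id by auto
  thus "y \<in> {z}" using zero by blast
 next
  fix y assume "y \<in> {z}"
  moreover have "(z, (\<lambda>_. 0)) \<in> rel (id_diagram k)" unfolding rel_id by (simp add: z_def)
  ultimately show "y \<in> {y \<in> colourings k 2. ((\<lambda>_. 0), y) \<in> rel d \<and> (y, (\<lambda>_. 0)) \<in> rel (id_diagram k)}"
   using zc zd(2) by blast
 qed
 hence "(2::nat) ^ ell d (id_diagram k) = 1" using ell_count[OF d id_in] by simp
 thus "ell d (id_diagram k) = 0" by (cases "ell d (id_diagram k)") simp_all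
qed

locale diagram_algebra =
 fixes A :: alg_kind and k n :: nat
 assumes n0: "0 < n"
begin

abbreviation "Bs \<equiv> diag_basis A k"
abbreviation "Car \<equiv> alg_carrier A k"
abbreviation "mul \<equiv> alg_mult A k n"
abbreviation "X \<equiv> colourings k n"

definition Rho :: "(diagram => complex) => (nat => nat) => (nat => nat) => complex" where
 "Rho a x y = (\<Sum>d\<in>Bs. a d * rho d x y)"

lemma carI: "(\<And>d. a d \<noteq> 0 ==> d \<in> Bs) ==> a \<in> Car"
 by (simp add: alg_carrier_def)

lemma carD: "a \<in> Car ==> a d \<noteq> 0 ==> d \<in> Bs"
 by (simp add: alg_carrier_def)

lemma car_add: "a \<in> Car ==> b \<in> Car ==> a + b \<in> Car"
 unfolding alg_carrier_def by (auto simp: plus_fun_def) (metis add_0)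

lemma car_diff: "a \<in> Car ==> b \<in> Car ==> a - b \<in> Car"
 unfolding alg_carrier_def by (auto simp: fun_diff_def) (metis diff_0_right)

lemma car_scale: "a \<in> Car ==> (\<lambda>d. c * a d) \<in> Car"
 unfolding alg_carrier_def by auto

lemma car_delta: "d \<in> Bs ==> delta d \<in> Car"
 unfolding alg_carrier_def delta_def by auto

lemma car_one: "alg_one k \<in> Car"
 unfolding alg_carrier_def alg_one_def using basis_id by auto

lemma car_mult: "mul a b \<in> Car"
proof (rule carI)
 fix e assume "mul a b e \<noteq> 0"
 then obtain d1 where d1: "d1 \<in> Bs" "(\<Sum>d2\<in>Bs. if d1 \<cdot> d2 = e then a d1 * b d2 * of_nat n ^ ell d1 d2 else 0) \<noteq> 0"
  unfolding alg_mult_def by (rule sum.not_neutral_contains_not_neutral)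
 obtain d2 where "d2 \<in> Bs" "(if d1 \<cdot> d2 = e then a d1 * b d2 * of_nat n ^ ell d1 d2 else 0) \<noteq> 0"
  using d1(2) by (rule sum.not_neutral_contains_not_neutral)
 thus "e \<in> Bs" using basis_compose d1(1) by (auto split: if_splits)
qed

lemma mult_supp:
 assumes "mul a b e \<noteq> 0"
 obtains d1 d2 where "d1 \<in> Bs" "d2 \<in> Bs" "d1 \<cdot> d2 = e" "a d1 \<noteq> 0" "b d2 \<noteq> 0"
proof -
 obtain d1 where d1: "d1 \<in> Bs" "(\<Sum>d2\<in>Bs. if d1 \<cdot> d2 = e then a d1 * b d2 * of_nat n ^ ell d1 d2 else 0) \<noteq> 0"
  using assms unfolding alg_mult_def by (rule sum.not_neutral_contains_not_neutral)
 obtain d2 where "d2 \<in> Bs" "(if d1 \<cdot> d2 = e then a d1 * b d2 * of_nat n ^ ell d1 d2 else 0) \<noteq> 0"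
  using d1(2) by (rule sum.not_neutral_contains_not_neutral)
 thus ?thesis using that[OF d1(1), of d2] by (auto split: if_splits)
qed

lemma sum_delta_left: "d \<in> Bs ==> (\<Sum>e\<in>Bs. delta d e * f e) = f d"
proof -
 assume d: "d \<in> Bs"
 have "(\<Sum>e\<in>Bs. delta d e * f e) = (\<Sum>e\<in>Bs. if e = d then f e else 0)"
  by (rule sum.cong[OF refl]) (simp add: delta_def)
 thus ?thesis using d by (simp add: sum.delta)
qed

lemma mult_alt: "mul a b e = (\<Sum>d1\<in>Bs. a d1 * (\<Sum>d2\<in>Bs. b d2 * (if d1 \<cdot> d2 = e then of_nat n ^ ell d1 d2 else 0)))"
 unfolding alg_mult_def sum_distrib_left by (intro sum.cong refl) simp

lemma mult_delta:
 "d1 \<in> Bs ==> d2 \<in> Bs ==> mul (delta d1) (delta d2) = (\<lambda>e. of_nat n ^ ell d1 d2 * delta (d1 \<cdot> d2) e)"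
 unfolding mult_alt by (rule ext) (simp only: sum_delta_left, simp add: delta_def)

lemma alg_one_delta: "alg_one k = delta (id_diagram k)"
 by (simp add: alg_one_def delta_def)

lemma mult_one_right: "a \<in> Car ==> mul a (alg_one k) = a"
proof
 fix e assume a: "a \<in> Car"
 have "mul a (alg_one k) e = (\<Sum>d1\<in>Bs. a d1 * (if d1 \<cdot> id_diagram k = e then of_nat n ^ ell d1 (id_diagram k) else 0))"
  unfolding mult_alt alg_one_delta by (simp only: sum_delta_left[OF basis_id])
 also have "\<dots> = (\<Sum>d1\<in>Bs. if d1 = e then a e else 0)"
  by (rule sum.cong[OF refl]) (auto simp: compose_id basis_sub ell_id[OF basis_sub])
 also have "\<dots> = a e" using carD[OF a, of e] by (auto simp: sum.delta)
 finally show "mul a (alg_one k) e = a e" .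
qed

lemma scale_one_mult_delta: "d \<in> Bs ==> mul (\<lambda>e. c * alg_one k e) (delta d) = (\<lambda>e. c * delta d e)"
proof
 fix e assume d: "d \<in> Bs"
 have "mul (\<lambda>e. c * alg_one k e) (delta d) e
   = (\<Sum>d1\<in>Bs. delta (id_diagram k) d1 * (c * (\<Sum>d2\<in>Bs. delta d d2 * (if d1 \<cdot> d2 = e then of_nat n ^ ell d1 d2 else 0))))"
  unfolding mult_alt alg_one_delta by (rule sum.cong[OF refl]) simp
 also have "\<dots> = c * (if id_diagram k \<cdot> d = e then of_nat n ^ ell (id_diagram k) d else 0)"
  by (simp only: sum_delta_left[OF basis_id] sum_delta_left[OF d])
 also have "\<dots> = c * delta d e"
  using id_compose[OF basis_sub[OF d]] ell_id(1)[OF basis_sub[OF d]] by (auto simp: delta_def)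
 finally show "mul (\<lambda>e. c * alg_one k e) (delta d) e = c * delta d e" .
qed

lemma mult_diff_left: "mul (a - b) c = mul a c - mul b c"
 unfolding mult_alt fun_diff_def by (rule ext) (simp add: left_diff_distrib sum_subtractf)

lemma mult_diff_right: "mul a (b - c) = mul a b - mul a c"
 unfolding mult_alt fun_diff_def
 by (rule ext) (simp add: left_diff_distrib right_diff_distrib sum_subtractf)

text \<open>An entry of the product of the two 0/1 matrices counts middle rows, so this is
  \<open>card_middle\<close>.\<close>

lemma rho_mult:
 assumes a: "a \<in> all_diagrams k" and b: "b \<in> all_diagrams k" and x: "x \<in> X" and z: "z \<in> X"
 shows "(\<Sum>y\<in>X. rho a x y * rho b y z) = of_nat n ^ ell a b * rho (a \<cdot> b) x z"
proof -
 have "(\<Sum>y\<in>X. rho a x y * rho b y z) = (\<Sum>y\<in>X. if (x, y) \<in> rel a \<and> (y, z) \<in> rel b then 1 else 0)"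
  by (rule sum.cong[OF refl]) (simp add: rho_def)
 also have "\<dots> = of_nat (card {y \<in> X. (x, y) \<in> rel a \<and> (y, z) \<in> rel b})"
  by (simp add: sum.If_cases Int_def)
 also have "\<dots> = of_nat n ^ ell a b * rho (a \<cdot> b) x z"
 proof (cases "(x, z) \<in> rel (a \<cdot> b)")
  case True
  have "y i < n" if "y \<in> X" "i \<in> {1..k}" for y i using that by (auto simp: colourings_def PiE_iff)
  thus ?thesis using card_middle[OF a b True _ _ n0] x z True by (simp add: rho_def)
 next
  case False
  hence "{y \<in> X. (x, y) \<in> rel a \<and> (y, z) \<in> rel b} = {}" unfolding rel_compose[OF a b] by blast
  thus ?thesis using False by (simp add: rho_def)
 qed
 finally show ?thesis .
qed

lemma Rho_mult:
 assumes x: "x \<in> X" and z: "z \<in> X"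
 shows "Rho (mul a b) x z = (\<Sum>y\<in>X. Rho a x y * Rho b y z)"
proof -
 have "Rho (mul a b) x z = (\<Sum>e\<in>Bs. \<Sum>d1\<in>Bs. \<Sum>d2\<in>Bs. (if d1 \<cdot> d2 = e then a d1 * b d2 * of_nat n ^ ell d1 d2 * rho e x z else 0))"
  unfolding Rho_def alg_mult_def sum_distrib_right by (intro sum.cong refl) simp
 also have "\<dots> = (\<Sum>d1\<in>Bs. \<Sum>e\<in>Bs. \<Sum>d2\<in>Bs. (if d1 \<cdot> d2 = e then a d1 * b d2 * of_nat n ^ ell d1 d2 * rho e x z else 0))"
  by (rule sum.swap)
 also have "\<dots> = (\<Sum>d1\<in>Bs. \<Sum>d2\<in>Bs. \<Sum>e\<in>Bs. (if d1 \<cdot> d2 = e then a d1 * b d2 * of_nat n ^ ell d1 d2 * rho e x z else 0))"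
  by (rule sum.cong[OF refl]) (rule sum.swap)
 also have "\<dots> = (\<Sum>d1\<in>Bs. \<Sum>d2\<in>Bs. a d1 * b d2 * (\<Sum>y\<in>X. rho d1 x y * rho d2 y z))"
 proof (intro sum.cong[OF refl])
  fix d1 d2 assume d: "d1 \<in> Bs" "d2 \<in> Bs"
  have "(\<Sum>e\<in>Bs. (if d1 \<cdot> d2 = e then a d1 * b d2 * of_nat n ^ ell d1 d2 * rho e x z else 0))
    = a d1 * b d2 * of_nat n ^ ell d1 d2 * rho (d1 \<cdot> d2) x z"
   using basis_compose[OF d] by (simp add: sum.delta')
  thus "(\<Sum>e\<in>Bs. (if d1 \<cdot> d2 = e then a d1 * b d2 * of_nat n ^ ell d1 d2 * rho e x z else 0))
    = a d1 * b d2 * (\<Sum>y\<in>X. rho d1 x y * rho d2 y z)"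
   unfolding rho_mult[OF basis_sub[OF d(1)] basis_sub[OF d(2)] x z] by simp
 qed
 also have "\<dots> = (\<Sum>d1\<in>Bs. \<Sum>d2\<in>Bs. \<Sum>y\<in>X. (a d1 * rho d1 x y) * (b d2 * rho d2 y z))"
  by (simp add: sum_distrib_left mult_ac)
 also have "\<dots> = (\<Sum>d1\<in>Bs. \<Sum>y\<in>X. \<Sum>d2\<in>Bs. (a d1 * rho d1 x y) * (b d2 * rho d2 y z))"
  by (rule sum.cong[OF refl]) (rule sum.swap)
 also have "\<dots> = (\<Sum>y\<in>X. \<Sum>d1\<in>Bs. \<Sum>d2\<in>Bs. (a d1 * rho d1 x y) * (b d2 * rho d2 y z))"
  by (rule sum.swap)
 also have "\<dots> = (\<Sum>y\<in>X. Rho a x y * Rho b y z)"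
  unfolding Rho_def sum_product ..
 finally show ?thesis .
qed

definition star :: "(diagram => complex) => diagram => complex" where
 "star a d = cnj (a (transp d))"

lemma star_star [simp]: "star (star a) = a"
 by (simp add: star_def fun_eq_iff)

lemma star_diff: "star (a - b) = star a - star b"
 by (simp add: star_def fun_eq_iff)

lemma car_star: "a \<in> Car ==> star a \<in> Car"
 using basis_transp[of "transp _"] unfolding alg_carrier_def star_def by fastforce

lemma Rho_star: "Rho (star a) x y = cnj (Rho a y x)"
proof -
 have "cnj (Rho a y x) = (\<Sum>d\<in>Bs. cnj (a d) * rho (transp d) x y)"
  unfolding Rho_def cnj_sum by (rule sum.cong[OF refl]) (simp add: rho_def rel_transp)
 also have "\<dots> = (\<Sum>d\<in>Bs. cnj (a (transp d)) * rho d x y)"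
  by (rule sum.reindex_bij_witness[where i = transp and j = transp]) (auto simp: basis_transp)
 finally show ?thesis by (simp add: Rho_def star_def)
qed

text \<open>The Hilbert-Schmidt form of the representing matrices. Multiplication by a has
  multiplication by \<open>star a\<close> as its adjoint, see \<open>h_adjoint\<close>.\<close>

definition h :: "(diagram => complex) => (diagram => complex) => complex" where
 "h a b = (\<Sum>x\<in>X. \<Sum>y\<in>X. Rho a x y * cnj (Rho b x y))"

lemma h_diff_left: "h (a - b) c = h a c - h b c"
proof -
 have "Rho (a - b) x y = Rho a x y - Rho b x y" for x y
  by (simp add: Rho_def left_diff_distrib sum_subtractf)
 thus ?thesis by (simp add: h_def left_diff_distrib sum_subtractf)
qed

lemma h_scale_left: "h (\<lambda>d. c * a d) b = c * h a b"
proof -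
 have "Rho (\<lambda>d. c * a d) x y = c * Rho a x y" for x y by (simp add: Rho_def sum_distrib_left mult.assoc)
 thus ?thesis by (simp add: h_def sum_distrib_left mult.assoc)
qed

lemma h_right: "h a b = (\<Sum>d\<in>Bs. cnj (b d) * h a (delta d))"
proof -
 have R: "Rho (delta d) x y = rho d x y" if "d \<in> Bs" for d x y
  unfolding Rho_def using sum_delta_left[OF that] .
 have "(\<Sum>d\<in>Bs. cnj (b d) * h a (delta d)) = (\<Sum>d\<in>Bs. \<Sum>x\<in>X. \<Sum>y\<in>X. Rho a x y * cnj (b d * rho d x y))"
  unfolding h_def sum_distrib_left by (intro sum.cong refl) (simp add: R)
 also have "\<dots> = (\<Sum>x\<in>X. \<Sum>d\<in>Bs. \<Sum>y\<in>X. Rho a x y * cnj (b d * rho d x y))" by (rule sum.swap)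
 also have "\<dots> = (\<Sum>x\<in>X. \<Sum>y\<in>X. \<Sum>d\<in>Bs. Rho a x y * cnj (b d * rho d x y))"
  by (rule sum.cong[OF refl]) (rule sum.swap)
 also have "\<dots> = h a b" unfolding h_def Rho_def[of b] cnj_sum sum_distrib_left ..
 finally show ?thesis by simp
qed

lemma h_adjoint: "h (mul a b) c = h b (mul (star a) c)"
proof -
 have "h (mul a b) c = (\<Sum>x\<in>X. \<Sum>z\<in>X. \<Sum>y\<in>X. Rho a x y * Rho b y z * cnj (Rho c x z))"
  unfolding h_def by (intro sum.cong refl) (simp add: Rho_mult sum_distrib_right)
 also have "\<dots> = (\<Sum>x\<in>X. \<Sum>y\<in>X. \<Sum>z\<in>X. Rho a x y * Rho b y z * cnj (Rho c x z))"
  by (rule sum.cong[OF refl]) (rule sum.swap)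
 also have "\<dots> = (\<Sum>y\<in>X. \<Sum>x\<in>X. \<Sum>z\<in>X. Rho a x y * Rho b y z * cnj (Rho c x z))" by (rule sum.swap)
 also have "\<dots> = (\<Sum>y\<in>X. \<Sum>z\<in>X. \<Sum>x\<in>X. Rho a x y * Rho b y z * cnj (Rho c x z))"
  by (rule sum.cong[OF refl]) (rule sum.swap)
 also have "\<dots> = h b (mul (star a) c)"
  unfolding h_def by (intro sum.cong refl) (simp add: Rho_mult Rho_star cnj_sum sum_distrib_left mult_ac)
 finally show ?thesis .
qed

lemma h_self_zero: "h a a = 0 ==> x \<in> X ==> y \<in> X ==> Rho a x y = 0"
proof -
 assume h0: "h a a = 0" and x: "x \<in> X" and y: "y \<in> X"
 have "h a a = complex_of_real (\<Sum>x\<in>X. \<Sum>y\<in>X. (cmod (Rho a x y))\<^sup>2)"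
  unfolding h_def of_real_sum complex_norm_square ..
 hence "(\<Sum>x\<in>X. \<Sum>y\<in>X. (cmod (Rho a x y))\<^sup>2) = 0" using h0 by (metis of_real_eq_0_iff)
 hence "(\<Sum>y\<in>X. (cmod (Rho a x y))\<^sup>2) = 0"
  using x by (subst (asm) sum_nonneg_eq_0_iff) (auto intro: sum_nonneg)
 hence "(cmod (Rho a x y))\<^sup>2 = 0" using y by (subst (asm) sum_nonneg_eq_0_iff) auto
 thus "Rho a x y = 0" by simp
qed

end

text \<open>Colouring the blocks of d with distinct colours needs 2k colours; this is where the bound on n
 enters.\<close>
lemma separating_colouring:
 assumes d: "d \<in> all_diagrams k" and n: "2 * k \<le> n"
 shows "\<exists>x\<in>colourings k n. \<exists>y\<in>colourings k n. \<forall>e\<in>all_diagrams k.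
  (x, y) \<in> rel e \<longleftrightarrow> (\<forall>u v. same e u v --> same d u v)"
proof -
 have cv: "card (verts k) = 2 * k"
 proof -
  have "card (verts k) = card (Top ` {1..k}) + card (Bot ` {1..k})"
   unfolding verts_def by (rule card_Un_disjoint) auto
  thus ?thesis by (simp add: card_image inj_on_def)
 qed
 define blk where "blk u = {v. same d u v}" for u
 have "d = blk ` verts k" using diagram_eq_same[OF d] unfolding blk_def by (simp add: Setcompr_eq_image)
 hence "card d \<le> 2 * k" using card_image_le[OF finite_verts, of blk k] cv by simp
 hence "card d \<le> card {..<n}" using n by simp
 then obtain c where c: "c ` d \<subseteq> {..<n}" "inj_on c d"
  using card_le_inj[OF finite_diagram[OF d] finite_lessThan] by blast
 have bd: "blk u \<in> d" if "u \<in> verts k" for u using \<open>d = blk ` verts k\<close> that by blast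
 define x y where "x = (\<lambda>i\<in>{1..k}. c (blk (Top i)))" and "y = (\<lambda>i\<in>{1..k}. c (blk (Bot i)))"
 have col: "vl x y u = c (blk u)" if "u \<in> verts k" for u using that by (cases u) (auto simp: x_def y_def)
 have xy: "x \<in> colourings k n" "y \<in> colourings k n"
  unfolding x_def y_def colourings_def using bd c(1) by (auto simp: image_subset_iff)
 have eq: "vl x y u = vl x y v \<longleftrightarrow> same d u v" if u: "u \<in> verts k" and v: "v \<in> verts k" for u v
 proof -
  have "vl x y u = vl x y v \<longleftrightarrow> blk u = blk v"
   unfolding col[OF u] col[OF v] by (rule inj_on_eq_iff[OF c(2) bd[OF u] bd[OF v]])
  also have "\<dots> \<longleftrightarrow> same d u v"
  proof
   assume "blk u = blk v"
   thus "same d u v" using same_refl[OF d v] unfolding blk_def by blast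
  next
   assume s: "same d u v"
   show "blk u = blk v" unfolding blk_def using same_trans[OF d] s same_sym[OF s] by blast
  qed
  finally show ?thesis .
 qed
 have "(x, y) \<in> rel e \<longleftrightarrow> (\<forall>u v. same e u v --> same d u v)" if e: "e \<in> all_diagrams k" for e
  unfolding rel_def mem_Collect_eq case_prod_conv using eq same_verts[OF e] by metis
 thus ?thesis using xy by blast
qed

locale semisimple_algebra = diagram_algebra +
 assumes n2k: "2 * k \<le> n"
begin

text \<open>Let d be a diagram in the support of a with the fewest connected pairs. A colouring with
  distinct colours on the blocks of d is compatible only with refinements of d, so the matrix entry
  at this colouring is exactly a d.\<close>

lemma Rho_faithful:
 assumes a: "a \<in> Car" and z: "\<And>x y. x \<in> X ==> y \<in> X ==> Rho a x y = 0"
 shows "a = 0"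
proof (rule ccontr)
 assume "a \<noteq> 0"
 hence ne: "{d. a d \<noteq> 0} \<noteq> {}" by (auto simp: fun_eq_iff)
 have fin: "finite {d. a d \<noteq> 0}" by (rule finite_subset[OF _ finite_basis[of A k]]) (use carD[OF a] in blast)
 define pairs where "pairs d = {(u, v). same d u v}" for d
 obtain d where d: "a d \<noteq> 0" and min: "\<And>e. a e \<noteq> 0 ==> card (pairs d) \<le> card (pairs e)"
  using arg_min_if_finite[OF fin ne, of "\<lambda>d. card (pairs d)"] by (metis (mono_tags, lifting) mem_Collect_eq not_less)
 have dB: "d \<in> Bs" using carD[OF a d] .
 note da = basis_sub[OF dB]
 have fp: "finite (pairs d)"
  by (rule finite_subset[of _ "verts k \<times> verts k"]) (use same_verts[OF da] in \<open>auto simp: pairs_def\<close>)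
 obtain x y where xy: "x \<in> X" "y \<in> X"
  and r: "\<And>e. e \<in> all_diagrams k ==> (x, y) \<in> rel e \<longleftrightarrow> (\<forall>u v. same e u v --> same d u v)"
  using separating_colouring[OF da n2k] by blast
 have "a e * rho e x y = (if e = d then a d else 0)" if e: "e \<in> Bs" for e
 proof (cases "e = d")
  case True
  hence "(x, y) \<in> rel e" using r[OF da] by blast
  thus ?thesis using True by (simp add: rho_def)
 next
  case False
  show ?thesis
  proof (cases "(x, y) \<in> rel e")
   case True
   hence sub: "pairs e \<subseteq> pairs d" using r[OF basis_sub[OF e]] unfolding pairs_def by blast
   have "pairs e \<noteq> pairs d"
    using diagram_eqI[OF basis_sub[OF e] da] False unfolding pairs_def by blast
   hence "card (pairs e) < card (pairs d)" using sub fp by (simp add: psubset_card_mono psubset_eq)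
   hence "a e = 0" using min by fastforce
   thus ?thesis using False by simp
  qed (use False in \<open>simp add: rho_def\<close>)
 qed
 hence "Rho a x y = (\<Sum>e\<in>Bs. if e = d then a d else 0)" unfolding Rho_def by (intro sum.cong refl) blast
 hence "Rho a x y = a d" using dB by (simp add: sum.delta)
 thus False using z[OF xy] d by simp
qed

lemma h_definite: "a \<in> Car ==> h a a = 0 ==> a = 0"
 using Rho_faithful h_self_zero by blast

text \<open>Gram-Schmidt orthogonalisation, one diagram of D at a time; definiteness of
  \<open>h\<close> makes the division possible.\<close>

lemma ex_projection:
 assumes "finite D" "D \<subseteq> Bs" "a \<in> Car"
 shows "\<exists>a0. (\<forall>d. a0 d \<noteq> 0 --> d \<in> D) \<and> (\<forall>d\<in>D. h (a - a0) (delta d) = 0)"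
 using assms
proof (induction D arbitrary: a rule: finite_induct)
 case empty
 thus ?case by (intro exI[of _ 0]) simp
next
 case (insert d D)
 have dB: "d \<in> Bs" and DB: "D \<subseteq> Bs" using insert.prems by auto
 obtain a0 where a0: "\<And>e. a0 e \<noteq> 0 ==> e \<in> D" "\<And>e. e \<in> D ==> h (a - a0) (delta e) = 0"
  using insert.IH[OF DB insert.prems(2)] by blast
 obtain b0 where b0: "\<And>e. b0 e \<noteq> 0 ==> e \<in> D" "\<And>e. e \<in> D ==> h (delta d - b0) (delta e) = 0"
  using insert.IH[OF DB car_delta[OF dB]] by blast
 define b1 where "b1 = delta d - b0"
 have b0C: "b0 \<in> Car" by (rule carI) (use b0(1) DB in blast)
 have b1C: "b1 \<in> Car" unfolding b1_def by (rule car_diff[OF car_delta[OF dB] b0C])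
 have "b1 d = 1" using b0(1)[of d] insert.hyps(2) by (auto simp: b1_def delta_def)
 hence "b1 \<noteq> 0" by auto
 \<comment> \<open>\<open>b1\<close> is the part of d orthogonal to the earlier diagrams. It is
   nonzero because its coefficient at d is 1.\<close>
 hence hb: "h b1 b1 \<noteq> 0" using h_definite[OF b1C] by blast
 define c where "c = h (a - a0) b1 / h b1 b1"
 define r where "r = (a - a0) - (\<lambda>e. c * b1 e)"
 have orth: "h r (delta e) = 0" if "e \<in> D" for e
  unfolding r_def h_diff_left[of "a - a0"] h_scale_left
  using a0(2)[OF that] b0(2)[OF that, folded b1_def] by simp
 have span: "h r b = 0" if "\<And>e. b e \<noteq> 0 ==> e \<in> D" for b
  unfolding h_right[of r b] by (rule sum.neutral) (use orth that in fastforce)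
 have rb1: "h r b1 = 0" unfolding r_def h_diff_left h_scale_left c_def using hb by simp
 have "h r (delta d) = h r b1 + h r b0"
 proof -
  have "h r (delta d) = (\<Sum>e\<in>Bs. cnj (delta d e) * h r (delta e))" by (rule h_right)
  also have "\<dots> = (\<Sum>e\<in>Bs. cnj (b1 e) * h r (delta e) + cnj (b0 e) * h r (delta e))"
   by (rule sum.cong[OF refl]) (simp add: b1_def algebra_simps)
  also have "\<dots> = h r b1 + h r b0" unfolding sum.distrib h_right[of r b1] h_right[of r b0] ..
  finally show ?thesis .
 qed
 hence rd: "h r (delta d) = 0" using rb1 span[of b0] b0(1) by simp
 define a0' where "a0' = (\<lambda>e. a0 e + c * b1 e)"
 have "a - a0' = r" by (simp add: a0'_def r_def fun_eq_iff)
 moreover have "e \<in> insert d D" if e: "a0' e \<noteq> 0" for e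
 proof (rule ccontr)
  assume "e \<notin> insert d D"
  hence "a0 e = 0" "b1 e = 0" using a0(1)[of e] b0(1)[of e] by (auto simp: b1_def delta_def)
  thus False using e by (simp add: a0'_def)
 qed
 ultimately show ?case using orth rd by (intro exI[of _ a0']) auto
qed

section \<open>The ideals of small propagating number\<close>

definition low :: "nat => (diagram => complex) set" where
 "low m = {a \<in> Car. \<forall>d. a d \<noteq> 0 --> pn d < m}"

lemma low_diff: "a \<in> low m ==> b \<in> low m ==> a - b \<in> low m"
proof -
 assume a: "a \<in> low m" and b: "b \<in> low m"
 have "pn d < m" if "(a - b) d \<noteq> 0" for d
 proof -
  have "a d \<noteq> 0 \<or> b d \<noteq> 0" using that by auto
  thus ?thesis using a b unfolding low_def by blast
 qed
 thus ?thesis using a b car_diff unfolding low_def by blast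
qed

lemma low_mult_left: "b \<in> low m ==> mul a b \<in> low m"
proof -
 assume b: "b \<in> low m"
 have "pn e < m" if e: "mul a b e \<noteq> 0" for e
  using e
 proof (rule mult_supp)
  fix d1 d2 assume "d1 \<in> Bs" "d2 \<in> Bs" "d1 \<cdot> d2 = e" "b d2 \<noteq> 0"
  thus "pn e < m" using pn_compose_le2[OF basis_sub basis_sub, of d1 A k d2 A] b unfolding low_def by fastforce
 qed
 thus ?thesis unfolding low_def using car_mult by blast
qed

lemma low_mult_right: "a \<in> low m ==> mul a b \<in> low m"
proof -
 assume a: "a \<in> low m"
 have "pn e < m" if e: "mul a b e \<noteq> 0" for e
  using e
 proof (rule mult_supp)
  fix d1 d2 assume "d1 \<in> Bs" "d2 \<in> Bs" "d1 \<cdot> d2 = e" "a d1 \<noteq> 0"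
  thus "pn e < m" using pn_compose_le1[OF basis_sub basis_sub, of d1 A k d2 A] a unfolding low_def by fastforce
 qed
 thus ?thesis unfolding low_def using car_mult by blast
qed

lemma low_star: "a \<in> low m ==> star a \<in> low m"
 using car_star unfolding low_def star_def by fastforce

text \<open>The ideals spanned by diagrams of small propagating number are radical: the component of a
 orthogonal to such an ideal J generates a left ideal meeting J trivially.\<close>
lemma low_of_star_mult:
 assumes a: "a \<in> Car" and aa: "mul (star a) a \<in> low m"
 shows "a \<in> low m"
proof -
 define D where "D = {d \<in> Bs. pn d < m}"
 obtain a0 where a0: "\<And>d. a0 d \<noteq> 0 ==> d \<in> D" "\<And>d. d \<in> D ==> h (a - a0) (delta d) = 0"
  using ex_projection[OF _ _ a, of D] unfolding D_def by auto
 have a0l: "a0 \<in> low m" unfolding low_def using a0(1) by (auto simp: D_def intro: carI)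
 define a1 where "a1 = a - a0"
 have a1C: "a1 \<in> Car" unfolding a1_def using car_diff[OF a] a0l unfolding low_def by blast
 have orth: "h a1 b = 0" if "b \<in> low m" for b
 proof -
  have "cnj (b d) * h a1 (delta d) = 0" if "d \<in> Bs" for d
  proof (cases "b d = 0")
   case False
   hence "d \<in> D" using \<open>b \<in> low m\<close> \<open>d \<in> Bs\<close> unfolding low_def D_def by blast
   thus ?thesis using a0(2) a1_def by simp
  qed simp
  thus ?thesis unfolding h_right[of a1 b] by (intro sum.neutral) blast
 qed
 define c where "c = mul (star a1) a1"
 have "c = (mul (star a) a - mul (star a) a0) - (mul (star a0) a - mul (star a0) a0)"
  unfolding c_def a1_def star_diff mult_diff_left mult_diff_right by simp
 hence cl: "c \<in> low m"
  using aa a0l low_star[OF a0l] by (auto intro!: low_diff intro: low_mult_left low_mult_right)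
 have cC: "c \<in> Car" using cl unfolding low_def by blast
 have "h c c = h a1 (mul a1 c)" using h_adjoint[of "star a1" a1 c] by (simp add: c_def)
 also have "\<dots> = 0" by (rule orth[OF low_mult_left[OF cl]])
 finally have c0: "c = 0" using h_definite[OF cC] by blast
 have "h a1 a1 = h (mul a1 (alg_one k)) a1" by (simp add: mult_one_right[OF a1C])
 also have "\<dots> = h (alg_one k) c" unfolding h_adjoint c_def ..
 also have "\<dots> = 0" unfolding c0 by (simp add: h_def Rho_def)
 finally have "a1 = 0" using h_definite[OF a1C] by blast
 hence "a = a0" by (simp add: a1_def)
 thus ?thesis using a0l by simp
qed

end

section \<open>Modules over a diagram algebra\<close>

context diagram_algebra
begin

lemma car_decomp:
 assumes a: "a \<in> Car" shows "a = (\<Sum>d\<in>Bs. (\<lambda>e. a d * delta d e))"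
proof
 fix e
 have "(\<Sum>d\<in>Bs. (\<lambda>e. a d * delta d e)) e = (\<Sum>d\<in>Bs. if d = e then a d else 0)"
  unfolding sum_fun_apply by (rule sum.cong[OF refl]) (auto simp: delta_def)
 also have "\<dots> = a e" using carD[OF a, of e] by (auto simp: sum.delta)
 finally show "a e = (\<Sum>d\<in>Bs. (\<lambda>e. a d * delta d e)) e" by simp
qed

end

locale alg_module = diagram_algebra +
 fixes V :: "'v::ab_group_add set" and act
 assumes modl: "is_module A k n V act"
begin

text \<open>A module carries only an addition and an action, so scalar multiplication is recovered
  from the multiples of the identity diagram. Together with the action \<open>D\<close> of single
  diagrams it determines everything, see \<open>act_expand\<close>.\<close>

definition sc :: "complex => 'v => 'v" where "sc c = act (\<lambda>e. c * alg_one k e)"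
definition D :: "diagram => 'v => 'v" where "D d = act (delta d)"

lemma V0: "0 \<in> V" and Vadd: "x \<in> V ==> y \<in> V ==> x + y \<in> V"
 and act_in: "a \<in> Car ==> x \<in> V ==> act a x \<in> V"
 and act_add: "a \<in> Car ==> b \<in> Car ==> x \<in> V ==> act (a + b) x = act a x + act b x"
 and act_dist: "a \<in> Car ==> x \<in> V ==> y \<in> V ==> act a (x + y) = act a x + act a y"
 and act_mul: "a \<in> Car ==> b \<in> Car ==> x \<in> V ==> act (mul a b) x = act a (act b x)"
 and act_one: "x \<in> V ==> act (alg_one k) x = x"
 using modl unfolding is_module_def by blast+

lemma sc_in: "x \<in> V ==> sc c x \<in> V"
 unfolding sc_def using act_in[OF car_scale[OF car_one]] .

lemma D_in: "d \<in> Bs ==> x \<in> V ==> D d x \<in> V"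
 unfolding D_def using act_in[OF car_delta] .

lemma sc_dist: "x \<in> V ==> y \<in> V ==> sc c (x + y) = sc c x + sc c y"
 unfolding sc_def using act_dist[OF car_scale[OF car_one]] .

lemma D_dist: "d \<in> Bs ==> x \<in> V ==> y \<in> V ==> D d (x + y) = D d x + D d y"
 unfolding D_def using act_dist[OF car_delta] .

lemma sc_add: "x \<in> V ==> sc (a + b) x = sc a x + sc b x"
proof -
 assume x: "x \<in> V"
 have "(\<lambda>e. (a + b) * alg_one k e) = (\<lambda>e. a * alg_one k e) + (\<lambda>e. b * alg_one k e)"
  by (simp add: fun_eq_iff distrib_right)
 thus ?thesis unfolding sc_def using act_add[OF car_scale[OF car_one] car_scale[OF car_one] x] by simp
qed

lemma sc_one: "x \<in> V ==> sc 1 x = x"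
 unfolding sc_def using act_one by simp

lemma act_scale: "d \<in> Bs ==> x \<in> V ==> act (\<lambda>e. c * delta d e) x = sc c (D d x)"
 unfolding sc_def D_def using act_mul[OF car_scale[OF car_one] car_delta] scale_one_mult_delta by metis

lemma sc_mult: "x \<in> V ==> sc (a * b) x = sc a (sc b x)"
proof -
 assume x: "x \<in> V"
 have "mul (\<lambda>e. a * alg_one k e) (\<lambda>e. b * alg_one k e) = (\<lambda>e. (a * b) * alg_one k e)"
 proof
  fix e
  have "mul (\<lambda>e. a * alg_one k e) (\<lambda>e. b * alg_one k e) e = b * mul (\<lambda>e. a * alg_one k e) (alg_one k) e"
   unfolding mult_alt by (simp add: sum_distrib_left mult_ac)
  thus "mul (\<lambda>e. a * alg_one k e) (\<lambda>e. b * alg_one k e) e = (a * b) * alg_one k e"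
   unfolding mult_one_right[OF car_scale[OF car_one]] by simp
 qed
 thus ?thesis
  unfolding sc_def using act_mul[OF car_scale[OF car_one, of a] car_scale[OF car_one, of b] x] by simp
qed

lemma sc_zero_right [simp]: "sc c 0 = 0"
 using sc_dist[OF V0 V0, of c] by simp

lemma sc_zero_left: "x \<in> V ==> sc 0 x = 0"
 using sc_add[of x 0 0] by simp

lemma D_zero: "d \<in> Bs ==> D d 0 = 0"
 using D_dist[OF _ V0 V0, of d] by simp

lemma sc_minus_one: "x \<in> V ==> sc (- 1) x = - x"
 using sc_add[of x 1 "- 1"] sc_zero_left[of x] sc_one[of x] by (simp add: eq_neg_iff_add_eq_0 add.commute)

lemma sc_inverse: "x \<in> V ==> c \<noteq> 0 ==> sc (1 / c) (sc c x) = x"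
 using sc_mult[of x "1 / c" c] sc_one[of x] by simp

lemma sum_in: "(\<And>i. i \<in> I ==> f i \<in> V) ==> (\<Sum>i\<in>I. f i) \<in> V"
 by (induction I rule: infinite_finite_induct) (auto intro: V0 Vadd)

lemma sc_sum: "(\<And>i. i \<in> I ==> f i \<in> V) ==> sc a (\<Sum>i\<in>I. f i) = (\<Sum>i\<in>I. sc a (f i))"
 by (induction I rule: infinite_finite_induct) (auto simp: sc_dist sum_in)

lemma D_sum: "d \<in> Bs ==> (\<And>i. i \<in> I ==> f i \<in> V) ==> D d (\<Sum>i\<in>I. f i) = (\<Sum>i\<in>I. D d (f i))"
 by (induction I rule: infinite_finite_induct) (auto simp: D_dist sum_in D_zero)

lemma D_sc: "d \<in> Bs ==> x \<in> V ==> D d (sc c x) = sc c (D d x)"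
proof -
 assume d: "d \<in> Bs" and x: "x \<in> V"
 have "mul (delta d) (\<lambda>e. c * alg_one k e) = (\<lambda>e. c * delta d e)"
 proof
  fix e
  have "mul (delta d) (\<lambda>e. c * alg_one k e) e = c * mul (delta d) (alg_one k) e"
   unfolding mult_alt by (simp add: sum_distrib_left mult_ac)
  thus "mul (delta d) (\<lambda>e. c * alg_one k e) e = c * delta d e"
   unfolding mult_one_right[OF car_delta[OF d]] .
 qed
 hence "D d (sc c x) = act (\<lambda>e. c * delta d e) x"
  unfolding sc_def D_def using act_mul[OF car_delta[OF d] car_scale[OF car_one] x] by metis
 thus ?thesis using act_scale[OF d x] by simp
qed

lemma D_D: "d \<in> Bs ==> e \<in> Bs ==> x \<in> V ==> D d (D e x) = sc (of_nat n ^ ell d e) (D (d \<cdot> e) x)"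
proof -
 assume d: "d \<in> Bs" and e: "e \<in> Bs" and x: "x \<in> V"
 have "D d (D e x) = act (mul (delta d) (delta e)) x"
  unfolding D_def using act_mul[OF car_delta[OF d] car_delta[OF e] x] by simp
 thus ?thesis unfolding mult_delta[OF d e] act_scale[OF basis_compose[OF d e] x] .
qed

lemma act_expand:
 assumes a: "a \<in> Car" and x: "x \<in> V"
 shows "act a x = (\<Sum>d\<in>Bs. sc (a d) (D d x))"
proof -
 have "act (\<Sum>d\<in>I. (\<lambda>e. a d * delta d e)) x = (\<Sum>d\<in>I. sc (a d) (D d x))" if "finite I" "I \<subseteq> Bs" for I
  using that
 proof (induction I rule: finite_induct)
  case empty
  have z: "0 \<in> Car" by (rule carI) simp
  have "act 0 x = act 0 x + act 0 x" using act_add[OF z z x] by (simp only: add_0_left)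
  hence "act 0 x = 0" by (metis add_cancel_right_right)
  thus ?case by (simp only: sum.empty)
 next
  case (insert d I)
  have s: "(\<Sum>d\<in>I. (\<lambda>e. a d * delta d e)) \<in> Car"
  proof (rule carI)
   fix e assume "(\<Sum>d\<in>I. (\<lambda>e. a d * delta d e)) e \<noteq> 0"
   hence "(\<Sum>d\<in>I. a d * delta d e) \<noteq> 0" unfolding sum_fun_apply .
   then obtain d' where "d' \<in> I" "a d' * delta d' e \<noteq> 0" by (rule sum.not_neutral_contains_not_neutral)
   thus "e \<in> Bs" using insert.prems unfolding delta_def by (cases "e = d'") auto
  qed
  have d: "d \<in> Bs" and I: "I \<subseteq> Bs" using insert.prems by auto
  show ?case
   unfolding sum.insert[OF insert.hyps] act_add[OF car_scale[OF car_delta[OF d]] s x]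
    act_scale[OF d x] insert.IH[OF I] ..
 qed
 note expand = this[OF finite_basis order_refl]
 have "act a x = act (\<Sum>d\<in>Bs. (\<lambda>e. a d * delta d e)) x"
  using car_decomp[OF a] by (rule arg_cong[where f = "\<lambda>a. act a x"])
 thus ?thesis unfolding expand .
qed

lemma submoduleI:
 assumes "U \<subseteq> V" "0 \<in> U" "\<And>x y. x \<in> U ==> y \<in> U ==> x + y \<in> U"
  and "\<And>c x. x \<in> U ==> sc c x \<in> U" "\<And>d x. d \<in> Bs ==> x \<in> U ==> D d x \<in> U"
 shows "is_submodule A k V act U"
 unfolding is_submodule_def
proof (intro conjI ballI)
 fix a x assume a: "a \<in> Car" and x: "x \<in> U"
 have "(\<Sum>d\<in>I. sc (a d) (D d x)) \<in> U" if "I \<subseteq> Bs" for I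
  using finite_subset[OF that finite_basis] that by (induction I rule: finite_induct) (use assms x in auto)
 thus "act a x \<in> U" using act_expand[OF a] assms(1) x by (metis order_refl subsetD)
qed (use assms in auto)

lemma submoduleD:
 assumes "is_submodule A k V act U"
 shows "U \<subseteq> V" "0 \<in> U" "\<And>x y. x \<in> U ==> y \<in> U ==> x + y \<in> U"
  and "\<And>c x. x \<in> U ==> sc c x \<in> U" "\<And>d x. d \<in> Bs ==> x \<in> U ==> D d x \<in> U"
 using assms car_scale[OF car_one] car_delta unfolding is_submodule_def sc_def D_def by blast+

end

locale module_pair = M1: alg_module A k n V act + M2: alg_module A k n W act'
 for A k n and V :: "'v::ab_group_add set" and act and W :: "'w::ab_group_add set" and act'
begin

lemma hom_act:
 assumes f: "\<And>x. x \<in> V ==> f x \<in> W" "\<And>x y. x \<in> V ==> y \<in> V ==> f (x + y) = f x + f y"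
  and s: "\<And>c x. x \<in> V ==> f (M1.sc c x) = M2.sc c (f x)"
  and d: "\<And>d x. d \<in> M1.Bs ==> x \<in> V ==> f (M1.D d x) = M2.D d (f x)"
  and a: "a \<in> M1.Car" and x: "x \<in> V"
 shows "f (act a x) = act' a (f x)"
proof -
 have f0: "f 0 = 0" using f(2)[OF M1.V0 M1.V0] by simp
 have "f (\<Sum>d\<in>I. M1.sc (a d) (M1.D d x)) = (\<Sum>d\<in>I. M2.sc (a d) (M2.D d (f x))) \<and> (\<Sum>d\<in>I. M1.sc (a d) (M1.D d x)) \<in> V"
  if "finite I" "I \<subseteq> M1.Bs" for I
  using that
 proof (induction I rule: finite_induct)
  case (insert e I)
  hence e: "M1.sc (a e) (M1.D e x) \<in> V" using M1.sc_in M1.D_in x by auto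
  have "f (M1.sc (a e) (M1.D e x)) = M2.sc (a e) (M2.D e (f x))" using insert.prems s d M1.D_in x by auto
  thus ?case using insert e f(2)[OF e] M1.Vadd[OF e] by auto
 qed (simp add: f0 M1.V0)
 thus ?thesis
  unfolding M1.act_expand[OF a x] M2.act_expand[OF a f(1)[OF x]] using finite_basis by blast
qed

text \<open>Schur's lemma: kernel and image of a nonzero homomorphism of irreducible modules.\<close>
lemma iso_of_hom:
 assumes f: "\<And>x. x \<in> V ==> f x \<in> W" "\<And>x y. x \<in> V ==> y \<in> V ==> f (x + y) = f x + f y"
  and s: "\<And>c x. x \<in> V ==> f (M1.sc c x) = M2.sc c (f x)"
  and d: "\<And>d x. d \<in> M1.Bs ==> x \<in> V ==> f (M1.D d x) = M2.D d (f x)"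
  and irr: "irreducible_module A k n V act" "irreducible_module A k n W act'"
  and nz: "x0 \<in> V" "f x0 \<noteq> 0"
 shows "module_iso A k V act W act'"
proof -
 have f0: "f 0 = 0" using f(2)[OF M1.V0 M1.V0] by simp
 have "is_submodule A k V act {x \<in> V. f x = 0}"
  by (rule M1.submoduleI)
   (auto simp: M1.V0 f0 M1.Vadd f(2) M1.sc_in s M1.D_in d M2.D_zero)
 hence "{x \<in> V. f x = 0} = {0}" using irr(1) nz unfolding irreducible_module_def by blast
 hence ker: "x = 0" if "x \<in> V" "f x = 0" for x using that by blast
 have "is_submodule A k W act' (f ` V)"
 proof (rule M2.submoduleI)
  show "f ` V \<subseteq> W" using f(1) by blast
  show "0 \<in> f ` V" using f0 M1.V0 by (metis imageI)
  show "x + y \<in> f ` V" if xy: "x \<in> f ` V" "y \<in> f ` V" for x y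
  proof -
   obtain u v where "u \<in> V" "v \<in> V" "x = f u" "y = f v" using xy by blast
   hence "x + y = f (u + v)" "u + v \<in> V" using f(2) M1.Vadd by auto
   thus ?thesis by blast
  qed
  show "M2.sc c x \<in> f ` V" if x: "x \<in> f ` V" for c x
  proof -
   obtain u where u: "u \<in> V" "x = f u" using x by blast
   have "M2.sc c x = f (M1.sc c u)" using s[OF u(1)] u(2) by simp
   thus ?thesis using M1.sc_in[OF u(1)] by blast
  qed
  show "M2.D e x \<in> f ` V" if e: "e \<in> M1.Bs" and x: "x \<in> f ` V" for e x
  proof -
   obtain u where u: "u \<in> V" "x = f u" using x by blast
   have "M2.D e x = f (M1.D e u)" using d[OF e u(1)] u(2) by simp
   thus ?thesis using M1.D_in[OF e u(1)] by blast
  qed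
 qed
 hence img: "f ` V = W" using irr(2) nz unfolding irreducible_module_def by blast
 have "inj_on f V"
 proof (rule inj_onI)
  fix x y assume xy: "x \<in> V" "y \<in> V" "f x = f y"
  have my: "- y \<in> V" using M1.sc_minus_one[OF xy(2)] M1.sc_in[OF xy(2)] by metis
  have "f (- y) = - f y" using s[OF xy(2), of "- 1"] M1.sc_minus_one[OF xy(2)] M2.sc_minus_one[OF f(1)[OF xy(2)]] by simp
  hence "f (x + - y) = 0" using f(2)[OF xy(1) my] xy(3) by simp
  hence "x + - y = 0" using ker M1.Vadd[OF xy(1) my] by blast
  thus "x = y" by simp
 qed
 hence "bij_betw f V W" using img by (simp add: bij_betw_def)
 moreover have "\<forall>a\<in>M1.Car. \<forall>x\<in>V. f (act a x) = act' a (f x)"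
  using hom_act[of f, OF f(1) f(2) s d] by simp
 moreover have "\<forall>x\<in>V. \<forall>y\<in>V. f (x + y) = f x + f y" using f(2) by blast
 ultimately show ?thesis unfolding module_iso_def by (intro exI[of _ f] conjI)
qed

lemma iso_hom:
 assumes "module_iso A k V act W act'"
 obtains f where "bij_betw f V W" "\<And>x y. x \<in> V ==> y \<in> V ==> f (x + y) = f x + f y"
  "\<And>c x. x \<in> V ==> f (M1.sc c x) = M2.sc c (f x)"
  "\<And>d x. d \<in> M1.Bs ==> x \<in> V ==> f (M1.D d x) = M2.D d (f x)"
proof -
 obtain f where f: "bij_betw f V W" "\<forall>x\<in>V. \<forall>y\<in>V. f (x + y) = f x + f y"
  "\<forall>a\<in>M1.Car. \<forall>x\<in>V. f (act a x) = act' a (f x)" using assms unfolding module_iso_def by blast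
 show ?thesis
 proof (rule that[of f])
  show "f (M1.sc c x) = M2.sc c (f x)" if "x \<in> V" for c x
   using f(3) M1.car_scale[OF M1.car_one] that unfolding M1.sc_def M2.sc_def by blast
  show "f (M1.D d x) = M2.D d (f x)" if "d \<in> M1.Bs" "x \<in> V" for d x
   using f(3) M1.car_delta that unfolding M1.D_def M2.D_def by blast
 qed (use f in auto)
qed

end

section \<open>The action on symmetric diagrams\<close>

definition conj_diagram :: "diagram => diagram => diagram" where
 "conj_diagram d w = d \<cdot> w \<cdot> transp d"

context diagram_algebra
begin

context
 fixes m :: nat
begin

abbreviation "Ws \<equiv> symW A k m"

lemma W_D: "w \<in> Ws ==> w \<in> Bs" "w \<in> Ws ==> is_proj w" "w \<in> Ws ==> pn w = m" "w \<in> Ws ==> w \<in> all_diagrams k"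
 using symW_iff basis_sub by blast+

lemma finite_W [simp]: "finite Ws"
 by (rule finite_subset[OF _ finite_basis[of A k]]) (auto dest: W_D)

lemma compose_transp_W: "d \<in> Bs ==> pn d = m ==> d \<cdot> transp d \<in> Ws"
 unfolding symW_iff
 using basis_compose basis_transp proj_compose_transp[OF basis_sub] pn_compose_transp[OF basis_sub] by blast

lemma transp_compose_W: "d \<in> Bs ==> pn d = m ==> transp d \<cdot> d \<in> Ws"
 using compose_transp_W[OF basis_transp, of d] by simp

text \<open>If no propagating block is lost, stability says that \<open>d \<cdot> w\<close> has
  lower half w; it is then an arrow from w to the conjugated diagram, and its permutation is the
  twist.\<close>

lemma conj_facts:
 assumes d: "d \<in> Bs" and w: "w \<in> Ws" and p: "pn (conj_diagram d w) = m"
 shows "pn (d \<cdot> w) = m" "conj_diagram d w = (d \<cdot> w) \<cdot> transp (d \<cdot> w)"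
  "transp (d \<cdot> w) \<cdot> (d \<cdot> w) = w" "conj_diagram d w \<in> Ws" "d \<cdot> w \<in> Bs"
  "twist d w m = perm (d \<cdot> w)"
proof -
 note da = basis_sub[OF d] and wa = W_D(4)[OF w] and wp = W_D(2)[OF w]
 show 1: "pn (d \<cdot> w) = m" using pn_conj[OF da wa wp] p unfolding conj_diagram_def by simp
 show 2: "conj_diagram d w = (d \<cdot> w) \<cdot> transp (d \<cdot> w)"
  unfolding conj_diagram_def by (rule conj_proj[OF da wa wp])
 show "transp (d \<cdot> w) \<cdot> (d \<cdot> w) = w"
  using pn_stable_bot[OF da wa] 1 W_D(3)[OF w] wp by (simp add: is_proj_def)
 show 3: "d \<cdot> w \<in> Bs" by (rule basis_compose[OF d W_D(1)[OF w]])
 show "conj_diagram d w \<in> Ws" unfolding 2 by (rule compose_transp_W[OF 3 1])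
 show "twist d w m = perm (d \<cdot> w)" by (rule twist_eq_perm[OF da wa wp W_D(3)[OF w] 1])
qed

lemma pn_conj_le:
 assumes d: "d \<in> Bs" and w: "w \<in> Bs"
 shows "pn (conj_diagram d w) \<le> pn w" "pn (conj_diagram d w) \<le> pn d"
 unfolding conj_diagram_def
 using pn_compose_le1[OF compose_in[OF basis_sub[OF d] basis_sub[OF w]] transp_in[OF basis_sub[OF d]]]
  pn_compose_le2[OF basis_sub[OF d] basis_sub[OF w]] pn_compose_le1[OF basis_sub[OF d] basis_sub[OF w]]
 by linarith+

lemma conj_compose:
 assumes a: "a \<in> Bs" and b: "b \<in> Bs" and w: "w \<in> Bs"
 shows "conj_diagram (a \<cdot> b) w = conj_diagram a (conj_diagram b w)"
 unfolding conj_diagram_def transp_compose[OF basis_sub[OF a] basis_sub[OF b]]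
 using a b w by (simp add: compose_assoc[of _ k] compose_in transp_in basis_sub)

text \<open>The cocycle identities behind associativity of the action.\<close>
lemma conj_cocycle:
 assumes a: "a \<in> Bs" and b: "b \<in> Bs" and w: "w \<in> Ws" and p: "pn (conj_diagram (a \<cdot> b) w) = m"
 shows "conj_diagram b w \<in> Ws" "pn (conj_diagram b w) = m"
  "ell b w + ell a (conj_diagram b w) = ell a b + ell (a \<cdot> b) w"
  "perm ((a \<cdot> b) \<cdot> w) = perm (a \<cdot> conj_diagram b w) \<circ> perm (b \<cdot> w)"
proof -
 let ?e = "b \<cdot> w" and ?w2 = "conj_diagram b w"
 note aa = basis_sub[OF a] and ba = basis_sub[OF b] and wa = W_D(4)[OF w]
 have w2B: "?w2 \<in> Bs" unfolding conj_diagram_def by (intro basis_compose basis_transp b W_D(1)[OF w])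
 have p2: "pn (conj_diagram a ?w2) = m" using p conj_compose[OF a b W_D(1)[OF w]] by simp
 thus pm: "pn ?w2 = m"
  using pn_conj_le[OF a w2B] pn_conj_le[OF b W_D(1)[OF w]] W_D(3)[OF w] by linarith
 note f = conj_facts[OF b w pm]
 show w2: "?w2 \<in> Ws" by (rule f(4))
 note g = conj_facts[OF a w2 p2]
 note ea = basis_sub[OF f(5)]
 note w2a = W_D(4)[OF w2] and w2p = W_D(2)[OF w2]
 have "ell a ?w2 = ell a ?e"
  by (rule ell_cong[OF aa aa refl w2a ea])
   (use w2p f(2) in \<open>simp add: is_proj_def\<close>)
 thus "ell b w + ell a ?w2 = ell a b + ell (a \<cdot> b) w" using ell_assoc[OF aa ba wa] by simp
 have "(a \<cdot> b) \<cdot> w = a \<cdot> (?e \<cdot> transp ?e \<cdot> ?e)"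
  using compose_regular[OF ea] compose_assoc[OF aa ba wa] by simp
 also have "\<dots> = (a \<cdot> ?w2) \<cdot> ?e" unfolding f(2)[symmetric] using compose_assoc[OF aa w2a ea] by simp
 finally have "perm ((a \<cdot> b) \<cdot> w) = perm ((a \<cdot> ?w2) \<cdot> ?e)" by simp
 also have "\<dots> = perm (a \<cdot> ?w2) \<circ> perm ?e"
  by (rule perm_compose[OF basis_sub[OF g(5)] ea trans[OF g(3) f(2)]])
 finally show "perm ((a \<cdot> b) \<cdot> w) = perm (a \<cdot> ?w2) \<circ> perm ?e" .
qed

text \<open>The action of a single diagram, with the twist already replaced by the permutation of
  \<open>d \<cdot> w\<close>; see \<open>Aact_dact\<close>.\<close>

definition dact :: "diagram => (diagram => (nat => nat) => complex) => diagram => (nat => nat) => complex" where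
 "dact d F = (\<lambda>w' T. \<Sum>w\<in>Ws. if conj_diagram d w = w' \<and> pn w' = m
   then of_nat n ^ ell d w * F w (T \<circ> perm (d \<cdot> w)) else 0)"

lemma dact_D:
 assumes a: "a \<in> Bs" and b: "b \<in> Bs"
 shows "dact a (dact b F) = (\<lambda>w' T. of_nat n ^ ell a b * dact (a \<cdot> b) F w' T)"
proof (intro ext)
 fix w' T
 let ?c = "\<lambda>w2 w. conj_diagram a w2 = w' \<and> pn w' = m \<and> conj_diagram b w = w2 \<and> pn w2 = m"
 let ?v = "\<lambda>w2 w. of_nat n ^ ell a w2 * (of_nat n ^ ell b w * F w (T \<circ> perm (a \<cdot> w2) \<circ> perm (b \<cdot> w))) :: complex"
 have "dact a (dact b F) w' T = (\<Sum>w2\<in>Ws. \<Sum>w\<in>Ws. if ?c w2 w then ?v w2 w else 0)"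
  unfolding dact_def
 proof (rule sum.cong[OF refl])
  fix w2
  show "(if conj_diagram a w2 = w' \<and> pn w' = m then of_nat n ^ ell a w2 *
    (\<Sum>w\<in>Ws. if conj_diagram b w = w2 \<and> pn w2 = m then of_nat n ^ ell b w *
     F w (T \<circ> perm (a \<cdot> w2) \<circ> perm (b \<cdot> w)) else 0) else 0) = (\<Sum>w\<in>Ws. if ?c w2 w then ?v w2 w else 0)"
  proof (cases "conj_diagram a w2 = w' \<and> pn w' = m")
   case True
   show ?thesis unfolding if_P[OF True] sum_distrib_left
    by (rule sum.cong[OF refl]) (use True in simp)
  next
   case False
   have "(\<Sum>w\<in>Ws. if ?c w2 w then ?v w2 w else 0) = 0"
    by (intro sum.neutral ballI if_not_P) (use False in blast)
   thus ?thesis unfolding if_not_P[OF False] by (rule sym)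
  qed
 qed
 also have "\<dots> = (\<Sum>w\<in>Ws. \<Sum>w2\<in>Ws. if ?c w2 w then ?v w2 w else 0)" by (rule sum.swap)
 also have "\<dots> = (\<Sum>w\<in>Ws. of_nat n ^ ell a b * (if conj_diagram (a \<cdot> b) w = w' \<and> pn w' = m
   then of_nat n ^ ell (a \<cdot> b) w * F w (T \<circ> perm ((a \<cdot> b) \<cdot> w)) else 0))"
 proof (rule sum.cong[OF refl])
  fix w assume w: "w \<in> Ws"
  let ?w2 = "conj_diagram b w"
  show "(\<Sum>w2\<in>Ws. if ?c w2 w then ?v w2 w else 0) = of_nat n ^ ell a b * (if conj_diagram (a \<cdot> b) w = w' \<and> pn w' = m
   then of_nat n ^ ell (a \<cdot> b) w * F w (T \<circ> perm ((a \<cdot> b) \<cdot> w)) else 0)"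
  proof (cases "conj_diagram (a \<cdot> b) w = w' \<and> pn w' = m")
   case True
   hence "pn (conj_diagram (a \<cdot> b) w) = m" by simp
   note cc = conj_cocycle[OF a b w this]
   have "(\<Sum>w2\<in>Ws. if ?c w2 w then ?v w2 w else 0) = (\<Sum>w2\<in>Ws. if w2 = ?w2 then ?v ?w2 w else 0)"
    by (rule sum.cong[OF refl]) (use True cc(2) conj_compose[OF a b W_D(1)[OF w]] in auto)
   also have "\<dots> = ?v ?w2 w" using cc(1) by (simp add: sum.delta)
   also have "\<dots> = of_nat n ^ (ell b w + ell a ?w2) * F w (T \<circ> perm ((a \<cdot> b) \<cdot> w))"
    unfolding cc(4) by (simp add: power_add comp_assoc)
   also have "\<dots> = of_nat n ^ ell a b * (of_nat n ^ ell (a \<cdot> b) w * F w (T \<circ> perm ((a \<cdot> b) \<cdot> w)))"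
    unfolding cc(3) by (simp add: power_add)
   finally show ?thesis using True by simp
  next
   case False
   hence "(\<Sum>w2\<in>Ws. if ?c w2 w then ?v w2 w else 0) = 0"
    using conj_compose[OF a b W_D(1)[OF w]] by (intro sum.neutral) auto
   thus ?thesis unfolding if_not_P[OF False] by simp
  qed
 qed
 finally show "dact a (dact b F) w' T = of_nat n ^ ell a b * dact (a \<cdot> b) F w' T"
  unfolding dact_def sum_distrib_left .
qed

lemma dact_id:
 assumes F: "\<And>w. w \<notin> Ws ==> F w = 0"
 shows "dact (id_diagram k) F = F"
proof (intro ext)
 fix w' T
 have c: "conj_diagram (id_diagram k) w = w" "ell (id_diagram k) w = 0" "perm (id_diagram k \<cdot> w) = id"
  if w: "w \<in> Ws" for w
  using W_D(4)[OF w] ell_id perm_proj[OF W_D(4)[OF w] W_D(2)[OF w]]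
  by (simp_all add: conj_diagram_def transp_id id_compose compose_id)
 have "dact (id_diagram k) F w' T = (\<Sum>w\<in>Ws. if w = w' then F w' T else 0)"
  unfolding dact_def
 proof (rule sum.cong[OF refl])
  fix w assume w: "w \<in> Ws"
  show "(if conj_diagram (id_diagram k) w = w' \<and> pn w' = m
    then of_nat n ^ ell (id_diagram k) w * F w (T \<circ> perm (id_diagram k \<cdot> w)) else 0) = (if w = w' then F w' T else 0)"
   unfolding c[OF w] using W_D(3)[OF w] by (cases "w = w'") simp_all
 qed
 also have "\<dots> = F w' T" using F[of w'] by (simp add: sum.delta)
 finally show "dact (id_diagram k) F w' T = F w' T" .
qed

end

lemma Aact_dact: "Aact A k n lam a F w' T = (\<Sum>d\<in>Bs. a d * dact (star_size lam) d F w' T)"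
proof -
 let ?m = "star_size lam"
 have "Aact A k n lam a F w' T = (\<Sum>d\<in>Bs. \<Sum>w\<in>symW A k ?m. a d * (if conj_diagram d w = w' \<and> pn w' = ?m
   then of_nat n ^ ell d w * F w (T \<circ> perm (d \<cdot> w)) else 0))"
  unfolding Aact_def
 proof (intro sum.cong[OF refl])
  fix d w assume d: "d \<in> Bs" and w: "w \<in> symW A k ?m"
  show "(if d \<cdot> w \<cdot> transp d = w' \<and> pn w' = ?m
     then a d * of_nat n ^ ell d w * perm_act (twist d w ?m) (F w) T else 0) =
   a d * (if conj_diagram d w = w' \<and> pn w' = ?m then of_nat n ^ ell d w * F w (T \<circ> perm (d \<cdot> w)) else 0)"
   using conj_facts(6)[OF d w] by (auto simp: conj_diagram_def perm_act_def)
 qed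
 thus ?thesis unfolding dact_def sum_distrib_left .
qed

lemma dact_add: "dact m d (F + G) = dact m d F + dact m d G"
 by (intro ext) (auto simp: dact_def plus_fun_def sum.distrib[symmetric] algebra_simps intro!: sum.cong)

lemma dact_scale: "dact m d (\<lambda>w T. c * F w T) = (\<lambda>w T. c * dact m d F w T)"
 by (intro ext) (auto simp: dact_def sum_distrib_left intro!: sum.cong)

lemma Aact_delta: "d \<in> Bs ==> Aact A k n lam (delta d) F = dact (star_size lam) d F"
 by (intro ext) (simp only: Aact_dact sum_delta_left)

lemma dact_Amod:
 assumes F: "F \<in> Amod A k lam" and d: "d \<in> Bs"
 shows "dact (star_size lam) d F \<in> Amod A k lam"
proof -
 let ?m = "star_size lam"
 have zero: "dact ?m d F w' = 0" if "w' \<notin> symW A k ?m" for w'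
 proof
  fix T
  show "dact ?m d F w' T = (0 :: (nat => nat) => complex) T"
   unfolding dact_def using conj_facts(4)[OF d, of _ ?m] that by (auto intro!: sum.neutral)
 qed
 have "dact ?m d F w' \<in> specht (tl lam)" for w'
 proof -
  have "dact ?m d F w' = (\<lambda>T. \<Sum>w\<in>{w \<in> symW A k ?m. conj_diagram d w = w' \<and> pn w' = ?m}.
    of_nat n ^ ell d w * perm_act (perm (d \<cdot> w)) (F w) T)"
   unfolding dact_def perm_act_def by (intro ext sum.mono_neutral_cong_right) auto
  also have "\<dots> \<in> specht (tl lam)"
  proof (rule specht_sum)
   fix w assume w: "w \<in> {w \<in> symW A k ?m. conj_diagram d w = w' \<and> pn w' = ?m}"
   hence w1: "w \<in> symW A k ?m" "pn (conj_diagram d w) = ?m" by auto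
   note f = conj_facts[OF d w1]
   have "perm (d \<cdot> w) permutes {1..sum_list (tl lam)}"
    using perm_permutes[OF basis_sub[OF f(5)]] f(1) by (simp add: star_size_def)
   thus "perm_act (perm (d \<cdot> w)) (F w) \<in> specht (tl lam)"
    using F w1(1) specht_perm_act unfolding Amod_def by blast
  qed
  finally show ?thesis .
 qed
 thus ?thesis unfolding Amod_def using zero by blast
qed

lemma Amod_zero: "0 \<in> Amod A k lam"
 unfolding Amod_def using specht_zero by simp

lemma Amod_add: "F \<in> Amod A k lam ==> G \<in> Amod A k lam ==> F + G \<in> Amod A k lam"
 unfolding Amod_def using specht_add by auto

lemma Amod_scale:
 assumes "F \<in> Amod A k lam" shows "(\<lambda>w T. c * F w T) \<in> Amod A k lam"
proof -
 have "(\<lambda>T. c * F w T) = 0" if "w \<notin> symW A k (star_size lam)" for w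
  using assms that unfolding Amod_def by (auto simp: fun_eq_iff)
 thus ?thesis using assms specht_scale unfolding Amod_def by blast
qed

lemma Aact_sum: "Aact A k n lam a F = (\<Sum>d\<in>Bs. (\<lambda>w T. a d * dact (star_size lam) d F w T))"
 by (intro ext) (simp add: Aact_dact sum_fun_apply)

lemma Amod_sum: "(\<And>i. i \<in> I ==> f i \<in> Amod A k lam) ==> (\<Sum>i\<in>I. f i) \<in> Amod A k lam"
 by (induction I rule: infinite_finite_induct) (auto intro: Amod_zero Amod_add)

lemma Aact_Amod: "F \<in> Amod A k lam ==> Aact A k n lam a F \<in> Amod A k lam"
 unfolding Aact_sum by (intro Amod_sum Amod_scale dact_Amod)

lemma dact_zero: "dact m d 0 = 0"
proof (intro ext)
 fix w T show "dact m d 0 w T = (0 :: diagram => (nat => nat) => complex) w T"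
  unfolding dact_def by (simp add: sum.neutral)
qed

lemma dact_sum: "dact m d (\<Sum>i\<in>I. f i) = (\<Sum>i\<in>I. dact m d (f i))"
proof (induction I rule: infinite_finite_induct)
 case (insert i I)
 show ?case unfolding sum.insert[OF insert.hyps] dact_add insert.IH ..
qed (simp_all only: sum.infinite sum.empty dact_zero not_False_eq_True)

lemma Aact_mult:
 shows "Aact A k n lam (mul a b) F = Aact A k n lam a (Aact A k n lam b F)"
proof (intro ext)
 fix w T
 let ?m = "star_size lam"
 have "Aact A k n lam a (Aact A k n lam b F) w T = (\<Sum>d1\<in>Bs. a d1 * (\<Sum>d2\<in>Bs. b d2 * dact ?m d1 (dact ?m d2 F) w T))"
  unfolding Aact_dact Aact_sum[of lam b] dact_sum dact_scale sum_fun_apply ..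
 also have "\<dots> = (\<Sum>d1\<in>Bs. \<Sum>d2\<in>Bs. a d1 * b d2 * of_nat n ^ ell d1 d2 * dact ?m (d1 \<cdot> d2) F w T)"
  unfolding sum_distrib_left by (intro sum.cong refl) (simp add: dact_D)
 also have "\<dots> = (\<Sum>d1\<in>Bs. \<Sum>d2\<in>Bs. \<Sum>e\<in>Bs. if d1 \<cdot> d2 = e then a d1 * b d2 * of_nat n ^ ell d1 d2 * dact ?m e F w T else 0)"
 proof (intro sum.cong[OF refl])
  fix d1 d2 assume "d1 \<in> Bs" "d2 \<in> Bs"
  thus "a d1 * b d2 * of_nat n ^ ell d1 d2 * dact ?m (d1 \<cdot> d2) F w T =
   (\<Sum>e\<in>Bs. if d1 \<cdot> d2 = e then a d1 * b d2 * of_nat n ^ ell d1 d2 * dact ?m e F w T else 0)"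
   using basis_compose by (simp add: sum.delta')
 qed
 also have "\<dots> = (\<Sum>d1\<in>Bs. \<Sum>e\<in>Bs. \<Sum>d2\<in>Bs. if d1 \<cdot> d2 = e then a d1 * b d2 * of_nat n ^ ell d1 d2 * dact ?m e F w T else 0)"
  by (rule sum.cong[OF refl]) (rule sum.swap)
 also have "\<dots> = (\<Sum>e\<in>Bs. \<Sum>d1\<in>Bs. \<Sum>d2\<in>Bs. if d1 \<cdot> d2 = e then a d1 * b d2 * of_nat n ^ ell d1 d2 * dact ?m e F w T else 0)"
  by (rule sum.swap)
 also have "\<dots> = Aact A k n lam (mul a b) F w T"
  unfolding Aact_dact alg_mult_def sum_distrib_right by (intro sum.cong refl) simp
 finally show "Aact A k n lam (mul a b) F w T = Aact A k n lam a (Aact A k n lam b F) w T" by simp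
qed

lemma Amod_module: "is_module A k n (Amod A k lam) (Aact A k n lam)"
 unfolding is_module_def
proof (intro conjI ballI)
 fix x assume x: "x \<in> Amod A k lam"
 have "- x = (\<lambda>w T. (- 1) * x w T)" by (simp add: fun_eq_iff)
 thus "- x \<in> Amod A k lam" using Amod_scale[OF x] by metis
 show "Aact A k n lam (alg_one k) x = x"
  unfolding alg_one_delta Aact_delta[OF basis_id]
  by (rule dact_id) (use x in \<open>auto simp: Amod_def\<close>)
next
 fix a b x
 show "Aact A k n lam (a + b) x = Aact A k n lam a x + Aact A k n lam b x"
  by (intro ext) (simp add: Aact_dact sum.distrib distrib_right)
next
 fix a x y
 show "Aact A k n lam a (x + y) = Aact A k n lam a x + Aact A k n lam a y"
  by (intro ext) (simp add: Aact_dact dact_add sum.distrib distrib_left)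
qed (simp_all add: Amod_zero Amod_add Aact_Amod Aact_mult)

end

section \<open>Irreducibility\<close>

definition single :: "diagram => ((nat => nat) => complex) => diagram => (nat => nat) => complex" where
 "single w v = (\<lambda>u. if u = w then v else 0)"

lemma single_apply [simp]: "single w v w = v"
 by (simp add: single_def)

context diagram_algebra
begin

context
 fixes m :: nat
begin

lemma dact_single:
 assumes d: "d \<in> Bs" and w: "w \<in> Ws m" and p: "pn (conj_diagram d w) = m"
 shows "dact m d (single w v) = single (conj_diagram d w) (\<lambda>T. of_nat n ^ ell d w * perm_act (perm (d \<cdot> w)) v T)"
proof (intro ext)
 fix w' T
 have "dact m d (single w v) w' T = (\<Sum>u\<in>Ws m. if u = w then (if conj_diagram d w = w' \<and> pn w' = m
   then of_nat n ^ ell d w * v (T \<circ> perm (d \<cdot> w)) else 0) else 0)"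
  unfolding dact_def
 proof (rule sum.cong[OF refl])
  fix u show "(if conj_diagram d u = w' \<and> pn w' = m then of_nat n ^ ell d u * single w v u (T \<circ> perm (d \<cdot> u)) else 0) =
   (if u = w then (if conj_diagram d w = w' \<and> pn w' = m then of_nat n ^ ell d w * v (T \<circ> perm (d \<cdot> w)) else 0) else 0)"
   by (cases "u = w") (simp_all add: single_def)
 qed
 also have "\<dots> = (if conj_diagram d w = w' \<and> pn w' = m then of_nat n ^ ell d w * v (T \<circ> perm (d \<cdot> w)) else 0)"
  using w by (simp add: sum.delta)
 also have "\<dots> = single (conj_diagram d w) (\<lambda>T. of_nat n ^ ell d w * perm_act (perm (d \<cdot> w)) v T) w' T"
  using p by (cases "conj_diagram d w = w'") (auto simp: single_def perm_act_def)
 finally show "dact m d (single w v) w' T = single (conj_diagram d w) (\<lambda>T. of_nat n ^ ell d w * perm_act (perm (d \<cdot> w)) v T) w' T" .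
qed

lemma dact_low: "d \<in> Bs ==> pn d < m ==> dact m d F = 0"
proof (intro ext)
 fix w' T assume d: "d \<in> Bs" and p: "pn d < m"
 have "(if conj_diagram d w = w' \<and> pn w' = m then of_nat n ^ ell d w * F w (T \<circ> perm (d \<cdot> w)) else 0) = 0"
  if w: "w \<in> Ws m" for w
  using pn_conj_le(2)[OF d W_D(1)[OF w]] p by auto
 thus "dact m d F w' T = (0 :: diagram => (nat => nat) => complex) w' T"
  unfolding dact_def by (simp add: sum.neutral)
qed

text \<open>When d itself has propagating number m, stability fixes the upper half of
  \<open>d \<cdot> w\<close> to be that of d. Such a diagram therefore concentrates every F on one
  symmetric diagram.\<close>

lemma dact_supp:
 assumes d: "d \<in> Bs" and p: "pn d = m" and ne: "w' \<noteq> d \<cdot> transp d"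
 shows "dact m d F w' = 0"
proof
 fix T
 have "\<not> (conj_diagram d w = w' \<and> pn w' = m)" if w: "w \<in> Ws m" for w
 proof
  assume c: "conj_diagram d w = w' \<and> pn w' = m"
  hence "pn (conj_diagram d w) = m" by simp
  note f = conj_facts[OF d w this]
  have "(d \<cdot> w) \<cdot> transp (d \<cdot> w) = d \<cdot> transp d"
   by (rule pn_stable_top[OF basis_sub[OF d] W_D(4)[OF w]]) (simp add: f(1) p)
  thus False using f(2) c ne by simp
 qed
 thus "dact m d F w' T = (0 :: (nat => nat) => complex) T"
  unfolding dact_def zero_fun_apply by (intro sum.neutral ballI if_not_P)
qed

lemma conj_linked:
 assumes g: "g \<in> Bs" "transp g \<cdot> g = w"
 shows "conj_diagram g w = g \<cdot> transp g" "g \<cdot> w = g"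
proof -
 note ga = basis_sub[OF g(1)]
 have "g \<cdot> (transp g \<cdot> g) = g"
  using compose_regular[OF ga] compose_assoc[OF ga transp_in[OF ga] ga] by simp
 thus 1: "g \<cdot> w = g" using g(2) by simp
 thus "conj_diagram g w = g \<cdot> transp g" unfolding conj_diagram_def by simp
qed

text \<open>Lifting F to the left ideal of diagrams with bottom half w0, modulo smaller propagating number.\<close>
definition lift :: "diagram => (nat => nat) => (diagram => (nat => nat) => complex) => diagram => complex" where
 "lift w0 T0 F d = (if d \<in> Bs \<and> transp d \<cdot> d = w0 then F (d \<cdot> transp d) (T0 \<circ> inv (perm d)) else 0)"

text \<open>Up to lower terms, lifting intertwines left multiplication with the module action. The
  diagrams d with lower half \<open>w0\<close> and \<open>d' \<cdot> d = e\<close> correspond to the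
  symmetric w that d' carries to the upper half of e: d gives \<open>d \<cdot> transp d\<close>, and
  w gives back \<open>transp (d' \<cdot> w) \<cdot> e\<close>.\<close>

lemma lift_action:
 assumes w0: "w0 \<in> Ws m" and d': "d' \<in> Bs" and e: "e \<in> Bs" "transp e \<cdot> e = w0" "pn e = m"
 shows "(\<Sum>d\<in>Bs. lift w0 T0 F d * (if d' \<cdot> d = e then of_nat n ^ ell d' d else 0)) =
  dact m d' F (e \<cdot> transp e) (T0 \<circ> inv (perm e))"
proof -
 let ?w' = "e \<cdot> transp e"
 note d'a = basis_sub[OF d'] and ea = basis_sub[OF e(1)]
 have pe: "pn ?w' = m" using pn_compose_transp[OF ea] e(3) by simp
 let ?S = "{d \<in> Bs. transp d \<cdot> d = w0 \<and> d' \<cdot> d = e}"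
 let ?U = "{w \<in> Ws m. conj_diagram d' w = ?w'}"
 have "(\<Sum>d\<in>Bs. lift w0 T0 F d * (if d' \<cdot> d = e then of_nat n ^ ell d' d else 0)) =
   (\<Sum>d\<in>?S. F (d \<cdot> transp d) (T0 \<circ> inv (perm d)) * of_nat n ^ ell d' d)"
  by (rule sum.mono_neutral_cong_right) (auto simp: lift_def)
 also have "\<dots> = (\<Sum>w\<in>?U. of_nat n ^ ell d' w * F w (T0 \<circ> inv (perm e) \<circ> perm (d' \<cdot> w)))"
 proof (rule sum.reindex_bij_witness[where i = "\<lambda>w. transp (d' \<cdot> w) \<cdot> e" and j = "\<lambda>d. d \<cdot> transp d"])
  fix d assume "d \<in> ?S"
  hence d: "d \<in> Bs" and db: "transp d \<cdot> d = w0" and de: "d' \<cdot> d = e" by auto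
  note da = basis_sub[OF d] and ta = transp_in[OF basis_sub[OF d]]
  have pd: "pn d = m" using pn_transp_compose[OF da] db W_D(3)[OF w0] by simp
  let ?w = "d \<cdot> transp d"
  have wW: "?w \<in> Ws m" by (rule compose_transp_W[OF d pd])
  note wa = W_D(4)[OF wW]
  have st: "transp (d' \<cdot> d) \<cdot> (d' \<cdot> d) = transp d \<cdot> d"
   by (rule pn_stable_bot[OF d'a da]) (simp add: de e(3) pd)
  have c: "conj_diagram d' ?w = ?w'"
  proof -
   have "conj_diagram d' ?w = (d' \<cdot> d) \<cdot> transp (d' \<cdot> d)"
    unfolding conj_diagram_def transp_compose[OF d'a da]
    by (simp only: compose_assoc[of _ k] d'a da ta transp_in compose_in)
   thus ?thesis unfolding de .
  qed
  hence pc: "pn (conj_diagram d' ?w) = m" using pe by simp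
  note f = conj_facts[OF d' wW pc]
  show "?w \<in> ?U" using wW c by simp
  show "transp (d' \<cdot> ?w) \<cdot> e = d"
  proof -
   have "transp (d' \<cdot> ?w) = d \<cdot> transp (d' \<cdot> d)"
    unfolding transp_compose[OF d'a wa] transp_compose[OF da ta] transp_compose[OF d'a da]
    by (simp only: transp_transp compose_assoc[of _ k] d'a da ta transp_in compose_in)
   hence "transp (d' \<cdot> ?w) \<cdot> e = d \<cdot> (transp (d' \<cdot> d) \<cdot> (d' \<cdot> d))"
    unfolding de using compose_assoc[OF da transp_in[OF ea] ea] by simp
   thus ?thesis unfolding st
    using compose_regular[OF da] compose_assoc[OF da ta da] by simp
  qed
  have "e = (d' \<cdot> ?w) \<cdot> d"
   using compose_regular[OF da] de compose_assoc[OF d'a wa da] by simp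
  hence "perm e = perm (d' \<cdot> ?w) \<circ> perm d"
   using perm_compose[OF basis_sub[OF f(5)] da f(3)] by simp
  hence "inv (perm e) = inv (perm d) \<circ> inv (perm (d' \<cdot> ?w))"
   using o_inv_distrib permutes_bij[OF perm_permutes[OF da]] permutes_bij[OF perm_permutes[OF basis_sub[OF f(5)]]] by metis
  hence "inv (perm e) \<circ> perm (d' \<cdot> ?w) = inv (perm d)"
   using permutes_inv_o(2)[OF perm_permutes[OF basis_sub[OF f(5)]]] by (simp add: comp_assoc)
  moreover have "ell d' ?w = ell d' d"
   by (rule ell_cong[OF d'a d'a refl wa da]) (use W_D(2)[OF wW] in \<open>simp add: is_proj_def\<close>)
  ultimately show "of_nat n ^ ell d' ?w * F ?w (T0 \<circ> inv (perm e) \<circ> perm (d' \<cdot> ?w)) =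
    F ?w (T0 \<circ> inv (perm d)) * of_nat n ^ ell d' d"
   by (simp add: comp_assoc)
 next
  fix w assume "w \<in> ?U"
  hence w: "w \<in> Ws m" and c: "conj_diagram d' w = ?w'" by auto
  have pc: "pn (conj_diagram d' w) = m" using pe c by simp
  note f = conj_facts[OF d' w pc]
  let ?g = "d' \<cdot> w" let ?d = "transp ?g \<cdot> e"
  note ga = basis_sub[OF f(5)]
  note tg = transp_in[OF ga] and te = transp_in[OF ea]
  have gg: "?g \<cdot> transp ?g = ?w'" using f(2) c by simp
  have dB: "?d \<in> Bs" by (intro basis_compose basis_transp f(5) e(1))
  have lk: "transp (transp ?g) \<cdot> transp ?g = e \<cdot> transp e" using gg by simp
  have b: "transp ?d \<cdot> ?d = w0" using linked_bot[OF tg ea lk] e(2) by simp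
  show jd: "?d \<cdot> transp ?d = w" using linked_top[OF tg ea lk] f(3) by simp
  have "d' \<cdot> ?d = conj_diagram d' w \<cdot> e"
  proof -
   have "transp ?g = w \<cdot> transp d'"
    using transp_compose[OF d'a W_D(4)[OF w]] W_D(2)[OF w] by (simp add: is_proj_def)
   thus ?thesis unfolding conj_diagram_def
    using d'a W_D(4)[OF w] ea by (simp add: compose_assoc[of _ k] compose_in transp_in)
  qed
  hence "d' \<cdot> ?d = e" unfolding c using compose_regular[OF ea] by simp
  thus "?d \<in> ?S" using dB b by simp
 qed
 also have "\<dots> = dact m d' F ?w' (T0 \<circ> inv (perm e))"
  unfolding dact_def by (rule sum.mono_neutral_cong_left) (auto simp: pe)
 finally show ?thesis .
qed

end

end

context semisimple_algebra
begin

text \<open>Suppose all diagrams of propagating number m kill F, and let a be its lift. Then a is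
  supported in propagating number m, and by \<open>lift_action\<close> the product
  \<open>mul (star a) a\<close> has no coefficients there. By \<open>low_of_star_mult\<close> a
  itself is low, although its coefficient at \<open>w0\<close> is a nonzero value of F.\<close>

lemma detect:
 assumes w0: "w0 \<in> Ws m" and F0: "F w0 \<noteq> 0"
 shows "\<exists>d\<in>Bs. pn d = m \<and> dact m d F \<noteq> 0"
proof (rule ccontr)
 assume "\<not> (\<exists>d\<in>Bs. pn d = m \<and> dact m d F \<noteq> 0)"
 hence z: "dact m d F = 0" if "d \<in> Bs" "pn d = m" for d using that by blast
 obtain T0 where T0: "F w0 T0 \<noteq> 0" using F0 by (auto simp: fun_eq_iff)
 define a where "a = lift w0 T0 F"
 have aC: "a \<in> Car" by (rule carI) (auto simp: a_def lift_def split: if_splits)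
 have supp: "d \<in> Bs \<and> transp d \<cdot> d = w0 \<and> pn d = m" if "a d \<noteq> 0" for d
 proof -
  have d: "d \<in> Bs" "transp d \<cdot> d = w0" using that by (auto simp: a_def lift_def split: if_splits)
  thus ?thesis using pn_transp_compose[OF basis_sub[OF d(1)]] W_D(3)[OF w0] by simp
 qed
 have "mul (star a) a \<in> low m"
  unfolding low_def mem_Collect_eq
 proof (intro conjI allI impI)
  fix e assume e: "mul (star a) a e \<noteq> 0"
  then obtain d1 d2 where d: "d1 \<in> Bs" "d2 \<in> Bs" "d1 \<cdot> d2 = e" "star a d1 \<noteq> 0" "a d2 \<noteq> 0"
   by (rule mult_supp)
  have p2: "pn d2 = m" "transp d2 \<cdot> d2 = w0" using supp[OF d(5)] by auto
  have le: "pn e \<le> m" using pn_compose_le2[OF basis_sub[OF d(1)] basis_sub[OF d(2)]] d(3) p2 by simp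
  show "pn e < m"
  proof (rule ccontr)
   assume "\<not> pn e < m"
   hence pe: "pn e = m" using le by simp
   have eB: "e \<in> Bs" using basis_compose[OF d(1,2)] d(3) by simp
   have eb: "transp e \<cdot> e = w0"
    using pn_stable_bot[OF basis_sub[OF d(1)] basis_sub[OF d(2)]] d(3) pe p2 by simp
   have "star a d' * (\<Sum>d\<in>Bs. a d * (if d' \<cdot> d = e then of_nat n ^ ell d' d else 0)) = 0" if d': "d' \<in> Bs" for d'
   proof (cases "star a d' = 0")
    case False
    hence "a (transp d') \<noteq> 0" by (simp add: star_def)
    hence "pn d' = m" using supp by fastforce
    thus ?thesis unfolding a_def lift_action[OF w0 d' eB eb pe] using z[OF d'] by simp
   qed simp
   hence "mul (star a) a e = 0" unfolding mult_alt by (intro sum.neutral) blast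
   thus False using e by simp
  qed
 qed (rule car_mult)
 hence "a \<in> low m" by (rule low_of_star_mult[OF aC])
 moreover have "a w0 = F w0 T0"
  using W_D[OF w0] perm_proj[OF W_D(4)[OF w0] W_D(2)[OF w0]]
  by (simp add: a_def lift_def is_proj_def)
 ultimately have "pn w0 < m" using T0 unfolding low_def by auto
 thus False using W_D(3)[OF w0] by simp
qed

end

section \<open>One-row shapes, and a spanning statement common to all seven algebras\<close>

lemma tabloid_one_row:
 assumes "length mu \<le> 1" "T \<in> tabloids mu" shows "T = (\<lambda>_. 0)"
proof
 fix j
 obtain t where t: "t \<in> tableaux mu" "T = tabloid_of mu t" using assms(2) unfolding tabloids_def by blast
 interpret tb: tableau mu t using t(1) by unfold_locales
 show "T j = 0"
 proof (cases "j \<in> tb.M")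
  case True
  hence "(T j, col_of mu t j) \<in> cells mu" using tb.cell_RC(1) t(2) by simp
  thus ?thesis using assms(1) by (auto simp: cells_def)
 next
  case False thus ?thesis using tb.R_out t(2) by simp
 qed
qed

lemma specht_one_row:
 assumes "length mu \<le> 1" "f \<in> specht mu"
 shows "f = (\<lambda>T. if T = (\<lambda>_. 0) then f (\<lambda>_. 0) else 0)"
proof
 fix T
 show "f T = (if T = (\<lambda>_. 0) then f (\<lambda>_. 0) else 0)"
 proof (cases "T = (\<lambda>_. 0)")
  case False
  hence "T \<notin> tabloids mu" using tabloid_one_row[OF assms(1)] by blast
  hence "f T = 0" using specht_tabloid_fun[OF assms(2)] unfolding tabloid_fun_def by blast
  thus ?thesis unfolding if_not_P[OF False] .
 qed simp
qed

lemma Lambda_D: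
 assumes "lam \<in> Lambda A k n"
 shows "is_int_partition lam n" "star_size lam \<le> k" "planar_kind A ==> length (tl lam) \<le> 1"
  "A = Brauer \<or> A = TemperleyLieb ==> star_size lam mod 2 = k mod 2"
 using assms by (cases A; auto simp: planar_kind_def)+

lemma Lambda_I:
 assumes "is_int_partition lam n" "star_size lam \<le> k" "planar_kind A ==> length lam \<le> 2"
  "A = Brauer \<or> A = TemperleyLieb ==> star_size lam mod 2 = k mod 2"
 shows "lam \<in> Lambda A k n"
 using assms by (cases A) (auto simp: planar_kind_def)

lemma tl_partition:
 assumes "is_int_partition lam n"
 shows "is_int_partition (tl lam) (star_size lam)"
 using assms by (cases lam) (auto simp: is_int_partition_def star_size_def)

text \<open>In the planar cases the Specht module is a line, so the trivial group already suffices;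
  otherwise this is \<open>specht_irreducible\<close>.\<close>

lemma specht_span:
 assumes lam: "lam \<in> Lambda A k n" and v: "v \<in> specht (tl lam)" "v \<noteq> 0" and u: "u \<in> specht (tl lam)"
 shows "\<exists>c. u = (\<lambda>T. \<Sum>s\<in>diag_perms A (star_size lam). c s * perm_act s v T)"
proof (cases "planar_kind A")
 case True
 have l: "length (tl lam) \<le> 1" using Lambda_D(3)[OF lam True] .
 let ?z = "\<lambda>_::nat. 0::nat"
 have row: "f T = 0" if f: "f \<in> specht (tl lam)" and T: "T \<noteq> ?z" for f T
  using fun_cong[OF specht_one_row[OF l f], of T] unfolding if_not_P[OF T] .
 have vz: "v ?z \<noteq> 0"
 proof
  assume z: "v ?z = 0"
  have "v T = 0" for T
  proof (cases "T = ?z")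
   case True show ?thesis unfolding True by (rule z)
  qed (rule row[OF v(1)])
  hence "v = 0" by (intro ext) (simp only: zero_fun_apply)
  thus False using v(2) by blast
 qed
 have "u = (\<lambda>T. (u ?z / v ?z) * v T)"
 proof
  fix T show "u T = (u ?z / v ?z) * v T"
  proof (cases "T = ?z")
   case True show ?thesis unfolding True using vz by simp
  next
   case False show ?thesis unfolding row[OF v(1) False] row[OF u False] by simp
  qed
 qed
 moreover have dp: "diag_perms A (star_size lam) = {id}" using True by (simp add: diag_perms_def)
 have "(\<lambda>T. \<Sum>s\<in>diag_perms A (star_size lam). (u ?z / v ?z) * perm_act s v T) = (\<lambda>T. (u ?z / v ?z) * v T)"
  unfolding dp by (simp add: perm_act_def)
 ultimately have "u = (\<lambda>T. \<Sum>s\<in>diag_perms A (star_size lam). (u ?z / v ?z) * perm_act s v T)" by simp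
 thus ?thesis by (rule exI[of _ "\<lambda>_. u ?z / v ?z"])
next
 case False
 have "sorted_wrt (\<ge>) (tl lam)" using tl_partition[OF Lambda_D(1)[OF lam]] by (simp add: is_int_partition_def)
 thus ?thesis
  using specht_irreducible[OF _ v u] False by (simp add: diag_perms_def star_size_def)
qed

lemma planar_refines_id:
 assumes w: "w \<in> all_diagrams k" and s: "\<And>u v. same w u v ==> same (id_diagram k) u v"
 shows "planar k w"
 unfolding planar_iff[OF w] noncrossing_def
proof (intro ballI impI, elim conjE)
 fix x y z t assume v: "x \<in> verts k" "y \<in> verts k" "z \<in> verts k" "t \<in> verts k"
  and o: "bpos k x < bpos k y" "bpos k y < bpos k z" "bpos k z < bpos k t"
  and xz: "same w x z" and yt: "same w y t"
 have "same (id_diagram k) x y"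
  using planar_id o v s[OF xz] s[OF yt] unfolding planar_iff[OF id_in] noncrossing_def by blast
 thus "same w x y" using s[OF xz] o unfolding same_id by auto
qed

text \<open>The first m vertices propagate vertically. The remaining ones are isolated, or, in the
  two algebras with only blocks of size 2, paired with a neighbour, for which the parity of k - m is
  needed.\<close>

lemma symW_nonempty:
 assumes m: "m \<le> k" and par: "A = Brauer \<or> A = TemperleyLieb ==> m mod 2 = k mod 2"
 shows "symW A k m \<noteq> {}"
proof (cases "A = Brauer \<or> A = TemperleyLieb")
 case False
 define P where "P = (\<lambda>i. {i}) ` {1..k}"
 define D where "D = (\<lambda>i. {i}) ` {1..m}"
 have P: "partition_on {1..k} P" unfolding P_def by (rule partition_onI) auto
 have D: "D \<subseteq> P" unfolding D_def P_def using m by auto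
 have cD: "card D = m" unfolding D_def by (simp add: card_image)
 let ?w = "sym_diagram_of P D"
 have w: "?w \<in> all_diagrams k" by (rule sym_diagram_in[OF P D])
 have bl: "\<exists>i\<in>{1..k}. X = {Top i, Bot i} \<or> X = {Top i} \<or> X = {Bot i}" if "X \<in> ?w" for X
  using that P_def by (elim sym_diagramE[OF P D]) auto
 have "rook_diag ?w"
  unfolding rook_diag_def
 proof
  fix X assume "X \<in> ?w"
  then obtain i where "X = {Top i, Bot i} \<or> X = {Top i} \<or> X = {Bot i}" using bl by blast
  hence "tp X \<subseteq> {i}" "bt X \<subseteq> {i}" by (auto simp: tp_def bt_def)
  thus "card (tp X) \<le> 1 \<and> card (bt X) \<le> 1" by (auto dest: subset_singletonD)
 qed
 moreover have "rookbrauer_diag ?w" unfolding rookbrauer_diag_def using bl by fastforce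
 moreover have "planar k ?w"
 proof (rule planar_refines_id[OF w])
  fix u v assume "same ?w u v"
  then obtain X where "X \<in> ?w" "u \<in> X" "v \<in> X" unfolding same_def by blast
  thus "same (id_diagram k) u v" unfolding same_id using bl by fastforce
 qed
 ultimately have "?w \<in> diag_basis A k" using w False by (cases A) auto
 thus ?thesis unfolding symW_def using P D cD by blast
next
 case True
 hence "m mod 2 = k mod 2" by (rule par)
 hence par': "even (k - m)" using m by presburger
 \<comment> \<open>The block of i: singletons up to m, then the pairs {m+1, m+2}, {m+3, m+4} and so
   on.\<close>
 define pr where "pr i = (if i \<le> m then {i} else if even (i - m) then {i - 1, i} else {i, i + 1})" for i :: nat
 have pr1: "pr i = {i}" if "i \<le> m" for i using that by (simp add: pr_def)
 have pr2: "pr (m + 2 * l) = {m + 2 * l - 1, m + 2 * l} \<and> pr (m + 2 * l - 1) = {m + 2 * l - 1, m + 2 * l}" if "0 < l" for l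
  using that by (cases l) (simp_all add: pr_def)
 have cs: "i \<le> m \<or> (\<exists>l>0. i = m + 2 * l \<or> i = m + 2 * l - 1)" for i
  by presburger
 define P where "P = pr ` {1..k}"
 define D where "D = (\<lambda>i. {i}) ` {1..m}"
 have mem: "j \<in> pr i \<longleftrightarrow> pr j = pr i \<and> 1 \<le> j" if "1 \<le> i" for i j
 proof -
  have "pr j = pr i \<and> 1 \<le> j" if j: "j \<in> pr i"
  proof (cases "i \<le> m")
   case True
   thus ?thesis using j \<open>1 \<le> i\<close> pr1[OF True] by simp
  next
   case False
   then obtain l where l: "0 < l" "i = m + 2 * l \<or> i = m + 2 * l - 1" using cs by blast
   hence pi: "pr i = {m + 2 * l - 1, m + 2 * l}" using pr2[OF l(1)] by blast
   hence "j = m + 2 * l \<or> j = m + 2 * l - 1" using j by blast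
   hence "pr j = {m + 2 * l - 1, m + 2 * l}" "1 \<le> j" using pr2[OF l(1)] l(1) by auto
   thus ?thesis using pi by simp
  qed
  moreover have "1 \<le> j ==> j \<in> pr j" by (auto simp: pr_def)
  ultimately show ?thesis by blast
 qed
 have inK: "pr i \<subseteq> {1..k}" if i: "i \<in> {1..k}" for i
 proof (cases "i \<le> m")
  case True
  thus ?thesis using i pr1[OF True] by simp
 next
  case False
  then obtain l where l: "0 < l" "i = m + 2 * l \<or> i = m + 2 * l - 1" using cs by blast
  hence pi: "pr i = {m + 2 * l - 1, m + 2 * l}" using pr2[OF l(1)] by blast
  have "m + 2 * l - 1 \<le> k" using i l(2) by auto
  hence "m + 2 * l \<le> k" using par' m l(1) by presburger
  thus ?thesis unfolding pi using l(1) by auto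
 qed
 have P: "partition_on {1..k} P"
 proof (rule partition_onI)
  show "\<Union>P = {1..k}"
  proof
   show "\<Union>P \<subseteq> {1..k}" unfolding P_def using inK by blast
   show "{1..k} \<subseteq> \<Union>P"
   proof
    fix i assume i: "i \<in> {1..k}"
    hence "i \<in> pr i" using mem by simp
    thus "i \<in> \<Union>P" unfolding P_def using i by blast
   qed
  qed
 next
  fix p q assume "p \<in> P" "q \<in> P" and ne: "p \<noteq> q"
  then obtain i j where ij: "i \<in> {1..k}" "j \<in> {1..k}" "p = pr i" "q = pr j" unfolding P_def by blast
  have "p \<inter> q = {}"
  proof (rule ccontr)
   assume "p \<inter> q \<noteq> {}"
   then obtain l where "l \<in> pr i" "l \<in> pr j" using ij by blast
   hence "pr l = pr i" "pr l = pr j" using mem[of i l] mem[of j l] ij(1,2) by simp_all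
   thus False using ij ne by simp
  qed
  thus "disjnt p q" unfolding disjnt_def .
 next
  show "{} \<notin> P" unfolding P_def pr_def by auto
 qed
 have D: "D \<subseteq> P"
 proof
  fix X assume "X \<in> D"
  then obtain i where "i \<in> {1..m}" "X = {i}" unfolding D_def by blast
  hence "X = pr i" "i \<in> {1..k}" using m by (auto simp: pr_def)
  thus "X \<in> P" unfolding P_def by blast
 qed
 have cD: "card D = m" unfolding D_def by (simp add: card_image)
 let ?w = "sym_diagram_of P D"
 have w: "?w \<in> all_diagrams k" by (rule sym_diagram_in[OF P D])
 have PD: "\<exists>i. B = {i, i + 1} \<and> 1 \<le> i \<and> i + 1 \<le> k" if "B \<in> P" "B \<notin> D" for B
 proof -
  obtain i where i: "i \<in> {1..k}" "B = pr i" using \<open>B \<in> P\<close> unfolding P_def by blast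
  have "\<not> i \<le> m" using i \<open>B \<notin> D\<close> by (auto simp: pr_def D_def)
  hence "m + 2 \<le> i" if "even (i - m)" using that by presburger
  hence "B = {i - 1, i} \<and> m + 2 \<le> i \<or> B = {i, i + 1}"
   using i(2) \<open>\<not> i \<le> m\<close> unfolding pr_def by (cases "even (i - m)") simp_all
  thus ?thesis
  proof
   assume "B = {i - 1, i} \<and> m + 2 \<le> i"
   thus ?thesis using i(1) by (intro exI[of _ "i - 1"]) auto
  next
   assume "B = {i, i + 1}"
   thus ?thesis using i inK[OF i(1)] by (intro exI[of _ i]) auto
  qed
 qed
 have bl: "(\<exists>i\<in>{1..k}. X = {Top i, Bot i}) \<or> (\<exists>i. 1 \<le> i \<and> i + 1 \<le> k \<and> (X = {Top i, Top (i + 1)} \<or> X = {Bot i, Bot (i + 1)}))"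
  if X: "X \<in> ?w" for X
  using X
 proof (rule sym_diagramE[OF P D])
  fix B assume B: "B \<in> D" "X = Top ` B \<union> Bot ` B"
  then obtain i where "i \<in> {1..m}" "B = {i}" unfolding D_def by blast
  thus ?thesis using B m by (intro disjI1 bexI[of _ i]) auto
 next
  fix B assume B: "B \<in> P" "B \<notin> D" "X = Top ` B"
  thus ?thesis using PD[OF B(1,2)] by auto
 next
  fix B assume B: "B \<in> P" "B \<notin> D" "X = Bot ` B"
  thus ?thesis using PD[OF B(1,2)] by auto
 qed
 have "brauer_diag ?w" unfolding brauer_diag_def using bl by fastforce
 moreover have "planar k ?w"
  unfolding planar_def
 proof (intro notI, elim bexE conjE)
  fix B C a c b e
  assume BC: "B \<in> ?w" "C \<in> ?w" "B \<noteq> C" "a \<in> B" "c \<in> B" "b \<in> C" "e \<in> C"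
   and o: "bpos k a < bpos k b" "bpos k b < bpos k c" "bpos k c < bpos k e"
  have "\<exists>i\<in>{1..k}. B = {Top i, Bot i}" using bl[OF BC(1)] BC(4,5) o by auto
  then obtain i where i: "i \<in> {1..k}" "B = {Top i, Bot i}" by blast
  have "\<exists>j\<in>{1..k}. C = {Top j, Bot j}" using bl[OF BC(2)] BC(6,7) o by auto
  then obtain j where j: "j \<in> {1..k}" "C = {Top j, Bot j}" by blast
  show False using i j BC(4-7) o by auto
 qed
 ultimately have "?w \<in> diag_basis A k" using w True by (cases A) auto
 thus ?thesis unfolding symW_def using P D cD by blast
qed

context semisimple_algebra
begin

lemma Amod_single:
 "w \<in> Ws (star_size lam) ==> v \<in> specht (tl lam) ==> single w v \<in> Amod A k lam"
 unfolding Amod_def single_def using specht_zero by auto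

lemma n_power_ne: "(of_nat n :: complex) ^ l \<noteq> 0"
 using n0 by simp

lemma single_ne: "v \<noteq> 0 ==> single w v \<noteq> 0"
 using single_apply[of w v] by (metis zero_fun_apply)

interpretation Mo: alg_module A k n "Amod A k lam" "Aact A k n lam" for lam
 by unfold_locales (rule Amod_module)

lemma Amod_D: "d \<in> Bs ==> Mo.D lam d F = dact (star_size lam) d F"
 unfolding Mo.D_def by (rule Aact_delta)

lemma Amod_sc:
 assumes F: "F \<in> Amod A k lam"
 shows "Mo.sc lam c F = (\<lambda>w T. c * F w T)"
proof -
 let ?m = "star_size lam"
 have "Mo.sc lam c F = Aact A k n lam (\<lambda>e. c * delta (id_diagram k) e) F" unfolding Mo.sc_def alg_one_delta ..
 also have "\<dots> = (\<lambda>w T. c * dact ?m (id_diagram k) F w T)"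
 proof (intro ext)
  fix w T
  have "Aact A k n lam (\<lambda>e. c * delta (id_diagram k) e) F w T = (\<Sum>d\<in>Bs. delta (id_diagram k) d * (c * dact ?m d F w T))"
   unfolding Aact_dact by (simp add: mult_ac)
  thus "Aact A k n lam (\<lambda>e. c * delta (id_diagram k) e) F w T = c * dact ?m (id_diagram k) F w T"
   unfolding sum_delta_left[OF basis_id] .
 qed
 also have "dact ?m (id_diagram k) F = F" by (rule dact_id) (use F in \<open>auto simp: Amod_def\<close>)
 finally show ?thesis .
qed

lemma Amod_decomp:
 assumes G: "G \<in> Amod A k lam"
 shows "G = (\<Sum>u\<in>Ws (star_size lam). single u (G u))"
proof (intro ext)
 fix w T
 have "(\<Sum>u\<in>Ws (star_size lam). single u (G u)) w T = (\<Sum>u\<in>Ws (star_size lam). if u = w then G w T else 0)"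
  unfolding sum_fun_apply by (rule sum.cong[OF refl]) (simp add: single_def)
 also have "\<dots> = G w T" using G unfolding Amod_def by (auto simp: sum.delta)
 finally show "G w T = (\<Sum>u\<in>Ws (star_size lam). single u (G u)) w T" by simp
qed

theorem Amod_irreducible:
 assumes lam: "lam \<in> Lambda A k n"
 shows "irreducible_module A k n (Amod A k lam) (Aact A k n lam)"
proof -
 let ?m = "star_size lam"
 obtain w where w: "w \<in> Ws ?m"
  using symW_nonempty[OF Lambda_D(2)[OF lam] Lambda_D(4)[OF lam]] by blast
 obtain v where v: "v \<in> specht (tl lam)" "v \<noteq> 0" using specht_nontrivial by blast
 have "single w v \<noteq> 0" by (rule single_ne[OF v(2)])
 hence ne: "Amod A k lam \<noteq> {0}" using Amod_single[OF w v(1)] by blast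
 have "U = Amod A k lam" if U: "is_submodule A k (Amod A k lam) (Aact A k n lam) U" and U0: "U \<noteq> {0}" for U
 proof -
  note UD = Mo.submoduleD[OF U]
  have U_sc: "(\<lambda>w T. c * F w T) \<in> U" if "F \<in> U" for c F using UD(4)[OF that, of c] Amod_sc[of F lam c] UD(1) that by auto
  have U_D: "dact ?m d F \<in> U" if "d \<in> Bs" "F \<in> U" for d F using UD(5)[OF that] Amod_D[OF that(1)] by simp
  have U_sum: "(\<Sum>i\<in>I. f i) \<in> U" if "\<And>i. i \<in> I ==> f i \<in> U" for I :: "'z set" and f
   using that by (induction I rule: infinite_finite_induct) (auto intro: UD(2,3))
  obtain F where F: "F \<in> U" "F \<noteq> 0" using U0 UD(2) by blast
  hence FA: "F \<in> Amod A k lam" using UD(1) by blast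
  obtain w0 where w0: "F w0 \<noteq> 0" using F(2) by (auto simp: fun_eq_iff)
  hence "w0 \<in> Ws ?m" using FA unfolding Amod_def by blast
  then obtain d where d: "d \<in> Bs" "pn d = ?m" "dact ?m d F \<noteq> 0" using detect[of w0 ?m F, OF _ w0] by blast
  define w1 where "w1 = d \<cdot> transp d"
  define v1 where "v1 = dact ?m d F w1"
  have w1: "w1 \<in> Ws ?m" unfolding w1_def by (rule compose_transp_W[OF d(1,2)])
  have e1: "dact ?m d F = single w1 v1"
  proof
   fix u show "dact ?m d F u = single w1 v1 u"
    using dact_supp[OF d(1,2), of u F] by (cases "u = w1") (simp_all add: w1_def v1_def single_def)
  qed
  have s1: "single w1 v1 \<in> U" using U_D[OF d(1) F(1)] e1 by simp
  have v1: "v1 \<in> specht (tl lam)" using dact_Amod[OF FA d(1)] w1 unfolding v1_def Amod_def by blast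
  have v1ne: "v1 \<noteq> 0"
  proof
   assume "v1 = 0"
   hence "dact ?m d F = 0" unfolding e1 by (auto simp: single_def fun_eq_iff)
   thus False using d(3) by blast
  qed
  \<comment> \<open>A diagram with halves u and w1 and permutation s carries the vector from w1 to u
    and twists it by s, up to a power of n.\<close>
  have tr: "single u (perm_act s v1) \<in> U" if u: "u \<in> Ws ?m" and s: "s \<in> diag_perms A ?m" for u s
  proof -
   obtain g where g: "g \<in> Bs" "g \<cdot> transp g = u" "transp g \<cdot> g = w1" "perm g = s"
    using ex_diagram_basis[OF u w1 s] by blast
   note l = conj_linked[OF g(1,3)]
   have "pn (conj_diagram g w1) = ?m" unfolding l(1) g(2) by (rule W_D(3)[OF u])
   hence "dact ?m g (single w1 v1) = single u (\<lambda>T. of_nat n ^ ell g w1 * perm_act s v1 T)"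
    using dact_single[OF g(1) w1] unfolding l g(2) g(4) by blast
   hence "single u (\<lambda>T. of_nat n ^ ell g w1 * perm_act s v1 T) \<in> U" using U_D[OF g(1) s1] by simp
   from U_sc[OF this, of "1 / of_nat n ^ ell g w1"]
   have "(\<lambda>w T. 1 / of_nat n ^ ell g w1 * single u (\<lambda>T. of_nat n ^ ell g w1 * perm_act s v1 T) w T) \<in> U" .
   moreover have "(\<lambda>w T. 1 / of_nat n ^ ell g w1 * single u (\<lambda>T. of_nat n ^ ell g w1 * perm_act s v1 T) w T) = single u (perm_act s v1)"
    using n0 by (intro ext) (simp add: single_def)
   ultimately show ?thesis by simp
  qed
  have all: "single u x \<in> U" if u: "u \<in> Ws ?m" and x: "x \<in> specht (tl lam)" for u x
  proof -
   obtain c where c: "x = (\<lambda>T. \<Sum>s\<in>diag_perms A ?m. c s * perm_act s v1 T)"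
    using specht_span[OF lam v1 v1ne x] by blast
   have "single u x = (\<Sum>s\<in>diag_perms A ?m. (\<lambda>w T. c s * single u (perm_act s v1) w T))"
    unfolding c by (intro ext) (simp add: single_def sum_fun_apply)
   thus ?thesis using U_sum[of "diag_perms A ?m" "\<lambda>s w T. c s * single u (perm_act s v1) w T"] U_sc tr[OF u] by simp
  qed
  have "G \<in> U" if G: "G \<in> Amod A k lam" for G
  proof -
   note Amod_decomp[OF G]
   moreover have "(\<Sum>u\<in>Ws ?m. single u (G u)) \<in> U"
    by (rule U_sum) (use G all in \<open>auto simp: Amod_def\<close>)
   ultimately show ?thesis by (simp only:)
  qed
  thus ?thesis using UD(1) by blast
 qed
 thus ?thesis unfolding irreducible_module_def using Amod_module ne by blast
qed

end

section \<open>Classification\<close>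

text \<open>For a block of size 2, the number of its top vertices plus 1 if it propagates is 0 or 2.
  Summing over all blocks gives k + pn d.\<close>

lemma brauer_parity:
 assumes d: "d \<in> all_diagrams k" and b: "brauer_diag d"
 shows "even (k + pn d)"
proof -
 have part: "partition_on (verts k) d" using d by (simp add: all_diagrams_def)
 have fv: "finite (verts k)" by (simp add: verts_def)
 have fd: "finite d" by (rule finite_elements[OF fv part])
 have sub: "B \<subseteq> verts k" if "B \<in> d" for B using partition_onD1[OF part] that by blast
 have tB: "tp B \<subseteq> {1..k}" "bt B \<subseteq> {1..k}" if "B \<in> d" for B
  using sub[OF that] by (auto simp: tp_def bt_def verts_def)
 have un: "(\<Union>B\<in>d. tp B) = {1..k}"
 proof
  show "(\<Union>B\<in>d. tp B) \<subseteq> {1..k}" using tB by blast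
  show "{1..k} \<subseteq> (\<Union>B\<in>d. tp B)"
  proof
   fix i assume "i \<in> {1..k}"
   hence "Top i \<in> \<Union>d" unfolding partition_onD1[OF part, symmetric] verts_def by blast
   thus "i \<in> (\<Union>B\<in>d. tp B)" by (auto simp: tp_def)
  qed
 qed
 have "card (\<Union>B\<in>d. tp B) = (\<Sum>B\<in>d. card (tp B))"
 proof (rule card_UN_disjoint[OF fd])
  show "\<forall>B\<in>d. finite (tp B)" using tB finite_subset by blast
  have "B = C" if "B \<in> d" "C \<in> d" "Top i \<in> B" "Top i \<in> C" for B C i
   using partition_onD2[OF part] that unfolding disjoint_def by blast
  thus "\<forall>B\<in>d. \<forall>C\<in>d. B \<noteq> C --> tp B \<inter> tp C = {}" unfolding tp_def by blast
 qed
 hence "k = (\<Sum>B\<in>d. card (tp B))" unfolding un by simp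
 moreover have "pn d = (\<Sum>B\<in>d. if propagating B then 1 else 0)"
  unfolding pn_def props_def using fd by (simp add: sum.If_cases Int_def)
 ultimately have "k + pn d = (\<Sum>B\<in>d. card (tp B) + (if propagating B then 1 else 0))"
  by (simp only: sum.distrib)
 moreover have "even (card (tp B) + (if propagating B then 1 else 0))" if B: "B \<in> d" for B
 proof -
  have f: "finite (tp B)" "finite (bt B)" using tB[OF B] finite_subset by blast+
  note block_split[of B]
  moreover have "card (Top ` tp B \<union> Bot ` bt B) = card (tp B) + card (bt B)"
   using f by (subst card_Un_disjoint) (auto simp: card_image inj_on_def)
  ultimately have c: "card (tp B) + card (bt B) = 2" using b B unfolding brauer_diag_def by metis
  show ?thesis
  proof (cases "propagating B")
   case True
   hence "card (tp B) \<noteq> 0" "card (bt B) \<noteq> 0" using f by (auto simp: propagating_def)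
   hence "card (tp B) = 1" using c by linarith
   thus ?thesis using True by simp
  next
   case False
   hence "card (tp B) = 0 \<or> card (bt B) = 0" by (auto simp: propagating_def)
   thus ?thesis using c False by auto
  qed
 qed
 ultimately show ?thesis by (simp only: dvd_sum)
qed

lemma id_diag_perms: "id \<in> diag_perms A m"
 by (simp add: diag_perms_def permutes_id)

lemma diag_perms_comp: "s \<in> diag_perms A m ==> t \<in> diag_perms A m ==> s \<circ> t \<in> diag_perms A m"
 by (auto simp: diag_perms_def permutes_compose split: if_splits)

lemma (in module_pair) iso_sym:
 assumes "module_iso A k V act W act'"
 shows "module_iso A k W act' V act"
proof -
 obtain f where f: "bij_betw f V W" "\<forall>x\<in>V. \<forall>y\<in>V. f (x + y) = f x + f y"
  "\<forall>a\<in>M1.Car. \<forall>x\<in>V. f (act a x) = act' a (f x)" using assms unfolding module_iso_def by blast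
 let ?g = "the_inv_into V f"
 have inj: "inj_on f V" using f(1) by (simp add: bij_betw_def)
 have g: "bij_betw ?g W V" by (rule bij_betw_the_inv_into[OF f(1)])
 have gV: "?g y \<in> V" "f (?g y) = y" if "y \<in> W" for y
  using g f_the_inv_into_f_bij_betw[OF f(1)] that by (auto simp: bij_betw_def)
 have "?g (x + y) = ?g x + ?g y" if "x \<in> W" "y \<in> W" for x y
  by (rule the_inv_into_f_eq[OF inj]) (use that gV f(2) M1.Vadd in auto)
 moreover have "?g (act' a x) = act a (?g x)" if "a \<in> M1.Car" "x \<in> W" for a x
  by (rule the_inv_into_f_eq[OF inj]) (use that gV f(3) M1.act_in in auto)
 ultimately show ?thesis unfolding module_iso_def using g by blast
qed

section \<open>Vectors supported on one symmetric diagram, and non-isomorphism\<close>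

context diagram_algebra
begin

lemma dact_single_zero:
 assumes "pn (conj_diagram d w) \<noteq> m"
 shows "dact m d (single w v) = 0"
proof (intro ext)
 fix w' T
 have "(if conj_diagram d u = w' \<and> pn w' = m then of_nat n ^ ell d u * single w v u (T \<circ> perm (d \<cdot> u)) else 0) = 0" for u
  using assms by (cases "u = w") (auto simp: single_def)
 thus "dact m d (single w v) w' T = (0 :: diagram => (nat => nat) => complex) w' T"
  unfolding dact_def by (simp only: sum.neutral_const zero_fun_apply)
qed

lemma dact_link:
 assumes g: "g \<in> Bs" "g \<cdot> transp g = u" "transp g \<cdot> g = w" and u: "u \<in> Ws m" and w: "w \<in> Ws m"
 shows "dact m g (single w v) = single u (\<lambda>T. of_nat n ^ ell g w * perm_act (perm g) v T)"
proof -
 note l = conj_linked[OF g(1,3)]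
 have "pn (conj_diagram g w) = m" unfolding l(1) g(2) by (rule W_D(3)[OF u])
 thus ?thesis using dact_single[OF g(1) w] unfolding l g(2) by blast
qed

lemma W_halves: "w \<in> Ws m ==> w \<cdot> transp w = w" "w \<in> Ws m ==> transp w \<cdot> w = w" "w \<in> Ws m ==> perm w = id"
 using W_D(2)[of w m] perm_proj[OF W_D(4)] by (auto simp: is_proj_def)

lemma dact_self:
 assumes w: "w \<in> Ws m"
 shows "dact m w (single w v) = single w (\<lambda>T. of_nat n ^ ell w w * v T)"
 using dact_link[OF W_D(1)[OF w] W_halves(1,2)[OF w] w w] W_halves(3)[OF w] by (simp add: perm_act_def)

text \<open>The action of w has image supported at w, and an eigenvector with nonzero eigenvalue
  lies in the image.\<close>

lemma single_of_eigen:
 assumes w: "w \<in> Ws m" and F: "dact m w F = (\<lambda>u T. of_nat n ^ ell w w * F u T)"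
 shows "F = single w (F w)"
proof
 fix u
 show "F u = single w (F w) u"
 proof (cases "u = w")
  case False
  have "dact m w F u = 0"
   by (rule dact_supp[OF W_D(1)[OF w] W_D(3)[OF w]]) (use False W_halves(1)[OF w] in simp)
  hence "of_nat n ^ ell w w * F u T = 0" for T using F by (metis zero_fun_apply)
  hence "F u T = 0" for T using n0 by simp
  thus ?thesis using False by (intro ext) (simp add: single_def)
 qed simp
qed

lemma single_scale: "(\<lambda>u T. c * single w v u T) = single w (\<lambda>T. c * v T)"
 by (intro ext) (simp add: single_def)

lemma single_add: "single w (v + v') = single w v + single w v'"
 by (intro ext) (simp add: single_def)

end

lemma one_row_unique:
 assumes "is_int_partition a m" "is_int_partition b m" "length a \<le> 1" "length b \<le> 1"
 shows "a = b"
proof -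
 have "c = (if m = 0 then [] else [m])" if "is_int_partition c m" "length c \<le> 1" for c
  using that by (cases c) (auto simp: is_int_partition_def)
 thus ?thesis using assms by metis
qed

lemma int_partition_eqI:
 assumes "is_int_partition lam n" "is_int_partition mu n" "tl lam = tl mu" "0 < n"
 shows "lam = mu"
 using assms by (cases lam; cases mu) (auto simp: is_int_partition_def)

context semisimple_algebra
begin

interpretation Mo: alg_module A k n "Amod A k lam" "Aact A k n lam" for lam
 by unfold_locales (rule Amod_module)

lemma Amod_pair: "module_pair A k n (Amod A k lam) (Aact A k n lam) (Amod A k mu) (Aact A k n mu)"
 by (intro module_pair.intro Mo.alg_module_axioms)

text \<open>A symmetric diagram of propagating number \<open>star_size lam\<close> acts nonzero on
  the first module, whereas all diagrams of propagating number below \<open>star_size mu\<close>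
  annihilate the second.\<close>

lemma iso_star_size_le:
 assumes lam: "lam \<in> Lambda A k n"
  and iso: "module_iso A k (Amod A k lam) (Aact A k n lam) (Amod A k mu) (Aact A k n mu)"
 shows "star_size mu \<le> star_size lam"
proof (rule ccontr)
 assume lt: "\<not> star_size mu \<le> star_size lam"
 interpret MP: module_pair A k n "Amod A k lam" "Aact A k n lam" "Amod A k mu" "Aact A k n mu"
  by (rule Amod_pair)
 obtain f where f: "bij_betw f (Amod A k lam) (Amod A k mu)"
  "\<And>d x. d \<in> Bs ==> x \<in> Amod A k lam ==> f (Mo.D lam d x) = Mo.D mu d (f x)"
  "\<And>x y. x \<in> Amod A k lam ==> y \<in> Amod A k lam ==> f (x + y) = f x + f y"
  using MP.iso_hom[OF iso] by metis
 obtain w where w: "w \<in> Ws (star_size lam)"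
  using symW_nonempty[OF Lambda_D(2)[OF lam] Lambda_D(4)[OF lam]] by blast
 obtain v where v: "v \<in> specht (tl lam)" "v \<noteq> 0" using specht_nontrivial by blast
 let ?x = "single w v"
 have x: "?x \<in> Amod A k lam" by (rule Amod_single[OF w v(1)])
 have wB: "w \<in> Bs" by (rule W_D(1)[OF w])
 have "f (Mo.D lam w ?x) = dact (star_size mu) w (f ?x)" using f(2)[OF wB x] unfolding Amod_D[OF wB] .
 also have "\<dots> = 0" by (rule dact_low[OF wB]) (use W_D(3)[OF w] lt in simp)
 finally have z: "f (Mo.D lam w ?x) = 0" .
 have f0: "f 0 = 0" using f(3)[OF Amod_zero Amod_zero] by (metis add_0 add_cancel_right_right)
 have "Mo.D lam w ?x = 0"
  using f(1) z f0 Mo.D_in[OF wB x] Amod_zero unfolding bij_betw_def by (metis inj_onD)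
 hence "single w (\<lambda>T. of_nat n ^ ell w w * v T) = 0" unfolding Amod_D[OF wB] dact_self[OF w] .
 hence "of_nat n ^ ell w w * v T = 0" for T
  using single_apply[of w "\<lambda>T. of_nat n ^ ell w w * v T"] by (metis zero_fun_apply)
 hence "v T = 0" for T using n0 by simp
 hence "v = 0" by (intro ext) (simp only: zero_fun_apply)
 thus False using v(2) by blast
qed

text \<open>The vectors supported at w form the eigenspace of w for its power of n, so an
  isomorphism preserves them and induces a bijection \<open>ph\<close> of Specht modules. Diagrams
  with both halves w realise the permutations, which makes \<open>ph\<close> equivariant.\<close>

theorem Amod_not_iso:
 assumes lam: "lam \<in> Lambda A k n" and mu: "mu \<in> Lambda A k n"
  and iso: "module_iso A k (Amod A k lam) (Aact A k n lam) (Amod A k mu) (Aact A k n mu)"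
 shows "lam = mu"
proof -
 interpret MP: module_pair A k n "Amod A k lam" "Aact A k n lam" "Amod A k mu" "Aact A k n mu"
  by (rule Amod_pair)
 define m where "m = star_size lam"
 have mu_m: "star_size mu = m"
  using iso_star_size_le[OF lam iso] iso_star_size_le[OF mu MP.iso_sym[OF iso]] by (simp add: m_def)
 obtain f where f: "bij_betw f (Amod A k lam) (Amod A k mu)"
  "\<And>x y. x \<in> Amod A k lam ==> y \<in> Amod A k lam ==> f (x + y) = f x + f y"
  "\<And>c x. x \<in> Amod A k lam ==> f (Mo.sc lam c x) = Mo.sc mu c (f x)"
  "\<And>d x. d \<in> Bs ==> x \<in> Amod A k lam ==> f (Mo.D lam d x) = Mo.D mu d (f x)"
  using MP.iso_hom[OF iso] by metis
 have fA: "f x \<in> Amod A k mu" if "x \<in> Amod A k lam" for x using f(1) that by (auto simp: bij_betw_def)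
 have fsc: "f (\<lambda>w T. c * x w T) = (\<lambda>w T. c * f x w T)" if x: "x \<in> Amod A k lam" for c x
  using f(3)[OF x, of c] unfolding Amod_sc[OF x] Amod_sc[OF fA[OF x]] .
 have fD: "f (dact m d x) = dact m d (f x)" if "d \<in> Bs" "x \<in> Amod A k lam" for d x
  using f(4)[OF that] unfolding Amod_D[OF that(1)] mu_m m_def[symmetric] .
 obtain w where w: "w \<in> Ws m"
  using symW_nonempty[OF Lambda_D(2)[OF lam] Lambda_D(4)[OF lam]] unfolding m_def by blast
 note wB = W_D(1)[OF w]
 let ?K = "of_nat n ^ ell w w :: complex"
 define ph where "ph v = f (single w v) w" for v
 have sA: "single w v \<in> Amod A k lam" if "v \<in> specht (tl lam)" for v
  using Amod_single[of w lam v] w that by (simp add: m_def)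
 have sB: "single w v \<in> Amod A k mu" if "v \<in> specht (tl mu)" for v
  using Amod_single[of w mu v] w that by (simp add: mu_m)
 have fs: "f (single w v) = single w (ph v)" if v: "v \<in> specht (tl lam)" for v
  unfolding ph_def
 proof (rule single_of_eigen[OF w])
  show "dact m w (f (single w v)) = (\<lambda>u T. ?K * f (single w v) u T)"
   using fD[OF wB sA[OF v]] fsc[OF sA[OF v], of ?K] unfolding dact_self[OF w] single_scale by simp
 qed
 have phS: "ph v \<in> specht (tl mu)" if "v \<in> specht (tl lam)" for v
  using fA[OF sA[OF that]] w unfolding ph_def Amod_def mu_m by blast
 have inj: "inj_on ph (specht (tl lam))"
 proof (rule inj_onI)
  fix x y assume x: "x \<in> specht (tl lam)" and y: "y \<in> specht (tl lam)" and e: "ph x = ph y"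
  have "f (single w x) = f (single w y)" unfolding fs[OF x] fs[OF y] e ..
  hence "single w x = single w y" using f(1) sA[OF x] sA[OF y] unfolding bij_betw_def by (metis inj_onD)
  thus "x = y" by (metis single_apply)
 qed
 have surj: "u \<in> ph ` specht (tl lam)" if u: "u \<in> specht (tl mu)" for u
 proof -
  obtain x where x: "x \<in> Amod A k lam" "f x = single w u"
   using f(1) sB[OF u] unfolding bij_betw_def by (metis imageE)
  have "f (dact m w x) = f (\<lambda>u T. ?K * x u T)"
   unfolding fD[OF wB x(1)] fsc[OF x(1)] x(2) dact_self[OF w] single_scale ..
  moreover have "dact m w x \<in> Amod A k lam" using dact_Amod[OF x(1) wB] by (simp add: m_def)
  ultimately have "dact m w x = (\<lambda>u T. ?K * x u T)"
   using f(1) Amod_scale[OF x(1), of ?K] unfolding bij_betw_def by (metis inj_onD)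
  hence xs: "x = single w (x w)" by (rule single_of_eigen[OF w])
  have xw: "x w \<in> specht (tl lam)" using x(1) w unfolding Amod_def m_def by blast
  have "ph (x w) = u" unfolding ph_def xs[symmetric] x(2) by simp
  thus ?thesis using xw by blast
 qed
 have bij: "bij_betw ph (specht (tl lam)) (specht (tl mu))"
  unfolding bij_betw_def using inj phS surj by blast
 note plam = tl_partition[OF Lambda_D(1)[OF lam], folded m_def]
 note pmu = tl_partition[OF Lambda_D(1)[OF mu], unfolded mu_m]
 have "tl lam = tl mu"
 proof (cases "planar_kind A")
  case True
  thus ?thesis using one_row_unique[OF plam pmu] Lambda_D(3)[OF lam] Lambda_D(3)[OF mu] by blast
 next
  case False
  have ph_sc: "ph (\<lambda>T. c * x T) = (\<lambda>T. c * ph x T)" if x: "x \<in> specht (tl lam)" for c x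
   using fsc[OF sA[OF x], of c] unfolding ph_def single_scale by (intro ext) simp
  have "perm_linear (tl lam) ph"
   unfolding perm_linear_def
  proof (intro conjI ballI allI impI)
   fix x y assume "x \<in> specht (tl lam)" "y \<in> specht (tl lam)"
   thus "ph (x + y) = ph x + ph y" using f(2)[OF sA sA, of x y] unfolding ph_def single_add by simp
  next
   fix c x assume "x \<in> specht (tl lam)"
   thus "ph (\<lambda>T. c * x T) = (\<lambda>T. c * ph x T)" by (rule ph_sc)
  next
   fix s x assume s: "s permutes {1..sum_list (tl lam)}" and x: "x \<in> specht (tl lam)"
   have "s \<in> diag_perms A m" using s False by (simp add: diag_perms_def m_def star_size_def)
   then obtain g where g: "g \<in> Bs" "g \<cdot> transp g = w" "transp g \<cdot> g = w" "perm g = s"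
    using ex_diagram_basis[OF w w] by blast
   let ?c = "of_nat n ^ ell g w :: complex"
   note dl = dact_link[OF g(1-3) w w, unfolded g(4)]
   have sx: "perm_act s x \<in> specht (tl lam)" by (rule specht_perm_act[OF s x])
   have "f (dact m g (single w x)) = dact m g (single w (ph x))" unfolding fD[OF g(1) sA[OF x]] fs[OF x] ..
   hence "f (single w (\<lambda>T. ?c * perm_act s x T)) = single w (\<lambda>T. ?c * perm_act s (ph x) T)"
    unfolding dl .
   moreover have "f (single w (\<lambda>T. ?c * perm_act s x T)) = single w (\<lambda>T. ?c * ph (perm_act s x) T)"
    using fsc[OF sA[OF sx], of ?c] unfolding fs[OF sx] single_scale .
   ultimately have "single w (\<lambda>T. ?c * ph (perm_act s x) T) = single w (\<lambda>T. ?c * perm_act s (ph x) T)"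
    by (simp only:)
   hence "(\<lambda>T. ?c * ph (perm_act s x) T) = (\<lambda>T. ?c * perm_act s (ph x) T)" by (metis single_apply)
   hence "?c * ph (perm_act s x) T = ?c * perm_act s (ph x) T" for T by (rule fun_cong)
   thus "ph (perm_act s x) = perm_act s (ph x)" using n0 by (intro ext) simp
  qed
  thus ?thesis using specht_iso_eq[OF plam pmu bij] by blast
 qed
 thus ?thesis using int_partition_eqI[OF Lambda_D(1)[OF lam] Lambda_D(1)[OF mu]] n0 by blast
qed

end

section \<open>Simple modules and the least propagating number acting on them\<close>

locale simple_module = semisimple_algebra + alg_module +
 assumes irr: "irreducible_module A k n V act"
begin

lemma generated:
 assumes x: "x \<in> V" "x \<noteq> 0" and y: "y \<in> V"
 shows "\<exists>a\<in>Car. y = act a x"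
proof -
 have z: "0 \<in> Car" by (rule carI) simp
 have "is_submodule A k V act ((\<lambda>a. act a x) ` Car)"
  unfolding is_submodule_def
 proof (intro conjI ballI)
  show "(\<lambda>a. act a x) ` Car \<subseteq> V" using act_in[OF _ x(1)] by blast
  have "act 0 x = act 0 x + act 0 x" using act_add[OF z z x(1)] by (simp only: add_0_left)
  hence "0 = act 0 x" by (metis add_cancel_right_right)
  thus "0 \<in> (\<lambda>a. act a x) ` Car" using z by blast
 next
  fix u v assume "u \<in> (\<lambda>a. act a x) ` Car" "v \<in> (\<lambda>a. act a x) ` Car"
  then obtain a b where "a \<in> Car" "b \<in> Car" "u = act a x" "v = act b x" by blast
  hence "u + v = act (a + b) x" "a + b \<in> Car" using act_add[OF _ _ x(1)] car_add by auto
  thus "u + v \<in> (\<lambda>a. act a x) ` Car" by blast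
 next
  fix b u assume b: "b \<in> Car" and "u \<in> (\<lambda>a. act a x) ` Car"
  then obtain a where "a \<in> Car" "u = act a x" by blast
  hence "act b u = act (mul b a) x" using act_mul[OF b _ x(1)] by simp
  thus "act b u \<in> (\<lambda>a. act a x) ` Car" using car_mult by blast
 qed
 moreover have "x \<in> (\<lambda>a. act a x) ` Car" using act_one[OF x(1)] car_one by (metis imageI)
 ultimately have "(\<lambda>a. act a x) ` Car = V" using irr x(2) unfolding irreducible_module_def by blast
 thus ?thesis using y by blast
qed

lemma ex_apex:
 "\<exists>m w0. w0 \<in> Ws m \<and> (\<forall>e\<in>Bs. pn e < m --> (\<forall>x\<in>V. D e x = 0)) \<and> (\<exists>x\<in>V. D w0 x \<noteq> 0)"
proof -
 let ?P = "\<lambda>m. \<exists>d\<in>Bs. pn d = m \<and> (\<exists>x\<in>V. D d x \<noteq> 0)"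
 obtain x where "x \<in> V" "x \<noteq> 0" using irr V0 unfolding irreducible_module_def by blast
 moreover have "D (id_diagram k) x = x" unfolding D_def alg_one_delta[symmetric] by (rule act_one) fact
 ultimately have "?P (pn (id_diagram k))" using basis_id by metis
 hence l: "?P (LEAST m. ?P m)" by (rule LeastI)
 define m where "m = (LEAST m. ?P m)"
 obtain d x where d: "d \<in> Bs" "pn d = m" "x \<in> V" "D d x \<noteq> 0" using l unfolding m_def by blast
 have low: "D e x = 0" if "e \<in> Bs" "pn e < m" "x \<in> V" for e x
  using not_less_Least[of "pn e" ?P] that unfolding m_def by blast
 \<comment> \<open>This projection acts nonzero as well, since d followed after it is d up to a
   power of n.\<close>
 let ?w = "transp d \<cdot> d"
 have w: "?w \<in> Ws m" by (rule transp_compose_W[OF d(1,2)])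
 have "d \<cdot> ?w = d" by (rule conj_linked(2)[OF d(1) refl])
 hence "D d (D ?w x) = sc (of_nat n ^ ell d ?w) (D d x)" using D_D[OF d(1) W_D(1)[OF w] d(3)] by simp
 moreover have "sc (of_nat n ^ ell d ?w) (D d x) \<noteq> 0"
 proof
  assume "sc (of_nat n ^ ell d ?w) (D d x) = 0"
  thus False using sc_inverse[OF D_in[OF d(1,3)] n_power_ne] d(4) by (metis sc_zero_right)
 qed
 ultimately have "D ?w x \<noteq> 0" using D_zero[OF d(1)] by metis
 thus ?thesis using w low d(3) by blast
qed

end

text \<open>The symmetric diagram w0 has the least propagating number m among diagrams acting nonzero;
 w0 V is then a representation of the group of diagrams with both halves equal to w0.\<close>
locale apex = simple_module +
 fixes m w0
 assumes w0: "w0 \<in> Ws m" and apex_low: "\<And>e x. e \<in> Bs ==> pn e < m ==> x \<in> V ==> D e x = 0"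
  and apex_ne: "\<exists>x\<in>V. D w0 x \<noteq> 0"
begin

abbreviation "Kp \<equiv> of_nat n ^ ell w0 w0 :: complex"
definition "Vw = D w0 ` V"
text \<open>By \<open>diagram_determined\<close> the diagram chosen here is unique. Every
  composition through \<open>w0\<close> produces the same factor \<open>Kp\<close>; dividing by it
  in \<open>ac\<close> turns the diagrams with both halves \<open>w0\<close> into an honest group
  action.\<close>

definition "q w s = (SOME d. d \<in> Bs \<and> d \<cdot> transp d = w \<and> transp d \<cdot> d = w0 \<and> perm d = s)"
definition "ac s y = sc (1 / Kp) (D (q w0 s) y)"

lemma Kp: "Kp \<noteq> 0" by (rule n_power_ne)

lemma w0B: "w0 \<in> Bs" and w0_transp: "transp w0 = w0" and w0_w0: "w0 \<cdot> w0 = w0"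
 using W_D[OF w0] by (auto simp: is_proj_def)

lemma q:
 assumes "w \<in> Ws m" "s \<in> diag_perms A m"
 shows "q w s \<in> Bs" "q w s \<cdot> transp (q w s) = w" "transp (q w s) \<cdot> q w s = w0" "perm (q w s) = s"
proof -
 have "\<exists>d. d \<in> Bs \<and> d \<cdot> transp d = w \<and> transp d \<cdot> d = w0 \<and> perm d = s"
  using ex_diagram_basis[OF assms(1) w0 assms(2)] by blast
 from someI_ex[OF this]
 show "q w s \<in> Bs" "q w s \<cdot> transp (q w s) = w" "transp (q w s) \<cdot> q w s = w0" "perm (q w s) = s"
  unfolding q_def by blast+
qed

lemma q_unique:
 assumes w: "w \<in> Ws m" and e: "e \<in> Bs" "e \<cdot> transp e = w" "transp e \<cdot> e = w0"
 shows "e = q w (perm e)"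
proof -
 have "pn e = m" using pn_compose_transp[OF basis_sub[OF e(1)]] e(2) W_D(3)[OF w] by simp
 hence "perm e \<in> diag_perms A m" using perm_diag_perms[OF e(1)] by simp
 note q' = q[OF w this]
 show ?thesis
  by (rule diagram_determined[OF basis_sub[OF e(1)] basis_sub[OF q'(1)]]) (simp_all add: e q')
qed

lemma q_w0: "q w0 id = w0"
 using q_unique[OF w0 w0B W_halves(1,2)[OF w0]] W_halves(3)[OF w0] by simp

lemma D_link:
 assumes a: "a \<in> Bs" "transp a \<cdot> a = w0" and b: "b \<in> Bs" "b \<cdot> transp b = w0" and x: "x \<in> V"
 shows "D a (D b x) = sc Kp (D (a \<cdot> b) x)"
proof -
 have "ell a b = ell w0 w0"
  by (rule ell_cong[OF basis_sub[OF a(1)] basis_sub[OF w0B] _ basis_sub[OF b(1)] basis_sub[OF w0B]])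
   (simp_all add: a b w0_transp w0_w0)
 thus ?thesis using D_D[OF a(1) b(1) x] by simp
qed

lemma q_compose:
 assumes w: "w \<in> Ws m" and s: "s \<in> diag_perms A m" and t: "t \<in> diag_perms A m"
 shows "q w s \<cdot> q w0 t = q w (s \<circ> t)"
proof -
 note a = q[OF w s] and b = q[OF w0 t]
 note aa = basis_sub[OF a(1)] and ba = basis_sub[OF b(1)]
 have l: "transp (q w s) \<cdot> q w s = q w0 t \<cdot> transp (q w0 t)" using a b by simp
 have "q w s \<cdot> q w0 t = q w (perm (q w s \<cdot> q w0 t))"
  by (rule q_unique[OF w basis_compose[OF a(1) b(1)]])
   (simp_all add: linked_top[OF aa ba l] linked_bot[OF aa ba l] a b)
 thus ?thesis unfolding perm_compose[OF aa ba l] a(4) b(4) .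
qed

lemma D_q_compose:
 assumes w: "w \<in> Ws m" and s: "s \<in> diag_perms A m" and t: "t \<in> diag_perms A m" and x: "x \<in> V"
 shows "D (q w s) (ac t x) = D (q w (s \<circ> t)) x"
proof -
 note a = q[OF w s] and b = q[OF w0 t]
 have "D (q w s) (ac t x) = sc (1 / Kp) (D (q w s) (D (q w0 t) x))"
  unfolding ac_def by (rule D_sc[OF a(1) D_in[OF b(1) x]])
 also have "\<dots> = sc (1 / Kp) (sc Kp (D (q w (s \<circ> t)) x))"
  unfolding D_link[OF a(1,3) b(1,2) x] q_compose[OF w s t] ..
 also have "\<dots> = D (q w (s \<circ> t)) x"
  by (rule sc_inverse[OF D_in[OF q(1)[OF w diag_perms_comp[OF s t]] x] Kp])
 finally show ?thesis .
qed

text \<open>Up to the factor \<open>Kp\<close> the diagram \<open>w0\<close> is idempotent, so its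
  image is an eigenspace.\<close>

lemma Vw_iff: "y \<in> Vw \<longleftrightarrow> y \<in> V \<and> D w0 y = sc Kp y"
proof
 assume "y \<in> Vw"
 then obtain x where x: "x \<in> V" "y = D w0 x" unfolding Vw_def by blast
 thus "y \<in> V \<and> D w0 y = sc Kp y" using D_in[OF w0B] D_D[OF w0B w0B x(1)] w0_w0 by simp
next
 assume y: "y \<in> V \<and> D w0 y = sc Kp y"
 hence "y = D w0 (sc (1 / Kp) y)" using D_sc[OF w0B, of y] sc_inverse[OF _ Kp, of y] by simp
 thus "y \<in> Vw" unfolding Vw_def using sc_in y by blast
qed

lemma Vw_V: "y \<in> Vw ==> y \<in> V"
 unfolding Vw_iff by blast

lemma Vw_closed:
 shows Vw_0: "0 \<in> Vw" and Vw_add: "x \<in> Vw ==> y \<in> Vw ==> x + y \<in> Vw" and Vw_sc: "x \<in> Vw ==> sc c x \<in> Vw"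
proof -
 show "0 \<in> Vw" unfolding Vw_iff using V0 D_zero[OF w0B] by simp
 show "x + y \<in> Vw" if "x \<in> Vw" "y \<in> Vw"
  using that unfolding Vw_iff by (simp add: Vadd D_dist[OF w0B] sc_dist)
 show "sc c x \<in> Vw" if "x \<in> Vw"
  using that sc_mult[of x c Kp] sc_mult[of x Kp c] unfolding Vw_iff by (simp add: sc_in D_sc[OF w0B] mult.commute)
qed

lemma ac_Vw: "s \<in> diag_perms A m ==> x \<in> V ==> ac s x \<in> Vw"
proof -
 assume s: "s \<in> diag_perms A m" and x: "x \<in> V"
 have "D w0 (ac s x) = D (q w0 s) x"
  using D_q_compose[OF w0 id_diag_perms s x] unfolding q_w0 by simp
 also have "\<dots> = sc Kp (ac s x)"
  unfolding ac_def using sc_mult[OF D_in[OF q(1)[OF w0 s] x], of Kp "1 / Kp"] sc_one[OF D_in[OF q(1)[OF w0 s] x]] n0 by simp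
 finally show ?thesis unfolding Vw_iff ac_def using sc_in D_in[OF q(1)[OF w0 s] x] by simp
qed

lemma ac_id: "x \<in> Vw ==> ac id x = x"
 unfolding ac_def q_w0 using Vw_iff[of x] sc_inverse[OF _ Kp, of x] by simp

lemma ac_comp:
 "s \<in> diag_perms A m ==> t \<in> diag_perms A m ==> x \<in> V ==> ac (s \<circ> t) x = ac s (ac t x)"
 unfolding ac_def[of s] ac_def[of "s \<circ> t"] using D_q_compose[OF w0] by simp

text \<open>As V is generated by x, y is a combination of vectors \<open>D d x\<close>; inserting
  \<open>w0\<close> on both sides changes x and y only by scalars. The diagram obtained from d by
  composing with \<open>w0\<close> on both sides either loses propagating blocks and acts as 0, or
  has both halves \<open>w0\<close> and acts as a group element up to a scalar.\<close>

lemma Vw_span: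
 assumes x: "x \<in> Vw" "x \<noteq> 0" and y: "y \<in> Vw"
 shows "\<exists>c. y = (\<Sum>s\<in>diag_perms A m. sc (c s) (ac s x))"
proof -
 let ?S = "\<lambda>z. \<exists>c. z = (\<Sum>s\<in>diag_perms A m. sc (c s) (ac s x))"
 note xV = Vw_V[OF x(1)]
 have acV: "ac s x \<in> V" if "s \<in> diag_perms A m" for s using ac_Vw[OF that xV] Vw_V by blast
 have fin: "finite (diag_perms A m)"
  by (rule finite_subset[OF _ finite_permutations[of "{1..m}"]]) (auto dest: diag_perms_permutes)
 have S0: "?S 0"
  by (rule exI[of _ "\<lambda>_. 0"], rule sym, rule sum.neutral) (use sc_zero_left acV in blast)
 have S_add: "?S (u + v)" if u: "?S u" and v: "?S v" for u v
 proof -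
  obtain c c' where c: "u = (\<Sum>s\<in>diag_perms A m. sc (c s) (ac s x))" "v = (\<Sum>s\<in>diag_perms A m. sc (c' s) (ac s x))"
   using u v by blast
  have "u + v = (\<Sum>s\<in>diag_perms A m. sc (c s + c' s) (ac s x))"
   unfolding c sum.distrib[symmetric] by (rule sum.cong[OF refl]) (rule sc_add[symmetric, OF acV])
  thus ?thesis by (rule exI[of _ "\<lambda>s. c s + c' s"])
 qed
 have S_sc: "?S (sc b u)" if u: "?S u" for b u
 proof -
  obtain c where c: "u = (\<Sum>s\<in>diag_perms A m. sc (c s) (ac s x))" using u by blast
  have "sc b u = (\<Sum>s\<in>diag_perms A m. sc b (sc (c s) (ac s x)))"
   unfolding c by (rule sc_sum) (rule sc_in[OF acV])
  also have "\<dots> = (\<Sum>s\<in>diag_perms A m. sc (b * c s) (ac s x))"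
   by (rule sum.cong[OF refl]) (rule sc_mult[symmetric, OF acV])
  finally show ?thesis by (rule exI[of _ "\<lambda>s. b * c s"])
 qed
 have S_ac: "?S (ac t x)" if t: "t \<in> diag_perms A m" for t
 proof (rule exI[of _ "\<lambda>s. if s = t then 1 else 0"])
  have "(\<Sum>s\<in>diag_perms A m. sc (if s = t then 1 else 0) (ac s x)) = (\<Sum>s\<in>diag_perms A m. if s = t then ac t x else 0)"
   by (rule sum.cong[OF refl]) (use sc_zero_left[OF acV] sc_one[OF acV] in auto)
  thus "ac t x = (\<Sum>s\<in>diag_perms A m. sc (if s = t then 1 else 0) (ac s x))"
   using fin t by (simp add: sum.delta)
 qed
 have S_D: "?S (D w0 (D d x))" if d: "d \<in> Bs" for d
 proof -
  note da = basis_sub[OF d] and wa = basis_sub[OF w0B]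
  let ?f = "d \<cdot> w0" and ?e = "w0 \<cdot> (d \<cdot> w0)"
  have fB: "?f \<in> Bs" by (rule basis_compose[OF d w0B])
  note eB = basis_compose[OF w0B fB]
  have S_e: "?S (D ?e x)"
  proof (cases "pn ?e < m")
   case True
   show ?thesis unfolding apex_low[OF eB True xV] by (rule S0)
  next
   case False
   have le: "pn ?e \<le> pn ?f" "pn ?f \<le> m" "pn w0 = m"
    using pn_compose_le2[OF wa basis_sub[OF fB]] pn_compose_le2[OF da wa] W_D(3)[OF w0] by auto
   hence p: "pn ?e = m" "pn ?f = m" using False by auto
   have "?e \<cdot> transp ?e = w0 \<cdot> transp w0"
    by (rule pn_stable_top[OF wa basis_sub[OF fB]]) (simp only: p le(3))
   moreover have "transp ?e \<cdot> ?e = transp ?f \<cdot> ?f"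
    by (rule pn_stable_bot[OF wa basis_sub[OF fB]]) (simp only: p)
   moreover have "transp ?f \<cdot> ?f = transp w0 \<cdot> w0"
    by (rule pn_stable_bot[OF da wa]) (simp only: p le(3))
   ultimately have "?e = q w0 (perm ?e)" using q_unique[OF w0 eB] w0_transp w0_w0 by simp
   moreover have pe: "perm ?e \<in> diag_perms A m" using perm_diag_perms[OF eB] p(1) by simp
   ultimately have "D ?e x = sc Kp (ac (perm ?e) x)"
    unfolding ac_def using sc_mult[OF D_in[OF eB xV], of Kp "1 / Kp"] sc_one[OF D_in[OF eB xV]] n0 by simp
   thus ?thesis using S_sc[OF S_ac[OF pe]] by simp
  qed
  have "x = sc (1 / Kp) (D w0 x)" using x(1) sc_inverse[OF xV Kp] unfolding Vw_iff by simp
  hence "D w0 (D d x) = D w0 (D d (sc (1 / Kp) (D w0 x)))" by simp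
  also have "\<dots> = sc (1 / Kp) (D w0 (D d (D w0 x)))"
   unfolding D_sc[OF d D_in[OF w0B xV]] D_sc[OF w0B D_in[OF d D_in[OF w0B xV]]] ..
  also have "\<dots> = sc (1 / Kp) (sc (of_nat n ^ ell d w0) (sc (of_nat n ^ ell w0 ?f) (D ?e x)))"
   unfolding D_D[OF d w0B xV] D_sc[OF w0B D_in[OF fB xV]] D_D[OF w0B fB xV] ..
  finally show ?thesis using S_sc[OF S_sc[OF S_sc[OF S_e]]] by simp
 qed
 obtain a where a: "a \<in> Car" "y = act a x" using generated[OF xV x(2) Vw_V[OF y]] by blast
 have S_sum: "?S (\<Sum>d\<in>I. h d)" if "\<And>d. d \<in> I ==> ?S (h d)" for I :: "diagram set" and h
  using that
 proof (induction I rule: infinite_finite_induct)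
  case (insert d I)
  show ?case unfolding sum.insert[OF insert.hyps]
   by (rule S_add[OF insert.prems[OF insertI1] insert.IH[OF insert.prems[OF insertI2]]])
 qed (simp_all only: S0 sum.infinite sum.empty not_False_eq_True)
 have "D w0 y = (\<Sum>d\<in>Bs. D w0 (sc (a d) (D d x)))"
  unfolding a(2) act_expand[OF a(1) xV] by (rule D_sum[OF w0B]) (rule sc_in[OF D_in[OF _ xV]])
 also have "\<dots> = (\<Sum>d\<in>Bs. sc (a d) (D w0 (D d x)))"
  by (rule sum.cong[OF refl]) (rule D_sc[OF w0B D_in[OF _ xV]])
 finally have "?S (D w0 y)" using S_sum[OF S_sc[OF S_D]] by simp
 from S_sc[OF this, of "1 / Kp"] show ?thesis using y sc_inverse[OF _ Kp, of y] unfolding Vw_iff by simp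
qed

lemma ex_nonzero: "\<exists>x\<in>Vw. x \<noteq> 0"
 using apex_ne unfolding Vw_def by blast

text \<open>A common form for both kinds of algebras. In the planar cases the group is trivial and
  the one-row Specht module is mapped onto the line of any nonzero vector; otherwise
  \<open>irreducible_is_specht\<close> applies.\<close>

lemma ex_specht_hom:
 "\<exists>la \<psi>. is_int_partition la m \<and> (planar_kind A --> length la \<le> 1) \<and> (\<forall>v\<in>specht la. \<psi> v \<in> Vw)
   \<and> (\<exists>v\<in>specht la. \<psi> v \<noteq> 0) \<and> (\<forall>x\<in>specht la. \<forall>y\<in>specht la. \<psi> (x + y) = \<psi> x + \<psi> y)
   \<and> (\<forall>c. \<forall>x\<in>specht la. \<psi> (\<lambda>T. c * x T) = sc c (\<psi> x))
   \<and> (\<forall>s\<in>diag_perms A m. \<forall>x\<in>specht la. \<psi> (perm_act s x) = ac s (\<psi> x))"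
proof (cases "planar_kind A")
 case True
 have dp: "diag_perms A m = {id}" using True by (simp add: diag_perms_def)
 obtain x where x: "x \<in> Vw" "x \<noteq> 0" using ex_nonzero by blast
 note xV = Vw_V[OF x(1)]
 define la where "la = (if m = 0 then [] else [m])"
 define z where "z = (\<lambda>_::nat. 0::nat)"
 define \<psi> where "\<psi> v = sc (v z) x" for v :: "(nat => nat) => complex"
 have la: "is_int_partition la m" "length la \<le> 1" by (simp_all add: la_def is_int_partition_def)
 obtain v where v: "v \<in> specht la" "v \<noteq> 0" using specht_nontrivial by blast
 have "v z \<noteq> 0"
 proof
  assume z: "v z = 0"
  have "v T = 0" for T
   using fun_cong[OF specht_one_row[OF la(2) v(1)], of T] z unfolding z_def by (cases "T = (\<lambda>_. 0)") simp_all
  hence "v = 0" by (intro ext) (simp only: zero_fun_apply)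
  thus False using v(2) by blast
 qed
 hence "\<psi> v \<noteq> 0" using sc_inverse[OF xV] x(2) unfolding \<psi>_def by (metis sc_zero_right)
 moreover have "\<psi> u \<in> Vw" for u unfolding \<psi>_def by (rule Vw_sc[OF x(1)])
 moreover have "\<psi> (u + u') = \<psi> u + \<psi> u'" for u u' unfolding \<psi>_def by (simp add: sc_add[OF xV])
 moreover have "\<psi> (\<lambda>T. c * u T) = sc c (\<psi> u)" for c u unfolding \<psi>_def by (rule sc_mult[OF xV])
 moreover have "\<psi> (perm_act id u) = ac id (\<psi> u)" for u
  using ac_id[OF Vw_sc[OF x(1)]] unfolding \<psi>_def by (simp add: perm_act_def)
 ultimately show ?thesis unfolding dp using la v(1) by (intro exI[of _ la] exI[of _ \<psi>]) blast
next
 case False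
 have dp: "diag_perms A m = {s. s permutes {1..m}}" using False by (simp add: diag_perms_def)
 have pr: "s \<in> diag_perms A m" if "s permutes {1..m}" for s unfolding dp using that by simp
 interpret R: perm_rep m Vw sc ac
 proof
  show "0 \<in> Vw" by (rule Vw_0)
  show "\<exists>x\<in>Vw. x \<noteq> 0" by (rule ex_nonzero)
  fix x y and a b :: complex assume x: "x \<in> Vw"
  note xV = Vw_V[OF x]
  show "sc a x \<in> Vw" by (rule Vw_sc[OF x])
  show "sc (a + b) x = sc a x + sc b x" by (rule sc_add[OF xV])
  show "sc (a * b) x = sc a (sc b x)" by (rule sc_mult[OF xV])
  show "sc 1 x = x" by (rule sc_one[OF xV])
  show "ac id x = x" by (rule ac_id[OF x])
  show "ac p x \<in> Vw" if "p permutes {1..m}" for p by (rule ac_Vw[OF pr[OF that] xV])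
  show "ac (p \<circ> r) x = ac p (ac r x)" if "p permutes {1..m}" "r permutes {1..m}" for p r
   by (rule ac_comp[OF pr[OF that(1)] pr[OF that(2)] xV])
  show "ac p (sc a x) = sc a (ac p x)" if p: "p permutes {1..m}" for p
  proof -
   note qB = q(1)[OF w0 pr[OF p]]
   show ?thesis unfolding ac_def D_sc[OF qB xV]
    using sc_mult[OF D_in[OF qB xV], of a "1 / Kp"] sc_mult[OF D_in[OF qB xV], of "1 / Kp" a] by (simp add: mult.commute)
  qed
  assume y: "y \<in> Vw"
  note yV = Vw_V[OF y]
  show "x + y \<in> Vw" by (rule Vw_add[OF x y])
  show "sc a (x + y) = sc a x + sc a y" by (rule sc_dist[OF xV yV])
  show "ac p (x + y) = ac p x + ac p y" if p: "p permutes {1..m}" for p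
  proof -
   note qB = q(1)[OF w0 pr[OF p]]
   show ?thesis unfolding ac_def D_dist[OF qB xV yV] by (rule sc_dist[OF D_in[OF qB xV] D_in[OF qB yV]])
  qed
  show "\<exists>c. y = (\<Sum>p | p permutes {1..m}. sc (c p) (ac p x))" if "x \<noteq> 0"
   using Vw_span[OF x that y] unfolding dp .
 qed
 obtain la f where f: "is_int_partition la m" "bij_betw f (specht la) Vw"
  "\<forall>x\<in>specht la. \<forall>y\<in>specht la. f (x + y) = f x + f y"
  "\<forall>c. \<forall>x\<in>specht la. f (\<lambda>T. c * x T) = sc c (f x)"
  "\<forall>s. s permutes {1..m} --> (\<forall>x\<in>specht la. f (perm_act s x) = ac s (f x))"
  using R.irreducible_is_specht by blast
 have "\<forall>v\<in>specht la. f v \<in> Vw" using f(2) by (auto simp: bij_betw_def)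
 moreover have "\<exists>v\<in>specht la. f v \<noteq> 0" using ex_nonzero f(2) unfolding bij_betw_def by (metis imageE)
 ultimately show ?thesis unfolding dp using f(1,3-5) False by (intro exI[of _ la] exI[of _ f]) simp
qed

text \<open>The composite of d with \<open>q w id\<close> factors through
  \<open>d \<cdot> w\<close>. Either it loses a propagating block and acts as 0, or it is the
  diagram over the conjugated w with permutation \<open>perm (d \<cdot> w)\<close>. This is the
  defining formula of the action on the tensor product, with y in the place of the Specht
  vector.\<close>

lemma D_q:
 assumes d: "d \<in> Bs" and w: "w \<in> Ws m" and y: "y \<in> V"
 shows "D d (D (q w id) y) = (if pn (conj_diagram d w) = m
  then sc (of_nat n ^ ell d w) (D (q (conj_diagram d w) id) (ac (perm (d \<cdot> w)) y)) else 0)"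
proof -
 note b = q[OF w id_diag_perms]
 let ?b = "q w id" and ?g = "d \<cdot> w"
 note da = basis_sub[OF d] and ba = basis_sub[OF b(1)] and wa = W_D(4)[OF w]
 have gB: "?g \<in> Bs" by (rule basis_compose[OF d W_D(1)[OF w]])
 note ga = basis_sub[OF gB]
 have "w \<cdot> ?b = ?b" using compose_regular[OF ba] b(2) by simp
 hence e: "d \<cdot> ?b = ?g \<cdot> ?b" using compose_assoc[OF da wa ba] by simp
 have eB: "d \<cdot> ?b \<in> Bs" by (rule basis_compose[OF d b(1)])
 have "ell d ?b = ell d w"
  by (rule ell_cong[OF da da refl ba wa]) (simp add: b(2) W_halves(1)[OF w])
 hence D1: "D d (D ?b y) = sc (of_nat n ^ ell d w) (D (d \<cdot> ?b) y)" using D_D[OF d b(1) y] by simp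
 show ?thesis
 proof (cases "pn (conj_diagram d w) = m")
  case True
  note f = conj_facts[OF d w True]
  have l: "transp ?g \<cdot> ?g = ?b \<cdot> transp ?b" using f(3) b(2) by simp
  have p: "perm (d \<cdot> ?b) = perm ?g" unfolding e perm_compose[OF ga ba l] b(4) by simp
  have s: "perm ?g \<in> diag_perms A m" using perm_diag_perms[OF gB] f(1) by simp
  have "d \<cdot> ?b = q (conj_diagram d w) (perm (d \<cdot> ?b))"
  proof (rule q_unique[OF f(4) eB])
   show "(d \<cdot> ?b) \<cdot> transp (d \<cdot> ?b) = conj_diagram d w" unfolding e linked_top[OF ga ba l] f(2) ..
   show "transp (d \<cdot> ?b) \<cdot> (d \<cdot> ?b) = w0" unfolding e linked_bot[OF ga ba l] b(3) ..
  qed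
  hence "D (d \<cdot> ?b) y = D (q (conj_diagram d w) id) (ac (perm ?g) y)"
   unfolding D_q_compose[OF f(4) id_diag_perms s y] p by simp
  thus ?thesis unfolding D1 if_P[OF True] by simp
 next
  case False
  have "pn (conj_diagram d w) \<le> m" using pn_conj_le(1)[OF d W_D(1)[OF w]] W_D(3)[OF w] by simp
  moreover have "pn (d \<cdot> w) = pn (conj_diagram d w)"
   using pn_conj[OF da wa W_D(2)[OF w]] unfolding conj_diagram_def by simp
  ultimately have "pn (d \<cdot> ?b) < m" using pn_compose_le1[OF ga ba] False e by simp
  hence "D (d \<cdot> ?b) y = 0" by (rule apex_low[OF eB _ y])
  thus ?thesis unfolding D1 if_not_P[OF False] by simp
 qed
qed

theorem ex_iso: "\<exists>lam\<in>Lambda A k n. module_iso A k V act (Amod A k lam) (Aact A k n lam)"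
proof -
 interpret Mo: alg_module A k n "Amod A k mu" "Aact A k n mu" for mu
  by unfold_locales (rule Amod_module)
 obtain la \<psi> where la: "is_int_partition la m" and pl: "planar_kind A --> length la \<le> 1"
  and \<psi>V: "\<forall>v\<in>specht la. \<psi> v \<in> Vw" and \<psi>ne: "\<exists>v\<in>specht la. \<psi> v \<noteq> 0"
  and \<psi>add: "\<forall>x\<in>specht la. \<forall>y\<in>specht la. \<psi> (x + y) = \<psi> x + \<psi> y"
  and \<psi>sc: "\<forall>c. \<forall>x\<in>specht la. \<psi> (\<lambda>T. c * x T) = sc c (\<psi> x)"
  and \<psi>ac: "\<forall>s\<in>diag_perms A m. \<forall>x\<in>specht la. \<psi> (perm_act s x) = ac s (\<psi> x)"
  using ex_specht_hom by blast
 have \<psi>in: "\<psi> v \<in> V" if "v \<in> specht la" for v using \<psi>V that Vw_V by blast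
 have \<psi>0: "\<psi> 0 = 0"
 proof -
  have "\<psi> (0 + 0) = \<psi> 0 + \<psi> 0" using \<psi>add specht_zero by blast
  thus ?thesis by (metis add_0 add_cancel_right_right)
 qed
 \<comment> \<open>From m <= k and n >= 2k it follows that n - m >= m, so the new first part is at
   least as large as every part of \<open>la\<close>.\<close>
 define lam where "lam = (n - m) # la"
 have tl: "tl lam = la" and ss: "star_size lam = m"
  using la by (simp_all add: lam_def star_size_def is_int_partition_def)
 have mk: "m \<le> k" using pn_le_k[OF W_D(4)[OF w0]] W_D(3)[OF w0] by simp
 have lamL: "lam \<in> Lambda A k n"
 proof (rule Lambda_I)
  have "x \<le> n - m" if "x \<in> set la" for x
   using member_le_sum_list[OF that] la mk n2k unfolding is_int_partition_def by linarith
  moreover have "0 < n - m" using n0 n2k mk by linarith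
  moreover have "n - m + sum_list la = n" using la mk n2k unfolding is_int_partition_def by linarith
  ultimately show "is_int_partition lam n" using la unfolding lam_def is_int_partition_def by simp
  show "star_size lam \<le> k" using mk ss by simp
  show "length lam \<le> 2" if "planar_kind A" using pl that unfolding lam_def by simp
  show "star_size lam mod 2 = k mod 2" if "A = Brauer \<or> A = TemperleyLieb"
  proof -
   have "brauer_diag w0" using w0B that by auto
   hence "even (k + m)" using brauer_parity[OF W_D(4)[OF w0]] W_D(3)[OF w0] by simp
   thus ?thesis unfolding ss by presburger
  qed
 qed
 \<comment> \<open>The homomorphism sends w tensor v to the translate of the image of v by the
   diagram from \<open>w0\<close> to w with trivial permutation.\<close>
 define \<Phi> where "\<Phi> F = (\<Sum>w\<in>Ws m. D (q w id) (\<psi> (F w)))" for F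
 note qB = q(1)[OF _ id_diag_perms]
 have FS: "F w \<in> specht la" if "F \<in> Amod A k lam" "w \<in> Ws m" for F w
  using that unfolding Amod_def ss tl by blast
 have \<Phi>V: "\<Phi> F \<in> V" if F: "F \<in> Amod A k lam" for F
  unfolding \<Phi>_def by (rule sum_in) (rule D_in[OF qB \<psi>in[OF FS[OF F]]])
 have \<Phi>add: "\<Phi> (F + G) = \<Phi> F + \<Phi> G" if F: "F \<in> Amod A k lam" and G: "G \<in> Amod A k lam" for F G
  unfolding \<Phi>_def sum.distrib[symmetric]
 proof (rule sum.cong[OF refl])
  fix w assume w: "w \<in> Ws m"
  have "\<psi> ((F + G) w) = \<psi> (F w) + \<psi> (G w)" using \<psi>add FS[OF F w] FS[OF G w] by simp
  thus "D (q w id) (\<psi> ((F + G) w)) = D (q w id) (\<psi> (F w)) + D (q w id) (\<psi> (G w))"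
   using D_dist[OF qB[OF w] \<psi>in[OF FS[OF F w]] \<psi>in[OF FS[OF G w]]] by simp
 qed
 have \<Phi>sc: "\<Phi> (\<lambda>w T. c * F w T) = sc c (\<Phi> F)" if F: "F \<in> Amod A k lam" for c F
 proof -
  have "\<Phi> (\<lambda>w T. c * F w T) = (\<Sum>w\<in>Ws m. sc c (D (q w id) (\<psi> (F w))))"
   unfolding \<Phi>_def
  proof (rule sum.cong[OF refl])
   fix w assume w: "w \<in> Ws m"
   have "\<psi> (\<lambda>T. c * F w T) = sc c (\<psi> (F w))" using \<psi>sc FS[OF F w] by blast
   thus "D (q w id) (\<psi> (\<lambda>T. c * F w T)) = sc c (D (q w id) (\<psi> (F w)))"
    using D_sc[OF qB[OF w] \<psi>in[OF FS[OF F w]]] by simp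
  qed
  also have "\<dots> = sc c (\<Phi> F)" unfolding \<Phi>_def by (rule sc_sum[symmetric]) (rule D_in[OF qB \<psi>in[OF FS[OF F]]])
  finally show ?thesis .
 qed
 have \<Phi>0: "\<Phi> 0 = 0" using \<Phi>add[OF Amod_zero Amod_zero] by (metis add_0 add_cancel_right_right)
 have \<Phi>sum: "\<Phi> (\<Sum>i\<in>I. f i) = (\<Sum>i\<in>I. \<Phi> (f i))" if "\<And>i. i \<in> I ==> f i \<in> Amod A k lam" for I :: "diagram set" and f
  using that
 proof (induction I rule: infinite_finite_induct)
  case (insert i I)
  have s: "(\<Sum>i\<in>I. f i) \<in> Amod A k lam" by (rule Amod_sum) (rule insert.prems, simp)
  have "\<Phi> (\<Sum>i\<in>I. f i) = (\<Sum>i\<in>I. \<Phi> (f i))" by (rule insert.IH) (rule insert.prems, simp)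
  thus ?case unfolding sum.insert[OF insert.hyps] \<Phi>add[OF insert.prems[OF insertI1] s] by simp
 qed (simp_all only: sum.infinite sum.empty \<Phi>0 not_False_eq_True)
 have \<Phi>single: "\<Phi> (single w v) = D (q w id) (\<psi> v)" if w: "w \<in> Ws m" and v: "v \<in> specht la" for w v
 proof -
  have "\<Phi> (single w v) = (\<Sum>u\<in>Ws m. if u = w then D (q w id) (\<psi> v) else 0)"
   unfolding \<Phi>_def by (rule sum.cong[OF refl]) (simp add: single_def \<psi>0 D_zero[OF qB])
  thus ?thesis using w by (simp add: sum.delta)
 qed
 have sA: "single w v \<in> Amod A k lam" if "w \<in> Ws m" "v \<in> specht la" for w v
  by (rule Amod_single) (use that ss tl in simp_all)
 have \<Phi>D1: "\<Phi> (dact m d (single w v)) = D d (\<Phi> (single w v))"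
  if d: "d \<in> Bs" and w: "w \<in> Ws m" and v: "v \<in> specht la" for d w v
 proof (cases "pn (conj_diagram d w) = m")
  case True
  let ?s = "perm (d \<cdot> w)" and ?w = "conj_diagram d w" and ?c = "of_nat n ^ ell d w :: complex"
  note f = conj_facts[OF d w True]
  have s: "?s \<in> diag_perms A m" using perm_diag_perms[OF f(5)] f(1) by simp
  have pv: "perm_act ?s v \<in> specht la"
   using specht_perm_act[OF _ v] diag_perms_permutes[OF s] la by (simp add: is_int_partition_def)
  have "\<Phi> (dact m d (single w v)) = sc ?c (D (q ?w id) (\<psi> (perm_act ?s v)))"
   unfolding dact_single[OF d w True] single_scale[symmetric] \<Phi>sc[OF sA[OF f(4) pv]] \<Phi>single[OF f(4) pv] ..
  also have "\<dots> = D d (D (q w id) (\<psi> v))"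
   unfolding D_q[OF d w \<psi>in[OF v]] if_P[OF True] using \<psi>ac s v by simp
  finally show ?thesis unfolding \<Phi>single[OF w v] .
 next
  case False
  show ?thesis
   unfolding dact_single_zero[OF False] \<Phi>0 \<Phi>single[OF w v] D_q[OF d w \<psi>in[OF v]] if_not_P[OF False] ..
 qed
 have \<Phi>D: "\<Phi> (dact m d F) = D d (\<Phi> F)" if d: "d \<in> Bs" and F: "F \<in> Amod A k lam" for d F
 proof -
  have dec: "F = (\<Sum>u\<in>Ws m. single u (F u))" using Amod_decomp[OF F] unfolding ss .
  have s: "single u (F u) \<in> Amod A k lam" if "u \<in> Ws m" for u by (rule sA[OF that FS[OF F that]])
  have "\<Phi> (dact m d F) = \<Phi> (\<Sum>u\<in>Ws m. dact m d (single u (F u)))"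
   using dec dact_sum[of m d] by metis
  also have "\<dots> = (\<Sum>u\<in>Ws m. \<Phi> (dact m d (single u (F u))))"
   by (rule \<Phi>sum) (use dact_Amod[OF s d] ss in simp)
  also have "\<dots> = (\<Sum>u\<in>Ws m. D d (\<Phi> (single u (F u))))"
   by (rule sum.cong[OF refl]) (rule \<Phi>D1[OF d _ FS[OF F]])
  also have "\<dots> = D d (\<Sum>u\<in>Ws m. \<Phi> (single u (F u)))"
   by (rule D_sum[OF d, symmetric]) (rule \<Phi>V[OF s])
  also have "(\<Sum>u\<in>Ws m. \<Phi> (single u (F u))) = \<Phi> (\<Sum>u\<in>Ws m. single u (F u))"
   by (rule \<Phi>sum[symmetric]) (rule s)
  finally show ?thesis unfolding dec[symmetric] .
 qed
 obtain v where v: "v \<in> specht la" "\<psi> v \<noteq> 0" using \<psi>ne by blast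
 have "\<Phi> (single w0 v) = sc Kp (\<psi> v)" unfolding \<Phi>single[OF w0 v(1)] q_w0 using \<psi>V v(1) Vw_iff by blast
 hence ne: "\<Phi> (single w0 v) \<noteq> 0" using sc_inverse[OF \<psi>in[OF v(1)] Kp] v(2) by (metis sc_zero_right)
 interpret MP: module_pair A k n "Amod A k lam" "Aact A k n lam" V act
  by (intro module_pair.intro Mo.alg_module_axioms alg_module_axioms)
 have "module_iso A k (Amod A k lam) (Aact A k n lam) V act"
 proof (rule MP.iso_of_hom[of \<Phi>])
  show "\<Phi> (Mo.sc lam c x) = sc c (\<Phi> x)" if "x \<in> Amod A k lam" for c x
   unfolding Amod_sc[OF that] by (rule \<Phi>sc[OF that])
  show "\<Phi> (Mo.D lam d x) = D d (\<Phi> x)" if "d \<in> Bs" "x \<in> Amod A k lam" for d x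
   unfolding Amod_D[OF that(1)] ss by (rule \<Phi>D[OF that])
 qed (use \<Phi>V \<Phi>add ne sA[OF w0 v(1)] Amod_irreducible[OF lamL] irr in blast)+
 thus ?thesis using MP.iso_sym lamL by blast
qed

end

theorem mainTheorem3:
  fixes A :: alg_kind and k n :: nat
  assumes "1 \<le> k" and "2 * k \<le> n"
  shows "(\<forall>lam \<in> Lambda A k n. irreducible_module A k n (Amod A k lam) (Aact A k n lam))
       \<and> (\<forall>lam \<in> Lambda A k n. \<forall>mu \<in> Lambda A k n. lam \<noteq> mu \<longrightarrow>
            \<not> module_iso A k (Amod A k lam) (Aact A k n lam) (Amod A k mu) (Aact A k n mu))
       \<and> (\<forall>(V :: 'v::ab_group_add set) act. irreducible_module A k n V act \<longrightarrow>
            (\<exists>lam \<in> Lambda A k n. module_iso A k V act (Amod A k lam) (Aact A k n lam)))"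
proof -
 interpret semisimple_algebra A k n using assms by unfold_locales auto
 have "\<exists>lam\<in>Lambda A k n. module_iso A k V act (Amod A k lam) (Aact A k n lam)"
  if irr: "irreducible_module A k n V act" for V :: "'v set" and act
 proof -
  interpret simple_module A k n V act
   by unfold_locales (use irr in \<open>auto simp: irreducible_module_def\<close>)
  obtain m w0 where w: "w0 \<in> Ws m" "\<forall>e\<in>Bs. pn e < m --> (\<forall>x\<in>V. D e x = 0)" "\<exists>x\<in>V. D w0 x \<noteq> 0"
   using ex_apex by blast
  interpret apex A k n V act m w0 by unfold_locales (use w in blast)+
  show ?thesis by (rule ex_iso)
 qed
 thus ?thesis using Amod_irreducible Amod_not_iso by blast
qed

end
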